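(* Suppose $n\geqslant1$ is an integer and $\{\psi,\Psi\}$ is a Battle-Lemarié system of order $n$. Let $1<p\leqslant\infty$. Then $W^{n+1}_p(\mathbb{R})$ consists exactly of those $f\in\mathcal{S}_{n-1}'(\mathbb{R})$ such that $$\sup_{j\geqslant-1}2^{j\left(n+1-\frac1p\right)}\left(\sum_{\mu\in\mathbb{Z}}|\mathsf{k}_{j,\mu}(f)|^p\right)^{1/p}<\infty$$ (with the usual modification, i.e. a supremum over $\mu$, if $p=\infty$). The quantity $\sup_{j\geqslant-1}2^{j\left(n+1-\frac1p\right)}\left(\sum_{\mu\in\mathbb{Z}}|\mathsf{k}_{j,\mu}(f)|^p\right)^{1/p}$ (with the same modification if $p=\infty$) is equivalent to the norm $\|f\|_{W^{n+1}_p(\mathbb{R})}=\|f\|_{L_p(\mathbb{R})}+\|f^{(n+1)}\|_{L_p(\mathbb{R})}$ on $W^{n+1}_p(\mathbb{R})$.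
   Context: $W^{k}_p(\mathbb{R})$ is the usual Sobolev space, normed for $k\in\mathbb{N}$ by $\|f\|_{L_p}+\|f^{(k)}\|_{L_p}$. For $r\in\mathbb{N}_0$, $\mathcal{S}_r$ is the space of real-valued $\varphi\in C^r(\mathbb{R})$ such that for all $k=0,\dots,r$ and all $\ell\in\mathbb{Z}$ there is $C_{\ell,k}>0$ with $|\varphi^{(k)}(x)|\leqslant C_{\ell,k}(1+|x|)^{-\ell}$ for all $x\in\mathbb{R}$, with convergence defined analogously to that in the Schwartz space; $\mathcal{S}_r'$ is its topological dual, and $(\cdot,\cdot)$ is the pairing between $\mathcal{S}_{n-1}'$ and $\mathcal{S}_{n-1}$. B-splines. $B_0=1_{[0,1)}$, $B_m=B_{m-1}*1_{[0,1)}$ for $m\geqslant1$. The multiresolution analysis of $L_2(\mathbb{R})$ generated by $B_m$: $V_0$ is the closed span in $L_2$ of the integer translates of $B_m$, $V_j=\{f(2^j\cdot):f\in V_0\}$, and $W_0$ is the orthogonal complement of $V_0$ in $V_1$. Battle-Lemarié system of order $n\geqslant 1$: a pair $\{\psi,\Psi\}$ of real-valued functions in $L_2(\mathbb{R})$ ($\Psi$ the scaling function, $\psi$ the wavelet) such that: (i) with $\psi_{j,\mu}(x)=\psi(2^jx-\mu)$ for $j\geqslant0$, $\psi_{-1,\mu}(x)=\sqrt2\,\Psi(x-\mu)$, $\mu\in\mathbb{Z}$, one has $(\psi_{j,\mu},\psi_{k,\nu})_{L_2}=2^{-j}\delta_{j,k}\delta_{\mu,\nu}$ for all $j,k\geqslant-1$,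 $\mu,\nu\in\mathbb{Z}$; (ii) (I) $\psi,\Psi\in C^{n-1}(\mathbb{R})$; (II) on each interval $(\mu,\mu+\frac12)$, $\mu\in\frac12\mathbb{Z}$, $\psi$ and $\Psi$ are polynomials of degree at most $n$; (III) there are $C_0,\gamma>0$ with $|\Psi^{(k)}(x)|+|\psi^{(k)}(x)|\leqslant C_0e^{-\gamma|x|}$ for $0\leqslant k\leqslant n-1$, $x\in\mathbb{R}$; (IV) $\int x^\kappa\psi(x)\,dx=0$ for $\kappa=0,\dots,n$; (iii) $\{\Psi(\cdot-\mu)\}_{\mu\in\mathbb{Z}}$ is an orthonormal basis of the space $V_0$ generated by $B_n$, and $\{\psi(\cdot-\mu)\}_{\mu\in\mathbb{Z}}$ is an orthonormal basis of the corresponding $W_0$. In particular $\psi,\Psi\in\mathcal{S}_{n-1}$. Shifted spline coefficients. $\widetilde\psi_{j,\mu}(x)=\psi(2^jx-\frac\mu2)$ for $j\geqslant0$, $\widetilde\psi_{-1,\mu}(x)=\Psi(x-\mu)$, $\mu\in\mathbb{Z}$; $\mathsf{k}_{j,\mu}(f)=2^j|(f,\widetilde\psi_{j,2\mu})|+2^j|(f,\widetilde\psi_{j,2\mu+1})|$ for $j\geqslant0$, and $\mathsf{k}_{-1,\mu}(f)=|(f,\widetilde\psi_{-1,\mu})|$. *)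

theory Defs
  imports "HOL-Probability.Essential_Supremum" "HOL-Computational_Algebra.Polynomial"
    "HOL-Library.FuncSet"
begin

text \<open>All function spaces are over the real scalars. Elements of \<open>L\<^sub>p\<close> are functions,
  not equivalence classes; the sets of functions below are closed under equality almost
  everywhere wherever this is relevant.\<close>

section \<open>Lebesgue spaces\<close>

definition ennreal_powr :: "ennreal \<Rightarrow> real \<Rightarrow> ennreal" where
  "ennreal_powr x a = (if x = \<infinity> then \<infinity> else ennreal (enn2real x powr a))"
  \<comment> \<open>only used with \<open>a > 0\<close>\<close>

definition Lp_norm :: "ennreal \<Rightarrow> (real \<Rightarrow> real) \<Rightarrow> ennreal" where
  "Lp_norm p f =
     (if p = \<infinity> then esssup lebesgue (\<lambda>x. ennreal \<bar>f x\<bar>)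
      else ennreal_powr (\<integral>\<^sup>+ x. ennreal (\<bar>f x\<bar> powr enn2real p) \<partial>lebesgue) (1 / enn2real p))"

definition Lp_space :: "ennreal \<Rightarrow> (real \<Rightarrow> real) set" where
  "Lp_space p = {f. f \<in> borel_measurable lebesgue \<and> Lp_norm p f < \<infinity>}"

definition L2_inner :: "(real \<Rightarrow> real) \<Rightarrow> (real \<Rightarrow> real) \<Rightarrow> real" where
  "L2_inner f g = (LINT x|lebesgue. f x * g x)"

definition L2_closed_span :: "('i \<Rightarrow> real \<Rightarrow> real) \<Rightarrow> (real \<Rightarrow> real) set" where
  "L2_closed_span e = {f \<in> Lp_space 2. \<forall>\<epsilon>>0. \<exists>A c. finite A \<and>
     Lp_norm 2 (\<lambda>x. f x - (\<Sum>i\<in>A. c i * e i x)) < ennreal \<epsilon>}"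

definition L2_orthonormal_basis :: "('i \<Rightarrow> real \<Rightarrow> real) \<Rightarrow> (real \<Rightarrow> real) set \<Rightarrow> bool" where
  "L2_orthonormal_basis e V \<longleftrightarrow>
     (\<forall>i. e i \<in> V) \<and>
     (\<forall>i i'. L2_inner (e i) (e i') = (if i = i' then 1 else 0)) \<and>
     L2_closed_span e = V"


section \<open>Smooth functions, weak derivatives and Sobolev spaces\<close>

definition Cr_functions :: "nat \<Rightarrow> (real \<Rightarrow> real) set" where
  "Cr_functions r = {\<phi>. (\<forall>k<r. \<forall>x. (deriv ^^ k) \<phi> differentiable (at x)) \<and>
                        (\<forall>k\<le>r. continuous_on UNIV ((deriv ^^ k) \<phi>))}"

definition smooth_compact_support :: "(real \<Rightarrow> real) set" where
  "smooth_compact_support =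
     {\<phi>. (\<forall>r. \<phi> \<in> Cr_functions r) \<and> compact (closure {x. \<phi> x \<noteq> 0})}"

definition locally_integrable :: "(real \<Rightarrow> real) \<Rightarrow> bool" where
  "locally_integrable f \<longleftrightarrow> (\<forall>a b. set_integrable lebesgue {a..b} f)"

definition has_weak_deriv :: "nat \<Rightarrow> (real \<Rightarrow> real) \<Rightarrow> (real \<Rightarrow> real) \<Rightarrow> bool" where
  "has_weak_deriv k g h \<longleftrightarrow> locally_integrable g \<and> locally_integrable h \<and>
     (\<forall>\<phi> \<in> smooth_compact_support.
        (LINT x|lebesgue. g x * (deriv ^^ k) \<phi> x) =
        (-1) ^ k * (LINT x|lebesgue. h x * \<phi> x))"

definition weak_deriv :: "nat \<Rightarrow> (real \<Rightarrow> real) \<Rightarrow> real \<Rightarrow> real" where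
  "weak_deriv k g = (SOME h. has_weak_deriv k g h)"
  \<comment> \<open>determined up to a null set, if it exists\<close>

definition Sobolev_space :: "nat \<Rightarrow> ennreal \<Rightarrow> (real \<Rightarrow> real) set" where
  "Sobolev_space k p =
     {g \<in> Lp_space p. \<forall>i\<in>{1..k}. \<exists>h \<in> Lp_space p. has_weak_deriv i g h}"

definition Sobolev_norm :: "nat \<Rightarrow> ennreal \<Rightarrow> (real \<Rightarrow> real) \<Rightarrow> ennreal" where
  "Sobolev_norm k p g = Lp_norm p g + Lp_norm p (weak_deriv k g)"


section \<open>The test function space \<open>S\<^sub>r\<close> and its dual\<close>

definition S_space :: "nat \<Rightarrow> (real \<Rightarrow> real) set" where
  "S_space r = {\<phi> \<in> Cr_functions r. \<forall>k\<le>r. \<forall>l::int. \<exists>C>0. \<forall>x.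
     \<bar>(deriv ^^ k) \<phi> x\<bar> \<le> C * (1 + \<bar>x\<bar>) powi (- l)}"

definition S_tendsto :: "nat \<Rightarrow> (nat \<Rightarrow> real \<Rightarrow> real) \<Rightarrow> (real \<Rightarrow> real) \<Rightarrow> bool" where
  "S_tendsto r \<Phi> \<phi> \<longleftrightarrow> (\<forall>k\<le>r. \<forall>l::int.
     uniform_limit UNIV (\<lambda>m x. (1 + \<bar>x\<bar>) powi l * (deriv ^^ k) (\<Phi> m) x)
       (\<lambda>x. (1 + \<bar>x\<bar>) powi l * (deriv ^^ k) \<phi> x) sequentially)"

text \<open>\<open>S\<^sub>r\<close> is metrizable, so a linear functional is continuous iff it is sequentially
  continuous. A functional is a HOL function that is \<^const>\<open>undefined\<close> off \<open>S\<^sub>r\<close>, so that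
  equality of functionals is equality on \<open>S\<^sub>r\<close>.\<close>

definition S_dual :: "nat \<Rightarrow> ((real \<Rightarrow> real) \<Rightarrow> real) set" where
  "S_dual r = {f \<in> extensional (S_space r).
     (\<forall>\<phi>\<in>S_space r. \<forall>\<eta>\<in>S_space r. f (\<lambda>x. \<phi> x + \<eta> x) = f \<phi> + f \<eta>) \<and>
     (\<forall>c. \<forall>\<phi>\<in>S_space r. f (\<lambda>x. c * \<phi> x) = c * f \<phi>) \<and>
     (\<forall>\<Phi> \<phi>. (\<forall>m. \<Phi> m \<in> S_space r) \<and> \<phi> \<in> S_space r \<and> S_tendsto r \<Phi> \<phi> \<longrightarrow>
        (\<lambda>m. f (\<Phi> m)) \<longlonglongrightarrow> f \<phi>)}"

text \<open>The usual embedding of functions into \<open>S\<^sub>r'\<close>.\<close>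

definition regular_functional :: "nat \<Rightarrow> (real \<Rightarrow> real) \<Rightarrow> (real \<Rightarrow> real) \<Rightarrow> real" where
  "regular_functional r g = (\<lambda>\<phi>\<in>S_space r. LINT x|lebesgue. g x * \<phi> x)"


section \<open>B-splines and Battle--Lemarie systems\<close>

primrec B_spline :: "nat \<Rightarrow> real \<Rightarrow> real" where
  "B_spline 0 = indicator {0..<1}"
| "B_spline (Suc m) = (\<lambda>x. LINT y|lebesgue. B_spline m (x - y) * indicator {0..<1} y)"

definition spline_V0 :: "nat \<Rightarrow> (real \<Rightarrow> real) set" where
  "spline_V0 m = L2_closed_span (\<lambda>(\<mu>::int) x. B_spline m (x - of_int \<mu>))"

definition spline_V :: "nat \<Rightarrow> int \<Rightarrow> (real \<Rightarrow> real) set" where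
  "spline_V m j = (\<lambda>f x. f (2 powi j * x)) ` spline_V0 m"

definition spline_W0 :: "nat \<Rightarrow> (real \<Rightarrow> real) set" where
  "spline_W0 m = {f \<in> spline_V m 1. \<forall>g \<in> spline_V m 0. L2_inner f g = 0}"

text \<open>In the following the level index \<open>j\<close> is an integer \<open>\<ge> -1\<close>, with \<open>j = -1\<close> standing for
  the scaling function.\<close>

definition wavelet_system ::
  "(real \<Rightarrow> real) \<Rightarrow> (real \<Rightarrow> real) \<Rightarrow> int \<Rightarrow> int \<Rightarrow> real \<Rightarrow> real" where
  "wavelet_system \<psi> \<Psi> j \<mu> =
     (if j \<ge> 0 then (\<lambda>x. \<psi> (2 powi j * x - of_int \<mu>))
      else (\<lambda>x. sqrt 2 * \<Psi> (x - of_int \<mu>)))"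

definition half_integer_piecewise_poly :: "nat \<Rightarrow> (real \<Rightarrow> real) \<Rightarrow> bool" where
  "half_integer_piecewise_poly n f \<longleftrightarrow>
     (\<forall>m::int. \<exists>P::real poly. degree P \<le> n \<and>
        (\<forall>x\<in>{of_int m / 2<..<of_int m / 2 + 1 / 2}. f x = poly P x))"

definition Battle_Lemarie_system :: "nat \<Rightarrow> (real \<Rightarrow> real) \<Rightarrow> (real \<Rightarrow> real) \<Rightarrow> bool" where
  "Battle_Lemarie_system n \<psi> \<Psi> \<longleftrightarrow>
     \<psi> \<in> Lp_space 2 \<and> \<Psi> \<in> Lp_space 2 \<and>
     (\<forall>j\<ge>-1. \<forall>k\<ge>-1. \<forall>\<mu> \<nu>.
        L2_inner (wavelet_system \<psi> \<Psi> j \<mu>) (wavelet_system \<psi> \<Psi> k \<nu>) =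
          (if j = k \<and> \<mu> = \<nu> then 2 powi (- j) else 0)) \<and>
     \<psi> \<in> Cr_functions (n - 1) \<and> \<Psi> \<in> Cr_functions (n - 1) \<and>
     half_integer_piecewise_poly n \<psi> \<and> half_integer_piecewise_poly n \<Psi> \<and>
     (\<exists>C>0. \<exists>\<gamma>>0. \<forall>k\<le>n - 1. \<forall>x.
        \<bar>(deriv ^^ k) \<Psi> x\<bar> + \<bar>(deriv ^^ k) \<psi> x\<bar> \<le> C * exp (- \<gamma> * \<bar>x\<bar>)) \<and>
     (\<forall>\<kappa>\<le>n. (LINT x|lebesgue. x ^ \<kappa> * \<psi> x) = 0) \<and>
     L2_orthonormal_basis (\<lambda>(\<mu>::int) x. \<Psi> (x - of_int \<mu>)) (spline_V0 n) \<and>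
     L2_orthonormal_basis (\<lambda>(\<mu>::int) x. \<psi> (x - of_int \<mu>)) (spline_W0 n)"


section \<open>Shifted spline coefficients\<close>

definition shifted_system ::
  "(real \<Rightarrow> real) \<Rightarrow> (real \<Rightarrow> real) \<Rightarrow> int \<Rightarrow> int \<Rightarrow> real \<Rightarrow> real" where
  "shifted_system \<psi> \<Psi> j \<mu> =
     (if j \<ge> 0 then (\<lambda>x. \<psi> (2 powi j * x - of_int \<mu> / 2))
      else (\<lambda>x. \<Psi> (x - of_int \<mu>)))"

definition spline_coeff ::
  "(real \<Rightarrow> real) \<Rightarrow> (real \<Rightarrow> real) \<Rightarrow> ((real \<Rightarrow> real) \<Rightarrow> real) \<Rightarrow> int \<Rightarrow> int \<Rightarrow> real" where
  "spline_coeff \<psi> \<Psi> f j \<mu> =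
     (if j \<ge> 0
      then 2 powi j * \<bar>f (shifted_system \<psi> \<Psi> j (2 * \<mu>))\<bar>
         + 2 powi j * \<bar>f (shifted_system \<psi> \<Psi> j (2 * \<mu> + 1))\<bar>
      else \<bar>f (shifted_system \<psi> \<Psi> j \<mu>)\<bar>)"

definition lp_seq_norm :: "ennreal \<Rightarrow> (int \<Rightarrow> real) \<Rightarrow> ennreal" where
  "lp_seq_norm p a =
     (if p = \<infinity> then (SUP \<mu>. ennreal \<bar>a \<mu>\<bar>)
      else ennreal_powr (\<Sum>\<^sub>\<infinity>\<mu>\<in>UNIV. ennreal (\<bar>a \<mu>\<bar> powr enn2real p)) (1 / enn2real p))"

text \<open>\<open>enn2real (1 / p)\<close> is \<open>0\<close> for \<open>p = \<infinity>\<close>.\<close>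

definition spline_quantity ::
  "nat \<Rightarrow> ennreal \<Rightarrow> (real \<Rightarrow> real) \<Rightarrow> (real \<Rightarrow> real) \<Rightarrow> ((real \<Rightarrow> real) \<Rightarrow> real) \<Rightarrow> ennreal" where
  "spline_quantity n p \<psi> \<Psi> f =
     (SUP j\<in>{-1..}. ennreal (2 powr (of_int j * (real n + 1 - enn2real (1 / p))))
        * lp_seq_norm p (spline_coeff \<psi> \<Psi> f j))"

end

theory Submission
  imports Defs "HOL-Probability.Sinc_Integral"
begin

text \<open>Wavelet coefficients of a Sobolev function are estimated by Taylor expansion with integral remainder and the
  vanishing moments. Conversely, the $(n+1)$-st differences of B-splines are series in the half-integer translates of
  \<open>\<psi>\<close>: the Chui-Wang wavelet lies in the wavelet space, so it is a rapidly convergent series in the integer translates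
  of \<open>\<psi>\<close>, and because the Gram sequence of the B-splines is invertible, the differences are in turn series in the
  half-integer translates of that wavelet. The shifted coefficients of a functional \<open>f\<close>
  therefore bound, at every scale, the step function which is the $(n+1)$-st derivative of a spline approximation of \<open>f\<close>. These
  step functions are bounded in \<open>L\<^sub>p\<close>, and suitable convex combinations converge in weighted \<open>L\<^sub>1\<close> to the
  weak derivative of a function representing \<open>f\<close>; its polynomial part is controlled by spline moments, that is by the
  coefficients at level \<open>-1\<close>. No Fourier analysis is needed.\<close>

text \<open>The coefficients see \<open>f\<close> through splines of degree n, which have only n - 1
  continuous derivatives, so n + 1 derivatives cannot be moved onto them. The way round is
  transposition. The quasi-interpolant of a test function is expanded in B_n, which
  \<open>S_space (n - 1)\<close> admits, with coefficients that are averages against B_(n+1). Read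
  in the other order, this pairs the test function with a spline of degree n + 1 whose coefficients
  are values of \<open>f\<close>; its top derivative is a step function made of (n+1)-st
  differences. A difference at scale 2^(j+1) is \<open>f\<close> applied to a half-integer translate
  of one fixed function at scale 2^j; integer translates alone would give only every second
  difference, whence the shifted coefficients. The weight (1 + |x|)^(-2) puts L_p for all p > 1,
  infinity included, into one weighted L_1, and p > 1 supplies the uniform integrability needed
  there. The convex combinations act on splines and step functions simultaneously, because the
  splines must keep converging to \<open>f\<close>.\<close>

abbreviation lebesgue_LI :: "(real \<Rightarrow> real) \<Rightarrow> real" (binder "LI " 60) where "lebesgue_LI \<equiv> integral\<^sup>L lebesgue"
abbreviation lint :: "(real \<Rightarrow> real) \<Rightarrow> bool" where "lint \<equiv> integrable lebesgue"
abbreviation lmeas :: "(real \<Rightarrow> 'b::topological_space) set" where "lmeas \<equiv> borel_measurable lebesgue"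
abbreviation cont :: "('a::topological_space \<Rightarrow> 'b::topological_space) \<Rightarrow> bool" where "cont \<equiv> continuous_on UNIV"
text \<open>The weight of \<open>S_space\<close> and \<open>S_tendsto\<close>. It is at least 1, so
  its powers increase with the exponent.\<close>

abbreviation jb :: "real \<Rightarrow> real" where "jb x \<equiv> 1 + \<bar>x\<bar>"
abbreviation "loc_int \<equiv> locally_integrable"
abbreviation "test_funs \<equiv> smooth_compact_support"

lemmas HK_integral_nonneg = Henstock_Kurzweil_Integration.integral_nonneg
lemmas HK_integral_combine = Henstock_Kurzweil_Integration.integral_combine
lemmas HK_integral_cong = Henstock_Kurzweil_Integration.integral_cong
lemmas LI_add = Bochner_Integration.integral_add
lemmas LI_diff = Bochner_Integration.integral_diff
lemmas LI_sum = Bochner_Integration.integral_sum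
lemmas LI_cong = Bochner_Integration.integral_cong
lemmas lint_add = Bochner_Integration.integrable_add
lemmas lint_sum = Bochner_Integration.integrable_sum
lemmas lint_bound = Bochner_Integration.integrable_bound

section \<open>Functions with continuous derivatives\<close>

lemma Cr_functions_0: "f \<in> Cr_functions 0 \<longleftrightarrow> cont f"
  by (simp add: Cr_functions_def)

text \<open>Trades the description by all orders at once for a recursion on the order; the closure
  properties below are inductions through it.\<close>

lemma Cr_functions_Suc:
  "f \<in> Cr_functions (Suc r) \<longleftrightarrow> (\<forall>x. f differentiable (at x)) \<and> deriv f \<in> Cr_functions r"
proof
  assume f: "f \<in> Cr_functions (Suc r)"
  have a: "(deriv ^^ k) f differentiable (at x)" if "k < Suc r" for k x
    using f that by (simp add: Cr_functions_def)
  have b: "cont ((deriv ^^ k) f)" if "k \<le> Suc r" for k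
    using f that by (simp add: Cr_functions_def)
  have "f differentiable (at x)" for x using a[of 0] by simp
  moreover have "(deriv ^^ k) (deriv f) differentiable (at x)" if "k < r" for k x
    using a[of "Suc k" x] that by (simp add: funpow_swap1)
  moreover have "cont ((deriv ^^ k) (deriv f))" if "k \<le> r" for k
    using b[of "Suc k"] that by (simp add: funpow_swap1)
  ultimately show "(\<forall>x. f differentiable (at x)) \<and> deriv f \<in> Cr_functions r"
    by (simp add: Cr_functions_def)
next
  assume f: "(\<forall>x. f differentiable (at x)) \<and> deriv f \<in> Cr_functions r"
  have "(deriv ^^ k) f differentiable (at x)" if "k < Suc r" for k x
  proof (cases k)
    case 0 then show ?thesis using f by simp
  next
    case (Suc i) then show ?thesis using f that by (simp add: funpow_swap1 Cr_functions_def)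
  qed
  moreover have "cont ((deriv ^^ k) f)" if "k \<le> Suc r" for k
  proof (cases k)
    case 0 then show ?thesis using f
      by (auto intro!: differentiable_imp_continuous_on simp: differentiable_on_def intro: differentiable_at_withinI)
  next
    case (Suc i) then show ?thesis using f that by (simp add: funpow_swap1 Cr_functions_def)
  qed
  ultimately show "f \<in> Cr_functions (Suc r)" by (simp add: Cr_functions_def)
qed

lemma Cr_functions_SucI:
  assumes "!!x. (f has_real_derivative g x) (at x)" "g \<in> Cr_functions r"
  shows "f \<in> Cr_functions (Suc r)"
proof -
  have "deriv f = g" using assms(1) by (auto intro!: DERIV_imp_deriv)
  then show ?thesis using assms by (auto simp: Cr_functions_Suc real_differentiable_def)
qed

lemma Cr_functions_SucD:
  assumes "f \<in> Cr_functions (Suc r)"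
  shows "(f has_real_derivative deriv f x) (at x)" "deriv f \<in> Cr_functions r"
  using assms by (auto simp: Cr_functions_Suc DERIV_deriv_iff_real_differentiable)

lemma Cr_functions_antimono: "r \<le> s ==> f \<in> Cr_functions s ==> f \<in> Cr_functions r"
  by (auto simp: Cr_functions_def)

lemma Cr_functions_const: "(\<lambda>x. c) \<in> Cr_functions r"
proof (induction r arbitrary: c)
  case 0 then show ?case by (simp add: Cr_functions_0)
next
  case (Suc r) show ?case by (rule Cr_functions_SucI[OF _ Suc]) (rule DERIV_const)
qed

lemma Cr_functions_add:
  "f \<in> Cr_functions r ==> g \<in> Cr_functions r ==> (\<lambda>x. f x + g x) \<in> Cr_functions r"
proof (induction r arbitrary: f g)
  case 0 then show ?case by (auto simp: Cr_functions_0 intro: continuous_on_add)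
next
  case (Suc r)
  show ?case
    by (rule Cr_functions_SucI[OF DERIV_add[OF Cr_functions_SucD(1)[OF Suc.prems(1)] Cr_functions_SucD(1)[OF Suc.prems(2)]]])
       (intro Suc.IH Cr_functions_SucD(2) Suc.prems)
qed

lemma Cr_functions_mult:
  "f \<in> Cr_functions r ==> g \<in> Cr_functions r ==> (\<lambda>x. f x * g x) \<in> Cr_functions r"
proof (induction r arbitrary: f g)
  case 0 then show ?case by (auto simp: Cr_functions_0 intro: continuous_on_mult)
next
  case (Suc r)
  have "f \<in> Cr_functions r" "g \<in> Cr_functions r" 
    using Suc.prems by (auto intro: Cr_functions_antimono[of r "Suc r"])
  then show ?case
    by (intro Cr_functions_SucI[OF DERIV_mult[OF Cr_functions_SucD(1)[OF Suc.prems(1)] Cr_functions_SucD(1)[OF Suc.prems(2)]]])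
       (intro Cr_functions_add Suc.IH Cr_functions_SucD(2) Suc.prems)
qed

lemma Cr_functions_cmult: "f \<in> Cr_functions r ==> (\<lambda>x. c * f x) \<in> Cr_functions r"
  by (intro Cr_functions_mult Cr_functions_const)

lemma Cr_functions_sum:
  "(!!i. i \<in> A ==> f i \<in> Cr_functions r) ==> (\<lambda>x. \<Sum>i\<in>A. f i x) \<in> Cr_functions r"
  by (induction A rule: infinite_finite_induct) (auto intro: Cr_functions_add Cr_functions_const)

lemma has_real_derivative_affine: "((\<lambda>x. a * x + b) has_real_derivative a) (at x within S)"
  by (auto intro!: derivative_eq_intros)

lemma Cr_functions_affine: "f \<in> Cr_functions r ==> (\<lambda>x. f (a * x + b)) \<in> Cr_functions r"
proof (induction r arbitrary: f)
  case 0 then show ?case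
    by (auto simp: Cr_functions_0 intro!: continuous_intros continuous_on_compose2[of UNIV f])
next
  case (Suc r)
  have "((\<lambda>x. f (a * x + b)) has_real_derivative a * deriv f (a * x + b)) (at x)" for x
    using DERIV_chain2[OF Cr_functions_SucD(1)[OF Suc.prems] has_real_derivative_affine, of a b x UNIV]
    by (simp add: mult.commute)
  then show ?case
    by (rule Cr_functions_SucI) (intro Cr_functions_cmult Suc.IH Cr_functions_SucD(2)[OF Suc.prems])
qed

lemma higher_deriv_affine:
  assumes "f \<in> Cr_functions r" "k \<le> r"
  shows "(deriv ^^ k) (\<lambda>x. f (a * x + b)) = (\<lambda>x. a ^ k * (deriv ^^ k) f (a * x + b))"
  using assms(2)
proof (induction k)
  case (Suc k)
  have d: "((deriv ^^ k) f has_real_derivative (deriv ^^ Suc k) f y) (at y)" for y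
    using assms Suc.prems by (auto simp: Cr_functions_def DERIV_deriv_iff_real_differentiable)
  have "((\<lambda>x. a ^ k * (deriv ^^ k) f (a * x + b)) has_real_derivative a ^ Suc k * (deriv ^^ Suc k) f (a * x + b)) (at x)" for x
    using DERIV_cmult[OF DERIV_chain2[OF d has_real_derivative_affine, of a b x UNIV], of "a ^ k"]
    by (simp add: algebra_simps)
  then show ?case using Suc by (auto intro!: DERIV_imp_deriv)
qed simp

lemma higher_deriv_add:
  assumes "f \<in> Cr_functions r" "g \<in> Cr_functions r" "k \<le> r"
  shows "(deriv ^^ k) (\<lambda>x. f x + g x) = (\<lambda>x. (deriv ^^ k) f x + (deriv ^^ k) g x)"
  using assms(3)
proof (induction k)
  case (Suc k)
  have d: "((deriv ^^ k) h has_real_derivative (deriv ^^ Suc k) h y) (at y)" if "h \<in> Cr_functions r" for h y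
    using that Suc.prems by (auto simp: Cr_functions_def DERIV_deriv_iff_real_differentiable)
  show ?case using DERIV_add[OF d[OF assms(1)] d[OF assms(2)]] Suc by (auto intro!: DERIV_imp_deriv)
qed simp

lemma higher_deriv_cmult:
  assumes "f \<in> Cr_functions r" "k \<le> r"
  shows "(deriv ^^ k) (\<lambda>x. c * f x) = (\<lambda>x. c * (deriv ^^ k) f x)"
  using assms(2)
proof (induction k)
  case (Suc k)
  have d: "((deriv ^^ k) f has_real_derivative (deriv ^^ Suc k) f y) (at y)" for y
    using assms Suc.prems by (auto simp: Cr_functions_def DERIV_deriv_iff_real_differentiable)
  show ?case using DERIV_cmult[OF d] Suc by (auto intro!: DERIV_imp_deriv)
qed simp

lemma higher_deriv_zero: "(deriv ^^ k) (\<lambda>x. 0) = (\<lambda>x. 0::real)"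
  by (induction k) auto

lemma higher_deriv_sum:
  assumes "!!i. i \<in> A ==> f i \<in> Cr_functions r" "k \<le> r"
  shows "(deriv ^^ k) (\<lambda>x. \<Sum>i\<in>A. f i x) = (\<lambda>x. \<Sum>i\<in>A. (deriv ^^ k) (f i) x)"
  using assms(1)
proof (induction A rule: infinite_finite_induct)
  case (insert i A)
  then show ?case
    using higher_deriv_add[of "f i" r "\<lambda>x. \<Sum>i\<in>A. f i x" k] assms(2) Cr_functions_sum[of A f r] by auto
qed (auto simp: higher_deriv_zero)

text \<open>For \<open>x > 0\<close> these are the functions \<open>x\<^sup>-\<^sup>k exp (- 1 / x)\<close>, whose linear span is closed
  under differentiation.\<close>

definition exp_bump :: "nat => real => real" where
  "exp_bump k x = (if x > 0 then (1 / x) ^ k * exp (- (1 / x)) else 0)"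

text \<open>A nonnegative series dominates each of its terms. This serves both the flatness of
  \<open>exp_bump\<close> at 0 and the passage from exponential to rapid decay.\<close>

lemma exp_ge_power_fact: "(y::real) \<ge> 0 ==> y ^ m / fact m \<le> exp y"
proof (cases "m = 0")
  case False
  assume "y \<ge> 0"
  have "(\<lambda>k. y ^ k / fact k) sums exp y" using exp_converges[of y] by (simp add: divide_inverse mult.commute scaleR_conv_of_real)
  then have "(\<Sum>k\<in>{m}. y ^ k / fact k) \<le> exp y"
    using \<open>y \<ge> 0\<close> by (metis (no_types, lifting) sums_summable sums_unique sum_le_suminf finite.emptyI finite_insert
      divide_nonneg_nonneg fact_ge_zero zero_le_power)
  then show ?thesis by simp
qed auto

text \<open>One term of the exponential series at \<open>1 / x\<close> controls
  \<open>(1 / x) ^ (k + 2)\<close>. The two spare powers leave \<open>x\<^sup>2\<close>, enough for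
  the difference quotient at 0 to vanish.\<close>

lemma exp_bump_bound: "\<bar>exp_bump k x\<bar> \<le> fact (k + 2) * x\<^sup>2"
proof (cases "x > 0")
  case True
  have "(1/x) ^ (k + 2) / fact (k + 2) \<le> exp (1/x)" using True by (intro exp_ge_power_fact) auto
  then have "(1/x) ^ (k + 2) \<le> fact (k + 2) * exp (1/x)" 
    by (subst (asm) pos_divide_le_eq) (simp_all only: fact_gt_zero mult.commute)
  then have "(1/x) ^ (k + 2) * exp (- (1/x)) * x\<^sup>2 \<le> fact (k + 2) * exp (1/x) * exp (- (1/x)) * x\<^sup>2"
    by (intro mult_right_mono) auto
  moreover have "(1/x) ^ (k + 2) * exp (- (1/x)) * x\<^sup>2 = exp_bump k x"
    using True by (simp add: exp_bump_def power_add power_divide power2_eq_square)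
  moreover have "fact (k + 2) * exp (1/x) * exp (- (1/x)) * x\<^sup>2 = fact (k + 2) * x\<^sup>2"
    by (simp add: exp_minus)
  ultimately have "exp_bump k x \<le> fact (k + 2) * x\<^sup>2" by argo
  then show ?thesis using True by (simp add: exp_bump_def abs_mult)
qed (auto simp: exp_bump_def)

lemma exp_bump_deriv:
  "(exp_bump k has_real_derivative - real k * exp_bump (Suc k) x + exp_bump (k + 2) x) (at x)"
proof -
  consider "x > 0" | "x < 0" | "x = 0" by linarith
  then show ?thesis
  proof cases
    case 1
    have "((\<lambda>x. (1 / x) ^ k * exp (- (1 / x))) has_real_derivative - real k * exp_bump (Suc k) x + exp_bump (k + 2) x) (at x)"
    proof (cases k)
      case 0 then show ?thesis
        using 1 by (auto intro!: derivative_eq_intros simp: exp_bump_def field_simps power2_eq_square)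
    next
      case (Suc i) then show ?thesis
        using 1 by (auto intro!: derivative_eq_intros simp: exp_bump_def power2_eq_square)
           (cases i; simp add: field_simps)
    qed
    then show ?thesis
      by (rule has_field_derivative_transform_within_open[of _ _ _ "{0<..}"]) (use 1 in \<open>auto simp: exp_bump_def\<close>)
  next
    case 2
    have "((\<lambda>x. 0) has_real_derivative - real k * exp_bump (Suc k) x + exp_bump (k + 2) x) (at x)"
      using 2 by (auto simp: exp_bump_def)
    then show ?thesis
      by (rule has_field_derivative_transform_within_open[of _ _ _ "{..<0}"]) (use 2 in \<open>auto simp: exp_bump_def\<close>)
  next
    case 3
    have "((\<lambda>h. exp_bump k h / h) \<longlongrightarrow> 0) (at 0)"
    proof (rule Lim_null_comparison)
      show "\<forall>\<^sub>F h in at 0. norm (exp_bump k h / h) \<le> fact (k + 2) * \<bar>h\<bar>"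
      proof (rule eventually_at_topological[THEN iffD2], intro exI[of _ UNIV] conjI ballI impI)
        fix h :: real assume "h \<noteq> 0"
        then show "norm (exp_bump k h / h) \<le> fact (k + 2) * \<bar>h\<bar>"
          using exp_bump_bound[of k h] power2_eq_square[of "\<bar>h\<bar>"]
          by (simp add: pos_divide_le_eq mult.assoc)
      qed auto
      show "((\<lambda>h. fact (k + 2) * \<bar>h\<bar>) \<longlongrightarrow> 0) (at (0::real))"
        by (intro tendsto_eq_intros) auto
    qed
    then have "(exp_bump k has_real_derivative 0) (at 0)"
      by (simp add: has_field_derivative_iff exp_bump_def)
    then show ?thesis using 3 by (simp add: exp_bump_def)
  qed
qed

lemma exp_bump_Cr: "exp_bump k \<in> Cr_functions r"
proof (induction r arbitrary: k)
  case 0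
  show ?case by (auto simp: Cr_functions_0 intro!: DERIV_continuous_on exp_bump_deriv DERIV_subset[OF exp_bump_deriv])
next
  case (Suc r)
  show ?case
    by (rule Cr_functions_SucI[OF exp_bump_deriv]) (intro Cr_functions_add Cr_functions_cmult Suc)
qed

section \<open>Test functions and primitives\<close>

lemma test_funs_iff:
  "phi \<in> test_funs \<longleftrightarrow>
     (\<forall>r. phi \<in> Cr_functions r) \<and> (\<exists>X. \<forall>x. \<bar>x\<bar> > X --> phi x = 0)"
proof -
  have "compact (closure {x. phi x \<noteq> 0}) \<longleftrightarrow> (\<exists>X. \<forall>x. \<bar>x\<bar> > X --> phi x = 0)"
    unfolding compact_closure bounded_iff by (auto simp: not_less[symmetric])
  then show ?thesis by (simp add: smooth_compact_support_def)
qed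

lemma scs_Cr: "phi \<in> test_funs ==> phi \<in> Cr_functions r"
  by (simp add: test_funs_iff)

lemma scs_continuous: "phi \<in> test_funs ==> continuous_on S phi"
  using scs_Cr[of phi 0] continuous_on_subset by (auto simp: Cr_functions_0)

lemma scs_DERIV: "phi \<in> test_funs ==> (phi has_real_derivative deriv phi x) (at x within S)"
  by (rule has_field_derivative_at_within) (rule Cr_functions_SucD(1)[OF scs_Cr[of phi "Suc 0"]])

lemma scs_support:
  assumes "phi \<in> test_funs"
  obtains X where "X > 0" "!!x. \<bar>x\<bar> \<ge> X ==> phi x = 0"
proof -
  obtain X where X: "!!x. \<bar>x\<bar> > X ==> phi x = 0" using assms by (auto simp: test_funs_iff)
  show ?thesis by (rule that[of "\<bar>X\<bar> + 1"]) (auto intro!: X)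
qed

lemma deriv_zero_outside:
  assumes "!!x. \<bar>x\<bar> > X ==> phi x = (0::real)" "\<bar>x\<bar> > (X::real)"
  shows "deriv phi x = 0"
proof -
  have "open {x::real. \<bar>x\<bar> > X}" by (intro open_Collect_less continuous_intros)
  then have "(phi has_real_derivative 0) (at x)"
    by (rule has_field_derivative_transform_within_open[OF DERIV_const[of 0]]) (use assms in auto)
  then show ?thesis by (rule DERIV_imp_deriv)
qed

lemma scs_deriv:
  assumes "phi \<in> test_funs" shows "deriv phi \<in> test_funs"
  using assms deriv_zero_outside[of _ phi] Cr_functions_SucD(2)
  unfolding test_funs_iff by blast

lemma scs_higher_deriv: "phi \<in> test_funs ==> (deriv ^^ k) phi \<in> test_funs"
  by (induction k) (auto intro: scs_deriv)

lemma scs_cmult: "phi \<in> test_funs ==> (\<lambda>x. c * phi x) \<in> test_funs"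
  unfolding test_funs_iff by (auto intro: Cr_functions_cmult)

lemma scs_add:
  assumes "phi \<in> test_funs" "eta \<in> test_funs"
  shows "(\<lambda>x. phi x + eta x) \<in> test_funs"
proof -
  obtain X Y where "!!x. \<bar>x\<bar> > X ==> phi x = 0" "!!x. \<bar>x\<bar> > Y ==> eta x = 0"
    using assms unfolding test_funs_iff by auto
  then have "\<forall>x. \<bar>x\<bar> > max X Y --> phi x + eta x = 0" by auto
  moreover have "\<forall>r. (\<lambda>x. phi x + eta x) \<in> Cr_functions r"
    using assms unfolding test_funs_iff by (auto intro: Cr_functions_add)
  ultimately show ?thesis unfolding test_funs_iff by blast
qed

lemma scs_shift:
  assumes "phi \<in> test_funs" shows "(\<lambda>x. phi (x - a)) \<in> test_funs"
proof -
  obtain X where "!!x. \<bar>x\<bar> > X ==> phi x = 0" using assms unfolding test_funs_iff by auto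
  then have "\<forall>x. \<bar>x\<bar> > X + \<bar>a\<bar> --> phi (x - a) = 0" by auto
  then show ?thesis using assms Cr_functions_affine[of phi _ 1 "-a"] unfolding test_funs_iff by auto
qed

lemma scs_sum:
  "(!!i. i \<in> A ==> f i \<in> test_funs) ==> (\<lambda>x. \<Sum>i\<in>A. f i x) \<in> test_funs"
proof (induction A rule: infinite_finite_induct)
  case (insert i A) then show ?case by (auto intro: scs_add)
qed (auto simp: test_funs_iff intro: Cr_functions_const)

lemma lmeas_continuous: "cont f ==> f \<in> lmeas"
  for f :: "real => real"
  by (intro measurable_completion) (simp add: borel_measurable_continuous_onI)

lemma loc_int_mult_continuous:
  fixes phi :: "real => real"
  assumes u: "loc_int u" and phi: "cont phi"
    and X: "!!x. x \<notin> {a..b} ==> phi x = 0"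
  shows "lint (\<lambda>x. u x * phi x)"
proof -
  have "bounded (phi ` {a..b})" 
    by (intro compact_imp_bounded compact_continuous_image continuous_on_subset[OF phi]) auto
  then obtain B where "\<forall>x\<in>{a..b}. \<bar>phi x\<bar> \<le> B" by (auto simp: bounded_iff)
  then have B: "!!x. x \<in> {a..b} ==> \<bar>phi x\<bar> \<le> B" by blast
  have i: "lint (\<lambda>x. indicator {a..b} x * u x)"
    using u by (simp add: locally_integrable_def set_integrable_def)
  have "lint (\<lambda>x. (indicator {a..b} x * u x) * phi x)"
  proof (rule lint_bound[OF integrable_mult_right[OF integrable_abs[OF i], of B]])
    show "(\<lambda>x. (indicator {a..b} x * u x) * phi x) \<in> lmeas"
      using i lmeas_continuous[OF phi]
      by (intro borel_measurable_times[where f="\<lambda>x. indicator {a..b} x * u x"]) auto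
    show "AE x in lebesgue. norm (indicator {a..b} x * u x * phi x) \<le> norm (B * \<bar>indicator {a..b} x * u x\<bar>)"
    proof (rule AE_I2)
      fix x show "norm (indicator {a..b} x * u x * phi x) \<le> norm (B * \<bar>indicator {a..b} x * u x\<bar>)"
        using B[of x] by (cases "x \<in> {a..b}") (auto simp: abs_mult mult.commute[of "\<bar>u x\<bar>"] intro!: mult_right_mono)
    qed
  qed
  moreover have "(\<lambda>x. (indicator {a..b} x * u x) * phi x) = (\<lambda>x. u x * phi x)"
    using X by (intro ext) (auto simp del: atLeastAtMost_iff simp: indicator_def)
  ultimately show ?thesis by simp
qed

lemma scs_integrable_mult:
  assumes "loc_int u" "phi \<in> test_funs"
  shows "lint (\<lambda>x. u x * phi x)"
proof -
  obtain X where "X > 0" "!!x. \<bar>x\<bar> \<ge> X ==> phi x = 0" using scs_support[OF assms(2)] by blast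
  then show ?thesis
    using assms scs_continuous by (intro loc_int_mult_continuous[of _ _ "-X" X]) (auto simp: abs_if)
qed

lemma loc_int_continuous:
  assumes "cont f" shows "loc_int f"
  unfolding locally_integrable_def
  using assms by (auto intro!: absolutely_integrable_continuous_real intro: continuous_on_subset)

lemma loc_int_add: "loc_int f ==> loc_int g ==> loc_int (\<lambda>x. f x + g x)"
  by (simp add: locally_integrable_def)

lemma loc_int_cmult: "loc_int f ==> loc_int (\<lambda>x. c * f x)"
  by (simp add: locally_integrable_def)

lemma loc_int_diff: "loc_int f ==> loc_int g ==> loc_int (\<lambda>x. f x - g x)"
  by (simp add: locally_integrable_def)

lemma loc_int_abs: "loc_int f ==> loc_int (\<lambda>x. \<bar>f x\<bar>)"
  by (simp add: locally_integrable_def set_integrable_abs)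

lemma loc_int_integrable_on: "loc_int f ==> f integrable_on {a..b}"
  unfolding locally_integrable_def by (simp add: set_lebesgue_integral_eq_integral)

lemma loc_int_measurable:
  assumes "loc_int f" shows "f \<in> lmeas"
proof (rule borel_measurable_LIMSEQ_real)
  fix N :: nat
  show "(\<lambda>x. indicator {- real N..real N} x * f x) \<in> lmeas"
    using assms unfolding locally_integrable_def set_integrable_def by auto
next
  fix x :: real
  have "\<forall>\<^sub>F N in sequentially. f x = indicator {- real N..real N} x * f x"
    using eventually_ge_at_top[of "nat \<lceil>\<bar>x\<bar>\<rceil>"]
  proof eventually_elim
    case (elim N) then have "\<bar>x\<bar> \<le> real N" by linarith
    then show ?case by (auto simp: indicator_def abs_le_iff)
  qed
  then show "(\<lambda>N. indicator {- real N..real N} x * f x) \<longlonglongrightarrow> f x"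
    by (rule Lim_transform_eventually[OF tendsto_const])
qed

section \<open>Oriented and iterated primitives of locally integrable functions\<close>

definition prim :: "(real => real) => real => real => real" where
  "prim u a x = integral {a..x} u - integral {x..a} u"

text \<open>\<open>prim\<close> is the oriented integral from \<open>a\<close> to \<open>x\<close>,
  since one of its two integrals runs over an empty or degenerate interval. With a base point
  \<open>c\<close> left of both arguments the case distinction disappears, and regularity follows
  from that of the unoriented integral.\<close>

lemma prim_eq:
  assumes u: "!!a b. u integrable_on {a..b}" and c: "c \<le> a" "c \<le> x"
  shows "prim u a x = integral {c..x} u - integral {c..a} u"
proof (cases "a \<le> x")
  case True
  then have "integral {x..a} u = 0" by (cases "a = x") auto
  then show ?thesis using HK_integral_combine[where a=c and c=a and b=x, OF _ _ u] c True by (simp add: prim_def)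
next
  case False
  then have "integral {a..x} u = 0" by auto
  then show ?thesis using HK_integral_combine[where a=c and c=x and b=a, OF _ _ u] c False by (simp add: prim_def)
qed

lemma prim_self [simp]: "prim u a a = 0" by (simp add: prim_def)

lemma prim_le: "a \<le> x ==> prim u a x = integral {a..x} u"
  by (cases "a = x") (auto simp: prim_def)

lemma prim_shift_base:
  assumes u: "!!a b. u integrable_on {a..b}"
  shows "prim u a x = prim u a b + prim u b x"
proof -
  define c where "c = min a (min b x)"
  show ?thesis using prim_eq[OF u, of c] by (simp add: c_def)
qed

lemma prim_DERIV:
  assumes u: "cont u"
  shows "(prim u a has_real_derivative u x) (at x)"
proof -
  define c where "c = min a x - 1"
  have ui: "u integrable_on {a..b}" for a b
    by (intro integrable_continuous_real continuous_on_subset[OF u]) auto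
  have "((\<lambda>x. integral {c..x} u) has_real_derivative u x) (at x within {c..x+1})"
    by (intro integral_has_real_derivative continuous_on_subset[OF u]) (auto simp: c_def)
  then have "((\<lambda>x. integral {c..x} u) has_real_derivative u x) (at x)"
    by (subst (asm) at_within_interior) (auto simp: c_def)
  then have "((\<lambda>x. integral {c..x} u - integral {c..a} u) has_real_derivative u x) (at x)"
    by (auto intro!: derivative_eq_intros)
  then show ?thesis
    by (rule has_field_derivative_transform_within_open[of _ _ _ "{c<..}"])
       (use prim_eq[OF ui, of c] in \<open>auto simp: c_def\<close>)
qed

lemma prim_continuous:
  assumes u: "!!a b. u integrable_on {a..b}"
  shows "cont (prim u a)"
proof -
  have "isCont (prim u a) x" for x
  proof -
    define c where "c = min a x - 1"
    have "continuous_on {c..x+1} (\<lambda>x. integral {c..x} u)"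
      by (rule indefinite_integral_continuous_1[OF u])
    then have "continuous_on {c..x+1} (\<lambda>x. integral {c..x} u - integral {c..a} u)"
      by (intro continuous_intros)
    then have "continuous_on {c..x+1} (prim u a)"
      by (rule continuous_on_eq) (use prim_eq[OF u, of c] in \<open>auto simp: c_def\<close>)
    then show ?thesis by (rule continuous_on_interior) (auto simp: c_def)
  qed
  then show ?thesis by (simp add: continuous_at_imp_continuous_on)
qed

lemma prim_unique:
  assumes u: "cont u" and f: "!!x. (f has_real_derivative u x) (at x)"
  shows "f x = f a + prim u a x"
proof -
  have "((\<lambda>x. f x - prim u a x) has_real_derivative 0) (at x)" for x
    using DERIV_diff[OF f prim_DERIV[OF u]] by simp
  then have "f x - prim u a x = f a - prim u a a"
    using DERIV_isconst_all[of "\<lambda>x. f x - prim u a x" x a] by simp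
  then show ?thesis by simp
qed

lemma loc_int_prim: "loc_int u ==> loc_int (prim u a)"
  by (rule loc_int_continuous, rule prim_continuous, rule loc_int_integrable_on)

lemma prim_add:
  assumes "!!a b. u integrable_on {a..b}" "!!a b. v integrable_on {a..b}"
  shows "prim (\<lambda>x. u x + v x) a x = prim u a x + prim v a x"
  using assms by (simp add: prim_def integral_add)

lemma prim_cmult: "prim (\<lambda>x. c * u x) a x = c * prim u a x"
  by (simp add: prim_def algebra_simps)

lemma prim_abs_mono:
  assumes "loc_int u"
  shows "\<bar>prim u a x\<bar> \<le> \<bar>prim (\<lambda>t. \<bar>u t\<bar>) a x\<bar>"
proof -
  have *: "\<bar>integral {c..d} u\<bar> \<le> integral {c..d} (\<lambda>t. \<bar>u t\<bar>)" for c d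
    using integral_norm_bound_integral[of u "{c..d}" "\<lambda>t. \<bar>u t\<bar>"]
      loc_int_integrable_on assms loc_int_abs by auto
  show ?thesis using *[of a x] *[of x a] by (cases "a \<le> x"; cases "a = x") (auto simp: prim_def)
qed

text \<open>With \<open>k\<close> the order of differentiation this is the integral remainder of
  Taylor's formula at \<open>a\<close>. The iterated form can be estimated one integration at a
  time, without the kernel \<open>(x - t) ^ (k - 1)\<close>.\<close>

fun iprim :: "nat => (real => real) => real => real => real" where
  "iprim 0 u a = u"
| "iprim (Suc k) u a = prim (iprim k u a) a"

lemma loc_int_iprim: "loc_int u ==> loc_int (iprim k u a)"
  by (induction k) (auto intro: loc_int_prim)

lemma iprim_continuous: "loc_int u ==> cont (iprim (Suc k) u a)"
  unfolding iprim.simps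
  by (rule prim_continuous, rule loc_int_integrable_on, rule loc_int_iprim)

text \<open>The two inequalities say that \<open>t\<close> lies between \<open>a\<close> and
  \<open>x\<close>, whichever side of \<open>a\<close> that is.\<close>

lemma prim_nonneg_mono:
  assumes u: "loc_int u" "!!x. u x \<ge> 0" and "\<bar>t - a\<bar> \<le> \<bar>x - a\<bar>" "(t - a) * (x - a) \<ge> 0"
  shows "\<bar>prim u a t\<bar> \<le> \<bar>prim u a x\<bar>"
proof (cases "x \<ge> a")
  case True
  then have "a \<le> t" "t \<le> x" using assms(3,4) by (auto simp: zero_le_mult_iff)
  then show ?thesis
    using integral_subset_le[of "{a..t}" "{a..x}" u] u loc_int_integrable_on[OF u(1)]
      HK_integral_nonneg[of u "{a..t}"]
    by (simp add: prim_le)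
next
  case False
  then have "t \<le> a" "x \<le> t" using assms(3,4) by (auto simp: zero_le_mult_iff)
  then show ?thesis
    using integral_subset_le[of "{t..a}" "{x..a}" u] u loc_int_integrable_on[OF u(1)]
      HK_integral_nonneg[of u "{t..a}"] False
    by (cases "t = a") (auto simp: prim_def)
qed

lemma prim_bound_const:
  assumes "!!t. \<bar>t - a\<bar> \<le> \<bar>x - a\<bar> ==> (t - a) * (x - a) \<ge> 0 ==> \<bar>u t\<bar> \<le> B"
    and "loc_int u"
  shows "\<bar>prim u a x\<bar> \<le> \<bar>x - a\<bar> * B"
proof (cases "x \<ge> a")
  case True
  have "norm (integral (cbox a x) u) \<le> B * measure lborel (cbox a x)"
  proof (rule integrable_bound)
    show "0 \<le> B" using assms(1)[of x] True by auto
    show "u integrable_on cbox a x" using loc_int_integrable_on[OF assms(2)] by simp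
    show "norm (u t) \<le> B" if "t \<in> cbox a x" for t using that assms(1)[of t] by auto
  qed
  then show ?thesis using True by (simp add: prim_le mult.commute)
next
  case False
  have "norm (integral (cbox x a) u) \<le> B * measure lborel (cbox x a)"
  proof (rule integrable_bound)
    show "0 \<le> B" using assms(1)[of x] False by auto
    show "u integrable_on cbox x a" using loc_int_integrable_on[OF assms(2)] by simp
    show "norm (u t) \<le> B" if "t \<in> cbox x a" for t 
      using that assms(1)[of t] False by (auto simp: mult_nonpos_nonpos)
  qed
  then show ?thesis using False by (simp add: prim_def mult.commute)
qed

text \<open>Only the innermost integration sees the size of \<open>u\<close>. Each further one
  integrates, over an interval of length \<open>\<bar>x - a\<bar>\<close>, a function that is
  bounded there by its bound at \<open>x\<close>.\<close>

lemma iprim_bound: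
  assumes u: "loc_int u"
  shows "\<bar>iprim (Suc k) u a x\<bar> \<le> \<bar>x - a\<bar> ^ k * \<bar>prim (\<lambda>t. \<bar>u t\<bar>) a x\<bar>"
proof (induction k arbitrary: x)
  case 0 then show ?case using prim_abs_mono[OF u] by simp
next
  case (Suc k)
  have "\<bar>prim (iprim (Suc k) u a) a x\<bar> \<le> \<bar>x - a\<bar> * (\<bar>x - a\<bar> ^ k * \<bar>prim (\<lambda>t. \<bar>u t\<bar>) a x\<bar>)"
  proof (rule prim_bound_const)
    fix t assume t: "\<bar>t - a\<bar> \<le> \<bar>x - a\<bar>" "(t - a) * (x - a) \<ge> 0"
    have "\<bar>iprim (Suc k) u a t\<bar> \<le> \<bar>t - a\<bar> ^ k * \<bar>prim (\<lambda>t. \<bar>u t\<bar>) a t\<bar>" by (rule Suc)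
    also have "... \<le> \<bar>x - a\<bar> ^ k * \<bar>prim (\<lambda>t. \<bar>u t\<bar>) a x\<bar>"
      using t by (intro mult_mono power_mono prim_nonneg_mono loc_int_abs u) auto
    finally show "\<bar>iprim (Suc k) u a t\<bar> \<le> \<bar>x - a\<bar> ^ k * \<bar>prim (\<lambda>t. \<bar>u t\<bar>) a x\<bar>" .
  qed (rule loc_int_iprim[OF u])
  then show ?case by (simp add: mult.assoc)
qed

text \<open>\<open>exp_bump 0\<close> times its reflection in 1/2 is supported in the unit interval.
  Its integral is not zero, since a nonnegative continuous function with zero integral would vanish
  at 1/2 as well.\<close>

lemma scs_bump:
  obtains th where "th \<in> test_funs" "!!x. th x \<ge> 0" "!!x. x \<notin> {0..1} ==> th x = 0"
    "integral {0..1} th = 1"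
proof -
  define beta where "beta = (\<lambda>x. exp_bump 0 x * exp_bump 0 (- 1 * x + 1))"
  have c: "beta \<in> Cr_functions r" for r unfolding beta_def by (intro Cr_functions_mult Cr_functions_affine exp_bump_Cr)
  have z: "beta x = 0" if "x \<notin> {0..1}" for x using that by (auto simp: beta_def exp_bump_def)
  have nn: "beta x \<ge> 0" for x by (auto simp: beta_def exp_bump_def)
  have cont: "continuous_on S beta" for S using c[of 0] continuous_on_subset by (auto simp: Cr_functions_0)
  have "integral {0..1} beta \<noteq> 0"
  proof
    assume "integral {0..1} beta = 0"
    then have "beta (1/2) = 0"
      using has_integral_0_cbox_imp_0[of 0 1 beta "1/2"] cont nn 
       integrable_integral[of beta "{0..1}"] integrable_continuous_real[of 0 1 beta] by auto
    then show False by (simp add: beta_def exp_bump_def)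
  qed
  moreover have "integral {0..1} beta \<ge> 0" using nn cont
    by (intro HK_integral_nonneg integrable_continuous_real) auto
  ultimately have p: "integral {0..1} beta > 0" by simp
  have "beta \<in> test_funs"
    unfolding test_funs_iff using c by (auto intro!: exI[of _ 1] z)
  show ?thesis
    by (rule that[of "\<lambda>x. inverse (integral {0..1} beta) * beta x"])
       (use p nn z \<open>beta \<in> test_funs\<close> in \<open>auto intro!: scs_cmult\<close>)
qed

lemma scs_lebesgue_integral:
  assumes "!!x. x \<notin> {a..b} ==> phi x = 0" "cont phi"
  shows "(LI x. phi x) = integral {a..b} (phi :: real => real)"
proof -
  have "set_integrable lebesgue {a..b} phi"
    by (intro absolutely_integrable_continuous_real continuous_on_subset[OF assms(2)]) auto
  then have "(LINT x:{a..b}|lebesgue. phi x) = integral {a..b} phi" by (rule set_lebesgue_integral_eq_integral)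
  moreover have "(\<lambda>x. indicator {a..b} x *\<^sub>R phi x) = phi" using assms(1) by (intro ext) (auto simp del: atLeastAtMost_iff simp: indicator_def)
  ultimately show ?thesis by (simp add: set_lebesgue_integral_def)
qed

text \<open>The primitive taken from the left is constant beyond the support, and the constant is
  the total integral; mean zero is exactly what makes it compactly supported.\<close>

lemma scs_primitive:
  assumes phi: "phi \<in> test_funs" and 0: "(LI x. phi x) = 0"
  obtains eta where "eta \<in> test_funs" "deriv eta = phi"
proof -
  obtain X where X: "X > 0" "!!x. \<bar>x\<bar> \<ge> X ==> phi x = 0" using scs_support[OF phi] by blast
  have cont: "continuous_on S phi" for S by (rule scs_continuous[OF phi])
  have ui: "phi integrable_on {a..b}" for a b by (intro integrable_continuous_real cont)
  have d: "(prim phi (-X) has_real_derivative phi x) (at x)" for x by (rule prim_DERIV[OF cont])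
  have "prim phi (-X) \<in> Cr_functions (Suc r)" for r by (rule Cr_functions_SucI[OF d scs_Cr[OF phi]])
  then have "prim phi (-X) \<in> Cr_functions r" for r using Cr_functions_antimono[of r "Suc r"] by auto
  moreover have "prim phi (-X) x = 0" if "\<bar>x\<bar> > X" for x
  proof (cases "x < 0")
    case True
    then have "integral {x..-X} phi = integral {x..-X} (\<lambda>x. 0)" using X that
      by (intro HK_integral_cong) auto
    then show ?thesis using True that by (simp add: prim_def)
  next
    case False
    have "prim phi (-X) x = integral {-X..x} phi" using False X by (intro prim_le) auto
    also have "... = (LI x. phi x)"
      using X False that by (intro scs_lebesgue_integral[symmetric] cont) (auto simp: abs_if)
    finally show ?thesis using 0 by simp
  qed
  ultimately have "prim phi (-X) \<in> test_funs" unfolding test_funs_iff by auto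
  moreover have "deriv (prim phi (-X)) = phi" using d by (auto intro: DERIV_imp_deriv)
  ultimately show ?thesis by (rule that)
qed

section \<open>Weak derivatives\<close>

lemma lmeas_indicator:
  "A \<in> sets borel ==> (indicator A :: real => real) \<in> lmeas"
  by (intro borel_measurable_indicator) auto

lemma scs_integral_deriv:
  assumes phi: "phi \<in> test_funs"
  shows "(LI x. deriv phi x) = 0"
    and "(LINT x|lborel. indicator {t..} x * deriv phi x) = - phi t"
proof -
  obtain X where X: "X > 0" "!!x. \<bar>x\<bar> \<ge> X ==> phi x = 0" using scs_support[OF phi] by blast
  have X': "deriv phi x = 0" if "\<bar>x\<bar> > X" for x
    using deriv_zero_outside[of X phi x] X that by auto
  have cont: "continuous_on S (deriv phi)" for S by (intro scs_continuous scs_deriv phi)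
  have ftc: "integral {a..b} (deriv phi) = phi b - phi a" if "a \<le> b" for a b
    using fundamental_theorem_of_calculus[OF that, of phi "deriv phi"] scs_DERIV[OF phi]
    by (auto simp: has_real_derivative_iff_has_vector_derivative intro!: integral_unique)
  show "(LI x. deriv phi x) = 0"
  proof (subst scs_lebesgue_integral[of "-X" X])
    show "deriv phi x = 0" if "x \<notin> {-X..X}" for x using that by (intro X') auto
    show "integral {-X..X} (deriv phi) = 0" using ftc[of "-X" X] X by simp
  qed (rule cont)
  define Y where "Y = max X t"
  have "(LINT x|lborel. indicator {t..} x * deriv phi x) = (LINT x|lborel. indicator {t..Y} x * deriv phi x)"
  proof (rule LI_cong[OF refl])
    fix x show "indicator {t..} x * deriv phi x = indicator {t..Y} x * deriv phi x"
      using X'[of x] X(1) by (cases "X < x") (auto simp: indicator_def Y_def)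
  qed
  also have "... = (LI x. indicator {t..Y} x * deriv phi x)"
    using borel_measurable_continuous_onI[OF cont]
    by (intro integral_completion[symmetric] borel_measurable_times borel_measurable_indicator) auto
  also have "... = integral {t..Y} (deriv phi)"
    using set_lebesgue_integral_eq_integral(2)[OF absolutely_integrable_continuous_real[OF cont], of t Y]
    by (simp add: set_lebesgue_integral_def)
  also have "... = - phi t" using X by (subst ftc) (auto simp: Y_def)
  finally show "(LINT x|lborel. indicator {t..} x * deriv phi x) = - phi t" .
qed

text \<open>\<open>u\<close> is only locally integrable, so integration by parts is Fubini's theorem
  on the half plane \<open>t \<le> x\<close>: integrating \<open>deriv phi\<close> from
  \<open>t\<close> on gives \<open>- phi t\<close>.\<close>

lemma integral_prim_mult_deriv:
  assumes u: "loc_int u" and phi: "phi \<in> test_funs"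
  shows "(LI x. prim u a x * deriv phi x) = - (LI x. u x * phi x)"
proof -
  obtain X where X: "X > 0" "!!x. \<bar>x\<bar> \<ge> X ==> phi x = 0" using scs_support[OF phi] by blast
  have X': "deriv phi x = 0" if "\<bar>x\<bar> > X" for x
    using deriv_zero_outside[of X phi x] X that by auto
  note dphi = scs_deriv[OF phi]
  have cont: "continuous_on S (deriv phi)" for S by (rule scs_continuous[OF dphi])
  have ui: "u integrable_on {a..b}" for a b by (rule loc_int_integrable_on[OF u])
  define v0 where "v0 = (\<lambda>x. indicator {-X..X} x * u x)"
  have v0: "lint v0"
    using u by (simp add: locally_integrable_def set_integrable_def v0_def)
  \<comment> \<open>The product measure is formed from \<open>lborel\<close>, so \<open>u\<close>,
    cut off to the support, is replaced by a Borel function that agrees with it almost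
    everywhere.\<close>
  then obtain v where v[measurable]: "v \<in> borel_measurable lborel" and vv0: "AE x in lborel. v0 x = v x"
    using completion_ex_borel_measurable_real[of v0 lborel] by auto
  have vv0': "AE x in lebesgue. v0 x = v x" by (rule AE_completion[OF vv0])
  have "lint v"
    using v0 vv0' v by (subst integrable_cong_AE[symmetric, of v0]) (auto intro: measurable_completion)
  then have vi: "integrable lborel v" using v by (subst (asm) integrable_completion) auto
  have m[measurable]: "deriv phi \<in> borel_measurable borel" by (intro borel_measurable_continuous_onI cont)
  have di: "integrable lborel (deriv phi)"
    using scs_integrable_mult[OF loc_int_continuous dphi, of "\<lambda>x. 1"] m
    by (simp add: integrable_completion)
  define F where "F t x = (if t \<le> x then v t else 0) * deriv phi x" for t x
  have Fi0: "integrable (lborel \<Otimes>\<^sub>M lborel) (\<lambda>(t, x). v t * deriv phi x)"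
  proof (rule lborel_pair.Fubini_integrable)
    have "(\<lambda>t. LINT x|lborel. norm (v t * deriv phi x)) = (\<lambda>t. \<bar>v t\<bar> * (LINT x|lborel. \<bar>deriv phi x\<bar>))"
      by (simp add: abs_mult)
    then show "integrable lborel (\<lambda>x. LINT y|lborel. norm (case (x, y) of (t, x) => v t * deriv phi x))"
      using vi by simp
  qed (use di in auto)
  have Fi: "integrable (lborel \<Otimes>\<^sub>M lborel) (\<lambda>(t, x). F t x)"
    by (rule lint_bound[OF Fi0]) (auto simp: F_def split: prod.split intro!: AE_I2)
  have inner: "prim u (-X) x * deriv phi x = (LINT t|lborel. F t x)" for x
  proof (cases "\<bar>x\<bar> > X")
    case False
    have "prim u (-X) x = integral {-X..x} u" using False by (intro prim_le) auto
    also have "... = (LINT t:{-X..x}|lebesgue. u t)"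
      using u by (subst set_lebesgue_integral_eq_integral) (auto simp: locally_integrable_def)
    also have "... = (LI t. indicator {..x} t * v0 t)"
      unfolding set_lebesgue_integral_def
      by (rule LI_cong) (use False in \<open>auto simp: v0_def indicator_def\<close>)
    also have "... = (LI t. indicator {..x} t * v t)"
      using vv0' v v0 by (intro integral_cong_AE borel_measurable_times) (auto intro: measurable_completion)
    also have "... = (LINT t|lborel. indicator {..x} t * v t)"
      by (rule integral_completion) auto
    finally have "prim u (-X) x * deriv phi x = (LINT t|lborel. indicator {..x} t * v t * deriv phi x)" by simp
    also have "... = (LINT t|lborel. F t x)"
      by (rule LI_cong) (auto simp: F_def)
    finally show ?thesis .
  qed (simp add: F_def X')
  \<comment> \<open>Moving the base point changes the primitive by a constant, against which
    \<open>deriv phi\<close> integrates to zero.\<close>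
  have "(LI x. prim u a x * deriv phi x) = (LI x. prim u a (-X) * deriv phi x + prim u (-X) x * deriv phi x)"
  proof (rule LI_cong[OF refl])
    fix x show "prim u a x * deriv phi x = prim u a (-X) * deriv phi x + prim u (-X) x * deriv phi x"
      by (subst prim_shift_base[OF ui, of a x "-X"]) (rule distrib_right)
  qed
  also have "... = (LI x. prim u a (-X) * deriv phi x) + (LI x. prim u (-X) x * deriv phi x)"
    by (intro LI_add scs_integrable_mult[OF _ dphi] loc_int_prim[OF u]
      loc_int_continuous continuous_on_const)
  also have "(LI x. prim u a (-X) * deriv phi x) = 0"
    using scs_integral_deriv(1)[OF phi] by simp
  also have "(LI x. prim u (-X) x * deriv phi x) = (LINT x|lborel. prim u (-X) x * deriv phi x)"
    by (intro integral_completion borel_measurable_times) 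
       (auto intro!: borel_measurable_continuous_onI prim_continuous ui cont)
  also have "... = (LINT x|lborel. LINT t|lborel. F t x)" by (simp add: inner)
  also have "... = (LINT t|lborel. LINT x|lborel. F t x)" by (rule lborel_pair.Fubini_integral[OF Fi])
  also have "... = (LINT t|lborel. - (v t * phi t))"
  proof (rule LI_cong[OF refl])
    fix t
    have "(LINT x|lborel. F t x) = (LINT x|lborel. v t * (indicator {t..} x * deriv phi x))"
      by (rule LI_cong) (auto simp: F_def)
    also have "... = v t * (LINT x|lborel. (indicator {t..} x * deriv phi x))"
      by (rule integral_mult_right_zero)
    finally show "(LINT x|lborel. F t x) = - (v t * phi t)" by (simp add: scs_integral_deriv(2)[OF phi])
  qed
  also have "... = (LI t. - (v t * phi t))"
    by (intro integral_completion[symmetric] borel_measurable_uminus borel_measurable_times)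
       (auto intro!: borel_measurable_continuous_onI scs_continuous[OF phi])
  also have "... = (LI t. - (v0 t * phi t))"
    using vv0' v0 lmeas_continuous[OF scs_continuous[OF phi]] v
    by (intro integral_cong_AE borel_measurable_uminus borel_measurable_times) (auto intro: measurable_completion)
  also have "... = (LI t. - (u t * phi t))"
  proof (rule LI_cong[OF refl])
    fix t show "- (v0 t * phi t) = - (u t * phi t)"
      using X(2)[of t] by (cases "\<bar>t\<bar> \<le> X") (auto simp: v0_def abs_le_iff)
  qed
  finally show ?thesis by simp
qed

text \<open>Lebesgue's differentiation theorem: off a null set \<open>u x\<close> is the limit of
  the means over \<open>[x, x + h]\<close>, and all of these vanish.\<close>

lemma AE_zero_if_interval_integrals_zero:
  assumes u: "loc_int u" and 0: "!!a b. a < b ==> integral {a..b} u = 0"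
  shows "AE x in lebesgue. u x = 0"
proof -
  have "!!a b. u integrable_on cbox a b" using loc_int_integrable_on[OF u] by simp
  from integrable_ccontinuous_explicit[OF this] obtain N where N: "negligible N" "!!x e. x \<notin> N ==> 0 < e ==>
      \<exists>d>0. \<forall>h. 0 < h \<and> h < d --> norm (integral (cbox x (x + h *\<^sub>R One)) u /\<^sub>R h ^ DIM(real) - u x) < e" by blast
  have "u x = 0" if x: "x \<notin> N" for x
  proof (rule ccontr)
    assume "u x \<noteq> 0"
    then obtain d where d: "d > 0" "!!h. 0 < h ==> h < d ==> norm (integral (cbox x (x + h *\<^sub>R One)) u /\<^sub>R h ^ DIM(real) - u x) < \<bar>u x\<bar>"
      using N(2)[OF x, of "\<bar>u x\<bar>"] by auto
    then show False using d(2)[of "d / 2"] 0[of x "x + d / 2"] by simp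
  qed
  moreover have "N \<in> null_sets lebesgue" using N(1) by (simp add: negligible_iff_null_sets)
  ultimately show ?thesis by (intro AE_I'[of N]) auto
qed

text \<open>The fundamental lemma of the calculus of variations. Rescaled smooth steps approximate
  the indicator of an interval boundedly, which reduces the claim to integrals over
  intervals.\<close>

lemma AE_zero_if_test_zero:
  assumes u: "loc_int u" and 0: "!!phi. phi \<in> test_funs ==> (LI x. u x * phi x) = 0"
  shows "AE x in lebesgue. u x = 0"
proof (rule AE_zero_if_interval_integrals_zero[OF u])
  fix a b :: real assume ab: "a < b"
  obtain th where th: "th \<in> test_funs" "!!x. th x \<ge> 0" "!!x. x \<notin> {0..1} ==> th x = 0"
    "integral {0..1} th = 1" using scs_bump by metis
  have ti: "th integrable_on {c..d}" for c d by (intro integrable_continuous_real scs_continuous[OF th(1)])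
  define S where "S = prim th 0"
  have S0: "S x = 0" if "x \<le> 0" for x
  proof -
    have "integral {x..0} th = integral {x..0} (\<lambda>_. 0)"
      by (rule integral_spike[of "{0}"]) (use th(3) in auto)
    then show ?thesis using that by (cases "x = 0") (auto simp: S_def prim_def)
  qed
  have S1: "S x = 1" if "x \<ge> 1" for x
  proof -
    have "integral {1..x} th = integral {1..x} (\<lambda>_. 0)"
      by (rule integral_spike[of "{1}"]) (use th(3) in auto)
    then show ?thesis using that th(4) HK_integral_combine[of 0 1 x th] ti
      by (auto simp: S_def prim_le)
  qed
  have Sd: "(S has_real_derivative th x) (at x)" for x
    unfolding S_def by (rule prim_DERIV[OF scs_continuous[OF th(1)]])
  have SC: "S \<in> Cr_functions r" for r
    using Cr_functions_antimono[of r "Suc r" S] Cr_functions_SucI[OF Sd scs_Cr[OF th(1)]] by auto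
  have mono: "S x \<le> S y" if "x \<le> y" for x y
    by (rule DERIV_nonneg_imp_nondecreasing[OF that]) (use Sd th(2) in blast)
  have S01: "0 \<le> S x" "S x \<le> 1" for x
    using mono[of "min x 0" x] S0[of "min x 0"] mono[of x "max x 1"] S1[of "max x 1"] by auto
  \<comment> \<open>Two steps of width \<open>1 / Suc m\<close> that start at \<open>a\<close> and
    at \<open>b\<close>. Their difference tends to the indicator of \<open>(a, b]\<close> and is
    bounded by 1 and supported in \<open>[a, b + 1]\<close> for every \<open>m\<close>.\<close>
  define phi where "phi m x = S (real (Suc m) * x + - (real (Suc m) * a)) + -1 * S (real (Suc m) * x + - (real (Suc m) * b))" for m x
  have phi0: "phi m x = 0" if "x \<notin> {a..b+1}" for m x
  proof (cases "x < a")
    case True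
    then have "real (Suc m) * (x - a) \<le> 0" "real (Suc m) * (x - b) \<le> 0" using ab by (auto intro!: mult_nonneg_nonpos)
    then show ?thesis by (simp add: phi_def algebra_simps S0)
  next
    case False
    then have "1 \<le> x - a" "1 \<le> x - b" using ab that by auto
    then have "1 * 1 \<le> real (Suc m) * (x - a)" "1 * 1 \<le> real (Suc m) * (x - b)"
      by (intro mult_mono; simp)+
    then show ?thesis by (simp add: phi_def algebra_simps S1)
  qed
  have phib: "\<bar>phi m x\<bar> \<le> 1" for m x using S01 by (simp add: phi_def abs_le_iff add_increasing add_increasing2 diff_le_eq)
  have phis: "phi m \<in> test_funs" for m
  proof -
    have "\<forall>x. \<bar>x\<bar> > \<bar>a\<bar> + \<bar>b\<bar> + 1 --> phi m x = 0" by (auto intro!: phi0)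
    moreover have "phi m \<in> Cr_functions r" for r
      unfolding phi_def by (intro Cr_functions_add Cr_functions_cmult Cr_functions_affine SC)
    ultimately show ?thesis unfolding test_funs_iff by blast
  qed
  have lim1: "(\<lambda>m. S (real (Suc m) * x + - (real (Suc m) * c))) \<longlonglongrightarrow> indicator {c<..} x" for x c
  proof (cases "x > c")
    case True
    obtain N where N: "1 / (x - c) \<le> real N" using real_arch_simple by blast
    have "\<forall>\<^sub>F m in sequentially. 1 = S (real (Suc m) * x + - (real (Suc m) * c))"
      using eventually_ge_at_top[of N]
    proof eventually_elim
      case (elim m)
      have "1 = (1 / (x - c)) * (x - c)" using True by simp
      also have "... \<le> real (Suc m) * (x - c)" using N elim True by (intro mult_right_mono) auto
      finally show ?case by (subst S1) (auto simp: algebra_simps)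
    qed
    then show ?thesis using True by (auto intro: Lim_transform_eventually[OF tendsto_const])
  next
    case False
    then have "S (real (Suc m) * x + - (real (Suc m) * c)) = 0" for m
      using mult_nonneg_nonpos[of "real (Suc m)" "x - c"] by (intro S0) (auto simp: algebra_simps)
    then show ?thesis using False by auto
  qed
  have "(\<lambda>m. LI x. u x * phi m x) \<longlonglongrightarrow> (LI x. u x * (indicator {a<..} x + -1 * indicator {b<..} x))"
  proof (rule integral_dominated_convergence)
    have "lint (\<lambda>x. indicator {a..b+1} x * \<bar>u x\<bar>)"
      using loc_int_abs[OF u] by (simp add: locally_integrable_def set_integrable_def)
    then show "lint (\<lambda>x. indicator {a..b+1} x * \<bar>u x\<bar>)" .
    show "AE x in lebesgue. (\<lambda>i. u x * phi i x) \<longlonglongrightarrow> u x * (indicator {a<..} x + -1 * indicator {b<..} x)"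
      unfolding phi_def by (intro AE_I2 tendsto_intros lim1)
    show "AE x in lebesgue. norm (u x * phi m x) \<le> indicator {a..b+1} x * \<bar>u x\<bar>" for m
    proof (rule AE_I2)
      fix x show "norm (u x * phi m x) \<le> indicator {a..b+1} x * \<bar>u x\<bar>"
        using phib[of m x] phi0[of x m] by (cases "x \<in> {a..b+1}") (auto simp: abs_mult mult_left_le simp del: atLeastAtMost_iff)
    qed
    show "(\<lambda>x. u x * phi m x) \<in> lmeas" for m
      using scs_integrable_mult[OF u phis] by auto
  qed (use loc_int_measurable[OF u] in \<open>auto intro!: borel_measurable_times borel_measurable_diff lmeas_indicator\<close>)
  then have "(LI x. u x * (indicator {a<..} x + -1 * indicator {b<..} x)) = 0"
    using 0[OF phis] LIMSEQ_unique[OF tendsto_const] by force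
  also have "(LI x. u x * (indicator {a<..} x + -1 * indicator {b<..} x)) = (LINT x:{a..b}|lebesgue. u x)"
    unfolding set_lebesgue_integral_def
    using AE_completion[OF AE_lborel_singleton[of a]] ab loc_int_measurable[OF u]
    by (intro integral_cong_AE borel_measurable_times borel_measurable_scaleR borel_measurable_add)
       (auto elim!: eventually_mono split: split_indicator intro!: lmeas_indicator)
  also have "... = integral {a..b} u"
    using u by (subst set_lebesgue_integral_eq_integral) (auto simp: locally_integrable_def)
  finally show "integral {a..b} u = 0" .
qed

lemma integral_iprim_mult_higher_deriv:
  assumes u: "loc_int u" and phi: "phi \<in> test_funs"
  shows "(LI x. iprim k u a x * (deriv ^^ k) phi x) = (-1) ^ k * (LI x. u x * phi x)"
  using phi
proof (induction k arbitrary: phi)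
  case (Suc k)
  have "(LI x. iprim (Suc k) u a x * (deriv ^^ Suc k) phi x) = - (LI x. iprim k u a x * (deriv ^^ k) phi x)"
    using integral_prim_mult_deriv[OF loc_int_iprim[OF u] scs_higher_deriv[OF Suc.prems]] by simp
  then show ?case using Suc by simp
qed simp

lemma poly_prim: "poly P x = poly P a + prim (poly (pderiv P)) a x"
  by (rule prim_unique) (auto intro!: continuous_intros poly_DERIV)

lemma loc_int_poly: "loc_int (poly P)"
  by (intro loc_int_continuous continuous_intros)

lemma integral_poly_mult_deriv:
  assumes phi: "phi \<in> test_funs"
  shows "(LI x. poly P x * deriv phi x) = - (LI x. poly (pderiv P) x * phi x)"
proof -
  note dphi = scs_deriv[OF phi]
  have "(LI x. poly P x * deriv phi x) = (LI x. poly P 0 * deriv phi x + prim (poly (pderiv P)) 0 x * deriv phi x)"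
    by (subst poly_prim[of P _ 0]) (simp add: distrib_right)
  also have "... = (LI x. poly P 0 * deriv phi x) + (LI x. prim (poly (pderiv P)) 0 x * deriv phi x)"
    by (intro LI_add scs_integrable_mult[OF _ dphi] loc_int_prim loc_int_poly
      loc_int_continuous continuous_on_const)
  finally show ?thesis using scs_integral_deriv(1)[OF phi] integral_prim_mult_deriv[OF loc_int_poly phi] by simp
qed

lemma integral_poly_mult_higher_deriv:
  assumes phi: "phi \<in> test_funs"
  shows "(LI x. poly P x * (deriv ^^ k) phi x) = (-1) ^ k * (LI x. poly ((pderiv ^^ k) P) x * phi x)"
  using phi
proof (induction k arbitrary: P)
  case (Suc k)
  have "(LI x. poly P x * (deriv ^^ Suc k) phi x) = - (LI x. poly (pderiv P) x * (deriv ^^ k) phi x)"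
    using integral_poly_mult_deriv[OF scs_higher_deriv[OF Suc.prems]] by simp
  then show ?case using Suc by (simp add: funpow_swap1)
qed simp

text \<open>The du Bois-Reymond lemma, by induction on \<open>k\<close>. The functions
  \<open>deriv eta\<close> are the test functions of mean zero, so modulo them there is a single
  direction, spanned by a bump \<open>th\<close>; a monomial of degree \<open>k\<close> corrects the
  value of \<open>u\<close> in that direction.\<close>

lemma AE_poly_if_test_zero:
  assumes u: "loc_int u"
    and 0: "!!phi. phi \<in> test_funs ==> (LI x. u x * (deriv ^^ k) phi x) = 0"
  shows "\<exists>P. (\<forall>i\<ge>k. coeff P i = 0) \<and> (AE x in lebesgue. u x = poly P x)"
  using assms
proof (induction k arbitrary: u)
  case 0
  then have "AE x in lebesgue. u x = 0" by (intro AE_zero_if_test_zero) auto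
  then show ?case by (intro exI[of _ 0]) auto
next
  case (Suc k)
  obtain th where th: "th \<in> test_funs" "!!x. th x \<ge> 0" "!!x. x \<notin> {0..1} ==> th x = 0"
    "integral {0..1} th = 1" using scs_bump by metis
  have t1: "(LI x. th x) = 1" using scs_lebesgue_integral[of 0 1 th] th scs_continuous by auto
  define c where "c = (LI x. u x * (deriv ^^ k) th x)"
  \<comment> \<open>The \<open>k\<close>-th derivative of \<open>q\<close> is the constant
    \<open>c * (-1) ^ k\<close>. Its sign cancels the one from \<open>k\<close> integrations by
    parts, so \<open>q\<close> and \<open>u\<close> have the same pairing with the
    \<open>k\<close>-th derivative of \<open>th\<close>.\<close>
  define q where "q = monom (c * (-1) ^ k / fact k) k"
  have pq: "(pderiv ^^ k) q = [:c * (-1) ^ k:]"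
  proof (rule poly_eqI)
    fix i show "coeff ((pderiv ^^ k) q) i = coeff [:c * (-1) ^ k:] i"
      by (cases i) (auto simp: q_def coeff_higher_pderiv pochhammer_fact[symmetric] coeff_pCons)
  qed
  have i1: "lint phi" if "phi \<in> test_funs" for phi
    using scs_integrable_mult[OF loc_int_continuous that, of "\<lambda>x. 1"] by simp
  have "(LI x. (u x - poly q x) * (deriv ^^ k) phi x) = 0" if phi: "phi \<in> test_funs" for phi
  proof -
    define I where "I = (LI x. phi x)"
    have s: "(\<lambda>x. phi x + (- I) * th x) \<in> test_funs" by (intro scs_add scs_cmult phi th(1))
    have "(LI x. phi x + (- I) * th x) = 0"
      using i1[OF phi] i1[OF th(1)] t1 by (simp add: I_def)
    then obtain eta where eta: "eta \<in> test_funs" "deriv eta = (\<lambda>x. phi x + (- I) * th x)"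
      using scs_primitive[OF s] by metis
    have "(deriv ^^ Suc k) eta = (deriv ^^ k) (\<lambda>x. phi x + (- I) * th x)"
      using eta(2) by (simp add: funpow_swap1)
    also have "... = (\<lambda>x. (deriv ^^ k) phi x + (- I) * (deriv ^^ k) th x)"
      using higher_deriv_add[OF scs_Cr[OF phi] scs_Cr[OF scs_cmult[OF th(1)]], of k k "- I"]
        higher_deriv_cmult[OF scs_Cr[OF th(1)], of k k "- I"] by simp
    finally have "(LI x. u x * ((deriv ^^ k) phi x + (- I) * (deriv ^^ k) th x)) = 0"
      using Suc.prems(2)[OF eta(1)] by simp
    then have "(LI x. u x * (deriv ^^ k) phi x + (- I) * (u x * (deriv ^^ k) th x)) = 0"
      by (simp add: algebra_simps)
    moreover have "(LI x. u x * (deriv ^^ k) phi x + (- I) * (u x * (deriv ^^ k) th x))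
        = (LI x. u x * (deriv ^^ k) phi x) + (- I) * c"
      unfolding c_def integral_mult_right_zero[symmetric]
      by (intro LI_add integrable_mult_right scs_integrable_mult Suc.prems scs_higher_deriv phi th(1))
    ultimately have 1: "(LI x. u x * (deriv ^^ k) phi x) = c * I" by (simp add: mult.commute)
    have 2: "(LI x. poly q x * (deriv ^^ k) phi x) = c * I"
      unfolding integral_poly_mult_higher_deriv[OF phi] pq by (simp add: I_def flip: power_mult_distrib mult.assoc)
    have "(LI x. (u x - poly q x) * (deriv ^^ k) phi x) =
       (LI x. u x * (deriv ^^ k) phi x) - (LI x. poly q x * (deriv ^^ k) phi x)"
      unfolding left_diff_distrib
      by (intro LI_diff scs_integrable_mult Suc.prems scs_higher_deriv phi loc_int_poly)
    then show ?thesis using 1 2 by simp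
  qed
  then obtain P where P: "\<forall>i\<ge>k. coeff P i = 0" "AE x in lebesgue. u x - poly q x = poly P x"
    using Suc.IH[OF loc_int_diff[OF Suc.prems(1) loc_int_poly], of q] by auto
  show ?case
  proof (intro exI[of _ "P + q"] conjI allI impI)
    fix i assume "Suc k \<le> i" then show "coeff (P + q) i = 0" using P(1) by (auto simp: q_def)
  next
    show "AE x in lebesgue. u x = poly (P + q) x" using P(2) by eventually_elim (auto simp: algebra_simps)
  qed
qed

text \<open>Taylor's formula with integral remainder for weak derivatives. The base point is free:
  it is placed at the centre of a wavelet to bound coefficients, and at each integer to bound the
  function.\<close>

lemma has_weak_deriv_imp_iprim:
  assumes "has_weak_deriv k g F"
  shows "\<exists>P. (\<forall>i\<ge>k. coeff P i = 0) \<and> (AE x in lebesgue. g x = poly P x + iprim k F a x)"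
proof -
  have li: "loc_int g" "loc_int F" using assms by (auto simp: has_weak_deriv_def)
  have "(LI x. (g x - iprim k F a x) * (deriv ^^ k) phi x) = 0" if phi: "phi \<in> test_funs" for phi
  proof -
    have "(LI x. (g x - iprim k F a x) * (deriv ^^ k) phi x) =
       (LI x. g x * (deriv ^^ k) phi x) - (LI x. iprim k F a x * (deriv ^^ k) phi x)"
      unfolding left_diff_distrib
      by (intro LI_diff scs_integrable_mult scs_higher_deriv phi loc_int_iprim li)
    then show ?thesis
      using assms phi integral_iprim_mult_higher_deriv[OF li(2) phi] by (simp add: has_weak_deriv_def)
  qed
  from AE_poly_if_test_zero[OF loc_int_diff[OF li(1) loc_int_iprim[OF li(2)]] this]
  obtain P where "\<forall>i\<ge>k. coeff P i = 0" "AE x in lebesgue. g x - iprim k F a x = poly P x" by auto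
  then show ?thesis by (intro exI[of _ P]) (auto elim!: eventually_mono)
qed

text \<open>The \<open>j\<close> primitives that remain describe the intermediate derivatives;
  \<open>j = 0\<close> gives the top one.\<close>

lemma has_weak_deriv_iprim:
  assumes F: "loc_int F" and P: "(pderiv ^^ k) P = Q"
  shows "has_weak_deriv k (\<lambda>x. poly P x + iprim (k + j) F a x) (\<lambda>x. poly Q x + iprim j F a x)"
proof -
  have it: "iprim (k + j) F a = iprim k (iprim j F a) a" for k by (induction k) auto
  have "(LI x. (poly P x + iprim (k + j) F a x) * (deriv ^^ k) phi x)
     = (-1) ^ k * (LI x. (poly Q x + iprim j F a x) * phi x)" if phi: "phi \<in> test_funs" for phi
  proof -
    have "(LI x. (poly P x + iprim (k + j) F a x) * (deriv ^^ k) phi x)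
       = (LI x. poly P x * (deriv ^^ k) phi x) + (LI x. iprim (k + j) F a x * (deriv ^^ k) phi x)"
      unfolding distrib_right
      by (intro LI_add scs_integrable_mult scs_higher_deriv phi loc_int_iprim F loc_int_poly)
    moreover have "(LI x. (poly Q x + iprim j F a x) * phi x)
       = (LI x. poly Q x * phi x) + (LI x. iprim j F a x * phi x)"
      unfolding distrib_right
      by (intro LI_add scs_integrable_mult scs_higher_deriv phi loc_int_iprim F loc_int_poly)
    ultimately show ?thesis
      by (simp add: it integral_iprim_mult_higher_deriv loc_int_iprim F phi integral_poly_mult_higher_deriv P distrib_left)
  qed
  then show ?thesis
    unfolding has_weak_deriv_def by (auto intro!: loc_int_add loc_int_poly loc_int_iprim F)
qed

lemma has_weak_deriv_unique:
  assumes "has_weak_deriv k g h" "has_weak_deriv k g' h'" and gg: "AE x in lebesgue. g x = g' x"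
  shows "AE x in lebesgue. h x = h' x"
proof -
  have li: "loc_int g" "loc_int h" "loc_int g'" "loc_int h'"
    using assms by (auto simp: has_weak_deriv_def)
  have "(LI x. (h x - h' x) * phi x) = 0" if phi: "phi \<in> test_funs" for phi
  proof -
    have e: "(LI x. (h x - h' x) * phi x) = (LI x. h x * phi x) - (LI x. h' x * phi x)"
      unfolding left_diff_distrib by (intro LI_diff scs_integrable_mult li phi)
    have "(LI x. g x * (deriv ^^ k) phi x) = (LI x. g' x * (deriv ^^ k) phi x)"
      using gg scs_integrable_mult[OF li(1) scs_higher_deriv[OF phi]] scs_integrable_mult[OF li(3) scs_higher_deriv[OF phi]]
      by (intro integral_cong_AE) (auto elim!: eventually_mono)
    then show ?thesis using assms(1,2) phi e by (auto simp: has_weak_deriv_def)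
  qed
  then have "AE x in lebesgue. h x - h' x = 0"
    by (intro AE_zero_if_test_zero loc_int_diff li)
  then show ?thesis by eventually_elim simp
qed

section \<open>B-splines\<close>

declare iprim.simps(2) [simp del]

lemma B_spline_outside: "x < 0 \<or> x \<ge> real m + 1 ==> B_spline m x = 0"
proof (induction m arbitrary: x)
  case (Suc m)
  have "(\<lambda>y. B_spline m (x - y) * indicator {0..<1} y) = (\<lambda>y. 0)"
    using Suc.prems by (intro ext) (auto simp: indicator_def intro!: Suc.IH)
  then show ?case by simp
qed (auto simp: indicator_def)

lemma B_spline_nonneg: "B_spline m x \<ge> 0"
  by (induction m arbitrary: x) (auto intro!: integral_nonneg_AE AE_I2)

text \<open>The substitution \<open>t = x - y\<close> turns convolution with the unit box into
  integration over the window \<open>(x - 1, x]\<close>, which is the same for every shift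
  \<open>c\<close>.\<close>

lemma B_spline_Suc_LINT:
  "B_spline (Suc m) (x - c) = (LI t. B_spline m (t - c) * indicator {x - 1<..x} t)"
proof -
  have "B_spline (Suc m) (x - c) = (LI y. B_spline m (x - c - y) * indicator {0..<1} y)" by simp
  also have "... = (LI t. B_spline m (x - c - (x + -1 * t)) * indicator {0..<1} (x + -1 * t))"
    by (subst lebesgue_integral_real_affine[of "-1" _ x]) auto
  also have "... = (LI t. B_spline m (t - c) * indicator {x - 1<..x} t)"
    by (intro LI_cong) (auto simp: indicator_def)
  finally show ?thesis .
qed

declare B_spline.simps(2) [simp del]

lemma AE_lebesgue_neq: "AE x in lebesgue. x \<noteq> (a::real)"
  by (rule AE_completion[OF AE_lborel_singleton])

lemma lmeas_affine:
  fixes f :: "real => real"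
  assumes "f \<in> lmeas" "a \<noteq> 0"
  shows "(\<lambda>x. f (a * x + b)) \<in> lmeas"
  using measurable_compose[OF lebesgue_affine_measurable[of "\<lambda>_. a" b] assms(1)] assms(2)
  by (simp add: inner_real_def add.commute)

lemma loc_int_affine:
  assumes u: "loc_int u" and a: "a \<noteq> 0"
  shows "loc_int (\<lambda>x. u (a * x + b))"
  unfolding locally_integrable_def
proof (intro allI)
  fix c d :: real
  define X where "X = min (a * c + b) (a * d + b)"
  define Y where "Y = max (a * c + b) (a * d + b)"
  have "lint (\<lambda>x. indicator {X..Y} x *\<^sub>R u x)"
    using u by (simp add: locally_integrable_def set_integrable_def)
  then have i: "lint (\<lambda>x. indicator {X..Y} (b + a * x) *\<^sub>R u (b + a * x))"
    by (subst lebesgue_integrable_real_affine_iff[OF a, of "\<lambda>x. indicator {X..Y} x *\<^sub>R u x"]) 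
  show "set_integrable lebesgue {c..d} (\<lambda>x. u (a * x + b))"
    unfolding set_integrable_def
  proof (rule lint_bound[OF i])
    show "(\<lambda>x. indicator {c..d} x *\<^sub>R u (a * x + b)) \<in> lmeas"
      using lmeas_affine[OF loc_int_measurable[OF u] a, of b]
      by (intro borel_measurable_scaleR lmeas_indicator) auto
    have "X \<le> b + a * x \<and> b + a * x \<le> Y" if "c \<le> x" "x \<le> d" for x
      using that mult_left_mono[of c x a] mult_left_mono[of x d a] mult_left_mono_neg[of c x a] mult_left_mono_neg[of x d a]
      by (cases "a \<ge> 0") (auto simp: X_def Y_def)
    then show "AE x in lebesgue. norm (indicator {c..d} x *\<^sub>R u (a * x + b)) \<le> norm (indicator {X..Y} (b + a * x) *\<^sub>R u (b + a * x))"
      by (auto simp: indicator_def add.commute intro!: AE_I2)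
  qed
qed

lemma loc_int_shift: "loc_int u ==> loc_int (\<lambda>x. u (x - c))"
  using loc_int_affine[of u 1 "-c"] by simp

lemma LINT_eq_integral_Ioc:
  assumes u: "loc_int u"
  shows "(LI t. u t * indicator {a<..b} t) = integral {a..b} u"
proof -
  have "(LI t. u t * indicator {a<..b} t) = (LINT t:{a..b}|lebesgue. u t)"
    unfolding set_lebesgue_integral_def
    using AE_lebesgue_neq[of a] loc_int_measurable[OF u]
    by (intro integral_cong_AE borel_measurable_scaleR borel_measurable_times)
       (auto elim!: eventually_mono split: split_indicator intro!: lmeas_indicator)
  also have "... = integral {a..b} u"
    using u by (subst set_lebesgue_integral_eq_integral) (auto simp: locally_integrable_def)
  finally show ?thesis .
qed

lemma loc_int_B_spline: "loc_int (B_spline m)"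
  and B_spline_continuous: "cont (B_spline (Suc m))"
proof -
  \<comment> \<open>Continuity of the next B-spline rests on local integrability of the present one,
    which in turn follows from continuity; only degree 0 is treated directly.\<close>
  have L: "loc_int (B_spline m) ==> cont (B_spline (Suc m))" for m
  proof -
    assume l: "loc_int (B_spline m)"
    note ui = loc_int_integrable_on[OF l]
    have "B_spline (Suc m) x = prim (B_spline m) 0 x - prim (B_spline m) 0 (x - 1)" for x
      using B_spline_Suc_LINT[of m x 0] LINT_eq_integral_Ioc[OF l, of "x - 1" x] prim_shift_base[OF ui, of 0 x "x - 1"]
      by (simp add: prim_le)
    then have e: "B_spline (Suc m) = (\<lambda>x. prim (B_spline m) 0 x - prim (B_spline m) 0 (x - 1))" by blast
    show ?thesis unfolding e
      by (intro continuous_intros prim_continuous ui continuous_on_compose2[OF prim_continuous]) auto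
  qed
  have l: "loc_int (B_spline m)" for m
  proof (induction m)
    case 0
    show ?case unfolding locally_integrable_def set_integrable_def
    proof (intro allI)
      fix a b :: real
      have "lint (\<lambda>x. indicator ({a..b} \<inter> {0..<1}) x :: real)"
      proof (rule integrable_real_indicator)
        have "emeasure lebesgue ({a..b} \<inter> {0..<1}) \<le> emeasure lebesgue {a..b}" by (rule emeasure_mono) auto
        also have "... < \<infinity>" by (auto simp: emeasure_lborel_Icc_eq)
        finally show "emeasure lebesgue ({a..b} \<inter> {0..<1}) < \<infinity>" .
      qed auto
      then show "lint (\<lambda>x. indicator {a..b} x *\<^sub>R B_spline 0 x)"
        by (simp add: indicator_inter_arith)
    qed
  next
    case (Suc m) show ?case by (rule loc_int_continuous[OF L[OF Suc]])
  qed
  show "loc_int (B_spline m)" by (rule l)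
  show "cont (B_spline (Suc m))" by (intro L l)
qed

lemma B_spline_Suc_integral: "B_spline (Suc m) (x - c) = integral {x - 1..x} (\<lambda>t. B_spline m (t - c))"
  unfolding B_spline_Suc_LINT
  by (rule LINT_eq_integral_Ioc[OF loc_int_shift[OF loc_int_B_spline]])

section \<open>Cardinal splines with arbitrary coefficients and their derivatives\<close>

definition nabla :: "(int => real) => int => real" where
  "nabla c nu = c nu - c (nu - 1)"

text \<open>The window holds every \<open>nu\<close> whose translate can be nonzero at
  \<open>x\<close>, so this is the full series, for coefficients of any growth.\<close>

definition spline :: "nat => (int => real) => real => real" where
  "spline m c x = (\<Sum>nu\<in>{\<lfloor>x\<rfloor> - int m..\<lfloor>x\<rfloor>}. c nu * B_spline m (x - of_int nu))"

lemma B_spline_int_outside: "nu \<notin> {\<lfloor>x\<rfloor> - int m..\<lfloor>x\<rfloor>} ==> B_spline m (x - of_int nu) = 0"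
  by (rule B_spline_outside) (auto simp: not_le; linarith)

lemma spline_eq_sum:
  assumes "finite W" "{\<lfloor>x\<rfloor> - int m..\<lfloor>x\<rfloor>} \<subseteq> W \<or> (\<forall>nu. nu \<notin> W --> c nu = 0)"
  shows "spline m c x = (\<Sum>nu\<in>W. c nu * B_spline m (x - of_int nu))"
proof -
  have "spline m c x = (\<Sum>nu\<in>W \<union> {\<lfloor>x\<rfloor> - int m..\<lfloor>x\<rfloor>}. c nu * B_spline m (x - of_int nu))"
    unfolding spline_def
    by (rule sum.mono_neutral_left) (use assms B_spline_int_outside in auto)
  also have "... = (\<Sum>nu\<in>W. c nu * B_spline m (x - of_int nu))"
    by (rule sum.mono_neutral_right) (use assms B_spline_int_outside in auto)
  finally show ?thesis .
qed

lemma prim_sum: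
  assumes "!!i. i \<in> A ==> loc_int (f i)"
  shows "prim (\<lambda>x. \<Sum>i\<in>A. f i x) a x = (\<Sum>i\<in>A. prim (f i) a x)"
proof (cases "finite A")
  case True
  then show ?thesis using assms
    by (simp add: prim_def integral_sum loc_int_integrable_on sum_subtractf)
qed (simp add: prim_def)

lemma loc_int_sum:
  "(!!i. i \<in> A ==> loc_int (f i)) ==> loc_int (\<lambda>x. \<Sum>i\<in>A. f i x)"
  by (induction A rule: infinite_finite_induct)
     (auto intro: loc_int_add loc_int_continuous)

lemma prim_cong:
  assumes "!!t. min a x \<le> t ==> t \<le> max a x ==> u t = v t"
  shows "prim u a x = prim v a x"
proof -
  have "integral {a..x} u = integral {a..x} v" "integral {x..a} u = integral {x..a} v"
    using assms by (auto intro!: HK_integral_cong)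
  then show ?thesis by (simp add: prim_def)
qed

text \<open>The rule B_(m+1)' = B_m - B_m(. - 1) in integrated form, which stays correct for
  \<open>m = 0\<close>, where the right-hand side jumps.\<close>

lemma B_spline_Suc_diff:
  "B_spline (Suc m) (x - c) - B_spline (Suc m) (a - c) = prim (\<lambda>t. B_spline m (t - c) - B_spline m (t - (c + 1))) a x"
proof -
  let ?u = "\<lambda>c t. B_spline m (t - c)"
  have li: "loc_int (?u c)" for c by (intro loc_int_shift loc_int_B_spline)
  note ui = loc_int_integrable_on[OF li]
  have b: "B_spline (Suc m) (x - c) = prim (?u c) a x - prim (?u c) a (x - 1)" for x
    using B_spline_Suc_integral[of m x c] prim_shift_base[OF ui, of c a x "x - 1"]
    by (simp add: prim_le)
  have sh: "prim (?u c) a (x - 1) = prim (?u (c + 1)) (a + 1) x" for x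
  proof -
    have "integral {a..b} (?u c) = integral {a+1..b+1} (?u (c+1))" for a b
    proof -
      have "integral {a..b} (?u c) = (LI t. ?u c t * indicator {a<..b} t)"
        by (rule LINT_eq_integral_Ioc[OF li, symmetric])
      also have "... = (LI t. ?u c (-1 + 1 * t) * indicator {a<..b} (-1 + 1 * t))"
        by (subst lebesgue_integral_real_affine[of 1 _ "-1"]) auto
      also have "... = (LI t. ?u (c + 1) t * indicator {a+1<..b+1} t)"
        by (intro LI_cong) (auto simp: indicator_def algebra_simps)
      also have "... = integral {a+1..b+1} (?u (c+1))" by (rule LINT_eq_integral_Ioc[OF li])
      finally show ?thesis .
    qed
    then show ?thesis by (simp add: prim_def)
  qed
  have "prim (\<lambda>t. ?u c t - ?u (c + 1) t) a x = prim (?u c) a x - prim (?u (c+1)) a x"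
    using prim_add[of "?u c" "\<lambda>t. -1 * ?u (c+1) t" a x] prim_cmult[of "-1" "?u (c+1)" a x] ui
      loc_int_integrable_on[OF loc_int_cmult[OF li, of "-1"]] by simp
  moreover have "B_spline (Suc m) (x - c) - B_spline (Suc m) (a - c) = prim (?u c) a x - prim (?u c) a a - (prim (?u c) a (x - 1) - prim (?u c) a (a - 1))"
    unfolding b[of x] b[of a] by simp
  moreover have "prim (?u c) a (x - 1) - prim (?u c) a (a - 1) = prim (?u (c+1)) a x"
    unfolding sh using prim_shift_base[OF ui, of "c+1" "a+1" x a] by simp
  ultimately show ?thesis by simp
qed

text \<open>Summation by parts moves the difference from the B-splines to the coefficients:
  differentiation lowers the degree and applies \<open>nabla\<close>. The integrated form includes
  the passage from degree 1 to degree 0.\<close>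

lemma spline_Suc_diff:
  "spline (Suc m) c x = spline (Suc m) c a + prim (spline m (nabla c)) a x"
proof -
  \<comment> \<open>This range contains the windows of all points between \<open>a\<close> and
    \<open>x\<close>, with enough margin to survive the index shift by one.\<close>
  define L U where "L = \<lfloor>min a x\<rfloor> - int m - 3" and "U = \<lfloor>max a x\<rfloor> + 1"
  define W where "W = {L..U}"
  have fl: "\<lfloor>min a x\<rfloor> \<le> \<lfloor>t\<rfloor>" "\<lfloor>t\<rfloor> \<le> \<lfloor>max a x\<rfloor>" if "min a x \<le> t" "t \<le> max a x" for t
    using that by (auto intro: floor_mono)
  have li: "loc_int (\<lambda>t. c nu * (B_spline m (t - of_int nu) - B_spline m (t - (of_int nu + 1))))" for nu
    by (intro loc_int_cmult loc_int_diff loc_int_shift loc_int_B_spline)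
  have "spline (Suc m) c x - spline (Suc m) c a = (\<Sum>nu\<in>W. c nu * (B_spline (Suc m) (x - of_int nu) - B_spline (Suc m) (a - of_int nu)))"
    using fl[of x] fl[of a]
    by (subst (1 2) spline_eq_sum[where W = W]) (auto simp: W_def L_def U_def right_diff_distrib sum_subtractf)
  also have "... = (\<Sum>nu\<in>W. prim (\<lambda>t. c nu * (B_spline m (t - of_int nu) - B_spline m (t - (of_int nu + 1)))) a x)"
    unfolding B_spline_Suc_diff prim_cmult ..
  also have "... = prim (\<lambda>t. \<Sum>nu\<in>W. c nu * (B_spline m (t - of_int nu) - B_spline m (t - (of_int nu + 1)))) a x"
    by (rule prim_sum[symmetric]) (rule li)
  also have "... = prim (spline m (nabla c)) a x"
  proof (rule prim_cong)
    fix t assume t: "min a x \<le> t" "t \<le> max a x"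
    have 1: "spline m c t = (\<Sum>nu\<in>W. c nu * B_spline m (t - of_int nu))"
      using fl[OF t] by (intro spline_eq_sum) (auto simp: W_def L_def U_def)
    have "(\<Sum>nu\<in>W. c nu * B_spline m (t - (of_int nu + 1))) = (\<Sum>nu\<in>{L+1..U+1}. c (nu - 1) * B_spline m (t - of_int nu))"
      unfolding W_def by (rule sum.reindex_bij_witness[of _ "\<lambda>nu. nu - 1" "\<lambda>nu. nu + 1"]) auto
    also have "... = spline m (\<lambda>nu. c (nu - 1)) t"
      using fl[OF t] by (intro spline_eq_sum[symmetric]) (auto simp: L_def U_def)
    finally show "(\<Sum>nu\<in>W. c nu * (B_spline m (t - of_int nu) - B_spline m (t - (of_int nu + 1)))) = spline m (nabla c) t"
      unfolding right_diff_distrib sum_subtractf 1[symmetric]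
      by (simp add: spline_def nabla_def left_diff_distrib sum_subtractf)
  qed
  finally show ?thesis by simp
qed

lemma loc_int_spline: "loc_int (spline m c)"
proof -
  have "set_integrable lebesgue {a..b} (spline m c)" for a b
  proof -
    define W where "W = {\<lfloor>a\<rfloor> - int m..\<lfloor>b\<rfloor>}"
    have "loc_int (\<lambda>x. \<Sum>nu\<in>W. c nu * B_spline m (x - of_int nu))"
      by (intro loc_int_sum loc_int_cmult loc_int_shift loc_int_B_spline)
    then have "set_integrable lebesgue {a..b} (\<lambda>x. \<Sum>nu\<in>W. c nu * B_spline m (x - of_int nu))"
      by (simp add: locally_integrable_def)
    then show ?thesis
    proof (rule set_integrable_cong[THEN iffD1, rotated -1])
      show "(\<Sum>nu\<in>W. c nu * B_spline m (x - of_int nu)) = spline m c x" if "x \<in> {a..b}" for x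
        using that by (intro spline_eq_sum[symmetric]) (auto simp: W_def intro: order_trans floor_mono)
    qed auto
  qed
  then show ?thesis by (simp add: locally_integrable_def)
qed

lemma spline_continuous: "cont (spline (Suc m) c)"
proof -
  have "spline (Suc m) c = (\<lambda>x. spline (Suc m) c 0 + prim (spline m (nabla c)) 0 x)"
    using spline_Suc_diff[of m c _ 0] by blast
  then show ?thesis
    by (metis (no_types, lifting) ext continuous_on_add continuous_on_const prim_continuous loc_int_integrable_on loc_int_spline)
qed

lemma spline_DERIV: "(spline (Suc (Suc m)) c has_real_derivative spline (Suc m) (nabla c) x) (at x)"
proof -
  have "spline (Suc (Suc m)) c = (\<lambda>x. spline (Suc (Suc m)) c 0 + prim (spline (Suc m) (nabla c)) 0 x)"
    using spline_Suc_diff[of "Suc m" c _ 0] by blast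
  moreover have "((\<lambda>x. spline (Suc (Suc m)) c 0 + prim (spline (Suc m) (nabla c)) 0 x) has_real_derivative spline (Suc m) (nabla c) x) (at x)"
    using DERIV_add[OF DERIV_const prim_DERIV[OF spline_continuous]] by simp
  ultimately show ?thesis by simp
qed

lemma spline_Cr: "spline (Suc r) c \<in> Cr_functions r"
proof (induction r arbitrary: c)
  case 0 show ?case by (simp add: Cr_functions_0 spline_continuous)
next
  case (Suc r) show ?case by (rule Cr_functions_SucI[OF spline_DERIV Suc])
qed

lemma spline_higher_deriv: "k < m ==> (deriv ^^ k) (spline m c) = spline (m - k) ((nabla ^^ k) c)"
proof (induction k)
  case (Suc k)
  then obtain i where i: "m - k = Suc (Suc i)" by (metis Suc_diff_Suc Suc_lessD)
  have "deriv (spline (Suc (Suc i)) ((nabla ^^ k) c)) = spline (Suc i) (nabla ((nabla ^^ k) c))"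
    using spline_DERIV by (auto intro!: DERIV_imp_deriv)
  then show ?case using Suc i by (simp add: diff_Suc)
qed simp

text \<open>Partition of unity, obtained for degree \<open>Suc m\<close> by integrating the identity
  of degree \<open>m\<close> over \<open>[x - 1, x]\<close>.\<close>

lemma spline_const: "spline m (\<lambda>_. c) x = c"
proof (induction m arbitrary: x)
  case 0
  have "x - of_int \<lfloor>x\<rfloor> \<in> {0..<1}" by (simp add: ) linarith
  then show ?case by (simp add: spline_def)
next
  case (Suc m)
  define W where "W = {\<lfloor>x - 1\<rfloor> - int (Suc m)..\<lfloor>x\<rfloor>}"
  have li: "loc_int (\<lambda>t. c * B_spline m (t - of_int nu))" for nu :: int
    by (intro loc_int_cmult loc_int_shift loc_int_B_spline)
  have "spline (Suc m) (\<lambda>_. c) x = (\<Sum>nu\<in>W. c * B_spline (Suc m) (x - of_int nu))"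
    by (rule spline_eq_sum) (auto simp: W_def)
  also have "... = (\<Sum>nu\<in>W. integral {x-1..x} (\<lambda>t. c * B_spline m (t - of_int nu)))"
    unfolding B_spline_Suc_integral by simp
  also have "... = integral {x-1..x} (\<lambda>t. \<Sum>nu\<in>W. c * B_spline m (t - of_int nu))"
    by (rule integral_sum[symmetric]) (auto simp: W_def intro!: loc_int_integrable_on li)
  also have "... = integral {x-1..x} (\<lambda>t. c)"
  proof (rule HK_integral_cong)
    fix t assume t: "t \<in> {x-1..x}"
    have "\<lfloor>x - 1\<rfloor> \<le> \<lfloor>t\<rfloor>" "\<lfloor>t\<rfloor> \<le> \<lfloor>x\<rfloor>" using t floor_mono[of "x-1" t] floor_mono[of t x] by auto
    then show "(\<Sum>nu\<in>W. c * B_spline m (t - of_int nu)) = c"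
      using Suc[of t] by (subst spline_eq_sum[symmetric]) (auto simp: W_def)
  qed
  finally show ?case by simp
qed

text \<open>The partition of unity by nonnegative B-splines makes the value at \<open>x\<close> a
  convex combination of the coefficients in the window.\<close>

lemma spline_bound:
  assumes "!!nu. nu \<in> {\<lfloor>x\<rfloor> - int m..\<lfloor>x\<rfloor>} ==> \<bar>c nu - a\<bar> \<le> K"
  shows "\<bar>spline m c x - a\<bar> \<le> K"
proof -
  let ?W = "{\<lfloor>x\<rfloor> - int m..\<lfloor>x\<rfloor>}"
  have "spline m c x - a = (\<Sum>nu\<in>?W. (c nu - a) * B_spline m (x - of_int nu))"
    using spline_const[of m a x] by (simp add: spline_def left_diff_distrib sum_subtractf)
  also have "\<bar>...\<bar> \<le> (\<Sum>nu\<in>?W. \<bar>(c nu - a) * B_spline m (x - of_int nu)\<bar>)" by (rule sum_abs)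
  also have "... \<le> (\<Sum>nu\<in>?W. K * B_spline m (x - of_int nu))"
    using assms B_spline_nonneg by (intro sum_mono) (simp add: abs_mult mult_right_mono)
  also have "... = K" using spline_const[of m K x] by (simp add: spline_def)
  finally show ?thesis .
qed

lemma B_spline_eq_spline: "B_spline m x = spline m (\<lambda>nu. if nu = 0 then 1 else 0) x"
  using spline_eq_sum[of "{0}" x m "\<lambda>nu. if nu = 0 then 1 else 0"] by simp

lemma B_spline_Cr: "B_spline (Suc r) \<in> Cr_functions r"
proof -
  have "B_spline (Suc r) = spline (Suc r) (\<lambda>nu. if nu = 0 then 1 else 0)" using B_spline_eq_spline by blast
  then show ?thesis using spline_Cr by metis
qed

text \<open>The values of B_(m+1) at the integers are the integrals of B_m over consecutive unit
  intervals, and they sum to 1 by the partition of unity of degree m + 1 at the point 0.\<close>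

lemma B_spline_LINT_1: "(LI x. B_spline m x) = 1"
proof -
  have z: "B_spline m x * indicator {-1<..real (Suc m)} x = B_spline m x" for x
    using B_spline_outside[of x m] by (cases "x < 0 \<or> x \<ge> real m + 1") (auto simp: indicator_def)
  have "B_spline (Suc m) (real k) = (LI x. B_spline m x * indicator {real k - 1<..real k} x)" for k
    using B_spline_Suc_LINT[of m "real k" 0] by simp
  have "1 = spline (Suc m) (\<lambda>_. 1) 0" by (simp add: spline_const)
  also have "... = (\<Sum>nu\<in>{-1 - int m..0}. B_spline (Suc m) (0 - of_int nu))"
    by (simp add: spline_def)
  also have "... = (\<Sum>k\<le>Suc m. B_spline (Suc m) (real k - 0))"
    by (rule sum.reindex_bij_witness[of _ "\<lambda>k. - int k" "\<lambda>nu. nat (-nu)"]) auto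
  also have "... = (\<Sum>k\<le>Suc m. integral {real k - 1..real k} (B_spline m))"
    unfolding B_spline_Suc_integral by simp
  also have "... = integral {-1..real (Suc m)} (B_spline m)"
  proof -
    have "(\<Sum>k\<le>j. integral {real k - 1..real k} (B_spline m)) = integral {-1..real j} (B_spline m)" for j
    proof (induction j)
      case (Suc j)
      then show ?case
        using HK_integral_combine[of "-1" "real j" "real j + 1" "B_spline m"]
          loc_int_integrable_on[OF loc_int_B_spline] by (simp add: add.commute)
    qed simp
    then show ?thesis .
  qed
  also have "... = (LI x. B_spline m x * indicator {-1<..real (Suc m)} x)"
    by (rule LINT_eq_integral_Ioc[OF loc_int_B_spline, symmetric])
  also have "... = (LI x. B_spline m x)" by (simp only: z)
  finally show ?thesis by simp
qed

text \<open>The refinement equation. After dilation by 2 the unit window consists of two unit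
  windows, so integrating one term yields two neighbouring ones, and Pascal's rule updates the
  binomial coefficients.\<close>

lemma B_spline_two_scale:
  "B_spline m x = (\<Sum>i\<le>Suc m. real (Suc m choose i) * B_spline m (2 * x - real i)) / 2 ^ m"
proof (induction m arbitrary: x)
  case 0 show ?case by (auto simp: indicator_def)
next
  case (Suc m)
  let ?b = "\<lambda>i t. B_spline m (t - real i)"
  have ii: "lint (\<lambda>t. B_spline m (t - c) * indicator {a<..b} t)" for c a b
  proof -
    have "lint (\<lambda>t. indicator {a..b} t * B_spline m (t - c))"
      using loc_int_shift[OF loc_int_B_spline] by (simp add: locally_integrable_def set_integrable_def)
    then show ?thesis
      by (rule lint_bound)
       (auto split: split_indicator intro!: AE_I2 borel_measurable_times lmeas_indicator
         loc_int_measurable[OF loc_int_shift[OF loc_int_B_spline]])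
  qed
  have half: "(LI t. B_spline m (2 * t - real i) * indicator {x - 1<..x} t) =
     (B_spline (Suc m) (2 * x - real i) + B_spline (Suc m) (2 * x - real (Suc i))) / 2" (is "?l i = _")
    and ih: "lint (\<lambda>t. B_spline m (2 * t - real i) * indicator {x - 1<..x} t)" for i
  proof -
    have "(LI s. ?b i s * indicator {2*x - 2<..2*x} s) = \<bar>2\<bar> *\<^sub>R (LI t. ?b i (0 + 2 * t) * indicator {2*x - 2<..2*x} (0 + 2 * t))"
      by (rule lebesgue_integral_real_affine) auto
    also have "(\<lambda>t. ?b i (0 + 2 * t) * indicator {2*x - 2<..2*x} (0 + 2 * t)) = (\<lambda>t. B_spline m (2 * t - real i) * indicator {x - 1<..x} t)"
      by (auto simp: indicator_def fun_eq_iff)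
    finally have 1: "(LI s. ?b i s * indicator {2*x - 2<..2*x} s) = 2 * ?l i" by simp
    have "(LI s. ?b i s * indicator {2*x - 2<..2*x} s) =
      (LI s. ?b i s * indicator {2*x - 1 - 1<..2*x - 1} s + ?b i s * indicator {2*x - 1<..2*x} s)"
      by (intro LI_cong) (auto simp: indicator_def)
    also have "... = B_spline (Suc m) (2*x - 1 - real i) + B_spline (Suc m) (2 * x - real i)"
      unfolding B_spline_Suc_LINT using ii by (intro LI_add) auto
    finally show "?l i = (B_spline (Suc m) (2 * x - real i) + B_spline (Suc m) (2 * x - real (Suc i))) / 2"
      using 1 by (simp add: algebra_simps)
    have "lint (\<lambda>t. ?b i (0 + 2 * t) * indicator {2*x - 2<..2*x} (0 + 2 * t))"
      by (subst lebesgue_integrable_real_affine_iff[of 2 "\<lambda>t. ?b i t * indicator {2*x - 2<..2*x} t" 0]) (use ii in auto)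
    also have "(\<lambda>t. ?b i (0 + 2 * t) * indicator {2*x - 2<..2*x} (0 + 2 * t)) = (\<lambda>t. B_spline m (2 * t - real i) * indicator {x - 1<..x} t)"
      by (auto simp: indicator_def fun_eq_iff)
    finally show "lint (\<lambda>t. B_spline m (2 * t - real i) * indicator {x - 1<..x} t)" .
  qed
  let ?B = "\<lambda>i. B_spline (Suc m) (2 * x - real i)"
  have "B_spline (Suc m) x = (LI t. B_spline m t * indicator {x - 1<..x} t)"
    using B_spline_Suc_LINT[of m x 0] by simp
  also have "... = (LI t. (\<Sum>i\<le>Suc m. (real (Suc m choose i) / 2 ^ m) * (B_spline m (2 * t - real i) * indicator {x - 1<..x} t)))"
    by (intro LI_cong refl, subst Suc.IH)
       (simp add: sum_distrib_right sum_divide_distrib mult.assoc del: sum.atMost_Suc binomial_Suc_Suc)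
  also have "... = (\<Sum>i\<le>Suc m. (real (Suc m choose i) / 2 ^ m) * ((?B i + ?B (Suc i)) / 2))"
    using ih by (subst LI_sum)
      (simp_all add: half mult.commute[of 2 "2 ^ m"] del: sum.atMost_Suc binomial_Suc_Suc of_nat_Suc)
  also have "... = (\<Sum>i\<le>Suc m. real (Suc m choose i) * (?B i + ?B (Suc i))) / 2 ^ Suc m"
    by (simp add: sum_divide_distrib mult.commute[of "2 ^ m" 2] del: sum.atMost_Suc binomial_Suc_Suc of_nat_Suc)
  also have "(\<Sum>i\<le>Suc m. real (Suc m choose i) * (?B i + ?B (Suc i))) = (\<Sum>i\<le>Suc (Suc m). real (Suc (Suc m) choose i) * ?B i)"
  proof -
    have a: "(\<Sum>i\<le>Suc m. real (Suc m choose i) * ?B i) = (\<Sum>i\<le>Suc (Suc m). real (Suc m choose i) * ?B i)"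
      by (subst (2) sum.atMost_Suc) (simp add: binomial_eq_0 del: sum.atMost_Suc binomial_Suc_Suc of_nat_Suc)
    have "(\<Sum>i\<le>Suc m. real (Suc m choose i) * (?B i + ?B (Suc i))) =
       (\<Sum>i\<le>Suc (Suc m). real (Suc m choose i) * ?B i) + (\<Sum>i\<le>Suc m. real (Suc m choose i) * ?B (Suc i))"
      unfolding a[symmetric] by (simp add: distrib_left sum.distrib del: sum.atMost_Suc binomial_Suc_Suc of_nat_Suc)
    also have "... = ?B 0 + (\<Sum>i\<le>Suc m. real (Suc m choose Suc i) * ?B (Suc i)) + (\<Sum>i\<le>Suc m. real (Suc m choose i) * ?B (Suc i))"
      by (subst sum.atMost_Suc_shift) (simp del: sum.atMost_Suc binomial_Suc_Suc of_nat_Suc)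
    also have "... = ?B 0 + (\<Sum>i\<le>Suc m. real (Suc (Suc m) choose Suc i) * ?B (Suc i))"
      by (simp add: distrib_right sum.distrib del: sum.atMost_Suc of_nat_Suc)
    also have "... = (\<Sum>i\<le>Suc (Suc m). real (Suc (Suc m) choose i) * ?B i)"
      by (subst (2) sum.atMost_Suc_shift) (simp del: sum.atMost_Suc binomial_Suc_Suc of_nat_Suc)
    finally show ?thesis .
  qed
  finally show ?case .
qed

section \<open>Rapid decay\<close>

definition rapid :: "(real => real) => bool" where
  "rapid f \<longleftrightarrow> (\<forall>l::nat. \<exists>C. \<forall>x. \<bar>f x\<bar> * jb x ^ l \<le> C)"

definition rapid_seq :: "(int => real) => bool" where
  "rapid_seq c \<longleftrightarrow> (\<forall>l::nat. \<exists>C. \<forall>nu. \<bar>c nu\<bar> * jb (of_int nu) ^ l \<le> C)"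

lemma rapidD:
  assumes "rapid f" obtains C where "C > 0" "!!x. \<bar>f x\<bar> * jb x ^ l \<le> C"
proof -
  obtain C where C: "\<forall>x. \<bar>f x\<bar> * jb x ^ l \<le> C" using assms unfolding rapid_def by blast
  show ?thesis by (rule that[of "\<bar>C\<bar> + 1"]) (use C in \<open>auto intro: order_trans\<close>)
qed

lemma rapid_seqD:
  assumes "rapid_seq c" obtains C where "C > 0" "!!nu. \<bar>c nu\<bar> * jb (of_int nu) ^ l \<le> C"
proof -
  obtain C where C: "\<forall>nu. \<bar>c nu\<bar> * jb (of_int nu) ^ l \<le> C" using assms unfolding rapid_seq_def by blast
  show ?thesis by (rule that[of "\<bar>C\<bar> + 1"]) (use C in \<open>auto intro: order_trans\<close>)
qed

text \<open>Peetre's inequality: the weight at \<open>x\<close> is shared between the translation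
  \<open>y\<close> and the translated point, so decay in both gives decay in
  \<open>x\<close>.\<close>

lemma one_plus_abs_peetre: "1 + \<bar>x\<bar> \<le> jb y * jb (x - y)" for x y :: real
proof -
  have "1 + \<bar>x\<bar> \<le> 1 + \<bar>y\<bar> + \<bar>x - y\<bar>" by linarith
  also have "... \<le> jb y * jb (x - y)" by (simp add: algebra_simps)
  finally show ?thesis .
qed

lemma rapid_add: "rapid f ==> rapid g ==> rapid (\<lambda>x. f x + g x)"
  unfolding rapid_def
proof
  fix l assume "\<forall>l. \<exists>C. \<forall>x. \<bar>f x\<bar> * jb x ^ l \<le> C" "\<forall>l. \<exists>C. \<forall>x. \<bar>g x\<bar> * jb x ^ l \<le> C"
  then obtain C D where CD: "!!x. \<bar>f x\<bar> * jb x ^ l \<le> C" "!!x. \<bar>g x\<bar> * jb x ^ l \<le> D" by metis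
  have "\<bar>f x + g x\<bar> * jb x ^ l \<le> C + D" for x
  proof -
    have "\<bar>f x + g x\<bar> * jb x ^ l \<le> (\<bar>f x\<bar> + \<bar>g x\<bar>) * jb x ^ l"
      by (intro mult_right_mono abs_triangle_ineq) auto
    then show ?thesis using CD[of x] by (simp add: distrib_right)
  qed
  then show "\<exists>C. \<forall>x. \<bar>f x + g x\<bar> * jb x ^ l \<le> C" by blast
qed

lemma rapid_bounded_mult:
  assumes "rapid f" "!!x. \<bar>g x\<bar> \<le> B" shows "rapid (\<lambda>x. g x * f x)"
  unfolding rapid_def
proof
  fix l
  obtain C where C: "C > 0" "!!x. \<bar>f x\<bar> * jb x ^ l \<le> C" using rapidD[OF assms(1)] by metis
  have B: "B \<ge> 0" using assms(2)[of 0] by linarith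
  have "\<bar>g x * f x\<bar> * jb x ^ l \<le> B * C" for x
  proof -
    have "\<bar>g x\<bar> * (\<bar>f x\<bar> * jb x ^ l) \<le> B * C" using assms(2) C(2) B by (intro mult_mono) auto
    then show ?thesis by (simp add: abs_mult mult.assoc)
  qed
  then show "\<exists>C. \<forall>x. \<bar>g x * f x\<bar> * jb x ^ l \<le> C" by blast
qed

lemma rapid_cmult: "rapid f ==> rapid (\<lambda>x. c * f x)"
  by (rule rapid_bounded_mult[where B = "\<bar>c\<bar>"]) auto

lemma rapid_diff: "rapid f ==> rapid g ==> rapid (\<lambda>x. f x - g x)"
  using rapid_add[OF _ rapid_cmult[of g "-1"], of f] by simp

lemma one_plus_abs_affine:
  fixes x a b :: real
  assumes a: "a \<noteq> 0" shows "1 + \<bar>x\<bar> \<le> ((1 + 1 / \<bar>a\<bar>) * jb b) * jb (a * x + b)"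
proof -
  define P where "P = jb b * jb (a * x + b)"
  have "\<bar>a\<bar> * \<bar>x\<bar> \<le> \<bar>a * x + b\<bar> + \<bar>b\<bar>" unfolding abs_mult[symmetric] by linarith
  also have "... \<le> P" by (simp add: P_def algebra_simps)
  finally have "\<bar>x\<bar> \<le> P / \<bar>a\<bar>" using a by (simp add: pos_le_divide_eq mult.commute)
  moreover have "1 * 1 \<le> P" unfolding P_def by (intro mult_mono) auto
  ultimately have "1 + \<bar>x\<bar> \<le> P + P / \<bar>a\<bar>" by linarith
  also have "... = ((1 + 1 / \<bar>a\<bar>) * jb b) * jb (a * x + b)" by (simp add: P_def distrib_right mult.assoc)
  finally show ?thesis .
qed

lemma rapid_affine:
  assumes f: "rapid f" and a: "a \<noteq> 0" shows "rapid (\<lambda>x. f (a * x + b))"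
  unfolding rapid_def
proof
  fix l
  obtain C where C: "C > 0" "!!x. \<bar>f x\<bar> * jb x ^ l \<le> C" using rapidD[OF f] by metis
  define K where "K = (1 + 1 / \<bar>a\<bar>) * jb b"
  have K: "1 + \<bar>x\<bar> \<le> K * jb (a * x + b)" for x unfolding K_def by (rule one_plus_abs_affine[OF a])
  have "\<bar>f (a * x + b)\<bar> * jb x ^ l \<le> K ^ l * C" for x
  proof -
    have K0: "K \<ge> 0" by (simp add: K_def)
    have "\<bar>f (a * x + b)\<bar> * jb x ^ l \<le> \<bar>f (a * x + b)\<bar> * (K * jb (a * x + b)) ^ l"
      by (intro mult_left_mono power_mono K) auto
    also have "... = K ^ l * (\<bar>f (a * x + b)\<bar> * jb (a * x + b) ^ l)" by (simp add: power_mult_distrib)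
    also have "... \<le> K ^ l * C" using C K0 by (intro mult_left_mono) auto
    finally show ?thesis .
  qed
  then show "\<exists>C. \<forall>x. \<bar>f (a * x + b)\<bar> * jb x ^ l \<le> C" by blast
qed

lemma rapid_shift: "rapid f ==> rapid (\<lambda>x. f (x - b))"
  using rapid_affine[of f 1 "-b"] by simp

lemma rapid_bounded: assumes "rapid f" obtains C where "C > 0" "!!x. \<bar>f x\<bar> \<le> C"
  using rapidD[OF assms, of 0] by auto

lemma rapid_weight:
  assumes "rapid f" shows "rapid (\<lambda>x. f x * jb x ^ j)"
  unfolding rapid_def
proof
  fix l
  obtain C where "!!x. \<bar>f x\<bar> * jb x ^ (j + l) \<le> C" using rapidD[OF assms] by metis
  then show "\<exists>C. \<forall>x. \<bar>f x * jb x ^ j\<bar> * jb x ^ l \<le> C"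
    by (intro exI[of _ C]) (simp add: abs_mult power_add mult.assoc)
qed

lemma integrable_weight: "lint (\<lambda>x::real. 1 / jb x ^ 2)"
proof -
  have "integrable lborel (\<lambda>x::real. inverse (1 + x^2))"
    using integrable_inverse_1_plus_square by (simp add: set_integrable_def)
  then have "integrable lborel (\<lambda>x::real. 1 / jb x ^ 2)"
  proof (rule lint_bound)
    show "AE x::real in lborel. norm (1 / (jb x)\<^sup>2) \<le> norm (inverse (1 + x\<^sup>2))"
    proof (rule AE_I2)
      fix x :: real
      have "1 + x\<^sup>2 \<le> (jb x)\<^sup>2" by (simp add: power2_sum)
      then have "inverse ((jb x)\<^sup>2) \<le> inverse (1 + x\<^sup>2)" by (intro le_imp_inverse_le) (auto intro: add_pos_nonneg)
      then show "norm (1 / (jb x)\<^sup>2) \<le> norm (inverse (1 + x\<^sup>2))"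
        by (simp add: inverse_eq_divide)
    qed
  qed auto
  then show ?thesis by (subst integrable_completion) auto
qed

lemma rapid_integrable:
  assumes "rapid f" "f \<in> lmeas"
  shows "lint f"
proof -
  obtain C where C: "C > 0" "!!x. \<bar>f x\<bar> * jb x ^ 2 \<le> C" using rapidD[OF assms(1)] by metis
  show ?thesis
  proof (rule lint_bound[OF integrable_mult_right[OF integrable_weight, of C]])
    show "AE x in lebesgue. norm (f x) \<le> norm (C * (1 / (jb x)\<^sup>2))"
      using C by (intro AE_I2) (simp add: field_simps)
  qed fact
qed

lemma summable_on_int_weight: "(\<lambda>nu::int. 1 / jb (real_of_int nu) ^ 2) summable_on UNIV"
proof -
  let ?f = "\<lambda>nu::int. 1 / jb (real_of_int nu) ^ 2"
  have s: "summable (\<lambda>n. 1 / (1 + real n) ^ 2)"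
    using summable_Suc_iff[of "\<lambda>n. inverse ((real n)\<^sup>2)"] inverse_power_summable[of 2, where ?'a=real]
    by (simp add: inverse_eq_divide)
  have a: "?f summable_on range int"
    unfolding summable_on_reindex[OF inj_of_nat] using s
    by (subst summable_on_UNIV_nonneg_real_iff) (auto simp: o_def)
  have "?f summable_on range (\<lambda>n. - int n)"
    unfolding summable_on_reindex[OF inj_onI[of UNIV "\<lambda>n. - int n"], simplified] using s
    by (subst summable_on_UNIV_nonneg_real_iff) (auto simp: o_def)
  then have b: "?f summable_on (range (\<lambda>n. - int n) - range int)"
    by (rule summable_on_subset_banach) auto
  have "UNIV = range int \<union> (range (\<lambda>n. - int n) - range int)"
  proof -
    have "nu \<in> range int \<union> range (\<lambda>n. - int n)" for nu :: int
      by (cases nu rule: int_cases2) auto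
    then show ?thesis by auto
  qed
  then show ?thesis using summable_on_Un_disjoint[OF a b] by auto
qed

lemma rapid_seq_weight_summable:
  assumes "rapid_seq c" shows "(\<lambda>nu. \<bar>c nu\<bar> * jb (of_int nu) ^ l) summable_on UNIV"
proof -
  obtain C where C: "C > 0" "!!nu. \<bar>c nu\<bar> * jb (of_int nu) ^ (l + 2) \<le> C" using rapid_seqD[OF assms] by metis
  show ?thesis
  proof (rule summable_on_comparison_test[OF summable_on_cmult_right[OF summable_on_int_weight, of C]])
    fix nu show "\<bar>c nu\<bar> * jb (of_int nu) ^ l \<le> C * (1 / (jb (of_int nu))\<^sup>2)"
    proof -
      have "\<bar>c nu\<bar> * jb (of_int nu) ^ l * (jb (of_int nu))\<^sup>2 \<le> C" using C(2)[of nu] by (simp only: power_add mult.assoc)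
      then have "\<bar>c nu\<bar> * jb (of_int nu) ^ l \<le> C / (jb (of_int nu))\<^sup>2"
        by (subst pos_le_divide_eq) (auto intro: add_pos_nonneg zero_less_power)
      then show ?thesis by simp
    qed
  qed auto
qed

lemma rapid_seq_summable:
  assumes "rapid_seq c" shows "(\<lambda>nu. \<bar>c nu\<bar>) summable_on UNIV"
  using rapid_seq_weight_summable[OF assms, of 0] by simp

text \<open>By Peetre's inequality the weight at \<open>k\<close> is paid for partly by
  \<open>u\<close> at \<open>x\<close> and partly by \<open>v\<close> at
  \<open>x - k\<close>.\<close>

lemma rapid_seq_inner:
  assumes u: "rapid u" "cont u" and v: "rapid v" "cont v"
  shows "rapid_seq (\<lambda>k. LI x. u x * v (x - of_int k))"
  unfolding rapid_seq_def
proof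
  fix l
  define w where "w x = u x * jb x ^ l" for x
  obtain C where C: "C > 0" "!!x. \<bar>v x\<bar> * jb x ^ l \<le> C" using rapidD[OF v(1)] by metis
  have w: "lint (\<lambda>x. C * \<bar>w x\<bar>)"
    unfolding w_def using u
    by (intro integrable_mult_right integrable_abs rapid_integrable rapid_weight lmeas_continuous continuous_intros) auto
  have "\<bar>LI x. u x * v (x - of_int k)\<bar> * jb (of_int k) ^ l \<le> (LI x. C * \<bar>w x\<bar>)" for k
  proof -
    have "\<bar>LI x. u x * v (x - of_int k)\<bar> * jb (of_int k) ^ l
       = \<bar>LI x. u x * v (x - of_int k) * jb (of_int k) ^ l\<bar>"
      by (simp add: abs_mult)
    also have "... \<le> (LI x. C * \<bar>w x\<bar>)"
    proof (rule order_trans[OF integral_abs_bound])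
      show "(LI x. \<bar>u x * v (x - of_int k) * jb (of_int k) ^ l\<bar>) \<le> (LI x. C * \<bar>w x\<bar>)"
      proof (rule integral_mono_AE'[OF w])
        show "AE x in lebesgue. \<bar>u x * v (x - of_int k) * jb (of_int k) ^ l\<bar> \<le> C * \<bar>w x\<bar>"
        proof (rule AE_I2)
          fix x :: real
          have "jb (of_int k) ^ l \<le> (jb x * jb (x - of_int k)) ^ l"
            using one_plus_abs_peetre[of "of_int k" x] by (intro power_mono) (auto simp: abs_minus_commute)
          then have "\<bar>u x\<bar> * \<bar>v (x - of_int k)\<bar> * jb (of_int k) ^ l \<le> \<bar>u x\<bar> * \<bar>v (x - of_int k)\<bar> * (jb x * jb (x - of_int k)) ^ l"
            by (intro mult_left_mono) auto
          also have "... = \<bar>w x\<bar> * (\<bar>v (x - of_int k)\<bar> * jb (x - of_int k) ^ l)"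
            by (simp add: w_def abs_mult power_mult_distrib)
          also have "... \<le> \<bar>w x\<bar> * C" using C by (intro mult_left_mono) auto
          finally show "\<bar>u x * v (x - of_int k) * jb (of_int k) ^ l\<bar> \<le> C * \<bar>w x\<bar>" by (simp add: abs_mult mult.commute)
        qed
      qed (use C in auto)
    qed
    finally show ?thesis .
  qed
  then show "\<exists>C. \<forall>k. \<bar>LI x. u x * v (x - of_int k)\<bar> * jb (of_int k) ^ l \<le> C" by blast
qed

lemma filterlim_symmetric_int_intervals: "filterlim (\<lambda>N. {- int N..int N}) (finite_subsets_at_top UNIV) sequentially"
  unfolding filterlim_finite_subsets_at_top
proof (intro allI impI)
  fix X :: "int set" assume X: "finite X \<and> X \<subseteq> UNIV"
  then obtain M where M: "!!x. x \<in> X ==> \<bar>x\<bar> \<le> M"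
    using finite_imageI[of X abs] Max_ge[of "abs ` X"] by (meson finite_imageI image_eqI Max_ge)
  show "\<forall>\<^sub>F N in sequentially. finite {- int N..int N} \<and> X \<subseteq> {- int N..int N} \<and> {- int N..int N} \<subseteq> UNIV"
    using eventually_ge_at_top[of "nat M"]
  proof eventually_elim
    case (elim N) then show ?case using M by (auto simp: abs_le_iff; force)
  qed
qed

lemma summable_on_int_symmetric_limit:
  fixes c :: "int => real"
  assumes "c summable_on UNIV"
  shows "(\<lambda>N. \<Sum>k\<in>{- int N..int N}. c k) \<longlonglongrightarrow> (\<Sum>\<^sub>\<infinity>k. c k)"
  using filterlim_compose[OF has_sum_infsum[OF assms, unfolded has_sum_def] filterlim_symmetric_int_intervals]
  by simp

text \<open>Unordered sums over the integers become sequences of symmetric partial sums, because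
  continuity of the functionals is sequential.\<close>

definition symm_sum :: "(int => real) => (int => real => real) => nat => real => real" where
  "symm_sum c g N x = (\<Sum>k\<in>{- int N..int N}. c k * g k x)"

text \<open>The error bound is the tail of a convergent numerical series and is independent of
  \<open>x\<close>, even after weighting. The condition on \<open>s\<close> gives
  \<open>\<bar>s * k\<bar> \<le> \<bar>k\<bar>\<close>; it admits integer and half-integer
  translates alike.\<close>

lemma rapid_series_tail:
  assumes c: "rapid_seq c" and zeta: "rapid zeta" and s: "\<bar>s\<bar> \<le> 1"
  shows "\<exists>eps. eps \<longlonglongrightarrow> 0 \<and> (\<forall>N x.
    \<bar>(\<Sum>\<^sub>\<infinity>k. c k * zeta (x - s * of_int k)) - symm_sum c (\<lambda>k x. zeta (x - s * of_int k)) N x\<bar> * jb x ^ l \<le> eps N)"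
proof -
  obtain C where C: "C > 0" "!!x. \<bar>zeta x\<bar> * jb x ^ l \<le> C" using rapidD[OF zeta] by metis
  define w where "w k = C * (\<bar>c k\<bar> * jb (of_int k) ^ l)" for k
  have w: "w summable_on UNIV" unfolding w_def by (intro summable_on_cmult_right rapid_seq_weight_summable c)
  have wb: "\<bar>c k * zeta (x - s * of_int k)\<bar> * jb x ^ l \<le> w k" for k x
  proof -
    have "\<bar>s * of_int k\<bar> \<le> \<bar>of_int k\<bar>" using s by (simp add: abs_mult mult_left_le_one_le)
    then have "jb x ^ l \<le> (jb (of_int k) * jb (x - s * of_int k)) ^ l"
      by (intro power_mono order_trans[OF one_plus_abs_peetre[of x "s * of_int k"]] mult_right_mono) auto
    then have "\<bar>c k * zeta (x - s * of_int k)\<bar> * jb x ^ l \<le> \<bar>c k * zeta (x - s * of_int k)\<bar> * (jb (of_int k) * jb (x - s * of_int k)) ^ l"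
      by (intro mult_left_mono) auto
    also have "... = (\<bar>c k\<bar> * jb (of_int k) ^ l) * (\<bar>zeta (x - s * of_int k)\<bar> * jb (x - s * of_int k) ^ l)"
      by (simp add: abs_mult power_mult_distrib)
    also have "... \<le> (\<bar>c k\<bar> * jb (of_int k) ^ l) * C" using C by (intro mult_left_mono) auto
    finally show ?thesis by (simp add: w_def mult.commute)
  qed
  have sm: "(\<lambda>k. norm ((c k * zeta (x - s * of_int k)) * jb x ^ l)) summable_on A" for x A
    by (rule summable_on_comparison_test[OF summable_on_subset_banach[OF w subset_UNIV]])
       (use wb in \<open>auto simp: abs_mult\<close>)
  have sm1: "(\<lambda>k. (c k * zeta (x - s * of_int k))) summable_on A" for x A
  proof -
    have "(\<lambda>k. ((c k * zeta (x - s * of_int k)) * jb x ^ l) * inverse (jb x ^ l)) summable_on A"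
      by (rule summable_on_cmult_left[OF abs_summable_summable[OF sm]])
    moreover have "jb x ^ l \<noteq> 0" using abs_ge_zero[of x] by (intro power_not_zero) linarith
    then have "(\<lambda>k. ((c k * zeta (x - s * of_int k)) * jb x ^ l) * inverse (jb x ^ l)) = (\<lambda>k. c k * zeta (x - s * of_int k))"
      by (simp add: mult.assoc del: power_eq_0_iff)
    ultimately show ?thesis by (simp only:)
  qed
  have bound: "\<bar>(\<Sum>\<^sub>\<infinity>k. c k * zeta (x - s * of_int k)) - symm_sum c (\<lambda>k x. zeta (x - s * of_int k)) N x\<bar> * jb x ^ l
      \<le> (\<Sum>\<^sub>\<infinity>k. w k) - (\<Sum>k\<in>{- int N..int N}. w k)" for N x
  proof -
    let ?I = "{- int N..int N}"
    have split: "infsum g UNIV = sum g ?I + infsum g (- ?I)" if "g summable_on UNIV" for g :: "int => real"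
      using infsum_Un_disjoint[of g ?I "- ?I"] summable_on_subset_banach[OF that] by (simp add: Compl_partition)
    have "\<bar>(\<Sum>\<^sub>\<infinity>k. c k * zeta (x - s * of_int k)) - symm_sum c (\<lambda>k x. zeta (x - s * of_int k)) N x\<bar> * jb x ^ l
      = \<bar>(\<Sum>\<^sub>\<infinity>k\<in>-?I. (c k * zeta (x - s * of_int k)) * jb x ^ l)\<bar>"
      unfolding split[OF sm1] symm_sum_def by (subst infsum_cmult_left[OF sm1]) (simp add: abs_mult)
    also have "... \<le> (\<Sum>\<^sub>\<infinity>k\<in>-?I. \<bar>(c k * zeta (x - s * of_int k)) * jb x ^ l\<bar>)"
      using norm_infsum_bound[OF sm] by simp
    also have "... \<le> (\<Sum>\<^sub>\<infinity>k\<in>-?I. w k)"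
      using sm wb by (intro infsum_mono summable_on_subset_banach[OF w]) (auto simp: abs_mult)
    also have "... = (\<Sum>\<^sub>\<infinity>k. w k) - (\<Sum>k\<in>?I. w k)" using split[OF w] by simp
    finally show ?thesis .
  qed
  have "(\<lambda>N. (\<Sum>\<^sub>\<infinity>k. w k) - (\<Sum>k\<in>{- int N..int N}. w k)) \<longlonglongrightarrow> (\<Sum>\<^sub>\<infinity>k. w k) - (\<Sum>\<^sub>\<infinity>k. w k)"
    by (intro tendsto_intros summable_on_int_symmetric_limit w)
  then show ?thesis using bound by (intro exI[of _ "\<lambda>N. (\<Sum>\<^sub>\<infinity>k. w k) - (\<Sum>k\<in>{- int N..int N}. w k)"]) simp
qed

lemma rapid_sum:
  "(!!i. i \<in> A ==> rapid (f i)) ==> rapid (\<lambda>x. \<Sum>i\<in>A. f i x)"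
proof (induction A rule: infinite_finite_induct)
  case (insert i A) then show ?case by (auto intro: rapid_add)
qed (auto simp: rapid_def)

lemma rapid_series:
  assumes c: "rapid_seq c" and zeta: "rapid zeta" and s: "\<bar>s\<bar> \<le> 1"
  shows "rapid (\<lambda>x. \<Sum>\<^sub>\<infinity>k. c k * zeta (x - s * of_int k))"
    and "cont zeta ==> cont (\<lambda>x. \<Sum>\<^sub>\<infinity>k. c k * zeta (x - s * of_int k))"
proof -
  let ?sg = "\<lambda>x. \<Sum>\<^sub>\<infinity>k. c k * zeta (x - s * of_int k)"
  let ?p = "symm_sum c (\<lambda>k x. zeta (x - s * of_int k))"
  have p: "rapid (?p N)" for N unfolding symm_sum_def by (intro rapid_sum rapid_cmult rapid_shift zeta)
  show "rapid ?sg"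
    unfolding rapid_def
  proof
    fix l
    obtain eps where eps: "eps \<longlonglongrightarrow> 0" "!!N x. \<bar>?sg x - ?p N x\<bar> * jb x ^ l \<le> eps N"
      using rapid_series_tail[OF c zeta s, of l] by blast
    obtain C where C: "!!x. \<bar>?p 0 x\<bar> * jb x ^ l \<le> C" using rapidD[OF p[of 0]] by metis
    have "\<bar>?sg x\<bar> * jb x ^ l \<le> eps 0 + C" for x
    proof -
      have "\<bar>?sg x\<bar> * jb x ^ l \<le> (\<bar>?sg x - ?p 0 x\<bar> + \<bar>?p 0 x\<bar>) * jb x ^ l"
        by (intro mult_right_mono) auto
      then show ?thesis using eps(2)[of x 0] C[of x] by (simp add: distrib_right)
    qed
    then show "\<exists>C. \<forall>x. \<bar>?sg x\<bar> * jb x ^ l \<le> C" by blast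
  qed
  assume cont: "cont zeta"
  obtain eps where eps: "eps \<longlonglongrightarrow> 0" "!!N x. \<bar>?sg x - ?p N x\<bar> * jb x ^ 0 \<le> eps N"
    using rapid_series_tail[OF c zeta s, of 0] by blast
  show "cont ?sg"
  proof (rule uniform_limit_theorem)
    show "\<forall>\<^sub>F N in sequentially. cont (?p N)"
      unfolding symm_sum_def by (intro always_eventually allI continuous_intros continuous_on_compose2[OF cont]) auto
    show "uniform_limit UNIV ?p ?sg sequentially"
      unfolding uniform_limit_iff
    proof (intro allI impI)
      fix e :: real assume "e > 0"
      then have "\<forall>\<^sub>F N in sequentially. eps N < e" using order_tendstoD(2)[OF eps(1)] by auto
      then show "\<forall>\<^sub>F N in sequentially. \<forall>x\<in>UNIV. dist (?p N x) (?sg x) < e"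
        by eventually_elim (use eps(2) in \<open>auto simp: dist_real_def abs_minus_commute intro: le_less_trans\<close>)
    qed
  qed auto
qed

section \<open>The spaces of test functions\<close>

text \<open>A bound with negative \<open>l\<close> follows from the one with exponent 0, because the
  weight is at least 1.\<close>

lemma S_space_iff: "phi \<in> S_space r \<longleftrightarrow> phi \<in> Cr_functions r \<and> (\<forall>k\<le>r. rapid ((deriv ^^ k) phi))"
proof -
  have "(\<forall>l::int. \<exists>C>0. \<forall>x. \<bar>f x\<bar> \<le> C * jb x powi (- l)) \<longleftrightarrow> rapid f" for f
  proof
    assume a: "\<forall>l::int. \<exists>C>0. \<forall>x. \<bar>f x\<bar> \<le> C * jb x powi (- l)"
    show "rapid f" unfolding rapid_def
    proof
      fix l :: nat
      obtain C where "\<forall>x. \<bar>f x\<bar> \<le> C * jb x powi (- int l)" using a by blast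
      then have "\<forall>x. \<bar>f x\<bar> * jb x ^ l \<le> C"
        by (simp add: power_int_minus field_simps add_pos_nonneg)
      then show "\<exists>C. \<forall>x. \<bar>f x\<bar> * jb x ^ l \<le> C" by blast
    qed
  next
    assume a: "rapid f"
    show "\<forall>l::int. \<exists>C>0. \<forall>x. \<bar>f x\<bar> \<le> C * jb x powi (- l)"
    proof
      fix l :: int
      obtain C where C: "C > 0" "!!x. \<bar>f x\<bar> * jb x ^ nat l \<le> C" using rapidD[OF a] by metis
      have "\<bar>f x\<bar> \<le> C * jb x powi (- l)" for x
      proof -
        have "\<bar>f x\<bar> \<le> C * jb x powi (- int j)" if "\<bar>f x\<bar> * jb x ^ j \<le> C" for j
          using that by (simp add: power_int_minus field_simps add_pos_nonneg)
        from this[OF C(2)] have "\<bar>f x\<bar> \<le> C * jb x powi (- int (nat l))" .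
        also have "... \<le> C * jb x powi (- l)"
          using C(1) by (intro mult_left_mono power_int_increasing) auto
        finally show ?thesis .
      qed
      then show "\<exists>C>0. \<forall>x. \<bar>f x\<bar> \<le> C * jb x powi (- l)" using C(1) by blast
    qed
  qed
  then show ?thesis by (simp add: S_space_def)
qed

lemma S_space_Cr: "phi \<in> S_space r ==> phi \<in> Cr_functions r" by (simp add: S_space_iff)

lemma S_space_rapid: "phi \<in> S_space r ==> k \<le> r ==> rapid ((deriv ^^ k) phi)" by (simp add: S_space_iff)

lemma S_space_rapid0: "phi \<in> S_space r ==> rapid phi" using S_space_rapid[of phi r 0] by simp

lemma S_space_continuous: "phi \<in> S_space r ==> continuous_on S phi"
  using S_space_Cr[THEN Cr_functions_antimono[of 0 r, rotated]] continuous_on_subset[of UNIV phi S]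
  by (auto simp: Cr_functions_0)

lemma S_space_add: "phi \<in> S_space r ==> eta \<in> S_space r ==> (\<lambda>x. phi x + eta x) \<in> S_space r"
  by (auto simp: S_space_iff higher_deriv_add[of phi r eta] intro: Cr_functions_add rapid_add)

lemma S_space_cmult: "phi \<in> S_space r ==> (\<lambda>x. c * phi x) \<in> S_space r"
  by (auto simp: S_space_iff higher_deriv_cmult[of phi r] intro: Cr_functions_cmult rapid_cmult)

lemma S_space_zero: "(\<lambda>x. 0) \<in> S_space r"
  by (auto simp: S_space_iff higher_deriv_zero Cr_functions_const rapid_def)

lemma S_space_sum: "(!!i. i \<in> A ==> f i \<in> S_space r) ==> (\<lambda>x. \<Sum>i\<in>A. f i x) \<in> S_space r"
  by (induction A rule: infinite_finite_induct) (auto intro: S_space_add S_space_zero)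

lemma S_space_affine: "phi \<in> S_space r ==> a \<noteq> 0 ==> (\<lambda>x. phi (a * x + b)) \<in> S_space r"
  by (auto simp: S_space_iff higher_deriv_affine[of phi r] intro!: Cr_functions_affine rapid_cmult rapid_affine)

lemma S_space_affine': "phi \<in> S_space r ==> a \<noteq> 0 ==> (\<lambda>x. phi (a * x - b)) \<in> S_space r"
  using S_space_affine[of phi r a "-b"] by simp

lemma S_space_shift: "phi \<in> S_space r ==> (\<lambda>x. phi (x - b)) \<in> S_space r"
  using S_space_affine[of phi r 1 "-b"] by simp

lemma rapid_compact_support:
  assumes "cont f" "!!x. \<bar>x\<bar> > X ==> f x = 0"
  shows "rapid f"
  unfolding rapid_def
proof
  fix l
  have "bounded ((\<lambda>x. \<bar>f x\<bar> * jb x ^ l) ` {-X..X})"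
    by (intro compact_imp_bounded compact_continuous_image continuous_intros continuous_on_subset[OF assms(1)]) auto
  then obtain C where C: "\<forall>x\<in>{-X..X}. \<bar>\<bar>f x\<bar> * jb x ^ l\<bar> \<le> C" by (auto simp: bounded_iff)
  have "\<bar>f x\<bar> * jb x ^ l \<le> \<bar>C\<bar>" for x
  proof (cases "\<bar>x\<bar> > X")
    case False
    then have "x \<in> {-X..X}" by auto
    from C[rule_format, OF this] show ?thesis by linarith
  qed (simp add: assms(2))
  then show "\<exists>C. \<forall>x. \<bar>f x\<bar> * jb x ^ l \<le> C" by blast
qed

lemma S_space_compact_support:
  assumes f: "f \<in> Cr_functions r" and X: "!!x. \<bar>x\<bar> > X ==> f x = 0"
  shows "f \<in> S_space r"
proof -
  have "(deriv ^^ k) f x = 0" if "\<bar>x\<bar> > X" for k x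
    using that by (induction k arbitrary: x) (auto intro: X deriv_zero_outside)
  then show ?thesis using f
    by (auto simp: S_space_iff Cr_functions_def intro!: rapid_compact_support[where X = X])
qed

lemma scs_S_space: "phi \<in> test_funs ==> phi \<in> S_space r"
  unfolding test_funs_iff using S_space_compact_support by blast

lemma B_spline_S_space: "B_spline (Suc r) \<in> S_space r"
  by (rule S_space_compact_support[OF B_spline_Cr, of "real r + 2"]) (auto intro!: B_spline_outside)

lemma S_tendstoI:
  assumes "!!k l. k \<le> r ==> \<exists>eps. eps \<longlonglongrightarrow> 0 \<and> (\<forall>m x. \<bar>(deriv ^^ k) (Phi m) x - (deriv ^^ k) phi x\<bar> * jb x ^ l \<le> eps m)"
  shows "S_tendsto r Phi phi"
  unfolding S_tendsto_def
proof (intro allI impI)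
  fix k and l :: int assume "k \<le> r"
  then obtain eps where eps: "eps \<longlonglongrightarrow> 0" "!!m x. \<bar>(deriv ^^ k) (Phi m) x - (deriv ^^ k) phi x\<bar> * jb x ^ nat l \<le> eps m"
    using assms[of k "nat l"] by blast
  show "uniform_limit UNIV (\<lambda>m x. jb x powi l * (deriv ^^ k) (Phi m) x) (\<lambda>x. jb x powi l * (deriv ^^ k) phi x) sequentially"
    unfolding uniform_limit_iff
  proof (intro allI impI)
    fix e :: real assume "e > 0"
    then have "\<forall>\<^sub>F N in sequentially. eps N < e" using order_tendstoD(2)[OF eps(1)] by auto
    then show "\<forall>\<^sub>F m in sequentially. \<forall>x\<in>UNIV. dist (jb x powi l * (deriv ^^ k) (Phi m) x) (jb x powi l * (deriv ^^ k) phi x) < e"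
    proof eventually_elim
      case (elim m)
      show ?case
      proof
        fix x :: real
        have "dist (jb x powi l * (deriv ^^ k) (Phi m) x) (jb x powi l * (deriv ^^ k) phi x)
          = jb x powi l * \<bar>(deriv ^^ k) (Phi m) x - (deriv ^^ k) phi x\<bar>"
          by (simp add: dist_real_def abs_mult flip: right_diff_distrib)
        also have "... \<le> jb x powi (int (nat l)) * \<bar>(deriv ^^ k) (Phi m) x - (deriv ^^ k) phi x\<bar>"
          by (intro mult_right_mono power_int_increasing) auto
        also have "... \<le> eps m" using eps(2)[of m x] unfolding power_int_of_nat by (simp only: mult.commute)
        finally show "dist (jb x powi l * (deriv ^^ k) (Phi m) x) (jb x powi l * (deriv ^^ k) phi x) < e"
          using elim by simp
      qed
    qed
  qed
qed

lemma S_tendstoD: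
  assumes "S_tendsto r Phi phi" "k \<le> r"
  shows "uniform_limit UNIV (\<lambda>m x. jb x ^ l * (deriv ^^ k) (Phi m) x) (\<lambda>x. jb x ^ l * (deriv ^^ k) phi x) sequentially"
  using assms(1)[unfolded S_tendsto_def, rule_format, OF assms(2), of "int l"] by simp

lemma S_tendsto_affine:
  assumes Phi: "!!m. Phi m \<in> S_space r" and phi: "phi \<in> S_space r" and lim: "S_tendsto r Phi phi" and a: "a \<noteq> 0"
  shows "S_tendsto r (\<lambda>m x. Phi m (a * x + b)) (\<lambda>x. phi (a * x + b))"
proof -
  define K where "K = (1 + 1 / \<bar>a\<bar>) * jb b"
  have K: "1 + \<bar>x\<bar> \<le> K * jb (a * x + b)" for x unfolding K_def by (rule one_plus_abs_affine[OF a])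
  have K0: "K > 0" by (auto simp: K_def intro!: mult_pos_pos add_pos_nonneg)
  show ?thesis
    unfolding S_tendsto_def
  proof (intro allI impI)
    fix k and l :: int assume k: "k \<le> r"
    define L where "L = nat l"
    define A where "A = \<bar>a\<bar> ^ k * K ^ L + 1"
    have A: "A > 0" using K0 by (simp add: A_def add_nonneg_pos)
    show "uniform_limit UNIV (\<lambda>m x. jb x powi l * (deriv ^^ k) (\<lambda>x. Phi m (a * x + b)) x)
            (\<lambda>x. jb x powi l * (deriv ^^ k) (\<lambda>x. phi (a * x + b)) x) sequentially"
      unfolding uniform_limit_iff
    proof (intro allI impI)
      fix e :: real assume e: "e > 0"
      have "\<forall>\<^sub>F m in sequentially. \<forall>y\<in>UNIV. dist (jb y ^ L * (deriv ^^ k) (Phi m) y) (jb y ^ L * (deriv ^^ k) phi y) < e / A"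
        using S_tendstoD[OF lim k, of L] e A unfolding uniform_limit_iff by auto
      then show "\<forall>\<^sub>F m in sequentially. \<forall>x\<in>UNIV. dist (jb x powi l * (deriv ^^ k) (\<lambda>x. Phi m (a * x + b)) x)
            (jb x powi l * (deriv ^^ k) (\<lambda>x. phi (a * x + b)) x) < e"
      proof eventually_elim
        case (elim m)
        show ?case
        proof
          fix x :: real
          let ?y = "a * x + b"
          let ?d = "\<bar>(deriv ^^ k) (Phi m) ?y - (deriv ^^ k) phi ?y\<bar>"
          have el: "jb (?y) ^ L * ?d < e / A"
            using elim[rule_format, of ?y] by (simp add: dist_real_def abs_mult flip: right_diff_distrib)
          have "dist (jb x powi l * (deriv ^^ k) (\<lambda>x. Phi m (a * x + b)) x) (jb x powi l * (deriv ^^ k) (\<lambda>x. phi (a * x + b)) x)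
             = jb x powi l * (\<bar>a\<bar> ^ k * ?d)"
            unfolding higher_deriv_affine[OF S_space_Cr[OF Phi] k] higher_deriv_affine[OF S_space_Cr[OF phi] k]
            by (simp add: dist_real_def abs_mult power_abs flip: right_diff_distrib)
          also have "... \<le> jb x powi (int L) * (\<bar>a\<bar> ^ k * ?d)"
            unfolding L_def by (intro mult_right_mono power_int_increasing) auto
          also have "... \<le> (K * jb (?y)) ^ L * (\<bar>a\<bar> ^ k * ?d)"
            using K by (auto intro!: mult_right_mono power_mono)
          also have "... = (\<bar>a\<bar> ^ k * K ^ L) * (jb (?y) ^ L * ?d)" by (simp add: power_mult_distrib)
          also have "... \<le> A * (jb (?y) ^ L * ?d)" by (intro mult_right_mono) (auto simp: A_def)
          also have "... < e" using el A by (simp add: field_simps)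
          finally show "dist (jb x powi l * (deriv ^^ k) (\<lambda>x. Phi m (a * x + b)) x) (jb x powi l * (deriv ^^ k) (\<lambda>x. phi (a * x + b)) x) < e" .
        qed
      qed
    qed
  qed
qed

text \<open>Termwise differentiation shows that a series with rapidly decreasing coefficients converges
  in \<open>S\<^sub>r\<close>.\<close>

lemma S_tendsto_series:
  assumes c: "rapid_seq c" and zeta: "zeta \<in> S_space r" and s: "\<bar>s\<bar> \<le> 1" and sg: "sg \<in> S_space r"
    and eq: "!!x. sg x = (\<Sum>\<^sub>\<infinity>k. c k * zeta (x - s * of_int k))"
  shows "S_tendsto r (symm_sum c (\<lambda>k x. zeta (x - s * of_int k))) sg"
proof -
  let ?t = "\<lambda>i x. \<Sum>\<^sub>\<infinity>k. c k * (deriv ^^ i) zeta (x - s * of_int k)"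
  let ?p = "\<lambda>i N x. symm_sum c (\<lambda>k x. (deriv ^^ i) zeta (x - s * of_int k)) N x"
  have shift: "(deriv ^^ i) (\<lambda>x. zeta (x - s * of_int k)) = (\<lambda>x. (deriv ^^ i) zeta (x - s * of_int k))" if "i \<le> r" for i k
    using higher_deriv_affine[OF S_space_Cr[OF zeta] that, of 1 "- (s * of_int k)"] by simp
  have Cr: "(\<lambda>x. c k * zeta (x - s * of_int k)) \<in> Cr_functions r" for k
    by (intro S_space_Cr S_space_cmult S_space_shift zeta)
  have pd: "(deriv ^^ i) (symm_sum c (\<lambda>k x. zeta (x - s * of_int k)) N) = ?p i N" if "i \<le> r" for i N
  proof -
    have "(deriv ^^ i) (symm_sum c (\<lambda>k x. zeta (x - s * of_int k)) N) = (\<lambda>x. \<Sum>k\<in>{- int N..int N}. (deriv ^^ i) (\<lambda>x. c k * zeta (x - s * of_int k)) x)"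
      unfolding symm_sum_def[abs_def] by (rule higher_deriv_sum[OF Cr that])
    also have "... = ?p i N"
      unfolding symm_sum_def using higher_deriv_cmult[OF S_space_Cr[OF S_space_shift[OF zeta]] that] shift[OF that] by simp
    finally show ?thesis .
  qed
  have ex: "\<exists>eps. eps \<longlonglongrightarrow> 0 \<and> (\<forall>N x. \<bar>?t i x - ?p i N x\<bar> * jb x ^ l \<le> eps N)" if "i \<le> r" for i l
    by (rule rapid_series_tail[OF c S_space_rapid[OF zeta that] s])
  have plim: "(\<lambda>N. ?p i N x) \<longlonglongrightarrow> ?t i x" if i: "i \<le> r" for i x
  proof -
    obtain eps where eps: "eps \<longlonglongrightarrow> 0" "!!N x. \<bar>?t i x - ?p i N x\<bar> * jb x ^ 0 \<le> eps N"
      using ex[OF i, of 0] by blast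
    show ?thesis
      by (rule Lim_transform_bound[OF _ eps(1), THEN LIM_zero_cancel])
         (use eps(2) in \<open>auto simp: abs_minus_commute intro!: always_eventually order_trans[OF _ abs_ge_self]\<close>)
  qed
  have td: "(deriv ^^ i) sg = ?t i" if "i \<le> r" for i
    using that
  proof (induction i)
    case 0 show ?case using eq by (simp add: fun_eq_iff)
  next
    case (Suc i)
    have dzeta: "((deriv ^^ i) zeta has_real_derivative (deriv ^^ Suc i) zeta y) (at y)" for y
      using S_space_Cr[OF zeta] Suc.prems by (auto simp: Cr_functions_def DERIV_deriv_iff_real_differentiable)
    have dp: "(?p i N has_real_derivative ?p (Suc i) N x) (at x)" for N x
      unfolding symm_sum_def
      using DERIV_cmult[OF DERIV_chain2[OF dzeta DERIV_diff[OF DERIV_ident DERIV_const]]]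
      by (intro DERIV_sum) simp
    obtain eps where eps: "eps \<longlonglongrightarrow> 0" "!!N x. \<bar>?t (Suc i) x - ?p (Suc i) N x\<bar> * jb x ^ 0 \<le> eps N"
      using ex[OF Suc.prems, of 0] by blast
    have "\<exists>g. \<forall>x\<in>UNIV. (\<lambda>N. ?p i N x) \<longlonglongrightarrow> g x \<and> (g has_derivative (*) (?t (Suc i) x)) (at x within UNIV)"
    proof (rule has_derivative_sequence[where f = "?p i" and f' = "\<lambda>N x. (*) (?p (Suc i) N x)" and ?x0.0 = 0])
      show "(?p i N has_derivative (*) (?p (Suc i) N x)) (at x within UNIV)" for N x
        using dp[of N x] by (simp add: has_field_derivative_def)
      fix e :: real assume "e > 0"
      then have "\<forall>\<^sub>F N in sequentially. eps N < e" using order_tendstoD(2)[OF eps(1)] by auto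
      then show "\<forall>\<^sub>F N in sequentially. \<forall>x\<in>UNIV. \<forall>h. norm (?p (Suc i) N x * h - ?t (Suc i) x * h) \<le> e * norm h"
      proof eventually_elim
        case (elim N)
        show ?case
        proof (intro ballI allI)
          fix x h
          have "\<bar>?p (Suc i) N x - ?t (Suc i) x\<bar> \<le> e" using eps(2)[of x N] elim by (simp add: abs_minus_commute)
          then show "norm (?p (Suc i) N x * h - ?t (Suc i) x * h) \<le> e * norm h"
            by (simp add: abs_mult mult_right_mono flip: left_diff_distrib)
        qed
      qed
    qed (use plim[of i 0] Suc.prems in auto)
    then obtain g where g: "!!x. (\<lambda>N. ?p i N x) \<longlonglongrightarrow> g x" "!!x. (g has_derivative (*) (?t (Suc i) x)) (at x)" by auto
    have "g = ?t i" using LIMSEQ_unique[OF g(1) plim[of i]] Suc.prems by auto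
    then have "(?t i has_real_derivative ?t (Suc i) x) (at x)" for x
      using g(2)[of x] by (simp add: has_field_derivative_def)
    then show ?case using Suc by (auto intro!: DERIV_imp_deriv)
  qed
  show ?thesis
  proof (rule S_tendstoI)
    fix i l assume i: "i \<le> r"
    obtain eps where eps: "eps \<longlonglongrightarrow> 0" "!!N x. \<bar>?t i x - ?p i N x\<bar> * jb x ^ l \<le> eps N"
      using ex[OF i, of l] by blast
    then show "\<exists>eps. eps \<longlonglongrightarrow> 0 \<and> (\<forall>m x. \<bar>(deriv ^^ i) (symm_sum c (\<lambda>k x. zeta (x - s * of_int k)) m) x - (deriv ^^ i) sg x\<bar> * jb x ^ l \<le> eps m)"
      unfolding pd[OF i] td[OF i] by (intro exI[of _ eps]) (auto simp: abs_minus_commute)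
  qed
qed

section \<open>Continuous functionals on the test spaces\<close>

lemma S_dual_add: "f \<in> S_dual r ==> phi \<in> S_space r ==> eta \<in> S_space r ==> f (\<lambda>x. phi x + eta x) = f phi + f eta"
  by (auto simp: S_dual_def)

lemma S_dual_cmult: "f \<in> S_dual r ==> phi \<in> S_space r ==> f (\<lambda>x. c * phi x) = c * f phi"
  by (auto simp: S_dual_def)

lemma S_dual_zero: "f \<in> S_dual r ==> f (\<lambda>x. 0) = 0"
  using S_dual_cmult[of f r "\<lambda>x. 0" 0] S_space_zero by simp

lemma S_dual_sum:
  assumes f: "f \<in> S_dual r" and phi: "!!i. i \<in> A ==> phi i \<in> S_space r"
  shows "f (\<lambda>x. \<Sum>i\<in>A. c i * phi i x) = (\<Sum>i\<in>A. c i * f (phi i))"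
  using phi
proof (induction A rule: infinite_finite_induct)
  case (insert i A)
  then show ?case
    using S_dual_add[OF f S_space_cmult[of "phi i" r "c i"] S_space_sum[of A "\<lambda>i x. c i * phi i x" r]] 
      S_dual_cmult[OF f, of "phi i"] S_space_cmult by auto
qed (auto simp: S_dual_zero[OF f])

lemma S_dual_tendsto:
  "f \<in> S_dual r ==> (!!m. Phi m \<in> S_space r) ==> phi \<in> S_space r ==> S_tendsto r Phi phi ==> (\<lambda>m. f (Phi m)) \<longlonglongrightarrow> f phi"
  unfolding S_dual_def by blast

text \<open>Turns an expansion of functions into an expansion of coefficients: convergence in the
  test space survives an affine change of variable, so the functional may be applied term by
  term.\<close>

lemma S_dual_series:
  assumes f: "f \<in> S_dual r" and c: "rapid_seq c" and zeta: "zeta \<in> S_space r" and s: "\<bar>s\<bar> \<le> 1" and sg: "sg \<in> S_space r"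
    and eq: "!!x. sg x = (\<Sum>\<^sub>\<infinity>k. c k * zeta (x - s * of_int k))" and a: "a \<noteq> 0"
  shows "(\<lambda>N. \<Sum>k\<in>{- int N..int N}. c k * f (\<lambda>x. zeta (a * x - b - s * of_int k))) \<longlonglongrightarrow> f (\<lambda>x. sg (a * x - b))"
proof -
  let ?Phi = "symm_sum c (\<lambda>k x. zeta (x - s * of_int k))"
  have Phi: "?Phi N \<in> S_space r" for N
    unfolding symm_sum_def[abs_def] by (intro S_space_sum S_space_cmult S_space_shift zeta)
  have "S_tendsto r (\<lambda>N x. ?Phi N (a * x + - b)) (\<lambda>x. sg (a * x + - b))"
    by (intro S_tendsto_affine Phi sg S_tendsto_series c zeta s eq a)
  then have "(\<lambda>N. f (\<lambda>x. ?Phi N (a * x + - b))) \<longlonglongrightarrow> f (\<lambda>x. sg (a * x + - b))"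
    by (rule S_dual_tendsto[OF f S_space_affine[OF Phi a] S_space_affine[OF sg a]])
  moreover have "f (\<lambda>x. ?Phi N (a * x + - b)) = (\<Sum>k\<in>{- int N..int N}. c k * f (\<lambda>x. zeta (a * x - b - s * of_int k)))" for N
    unfolding symm_sum_def using S_space_affine'[OF zeta a] by (subst S_dual_sum[OF f, symmetric]) (auto simp: diff_diff_eq)
  ultimately show ?thesis by simp
qed

section \<open>Orthogonality in \<open>L\<^sub>2\<close>\<close>

text \<open>A class stable under sums, products, translations and rapidly convergent series, which
  contains the B-splines of positive degree, \<open>\<psi>\<close>, \<open>\<Psi>\<close> and the
  test functions. Products are integrable, and equality almost everywhere is equality, so
  orthogonality arguments give pointwise identities.\<close>

definition cont_rapid :: "(real => real) => bool" where
  "cont_rapid f \<longleftrightarrow> cont f \<and> rapid f"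

lemma cont_rapid_continuous: "cont_rapid f ==> continuous_on S f"
  unfolding cont_rapid_def using continuous_on_subset by blast

lemma cont_rapid_rapid: "cont_rapid f ==> rapid f" by (simp add: cont_rapid_def)

lemma S_space_cont_rapid: "f \<in> S_space r ==> cont_rapid f"
  by (simp add: cont_rapid_def S_space_continuous S_space_rapid0)

lemma cont_rapid_measurable: "cont_rapid f ==> f \<in> lmeas"
  by (intro lmeas_continuous cont_rapid_continuous)

lemma cont_rapid_add: "cont_rapid f ==> cont_rapid g ==> cont_rapid (\<lambda>x. f x + g x)"
  by (auto simp: cont_rapid_def intro: continuous_on_add rapid_add)

lemma cont_rapid_cmult: "cont_rapid f ==> cont_rapid (\<lambda>x. c * f x)"
  by (auto simp: cont_rapid_def intro: continuous_intros rapid_cmult)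

lemma cont_rapid_diff: "cont_rapid f ==> cont_rapid g ==> cont_rapid (\<lambda>x. f x - g x)"
  by (auto simp: cont_rapid_def intro: continuous_intros rapid_diff)

lemma cont_rapid_sum: "(!!i. i \<in> A ==> cont_rapid (f i)) ==> cont_rapid (\<lambda>x. \<Sum>i\<in>A. f i x)"
  unfolding cont_rapid_def by (auto intro: continuous_on_sum rapid_sum)

lemma cont_rapid_shift: "cont_rapid f ==> cont_rapid (\<lambda>x. f (x - a))"
  unfolding cont_rapid_def by (auto intro!: rapid_shift continuous_on_compose2[of UNIV f] continuous_intros)

lemma cont_rapid_mult: "cont_rapid f ==> cont_rapid g ==> cont_rapid (\<lambda>x. f x * g x)"
  unfolding cont_rapid_def using rapid_bounded[of f] rapid_bounded_mult[of g f] by (metis continuous_on_mult)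

lemma cont_rapid_integrable: "cont_rapid f ==> lint f"
  by (intro rapid_integrable cont_rapid_rapid cont_rapid_measurable)

lemma cont_rapid_integrable_mult: "cont_rapid f ==> cont_rapid g ==> lint (\<lambda>x. f x * g x)"
  by (intro cont_rapid_integrable cont_rapid_mult)

lemma cont_rapid_scs: "phi \<in> test_funs ==> cont_rapid phi"
  by (rule S_space_cont_rapid[OF scs_S_space])

lemma cont_rapid_series:
  assumes "rapid_seq c" "cont_rapid zeta" "\<bar>s\<bar> \<le> 1"
  shows "cont_rapid (\<lambda>x. \<Sum>\<^sub>\<infinity>k. c k * zeta (x - s * of_int k))"
  using assms rapid_series[of c zeta s] by (simp add: cont_rapid_def)

lemma LINT_shift: "(LI x. f (x - a)) = (LI x. f (x::real) :: real)"
  using lebesgue_integral_real_affine[of 1 "\<lambda>x. f (x - a)" a] by simp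

lemma integral_series_mult:
  assumes c: "rapid_seq c" and zeta: "cont_rapid zeta" and s: "\<bar>s\<bar> \<le> 1" and v: "cont_rapid v"
  shows "(\<lambda>N. \<Sum>k\<in>{- int N..int N}. c k * (LI x. zeta (x - s * of_int k) * v x))
     \<longlonglongrightarrow> (LI x. (\<Sum>\<^sub>\<infinity>k. c k * zeta (x - s * of_int k)) * v x)"
proof -
  let ?sg = "\<lambda>x. \<Sum>\<^sub>\<infinity>k. c k * zeta (x - s * of_int k)"
  let ?p = "symm_sum c (\<lambda>k x. zeta (x - s * of_int k))"
  obtain eps where eps: "eps \<longlonglongrightarrow> 0" "!!N x. \<bar>?sg x - ?p N x\<bar> * jb x ^ 2 \<le> eps N"
    using rapid_series_tail[OF c cont_rapid_rapid[OF zeta] s, of 2] by blast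
  obtain B where B: "B > 0" "!!x. \<bar>v x\<bar> \<le> B" using rapid_bounded[OF cont_rapid_rapid[OF v]] by metis
  define I where "I = (LI x. 1 / jb (x::real) ^ 2)"
  have sg: "cont_rapid ?sg" by (rule cont_rapid_series[OF c zeta s])
  have p: "cont_rapid (?p N)" for N unfolding symm_sum_def by (intro cont_rapid_sum cont_rapid_cmult cont_rapid_shift zeta)
  have pe: "(LI x. ?p N x * v x) = (\<Sum>k\<in>{- int N..int N}. c k * (LI x. zeta (x - s * of_int k) * v x))" for N
  proof -
    have "(LI x. ?p N x * v x) = (LI x. (\<Sum>k\<in>{- int N..int N}. c k * (zeta (x - s * of_int k) * v x)))"
      by (simp add: symm_sum_def sum_distrib_right mult.assoc)
    also have "... = (\<Sum>k\<in>{- int N..int N}. LI x. c k * (zeta (x - s * of_int k) * v x))"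
      by (intro LI_sum integrable_mult_right cont_rapid_integrable_mult cont_rapid_shift zeta v)
    finally show ?thesis by simp
  qed
  have "\<bar>(LI x. ?sg x * v x) - (LI x. ?p N x * v x)\<bar> \<le> eps N * (B * I)" for N
  proof -
    have "\<bar>(LI x. ?sg x * v x) - (LI x. ?p N x * v x)\<bar> = \<bar>LI x. (?sg x - ?p N x) * v x\<bar>"
      by (subst LI_diff[symmetric]) (auto intro!: cont_rapid_integrable_mult sg p v simp: left_diff_distrib)
    also have "... \<le> (LI x. \<bar>(?sg x - ?p N x) * v x\<bar>)" by (rule integral_abs_bound)
    also have "... \<le> (LI x. (eps N * B) * (1 / jb x ^ 2))"
    proof (rule integral_mono_AE)
      show "lint (\<lambda>x. \<bar>(?sg x - ?p N x) * v x\<bar>)"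
        by (rule integrable_abs[OF cont_rapid_integrable_mult[OF cont_rapid_diff[OF sg p] v]])
      show "lint (\<lambda>x::real. (eps N * B) * (1 / jb x ^ 2))"
        by (rule integrable_mult_right[OF integrable_weight])
      show "AE x in lebesgue. \<bar>(?sg x - ?p N x) * v x\<bar> \<le> (eps N * B) * (1 / jb x ^ 2)"
      proof (rule AE_I2)
        fix x :: real
        have w: "jb x ^ 2 > 0" by (intro zero_less_power) linarith
        have "\<bar>?sg x - ?p N x\<bar> \<le> eps N / jb x ^ 2" using eps(2)[of x N] w by (simp add: pos_le_divide_eq)
        then have "\<bar>?sg x - ?p N x\<bar> * \<bar>v x\<bar> \<le> eps N / jb x ^ 2 * B" 
          using B by (intro mult_mono) (auto intro: order_trans[OF abs_ge_zero])
        then show "\<bar>(?sg x - ?p N x) * v x\<bar> \<le> (eps N * B) * (1 / jb x ^ 2)" by (simp add: abs_mult)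
      qed
    qed
    also have "... = eps N * (B * I)" unfolding I_def integral_mult_right_zero by simp
    finally show ?thesis .
  qed
  then have "\<forall>\<^sub>F N in sequentially. norm ((LI x. ?sg x * v x) - (LI x. ?p N x * v x)) \<le> eps N * (B * I)"
    by simp
  moreover have "(\<lambda>N. eps N * (B * I)) \<longlonglongrightarrow> 0" using tendsto_mult_left_zero[OF eps(1)] .
  ultimately have "(\<lambda>N. (LI x. ?sg x * v x) - (LI x. ?p N x * v x)) \<longlonglongrightarrow> 0"
    by (rule Lim_null_comparison)
  from tendsto_diff[OF tendsto_const[of "LI x. ?sg x * v x"] this]
  have "(\<lambda>N. (LI x. ?p N x * v x)) \<longlonglongrightarrow> (LI x. ?sg x * v x)" by simp
  then show ?thesis by (simp add: pe)
qed

text \<open>The set where \<open>f\<close> does not vanish is open, and a nonempty open set is not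
  negligible.\<close>

lemma continuous_AE_zero:
  assumes f: "cont f" and z: "AE x in lebesgue. f x = (0::real)"
  shows "f x = 0"
proof -
  have o: "open {x. f x \<noteq> 0}" using f by (intro open_Collect_neq) auto
  have "{x. f x \<noteq> 0} \<in> null_sets lebesgue"
    using z AE_iff_null_sets[of "{x. f x \<noteq> 0}" lebesgue] o by auto
  then have "negligible {x. f x \<noteq> 0}" by (simp add: negligible_iff_null_sets)
  then have "{x. f x \<noteq> 0} = {}" using open_not_negligible[OF o] by blast
  then show ?thesis by auto
qed

section \<open>Closed spans of continuous rapidly decreasing functions\<close>

lemma Lp_norm_2:
  assumes "f \<in> lmeas"
  shows "Lp_norm 2 f = ennreal_powr (\<integral>\<^sup>+x. ennreal ((f x)\<^sup>2) \<partial>lebesgue) (1/2)"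
proof -
  have "\<bar>y\<bar> powr 2 = y\<^sup>2" for y :: real by (cases "y = 0") (auto simp: powr_numeral)
  then show ?thesis by (simp add: Lp_norm_def)
qed

lemma Lp_norm_2_less:
  assumes f: "f \<in> lmeas" and eps: "eps > 0"
  shows "Lp_norm 2 f < ennreal eps \<longleftrightarrow> (\<integral>\<^sup>+x. ennreal ((f x)\<^sup>2) \<partial>lebesgue) < ennreal (eps\<^sup>2)"
proof (cases "(\<integral>\<^sup>+x. ennreal ((f x)\<^sup>2) \<partial>lebesgue)")
  case (real r)
  have "sqrt r < eps \<longleftrightarrow> r < eps\<^sup>2" using eps real(1) real_less_rsqrt real_sqrt_less_iff[of r "eps\<^sup>2"] by simp
  then show ?thesis using real eps by (simp add: Lp_norm_2[OF f] ennreal_powr_def powr_half_sqrt ennreal_less_iff)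
next
  case top
  then show ?thesis by (simp add: Lp_norm_2[OF f] ennreal_powr_def)
qed

lemma Lp_norm_2_less':
  assumes f: "lint (\<lambda>x. (f x)\<^sup>2)" "f \<in> lmeas" and eps: "eps > 0"
  shows "Lp_norm 2 f < ennreal eps \<longleftrightarrow> (LI x. (f x)\<^sup>2) < eps\<^sup>2"
  unfolding Lp_norm_2_less[OF f(2) eps] by (subst nn_integral_eq_integral[OF f(1)]) (auto simp: ennreal_less_iff)

lemma cont_rapid_square_integrable: "cont_rapid f ==> lint (\<lambda>x. (f x)\<^sup>2)"
  unfolding power2_eq_square by (rule cont_rapid_integrable_mult)

lemma cont_rapid_Lp_space_2: assumes "cont_rapid f" shows "f \<in> Lp_space 2"
proof -
  have "\<exists>eps>0. (LI x. (f x)\<^sup>2) < eps\<^sup>2"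
    by (intro exI[of _ "sqrt (\<bar>LI x. (f x)\<^sup>2\<bar> + 1)"]) (auto simp: add_nonneg_pos)
  then obtain eps where "eps > 0" "(LI x. (f x)\<^sup>2) < eps\<^sup>2" by blast
  then have "Lp_norm 2 f < ennreal eps"
    using Lp_norm_2_less'[OF cont_rapid_square_integrable[OF assms] cont_rapid_measurable[OF assms]] by blast
  also have "... < \<infinity>" by simp
  finally show ?thesis using cont_rapid_measurable[OF assms] by (simp add: Lp_space_def)
qed

lemma closed_span_iff:
  assumes f: "cont_rapid f" and e: "!!i. cont_rapid (e i)"
  shows "f \<in> L2_closed_span e \<longleftrightarrow> (\<forall>eps>0. \<exists>A c. finite A \<and> (LI x. (f x - (\<Sum>i\<in>A. c i * e i x))\<^sup>2) < eps)"
    (is "?L \<longleftrightarrow> ?R")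
proof -
  have r: "cont_rapid (\<lambda>x. f x - (\<Sum>i\<in>A. c i * e i x))" for A c
    by (intro cont_rapid_diff cont_rapid_sum cont_rapid_cmult f e)
  have iff: "Lp_norm 2 (\<lambda>x. f x - (\<Sum>i\<in>A. c i * e i x)) < ennreal eps \<longleftrightarrow> (LI x. (f x - (\<Sum>i\<in>A. c i * e i x))\<^sup>2) < eps\<^sup>2" 
    if "eps > 0" for A c eps
    by (rule Lp_norm_2_less'[OF cont_rapid_square_integrable[OF r] cont_rapid_measurable[OF r] that])
  show ?thesis
  proof
    assume L: ?L
    show ?R
    proof (intro allI impI)
      fix eps :: real assume "eps > 0"
      then have s: "sqrt eps > 0" by simp
      then obtain A c where "finite A" "Lp_norm 2 (\<lambda>x. f x - (\<Sum>i\<in>A. c i * e i x)) < ennreal (sqrt eps)"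
        using L unfolding L2_closed_span_def by blast
      then have "finite A \<and> (LI x. (f x - (\<Sum>i\<in>A. c i * e i x))\<^sup>2) < eps"
        using \<open>eps > 0\<close> by (simp add: iff[OF s])
      then show "\<exists>A c. finite A \<and> (LI x. (f x - (\<Sum>i\<in>A. c i * e i x))\<^sup>2) < eps" by blast
    qed
  next
    assume R: ?R
    have "\<exists>A c. finite A \<and> Lp_norm 2 (\<lambda>x. f x - (\<Sum>i\<in>A. c i * e i x)) < ennreal eps" if eps: "eps > 0" for eps
    proof -
      have "eps\<^sup>2 > 0" using eps by simp
      from R[rule_format, OF this] obtain A c where "finite A" "(LI x. (f x - (\<Sum>i\<in>A. c i * e i x))\<^sup>2) < eps\<^sup>2"
        by blast
      then show ?thesis by (intro exI[of _ A] exI[of _ c]) (simp add: iff[OF eps])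
    qed
    then show ?L using cont_rapid_Lp_space_2[OF f] unfolding L2_closed_span_def by blast
  qed
qed

lemma closed_span_base:
  assumes e: "!!i. cont_rapid (e i)" shows "e i \<in> L2_closed_span e"
  unfolding closed_span_iff[OF e e]
proof (intro allI impI)
  fix eps :: real assume "eps > 0"
  then show "\<exists>A c. finite A \<and> (LI x. (e i x - (\<Sum>i\<in>A. c i * e i x))\<^sup>2) < eps"
    by (intro exI[of _ "{i}"] exI[of _ "\<lambda>_. 1"]) simp
qed

text \<open>The factor 2 takes the place of Minkowski's inequality; its only effect is that
  approximations are chosen with error \<open>eps / 4\<close>.\<close>

lemma square_integral_add_le:
  assumes "cont_rapid p" "cont_rapid q"
  shows "(LI x. (p x + q x)\<^sup>2) \<le> 2 * (LI x. (p x)\<^sup>2) + 2 * (LI x. (q x)\<^sup>2)"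
proof -
  have "(LI x. (p x + q x)\<^sup>2) \<le> (LI x. 2 * (p x)\<^sup>2 + 2 * (q x)\<^sup>2)"
  proof (rule integral_mono_AE)
    show "AE x in lebesgue. (p x + q x)\<^sup>2 \<le> 2 * (p x)\<^sup>2 + 2 * (q x)\<^sup>2"
    proof (rule AE_I2)
      fix x show "(p x + q x)\<^sup>2 \<le> 2 * (p x)\<^sup>2 + 2 * (q x)\<^sup>2"
        using zero_le_power2[of "p x - q x"] by (simp add: power2_eq_square algebra_simps)
    qed
  qed (auto intro!: cont_rapid_square_integrable cont_rapid_add assms)
  also have "... = 2 * (LI x. (p x)\<^sup>2) + 2 * (LI x. (q x)\<^sup>2)"
    using cont_rapid_square_integrable[OF assms(1)] cont_rapid_square_integrable[OF assms(2)] by simp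
  finally show ?thesis .
qed

lemma closed_span_add:
  assumes f: "cont_rapid f" "f \<in> L2_closed_span e" and g: "cont_rapid g" "g \<in> L2_closed_span e" and e: "!!i. cont_rapid (e i)"
  shows "(\<lambda>x. f x + g x) \<in> L2_closed_span e"
  unfolding closed_span_iff[OF cont_rapid_add[OF f(1) g(1)] e]
proof (intro allI impI)
  fix eps :: real assume "eps > 0"
  then have pos: "eps / 4 > 0" by simp
  obtain A c where A: "finite A" "(LI x. (f x - (\<Sum>i\<in>A. c i * e i x))\<^sup>2) < eps / 4"
    using f(2)[unfolded closed_span_iff[OF f(1) e], rule_format, OF pos] by blast
  obtain B d where B: "finite B" "(LI x. (g x - (\<Sum>i\<in>B. d i * e i x))\<^sup>2) < eps / 4"
    using g(2)[unfolded closed_span_iff[OF g(1) e], rule_format, OF pos] by blast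
  define h where "h i = (if i \<in> A then c i else 0) + (if i \<in> B then d i else 0)" for i
  have eq: "f x + g x - (\<Sum>i\<in>A\<union>B. h i * e i x) = (f x - (\<Sum>i\<in>A. c i * e i x)) + (g x - (\<Sum>i\<in>B. d i * e i x))" for x
  proof -
    have "(\<Sum>i\<in>A\<union>B. (if i \<in> A then c i else 0) * e i x) = (\<Sum>i\<in>A. c i * e i x)"
      by (rule sum.mono_neutral_cong_right) (use A B in auto)
    moreover have "(\<Sum>i\<in>A\<union>B. (if i \<in> B then d i else 0) * e i x) = (\<Sum>i\<in>B. d i * e i x)"
      by (rule sum.mono_neutral_cong_right) (use A B in auto)
    ultimately show ?thesis by (simp add: h_def distrib_right sum.distrib)
  qed
  have "(LI x. (f x + g x - (\<Sum>i\<in>A\<union>B. h i * e i x))\<^sup>2) \<le>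
    2 * (LI x. (f x - (\<Sum>i\<in>A. c i * e i x))\<^sup>2) + 2 * (LI x. (g x - (\<Sum>i\<in>B. d i * e i x))\<^sup>2)"
    unfolding eq by (intro square_integral_add_le cont_rapid_diff cont_rapid_sum cont_rapid_cmult f g e)
  then show "\<exists>A c. finite A \<and> (LI x. (f x + g x - (\<Sum>i\<in>A. c i * e i x))\<^sup>2) < eps"
    using A B by (intro exI[of _ "A \<union> B"] exI[of _ h]) auto
qed

lemma closed_span_cmult:
  assumes f: "cont_rapid f" "f \<in> L2_closed_span e" and e: "!!i. cont_rapid (e i)"
  shows "(\<lambda>x. a * f x) \<in> L2_closed_span e"
proof (cases "a = 0")
  case True
  then show ?thesis unfolding closed_span_iff[OF cont_rapid_cmult[OF f(1)] e] by (auto intro!: exI[of _ "{}"])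
next
  case False
  show ?thesis unfolding closed_span_iff[OF cont_rapid_cmult[OF f(1)] e]
  proof (intro allI impI)
    fix eps :: real assume "eps > 0"
    then have "eps / a\<^sup>2 > 0" using False by simp
    then obtain A c where A: "finite A" "(LI x. (f x - (\<Sum>i\<in>A. c i * e i x))\<^sup>2) < eps / a\<^sup>2"
      using f(2)[unfolded closed_span_iff[OF f(1) e], rule_format, OF \<open>eps / a\<^sup>2 > 0\<close>] by blast
    have "(a * f x - (\<Sum>i\<in>A. (a * c i) * e i x))\<^sup>2 = a\<^sup>2 * (f x - (\<Sum>i\<in>A. c i * e i x))\<^sup>2" for x
      by (simp only: power_mult_distrib[symmetric] right_diff_distrib sum_distrib_left mult.assoc)
    then show "\<exists>A c. finite A \<and> (LI x. (a * f x - (\<Sum>i\<in>A. c i * e i x))\<^sup>2) < eps"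
      using A False by (intro exI[of _ A] exI[of _ "\<lambda>i. a * c i"]) (simp add: pos_less_divide_eq mult.commute)
  qed
qed

lemma closed_span_sum:
  assumes "finite A" "!!i. i \<in> A ==> cont_rapid (f i)" "!!i. i \<in> A ==> f i \<in> L2_closed_span e" and e: "!!i. cont_rapid (e i)"
  shows "(\<lambda>x. \<Sum>i\<in>A. f i x) \<in> L2_closed_span e"
  using assms(1-3)
proof (induction A rule: finite_induct)
  case empty
  have c: "cont_rapid (\<lambda>x. 0)" using cont_rapid_cmult[OF e, of 0] by simp
  show ?case using closed_span_cmult[OF e closed_span_base[OF e] e, of 0] by simp
next
  case (insert i A)
  then show ?case by (auto intro!: closed_span_add cont_rapid_sum e)
qed

lemma closed_span_limit:
  assumes f: "cont_rapid f" and e: "!!i. cont_rapid (e i)"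
    and g: "!!eps. eps > 0 ==> \<exists>g. cont_rapid g \<and> g \<in> L2_closed_span e \<and> (LI x. (f x - g x)\<^sup>2) < eps"
  shows "f \<in> L2_closed_span e"
  unfolding closed_span_iff[OF f e]
proof (intro allI impI)
  fix eps :: real assume "eps > 0"
  then have eps: "eps / 4 > 0" by simp
  from g[OF this] obtain g where g: "cont_rapid g" "g \<in> L2_closed_span e" "(LI x. (f x - g x)\<^sup>2) < eps / 4" by blast
  obtain A c where A: "finite A" "(LI x. (g x - (\<Sum>i\<in>A. c i * e i x))\<^sup>2) < eps / 4"
    using g(2)[unfolded closed_span_iff[OF g(1) e], rule_format, OF eps] by blast
  have "(LI x. (f x - (\<Sum>i\<in>A. c i * e i x))\<^sup>2) = (LI x. ((f x - g x) + (g x - (\<Sum>i\<in>A. c i * e i x)))\<^sup>2)"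
    by simp
  also have "... \<le> 2 * (LI x. (f x - g x)\<^sup>2) + 2 * (LI x. (g x - (\<Sum>i\<in>A. c i * e i x))\<^sup>2)"
    by (intro square_integral_add_le cont_rapid_diff cont_rapid_sum cont_rapid_cmult f g e)
  finally show "\<exists>A c. finite A \<and> (LI x. (f x - (\<Sum>i\<in>A. c i * e i x))\<^sup>2) < eps"
    using A g by (intro exI[of _ A] exI[of _ c]) auto
qed

text \<open>By orthogonality the squared norm of \<open>u\<close> is the inner product of
  \<open>u\<close> with \<open>u - s\<close> for every finite combination \<open>s\<close>, hence at
  most the squared norm of \<open>u - s\<close>, which can be made arbitrarily small.\<close>

lemma closed_span_orthogonal_zero:
  assumes u: "cont_rapid u" "u \<in> L2_closed_span e" and e: "!!i. cont_rapid (e i)"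
    and 0: "!!i. (LI x. u x * e i x) = 0"
  shows "u x = 0"
proof -
  have "(LI x. (u x)\<^sup>2) \<le> eps" if eps: "eps > 0" for eps
  proof -
    obtain A c where A: "finite A" "(LI x. (u x - (\<Sum>i\<in>A. c i * e i x))\<^sup>2) < eps"
      using u(2)[unfolded closed_span_iff[OF u(1) e], rule_format, OF eps] by blast
    define q where "q x = u x - (\<Sum>i\<in>A. c i * e i x)" for x
    have q: "cont_rapid q" unfolding q_def by (intro cont_rapid_diff cont_rapid_sum cont_rapid_cmult u e)
    have "(LI x. u x * q x) = (LI x. (u x)\<^sup>2 - (\<Sum>i\<in>A. c i * (u x * e i x)))"
      by (simp add: q_def right_diff_distrib power2_eq_square sum_distrib_left algebra_simps)
    also have "... = (LI x. (u x)\<^sup>2) - (\<Sum>i\<in>A. c i * (LI x. u x * e i x))"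
      by (subst LI_diff)
         (auto intro!: cont_rapid_square_integrable u lint_sum integrable_mult_right cont_rapid_integrable_mult e
           simp: LI_sum cont_rapid_integrable_mult[OF u(1) e])
    finally have uq: "(LI x. u x * q x) = (LI x. (u x)\<^sup>2)" using 0 by simp
    have "(LI x. u x * q x) \<le> (LI x. (u x)\<^sup>2 / 2 + (q x)\<^sup>2 / 2)"
    proof (rule integral_mono_AE)
      show "AE x in lebesgue. u x * q x \<le> (u x)\<^sup>2 / 2 + (q x)\<^sup>2 / 2"
      proof (rule AE_I2)
        fix x show "u x * q x \<le> (u x)\<^sup>2 / 2 + (q x)\<^sup>2 / 2"
          using zero_le_power2[of "u x - q x"] by (simp add: power2_eq_square algebra_simps)
      qed
    qed (auto intro!: cont_rapid_integrable_mult cont_rapid_square_integrable u q)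
    also have "... = (LI x. (u x)\<^sup>2) / 2 + (LI x. (q x)\<^sup>2) / 2"
      using cont_rapid_square_integrable[OF u(1)] cont_rapid_square_integrable[OF q] by simp
    finally have "(LI x. (u x)\<^sup>2) \<le> (LI x. (q x)\<^sup>2)" using uq by simp
    then show ?thesis using A(2) by (simp add: q_def)
  qed
  then have "(LI x. (u x)\<^sup>2) \<le> 0" by (rule field_le_epsilon[of _ 0, simplified])
  then have "(LI x. (u x)\<^sup>2) = 0" by (intro antisym) auto
  then have "AE x in lebesgue. (u x)\<^sup>2 = 0"
    using integral_nonneg_eq_0_iff_AE[OF cont_rapid_square_integrable[OF u(1)]] by auto
  then have "AE x in lebesgue. u x = 0" by eventually_elim simp
  then show ?thesis by (rule continuous_AE_zero[OF cont_rapid_continuous[OF u(1)]])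
qed

text \<open>The tail bound with one power of the weight has an integrable square, so the partial
  sums converge in \<open>L\<^sub>2\<close> as well.\<close>

lemma series_in_closed_span:
  fixes zeta :: "real => real" and m :: int
  assumes c: "rapid_seq c" and zeta: "cont_rapid zeta"
  shows "(\<lambda>x. \<Sum>\<^sub>\<infinity>k. c k * zeta (x - of_int m - of_int k)) \<in> L2_closed_span (\<lambda>k x. zeta (x - of_int k))"
proof (rule closed_span_limit)
  let ?sg = "\<lambda>x. \<Sum>\<^sub>\<infinity>k. c k * zeta (x - of_int k)"
  let ?p = "symm_sum c (\<lambda>k x. zeta (x - of_int k))"
  have sg: "cont_rapid ?sg" using cont_rapid_series[OF c zeta, of 1] by simp
  show "cont_rapid (\<lambda>x. \<Sum>\<^sub>\<infinity>k. c k * zeta (x - of_int m - of_int k))"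
    using cont_rapid_shift[OF sg, of "of_int m"] by simp
  have p: "cont_rapid (?p N)" for N unfolding symm_sum_def by (intro cont_rapid_sum cont_rapid_cmult cont_rapid_shift zeta)
  fix eps :: real assume "eps > 0"
  obtain dl where dl: "dl \<longlonglongrightarrow> 0" "!!N x. \<bar>?sg x - ?p N x\<bar> * jb x ^ 1 \<le> dl N"
    using rapid_series_tail[OF c cont_rapid_rapid[OF zeta], of 1 1] by auto
  define I where "I = (LI x. 1 / jb (x::real) ^ 2)"
  have "(\<lambda>N. (dl N)\<^sup>2 * I) \<longlonglongrightarrow> 0\<^sup>2 * I" by (intro tendsto_intros dl(1))
  then have "\<forall>\<^sub>F N in sequentially. (dl N)\<^sup>2 * I < eps" using order_tendstoD(2) \<open>eps > 0\<close> by fastforce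
  then obtain N where N: "(dl N)\<^sup>2 * I < eps" using eventually_happens'[OF sequentially_bot] by blast
  have "(LI x. (?sg x - ?p N x)\<^sup>2) \<le> (LI x. (dl N)\<^sup>2 * (1 / jb x ^ 2))"
  proof (rule integral_mono_AE)
    show "AE x in lebesgue. (?sg x - ?p N x)\<^sup>2 \<le> (dl N)\<^sup>2 * (1 / jb x ^ 2)"
    proof (rule AE_I2)
      fix x :: real
      have w: "1 + \<bar>x\<bar> > 0" by linarith
      have "\<bar>?sg x - ?p N x\<bar> \<le> dl N / jb x" using dl(2)[of x N] w by (simp add: pos_le_divide_eq)
      then have "\<bar>?sg x - ?p N x\<bar> ^ 2 \<le> (dl N / jb x) ^ 2" by (intro power_mono) auto
      then show "(?sg x - ?p N x)\<^sup>2 \<le> (dl N)\<^sup>2 * (1 / jb x ^ 2)" by (simp add: power_divide)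
    qed
  qed (auto intro!: cont_rapid_square_integrable cont_rapid_diff sg p integrable_mult_right integrable_weight simp del: times_divide_eq_right)
  also have "... = (dl N)\<^sup>2 * I" by (simp add: I_def del: times_divide_eq_right)
  finally have le: "(LI x. (?sg x - ?p N x)\<^sup>2) < eps" using N by simp
  have "(\<lambda>x. ?p N (x - of_int m)) \<in> L2_closed_span (\<lambda>k x. zeta (x - of_int k))"
    unfolding symm_sum_def
  proof (intro closed_span_sum closed_span_cmult cont_rapid_cmult cont_rapid_shift zeta)
    fix k show "(\<lambda>x. zeta (x - of_int m - of_int k)) \<in> L2_closed_span (\<lambda>k x. zeta (x - of_int k))"
      using closed_span_base[of "\<lambda>k x. zeta (x - of_int k)" "m + k"] cont_rapid_shift[OF zeta] by (simp add: diff_diff_eq)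
  qed auto
  then show "\<exists>g. cont_rapid g \<and> g \<in> L2_closed_span (\<lambda>k x. zeta (x - of_int k)) \<and>
     (LI x. ((\<Sum>\<^sub>\<infinity>k. c k * zeta (x - of_int m - of_int k)) - g x)\<^sup>2) < eps"
    using le LINT_shift[of "\<lambda>x. (?sg x - ?p N x)\<^sup>2" "of_int m"] cont_rapid_shift[OF p]
    by (intro exI[of _ "\<lambda>x. ?p N (x - of_int m)"]) auto
qed (intro cont_rapid_shift zeta)

text \<open>The difference of \<open>u\<close> and its series lies in the span, is orthogonal to it
  and is continuous, so it vanishes at every point. The coefficients decay rapidly because
  \<open>u\<close> and \<open>zeta\<close> do.\<close>

lemma orthonormal_expansion:
  assumes u: "cont_rapid u" "u \<in> L2_closed_span (\<lambda>(k::int) x. zeta (x - of_int k))" and zeta: "cont_rapid zeta"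
    and orth: "!!k l::int. L2_inner (\<lambda>x. zeta (x - of_int k)) (\<lambda>x. zeta (x - of_int l)) = (if k = l then 1 else 0)"
  defines "c \<equiv> \<lambda>k::int. LI x. u x * zeta (x - of_int k)"
  shows "rapid_seq c" "u x = (\<Sum>\<^sub>\<infinity>k. c k * zeta (x - of_int k))"
proof -
  show c: "rapid_seq c" unfolding c_def by (intro rapid_seq_inner cont_rapid_rapid cont_rapid_continuous u zeta)
  let ?sg = "\<lambda>x. \<Sum>\<^sub>\<infinity>k. c k * zeta (x - of_int k)"
  have sg: "cont_rapid ?sg" using cont_rapid_series[OF c zeta, of 1] by simp
  have sgs: "?sg \<in> L2_closed_span (\<lambda>(k::int) x. zeta (x - of_int k))"
    using series_in_closed_span[OF c zeta, of 0] by simp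
  have insg: "(LI x. ?sg x * zeta (x - of_int l)) = c l" for l
  proof (rule LIMSEQ_unique)
    show "(\<lambda>N. \<Sum>k\<in>{- int N..int N}. c k * (LI x. zeta (x - of_int k) * zeta (x - of_int l))) \<longlonglongrightarrow> (LI x. ?sg x * zeta (x - of_int l))"
      using integral_series_mult[OF c zeta _ cont_rapid_shift[OF zeta, of "of_int l"], of 1] by simp
    have "\<forall>\<^sub>F N in sequentially. c l = (\<Sum>k\<in>{- int N..int N}. c k * (LI x. zeta (x - of_int k) * zeta (x - of_int l)))"
      using eventually_ge_at_top[of "nat \<bar>l\<bar>"]
    proof eventually_elim
      case (elim N)
      have "(\<Sum>k\<in>{- int N..int N}. c k * (LI x. zeta (x - of_int k) * zeta (x - of_int l))) = (\<Sum>k\<in>{- int N..int N}. if k = l then c k else 0)"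
        using orth by (intro sum.cong) (auto simp: L2_inner_def)
      also have "... = c l" using elim by (subst sum.delta) auto
      finally show ?case by simp
    qed
    then show "(\<lambda>N. \<Sum>k\<in>{- int N..int N}. c k * (LI x. zeta (x - of_int k) * zeta (x - of_int l))) \<longlonglongrightarrow> c l"
      by (rule Lim_transform_eventually[OF tendsto_const])
  qed
  have "u x + (-1) * ?sg x = 0" for x
  proof (rule closed_span_orthogonal_zero[where u = "\<lambda>x. u x + (-1) * ?sg x" and e = "\<lambda>(k::int) x. zeta (x - of_int k)"])
    show "cont_rapid (\<lambda>x. u x + (-1) * ?sg x)" by (intro cont_rapid_add cont_rapid_cmult u sg)
    show "(\<lambda>x. u x + (-1) * ?sg x) \<in> L2_closed_span (\<lambda>(k::int) x. zeta (x - of_int k))"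
      by (intro closed_span_add closed_span_cmult cont_rapid_cmult u sg sgs cont_rapid_shift zeta)
    fix l
    have "(LI x. (u x + (-1) * ?sg x) * zeta (x - of_int l)) = (LI x. u x * zeta (x - of_int l) - ?sg x * zeta (x - of_int l))"
      by (simp add: left_diff_distrib)
    also have "... = c l - (LI x. ?sg x * zeta (x - of_int l))"
      unfolding c_def by (intro LI_diff cont_rapid_integrable_mult u cont_rapid_shift zeta sg[unfolded c_def])
    finally show "(LI x. (u x + (-1) * ?sg x) * zeta (x - of_int l)) = 0" using insg by simp
  qed (intro cont_rapid_shift zeta)
  then show "u x = ?sg x" by (simp add: algebra_simps)
qed

section \<open>The dual of the B-spline basis\<close>

lemma B_spline_S_space': "n \<ge> 1 ==> B_spline n \<in> S_space (n - 1)"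
  using B_spline_S_space[of "n - 1"] by (cases n) auto

lemma B_spline_cont_rapid: "n \<ge> 1 ==> cont_rapid (B_spline n)"
  by (rule S_space_cont_rapid[OF B_spline_S_space'])

lemma integrable_B_spline_scs:
  "phi \<in> test_funs ==> lint (\<lambda>x. phi x * B_spline m (x - a))"
  using scs_integrable_mult[OF loc_int_shift[OF loc_int_B_spline]] by (simp add: mult.commute)

text \<open>Induction on the degree. Translated derivatives of the previous dual function pair with
  the next B-splines to differences of deltas, and so reach every finitely supported sequence of sum
  zero; a bump \<open>th\<close> supplies the remaining total mass 1.\<close>

lemma B_spline_dual_exists:
  "\<exists>eta\<in>test_funs. \<forall>k::int. (LI x. eta x * B_spline n (x - of_int k)) = (if k = 0 then 1 else 0)"
proof (induction n)
  case 0
  obtain th where th: "th \<in> test_funs" "!!x. th x \<ge> 0" "!!x. x \<notin> {0..1} ==> th x = 0"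
    "integral {0..1} th = 1" using scs_bump by metis
  have t1: "(LI x. th x) = 1" using scs_lebesgue_integral[of 0 1 th] th scs_continuous by auto
  have m: "(\<lambda>x. th x * B_spline 0 (x - of_int k)) \<in> lmeas" for k :: int
    using integrable_B_spline_scs[OF th(1)] by blast
  have "(LI x. th x * B_spline 0 (x - of_int k)) = (if k = 0 then 1 else 0)" for k :: int
  proof -
    have "(LI x. th x * B_spline 0 (x - of_int k)) = (LI x. (if k = 0 then th x else 0))"
    proof (rule integral_cong_AE[OF m])
      show "(\<lambda>x. if k = 0 then th x else 0) \<in> lmeas"
        using lmeas_continuous[OF scs_continuous[OF th(1)]] by (cases "k = 0") auto
      show "AE x in lebesgue. th x * B_spline 0 (x - of_int k) = (if k = 0 then th x else 0)"
        using AE_lebesgue_neq[of 0] AE_lebesgue_neq[of 1]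
      proof eventually_elim
        case (elim x)
        show ?case
        proof (cases "x \<in> {0..1}")
          case True
          then have "0 < x" "x < 1" using elim by auto
          then have "x - of_int k \<in> {0..<1} \<longleftrightarrow> k = 0" by auto
          then show ?thesis by (simp add: indicator_def)
        qed (simp add: th(3))
      qed
    qed
    then show ?thesis using t1 by simp
  qed
  then show ?case using th(1) by blast
next
  case (Suc n)
  then obtain eta where eta: "eta \<in> test_funs"
    and d: "!!k::int. (LI x. eta x * B_spline n (x - of_int k)) = (if k = 0 then 1 else 0)" by blast
  obtain th where th: "th \<in> test_funs" "!!x. th x \<ge> 0" "!!x. x \<notin> {0..1} ==> th x = 0"
    "integral {0..1} th = 1" using scs_bump by metis
  have t1: "(LI x. th x) = 1" using scs_lebesgue_integral[of 0 1 th] th scs_continuous by auto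
  let ?B = "\<lambda>(k::int) x. B_spline (Suc n) (x - of_int k)"
  have iB: "lint (\<lambda>x. phi x * ?B k x)" if "phi \<in> test_funs" for phi k
    by (rule integrable_B_spline_scs[OF that])
  define w where "w k = (LI x. th x * ?B k x)" for k
  define M where "M = int n + 3"
  have w0: "w k = 0" if "k \<notin> {-M..1}" for k
  proof -
    have "th x * ?B k x = 0" for x
    proof (cases "x \<in> {0..1}")
      case True
      have "k < - M \<or> k > 1" using that by auto
      then have "real_of_int k < - real n - 3 \<or> real_of_int k > 1" unfolding M_def by linarith
      then have "?B k x = 0" using True by (intro B_spline_outside) auto
      then show ?thesis by (simp only: mult_zero_right)
    qed (simp add: th(3))
    then have "(\<lambda>x. th x * ?B k x) = (\<lambda>x. 0)" by blast
    then show ?thesis by (simp add: w_def)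
  qed
  have sw: "(\<Sum>k\<in>{-M..1}. w k) = 1"
  proof -
    have "(\<Sum>k\<in>{-M..1}. w k) = (LI x. (\<Sum>k\<in>{-M..1}. th x * ?B k x))"
      unfolding w_def by (rule LI_sum[symmetric]) (rule iB[OF th(1)])
    also have "... = (LI x. th x)"
    proof (rule LI_cong[OF refl])
      fix x show "(\<Sum>k\<in>{-M..1}. th x * ?B k x) = th x"
      proof (cases "x \<in> {0..1}")
        case True
        then have "\<lfloor>x\<rfloor> \<ge> 0" "\<lfloor>x\<rfloor> \<le> 1" by (auto simp: floor_le_iff)
        then have "spline (Suc n) (\<lambda>_. th x) x = (\<Sum>k\<in>{-M..1}. th x * ?B k x)"
          by (intro spline_eq_sum) (auto simp: M_def)
        then show ?thesis by (simp only: spline_const)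
      qed (simp add: th(3))
    qed
    finally show ?thesis using t1 by simp
  qed
  define dl :: "int => real" where "dl k = (if k = 0 then 1 else 0)" for k
  \<comment> \<open>A solution of \<open>e (k + 1) - e k = dl k - w k\<close> with finite support:
    the partial sums vanish far to the right because \<open>dl\<close> and \<open>w\<close> both
    have sum 1.\<close>
  define e where "e k = (\<Sum>i\<in>{-M..k-1}. dl i - w i)" for k
  have e_step: "e (k + 1) - e k = dl k - w k" for k
  proof (cases "k \<ge> - M")
    case True
    then have "{-M..k} = insert k {-M..k-1}" by auto
    then show ?thesis by (simp add: e_def)
  next
    case False
    then show ?thesis using w0[of k] by (auto simp: e_def dl_def M_def)
  qed
  have e0: "e k = 0" if "k \<notin> {-M..1}" for k
  proof (cases "k \<le> -M")
    case False
    then have k: "k \<ge> 2" using that by auto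
    have "e k = (\<Sum>i\<in>{-M..1}. dl i - w i)" unfolding e_def
      by (rule sum.mono_neutral_right) (use k w0 in \<open>auto simp: dl_def\<close>)
    also have "... = 0" using sw by (simp add: sum_subtractf dl_def M_def)
    finally show ?thesis .
  qed (use that in \<open>auto simp: e_def\<close>)
  have ibp: "(LI x. deriv eta (x - of_int i) * ?B k x) = dl (i - (k + 1)) - dl (i - k)" for i k :: int
  proof -
    let ?u = "\<lambda>t. B_spline n (t - of_int k) - B_spline n (t - (of_int k + 1))"
    let ?eta = "\<lambda>x. eta (x - of_int i)"
    have li: "loc_int ?u"
      by (intro loc_int_diff loc_int_shift loc_int_B_spline)
    have etas: "?eta \<in> test_funs" by (rule scs_shift[OF eta])
    have de: "deriv ?eta = (\<lambda>x. deriv eta (x - of_int i))"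
      using higher_deriv_affine[OF scs_Cr[OF eta], of 1 1 1 "- of_int i"] by simp
    have pr: "prim ?u (of_int k - 1) x = ?B k x" for x
      using B_spline_Suc_diff[of n x "of_int k" "of_int k - 1"] B_spline_outside[of "-1" "Suc n"]
      by simp
    have sh: "(LI x. B_spline n (x - of_int j) * eta (x - of_int i)) = dl (i - j)" for j :: int
    proof -
      have "(LI x. B_spline n (x - of_int j) * eta (x - of_int i))
         = (LI x. (\<lambda>y. eta y * B_spline n (y - of_int (j - i))) (x - of_int i))"
        by (simp add: mult.commute)
      also have "... = (LI y. eta y * B_spline n (y - of_int (j - i)))" by (rule LINT_shift)
      finally show ?thesis using d[of "j - i"] by (auto simp: dl_def)
    qed
    have ic: "lint (\<lambda>x. B_spline n (x - c) * ?eta x)" for c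
      using integrable_B_spline_scs[OF etas, of n c] by (simp only: mult.commute)
    have "(LI x. prim ?u (of_int k - 1) x * deriv ?eta x) = - (LI x. ?u x * ?eta x)"
      by (rule integral_prim_mult_deriv[OF li etas])
    then have "(LI x. deriv eta (x - of_int i) * ?B k x) = - (LI x. ?u x * ?eta x)"
      unfolding pr de by (simp only: mult.commute)
    also have "(LI x. ?u x * ?eta x) = (LI x. B_spline n (x - of_int k) * ?eta x - B_spline n (x - of_int (k + 1)) * ?eta x)"
      by (simp add: left_diff_distrib)
    also have "... = dl (i - k) - dl (i - (k + 1))"
      unfolding sh[symmetric] by (intro LI_diff ic)
    finally show ?thesis by simp
  qed
  let ?L = "\<lambda>x. th x + (\<Sum>i\<in>{-M..1}. e i * deriv eta (x - of_int i))"
  show ?case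
  proof (intro bexI[of _ ?L] allI)
    show "?L \<in> test_funs" by (intro scs_add scs_sum scs_cmult scs_shift scs_deriv th eta)
    fix k :: int
    have i2: "lint (\<lambda>x. deriv eta (x - of_int i) * ?B k x)" for i :: int
      by (intro iB scs_shift scs_deriv eta)
    have "(LI x. ?L x * ?B k x) = (LI x. th x * ?B k x + (\<Sum>i\<in>{-M..1}. e i * (deriv eta (x - of_int i) * ?B k x)))"
      by (simp only: distrib_right sum_distrib_right mult.assoc)
    also have "... = w k + (LI x. (\<Sum>i\<in>{-M..1}. e i * (deriv eta (x - of_int i) * ?B k x)))"
      unfolding w_def
      by (intro LI_add iB th lint_sum integrable_mult_right i2)
    also have "... = w k + (\<Sum>i\<in>{-M..1}. e i * (dl (i - (k + 1)) - dl (i - k)))"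
      unfolding ibp[symmetric] using i2 by (subst LI_sum) auto
    also have "(\<Sum>i\<in>{-M..1}. e i * (dl (i - (k + 1)) - dl (i - k))) = e (k + 1) - e k"
    proof -
      have "(\<Sum>i\<in>{-M..1}. e i * dl (i - j)) = e j" for j
      proof -
        have "(\<Sum>i\<in>{-M..1}. e i * dl (i - j)) = (\<Sum>i\<in>{-M..1}. if i = j then e i else 0)"
          by (rule sum.cong) (auto simp: dl_def)
        then show ?thesis using e0[of j] by (simp add: sum.delta)
      qed
      then show ?thesis by (simp add: right_diff_distrib sum_subtractf)
    qed
    finally show "(LI x. ?L x * ?B k x) = (if k = 0 then 1 else 0)"
      using e_step[of k] by (simp add: dl_def)
  qed
qed

section \<open>The Gram sequence of the B-splines and its inverse\<close>

definition Gram :: "nat => int => real" where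
  "Gram n k = (LI x. B_spline n x * B_spline n (x - of_int k))"

lemma Gram_outside: assumes "\<bar>k\<bar> > int n" shows "Gram n k = 0"
proof -
  have "B_spline n x * B_spline n (x - of_int k) = 0" for x
  proof -
    have "x < 0 \<or> x \<ge> real n + 1 \<or> x - of_int k < 0 \<or> x - of_int k \<ge> real n + 1"
    proof (cases "k > 0")
      case True then have "of_int k \<ge> real n + 1" using assms by linarith
      then show ?thesis by linarith
    next
      case False then have "of_int k \<le> - real n - 1" using assms by linarith
      then show ?thesis by linarith
    qed
    then show ?thesis using B_spline_outside[of x n] B_spline_outside[of "x - of_int k" n] by auto
  qed
  then have "(\<lambda>x. B_spline n x * B_spline n (x - of_int k)) = (\<lambda>x. 0)" by blast
  then show ?thesis by (simp add: Gram_def)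
qed

lemma Gram_nonzero: "Gram n k \<noteq> 0 ==> \<bar>k\<bar> \<le> int n"
  using Gram_outside[of n k] by linarith

lemma LINT_B_spline_shift_mult:
  "(LI x. B_spline n (x - of_int j) * B_spline n (x - of_int k)) = Gram n (k - j)"
  using LINT_shift[of "\<lambda>x. B_spline n x * B_spline n (x - of_int (k - j))" "of_int j"]
  by (simp add: Gram_def)

lemma L2_inner_orthD:
  "L2_orthonormal_basis e V ==> L2_inner (e i) (e j) = (if i = j then 1 else 0)"
  "L2_orthonormal_basis e V ==> L2_closed_span e = V"
  by (auto simp: L2_orthonormal_basis_def)

text \<open>The inverse of the Gram sequence is the Gram sequence of the dual basis in
  \<open>V\<^sub>0\<close>. The given orthonormal basis turns projection onto
  \<open>V\<^sub>0\<close> into a rapidly convergent series, so the dual basis, and with it the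
  inverse, decays rapidly.\<close>

lemma Gram_inverse:
  assumes n: "n \<ge> 1" and zeta: "cont_rapid zeta"
    and basis: "L2_orthonormal_basis (\<lambda>(mu::int) x. zeta (x - of_int mu)) (spline_V0 n)"
  shows "\<exists>H. rapid_seq H \<and> (\<forall>m::int. (\<Sum>k\<in>{- int n..int n}. Gram n k * H (m - k)) = (if m = 0 then 1 else 0))"
proof -
  note B = B_spline_cont_rapid[OF n]
  let ?Z = "\<lambda>(mu::int) x. zeta (x - of_int mu)"
  let ?B = "\<lambda>(mu::int) x. B_spline n (x - of_int mu)"
  have Zc: "cont_rapid (?Z k)" for k by (rule cont_rapid_shift[OF zeta])
  have Bc: "cont_rapid (?B k)" for k by (rule cont_rapid_shift[OF B])
  have span: "L2_closed_span ?Z = L2_closed_span ?B"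
    using L2_inner_orthD(2)[OF basis] by (simp add: spline_V0_def)
  note orth = L2_inner_orthD(1)[OF basis]
  obtain eta where eta: "eta \<in> test_funs"
    and d: "!!k::int. (LI x. eta x * ?B k x) = (if k = 0 then 1 else 0)" using B_spline_dual_exists[of n] by blast
  note etac = cont_rapid_scs[OF eta]
  define a where "a k = (LI x. eta x * ?Z k x)" for k
  have a: "rapid_seq a" unfolding a_def by (intro rapid_seq_inner cont_rapid_rapid cont_rapid_continuous etac zeta)
  \<comment> \<open>The orthogonal projection of \<open>eta\<close> onto the span. It has the same
    pairings with the translated B-splines as \<open>eta\<close>, but lies in the span
    itself.\<close>
  define P where "P x = (\<Sum>\<^sub>\<infinity>k. a k * zeta (x - of_int k))" for x
  have P: "cont_rapid P" unfolding P_def using cont_rapid_series[OF a zeta, of 1] by simp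
  have Pspan: "(\<lambda>x. P (x - of_int m)) \<in> L2_closed_span ?Z" for m
    unfolding P_def by (rule series_in_closed_span[OF a zeta])
  have PB: "(LI x. P x * ?B m x) = (if m = 0 then 1 else 0)" for m
  proof -
    have Bs: "?B m \<in> L2_closed_span ?Z" unfolding span by (rule closed_span_base[OF Bc])
    define c where "c k = (LI x. ?B m x * ?Z k x)" for k
    have c: "rapid_seq c" unfolding c_def by (rule orthonormal_expansion(1)[OF Bc Bs zeta orth])
    have c2: "?B m x = (\<Sum>\<^sub>\<infinity>k. c k * zeta (x - of_int k))" for x
      unfolding c_def by (rule orthonormal_expansion(2)[OF Bc Bs zeta orth])
    have 1: "(\<lambda>N. \<Sum>k\<in>{- int N..int N}. c k * a k) \<longlonglongrightarrow> (LI x. ?B m x * eta x)"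
      using integral_series_mult[OF c zeta _ etac, of 1] by (simp add: c2 a_def mult.commute)
    have 2: "(\<lambda>N. \<Sum>k\<in>{- int N..int N}. a k * c k) \<longlonglongrightarrow> (LI x. P x * ?B m x)"
      using integral_series_mult[OF a zeta _ Bc, of 1 m] unfolding P_def c_def by (simp add: mult.commute)
    have "(LI x. P x * ?B m x) = (LI x. ?B m x * eta x)"
      by (rule LIMSEQ_unique[OF 2]) (use 1 in \<open>simp add: mult.commute\<close>)
    then show ?thesis using d[of m] by (simp add: mult.commute)
  qed
  let ?N = "{- int n..int n}"
  \<comment> \<open>Both sides lie in the span and have equal inner products with every
    \<open>?B m\<close>, so the B-spline is the Gram combination of its dual functions.\<close>
  have BP: "B_spline n x = (\<Sum>k\<in>?N. Gram n k * P (x - of_int k))" for x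
  proof -
    define u where "u x = B_spline n x + (\<Sum>k\<in>?N. (- Gram n k) * P (x - of_int k))" for x
    have uc: "cont_rapid u" unfolding u_def by (intro cont_rapid_add cont_rapid_sum cont_rapid_cmult cont_rapid_shift B P)
    have Bs: "B_spline n \<in> L2_closed_span ?Z" unfolding span using closed_span_base[of ?B 0] Bc by simp
    have "u x = 0" for x
    proof (rule closed_span_orthogonal_zero[where u = u and e = ?B])
      show "u \<in> L2_closed_span ?B" unfolding span[symmetric] u_def
        by (intro closed_span_add closed_span_sum closed_span_cmult cont_rapid_sum cont_rapid_cmult Bs Zc Pspan B cont_rapid_shift P finite_atLeastAtMost_int)
      fix m
      have "(LI x. u x * ?B m x) = (LI x. B_spline n x * ?B m x + (\<Sum>k\<in>?N. (- Gram n k) * (P (x - of_int k) * ?B m x)))"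
        by (simp only: u_def distrib_right sum_distrib_right mult.assoc)
      also have "... = Gram n m + (LI x. (\<Sum>k\<in>?N. (- Gram n k) * (P (x - of_int k) * ?B m x)))"
        unfolding Gram_def by (intro LI_add lint_sum integrable_mult_right
          cont_rapid_integrable_mult cont_rapid_shift B P)
      also have "(LI x. (\<Sum>k\<in>?N. (- Gram n k) * (P (x - of_int k) * ?B m x))) = (\<Sum>k\<in>?N. (- Gram n k) * (LI x. P (x - of_int k) * ?B m x))"
        by (subst LI_sum)
           (auto intro!: integrable_mult_right cont_rapid_integrable_mult cont_rapid_shift B P)
      also have "... = (\<Sum>k\<in>?N. if k = m then - Gram n k else 0)"
      proof (rule sum.cong[OF refl])
        fix k
        have "(LI x. P (x - of_int k) * ?B m x) = (if k = m then 1 else 0)"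
          using LINT_shift[of "\<lambda>x. P x * ?B (m - k) x" "of_int k"] PB[of "m - k"] by simp
        then show "(- Gram n k) * (LI x. P (x - of_int k) * ?B m x) = (if k = m then - Gram n k else 0)" by simp
      qed
      also have "Gram n m + ... = 0" using Gram_outside[of n m] by (auto simp: sum.delta abs_if not_le split: if_splits)
      finally show "(LI x. u x * ?B m x) = 0" .
    qed (rule uc Bc)+
    then show ?thesis using u_def[of x] by (simp add: sum_negf)
  qed
  \<comment> \<open>Pairing the expansion just proved with \<open>P (x - m)\<close> and using
    duality shows that the autocorrelation of \<open>P\<close> is the convolution inverse.\<close>
  define H where "H k = (LI x. P x * P (x - of_int k))" for k :: int
  have H: "rapid_seq H" unfolding H_def by (intro rapid_seq_inner cont_rapid_rapid cont_rapid_continuous P)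
  have "(\<Sum>k\<in>?N. Gram n k * H (m - k)) = (if m = 0 then 1 else 0)" for m
  proof -
    have "(\<Sum>k\<in>?N. Gram n k * H (m - k)) = (\<Sum>k\<in>?N. Gram n k * (LI x. P (x - of_int k) * P (x - of_int m)))"
      using LINT_shift[of "\<lambda>x. P x * P (x - of_int (m - k))" "of_int k" for k] by (simp add: H_def)
    also have "... = (LI x. (\<Sum>k\<in>?N. Gram n k * (P (x - of_int k) * P (x - of_int m))))"
      by (subst LI_sum) (auto intro!: integrable_mult_right cont_rapid_integrable_mult cont_rapid_shift P)
    also have "... = (LI x. B_spline n x * P (x - of_int m))"
      by (simp only: BP sum_distrib_right mult.assoc)
    also have "... = (LI x. P x * ?B (- m) x)"
      using LINT_shift[of "\<lambda>x. P x * ?B (- m) x" "of_int m"] by (simp add: mult.commute)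
    also have "... = (if m = 0 then 1 else 0)" using PB[of "- m"] by simp
    finally show ?thesis .
  qed
  then show ?thesis using H by blast
qed

section \<open>A compactly supported wavelet\<close>

definition sgn_parity :: "int => real" where "sgn_parity k = (if even k then 1 else -1)"

lemma sgn_parity_add: "sgn_parity (a + b) = sgn_parity a * sgn_parity b"
  by (auto simp: sgn_parity_def)

lemma sgn_parity_square [simp]: "sgn_parity a * sgn_parity a = 1"
  by (auto simp: sgn_parity_def)

lemma abs_sgn_parity [simp]: "\<bar>sgn_parity a\<bar> = 1"
  by (auto simp: sgn_parity_def)

text \<open>For \<open>n \<ge> 1\<close> this is the (n+1)-st derivative of B_(2n+1) at the point
  2y. A functional applied to its half-integer translates yields the (n+1)-st differences of
  B-spline coefficients on the grid twice as fine.\<close>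

definition diff_spline :: "nat => real => real" where
  "diff_spline n y = (\<Sum>i\<le>Suc n. sgn_parity (int i) * real (Suc n choose i) * B_spline n (2 * y - real i))"

text \<open>Up to a shift and a constant this is the semi-orthogonal spline wavelet of Chui and Wang; the
  half-integer translates of \<open>diff_spline\<close> can be recovered from those of \<open>spline_wavelet\<close> since the
  Gram sequence is invertible.\<close>

definition spline_wavelet :: "nat => real => real" where
  "spline_wavelet n x = (\<Sum>k\<in>{- int n..int n}. sgn_parity k * Gram n k * diff_spline n (x - (of_int k + real n) / 2))"

lemma diff_spline_S_space: "n \<ge> 1 ==> diff_spline n \<in> S_space (n - 1)"
  unfolding diff_spline_def[abs_def]
  by (intro S_space_sum S_space_cmult S_space_affine' B_spline_S_space') auto

lemma spline_wavelet_S_space: "n \<ge> 1 ==> spline_wavelet n \<in> S_space (n - 1)"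
  unfolding spline_wavelet_def[abs_def]
  by (intro S_space_sum S_space_cmult S_space_shift diff_spline_S_space)

lemma spline_wavelet_eq:
  "spline_wavelet n x = (\<Sum>k\<in>{- int n..int n}. \<Sum>i\<le>Suc n. sgn_parity k * Gram n k * (sgn_parity (int i) * real (Suc n choose i)
      * B_spline n (2 * x - of_int (k + int n + int i))))"
proof -
  have e: "2 * (x - (of_int k + real n) / 2) - real i = 2 * x - of_int (k + int n + int i)" for k i
    by (simp add: field_simps)
  show ?thesis unfolding spline_wavelet_def diff_spline_def sum_distrib_left e ..
qed

lemma LINT_B_spline_dilated_mult:
  "(LI x. B_spline n (2 * x - of_int j) * B_spline n (2 * x - of_int k)) = Gram n (k - j) / 2"
  using lebesgue_integral_real_affine[of 2 "\<lambda>x. B_spline n (x - of_int j) * B_spline n (x - of_int k)" 0]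
    LINT_B_spline_shift_mult[of n j k] by simp

text \<open>The sum below changes sign under the involution
  \<open>(k, i, l) \<mapsto> (2 m + l - i - n - k, n + 1 - l, n + 1 - i)\<close>.\<close>

lemma spline_wavelet_orthogonal_B_spline:
  assumes n: "n \<ge> 1"
  shows "(LI x. spline_wavelet n x * B_spline n (x - of_int m)) = 0"
proof -
  note B = B_spline_cont_rapid[OF n]
  have Bc: "cont_rapid (\<lambda>x. B_spline n (2 * x - c))" for c
    by (rule S_space_cont_rapid[OF S_space_affine'[OF B_spline_S_space'[OF n]]]) simp
  let ?N = "{- int n..int n}" and ?I = "{..Suc n}"
  define q where "q i l = 2 * m + int l - int i - int n" for i l :: nat
  define t where "t = (\<lambda>(k, i, l). sgn_parity (k + int i) * Gram n k * real (Suc n choose i) * real (Suc n choose l) * Gram n (q i l - k))"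
  define T where "T = ?N \<times> ?I \<times> ?I"
  \<comment> \<open>Outside this set the second Gram factor vanishes; inside it the involution stays
    within the index ranges.\<close>
  define T' where "T' = {(k, i, l) \<in> T. \<bar>q i l - k\<bar> \<le> int n}"
  have "(\<Sum>z\<in>T'. t z) = (\<Sum>z\<in>T'. - t z)"
  proof (rule sum.reindex_bij_witness[of _ "\<lambda>(k, i, l). (q i l - k, Suc n - l, Suc n - i)" "\<lambda>(k, i, l). (q i l - k, Suc n - l, Suc n - i)"])
    fix z assume "z \<in> T'"
    then obtain k i l where z: "z = (k, i, l)" "\<bar>k\<bar> \<le> int n" "i \<le> Suc n" "l \<le> Suc n" "\<bar>q i l - k\<bar> \<le> int n"
      by (auto simp: T'_def T_def)
    have qq: "q (Suc n - l) (Suc n - i) = q i l" using z by (simp add: q_def of_nat_diff)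
    \<comment> \<open>The two exponents add up to \<open>2 * m + 1\<close>, so the signs are
      opposite.\<close>
    have par: "sgn_parity (q i l - k + int (Suc n - l)) = - sgn_parity (k + int i)"
      using z by (simp add: q_def of_nat_diff sgn_parity_def)
    show "(case (case z of (k, i, l) => (q i l - k, Suc n - l, Suc n - i)) of (k, i, l) => (q i l - k, Suc n - l, Suc n - i)) = z"
      using z qq by simp
    then show "(case (case z of (k, i, l) => (q i l - k, Suc n - l, Suc n - i)) of (k, i, l) => (q i l - k, Suc n - l, Suc n - i)) = z" .
    show "(case z of (k, i, l) => (q i l - k, Suc n - l, Suc n - i)) \<in> T'"
      using z qq by (auto simp: T'_def T_def abs_le_iff)
    then show "(case z of (k, i, l) => (q i l - k, Suc n - l, Suc n - i)) \<in> T'" .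
    show "- t (case z of (k, i, l) => (q i l - k, Suc n - l, Suc n - i)) = t z"
      using z qq par binomial_symmetric[of i "Suc n"] binomial_symmetric[of l "Suc n"] by (simp add: t_def)
  qed
  then have 0: "(\<Sum>z\<in>T'. t z) = 0" by (simp add: sum_negf)
  have TT: "(\<Sum>z\<in>T. t z) = (\<Sum>z\<in>T'. t z)"
    by (rule sum.mono_neutral_right) (auto simp: T'_def T_def t_def dest: Gram_nonzero)
  have "(LI x. spline_wavelet n x * B_spline n (x - of_int m)) =
    (LI x. (\<Sum>k\<in>?N. \<Sum>i\<in>?I. \<Sum>l\<in>?I. (sgn_parity (k + int i) * Gram n k * real (Suc n choose i) * real (Suc n choose l) / 2 ^ n)
       * (B_spline n (2 * x - of_int (k + int n + int i)) * B_spline n (2 * x - of_int (2 * m + int l)))))"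
  proof (rule LI_cong[OF refl])
    fix x
    have v: "B_spline n (x - of_int m) = (\<Sum>l\<in>?I. real (Suc n choose l) * B_spline n (2 * x - of_int (2 * m + int l)) / 2 ^ n)"
      by (subst B_spline_two_scale)
        (simp add: algebra_simps sum_divide_distrib del: sum.atMost_Suc binomial_Suc_Suc)
    show "spline_wavelet n x * B_spline n (x - of_int m) = (\<Sum>k\<in>?N. \<Sum>i\<in>?I. \<Sum>l\<in>?I. (sgn_parity (k + int i) * Gram n k * real (Suc n choose i) * real (Suc n choose l) / 2 ^ n)
       * (B_spline n (2 * x - of_int (k + int n + int i)) * B_spline n (2 * x - of_int (2 * m + int l))))"
      unfolding spline_wavelet_eq sum_distrib_right
      by (intro sum.cong refl, subst v, unfold sum_distrib_left, intro sum.cong refl, simp add: sgn_parity_add)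
  qed
  also have "... = (\<Sum>k\<in>?N. \<Sum>i\<in>?I. \<Sum>l\<in>?I. (sgn_parity (k + int i) * Gram n k * real (Suc n choose i) * real (Suc n choose l) / 2 ^ n)
       * (Gram n ((2 * m + int l) - (k + int n + int i)) / 2))"
  proof -
    let ?f = "\<lambda>k i l x. (sgn_parity (k + int i) * Gram n k * real (Suc n choose i) * real (Suc n choose l) / 2 ^ n)
       * (B_spline n (2 * x - of_int (k + int n + int i)) * B_spline n (2 * x - of_int (2 * m + int l)))"
    have i1: "lint (?f k i l)" for k i l
      by (intro integrable_mult_right cont_rapid_integrable_mult Bc)
    have i2: "lint (\<lambda>x. \<Sum>l\<in>?I. ?f k i l x)" for k i by (intro lint_sum i1)
    have i3: "lint (\<lambda>x. \<Sum>i\<in>?I. \<Sum>l\<in>?I. ?f k i l x)" for k by (intro lint_sum i2)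
    show ?thesis
      unfolding LI_sum[OF i3] LI_sum[OF i2] LI_sum[OF i1]
        integral_mult_right_zero LINT_B_spline_dilated_mult ..
  qed
  also have "... = (\<Sum>z\<in>T. t z) / 2 ^ Suc n"
  proof -
    have "(\<Sum>z\<in>T. t z) = (\<Sum>k\<in>?N. \<Sum>i\<in>?I. \<Sum>l\<in>?I. t (k, i, l))"
      unfolding T_def by (simp only: sum.cartesian_product')
    then show ?thesis
      by (simp only: sum_divide_distrib) (intro sum.cong refl, simp add: t_def q_def algebra_simps)
  qed
  finally show ?thesis using 0 TT by simp
qed

text \<open>Here \<open>g\<close> is an arbitrary member of the closed span, with neither continuity
  nor decay at hand. Young's inequality with parameter \<open>eps\<close> estimates the error and
  also yields integrability of the product.\<close>

lemma L2_closed_span_orthogonal: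
  assumes w: "cont_rapid w" and e: "!!i. cont_rapid (e i)" and 0: "!!i. (LI x. w x * e i x) = 0"
    and g: "g \<in> L2_closed_span e"
  shows "L2_inner w g = 0"
proof -
  define I where "I = (LI x. (w x)\<^sup>2)"
  have gm: "g \<in> lmeas" using g by (simp add: L2_closed_span_def Lp_space_def)
  have "\<bar>L2_inner w g\<bar> \<le> eps * ((I + 1) / 2)" if eps: "eps > 0" for eps
  proof -
    obtain A c where A: "finite A" "Lp_norm 2 (\<lambda>x. g x - (\<Sum>i\<in>A. c i * e i x)) < ennreal eps"
      using g eps unfolding L2_closed_span_def by blast
    define s where "s x = (\<Sum>i\<in>A. c i * e i x)" for x
    define q where "q x = g x - s x" for x
    have s: "cont_rapid s" unfolding s_def by (intro cont_rapid_sum cont_rapid_cmult e)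
    have qm: "q \<in> lmeas" unfolding q_def by (intro borel_measurable_diff gm cont_rapid_measurable[OF s])
    have qf: "(\<integral>\<^sup>+x. ennreal ((q x)\<^sup>2) \<partial>lebesgue) < ennreal (eps\<^sup>2)"
    proof -
      have "Lp_norm 2 q < ennreal eps" using A(2) by (simp add: q_def[abs_def] s_def)
      then show ?thesis using Lp_norm_2_less[OF qm eps] by simp
    qed
    have qi: "lint (\<lambda>x. (q x)\<^sup>2)"
      by (rule integrableI_bounded) (use qm qf in \<open>auto intro: order.strict_trans\<close>)
    have q2: "(LI x. (q x)\<^sup>2) \<le> eps\<^sup>2"
      using qf nn_integral_eq_integral[OF qi] eps by (simp add: ennreal_less_iff)
    have bnd: "\<bar>w x * q x\<bar> \<le> eps / 2 * (w x)\<^sup>2 + 1 / (2 * eps) * (q x)\<^sup>2" for x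
    proof -
      have "0 \<le> (eps * \<bar>w x\<bar> - \<bar>q x\<bar>)\<^sup>2" by simp
      then have "2 * (eps * (\<bar>w x\<bar> * \<bar>q x\<bar>)) \<le> eps\<^sup>2 * (w x)\<^sup>2 + (q x)\<^sup>2"
        by (simp add: power2_diff power_mult_distrib algebra_simps)
      then have "(2 * eps) * (\<bar>w x\<bar> * \<bar>q x\<bar>) / (2 * eps) \<le> (eps\<^sup>2 * (w x)\<^sup>2 + (q x)\<^sup>2) / (2 * eps)"
        using eps by (intro divide_right_mono) (auto simp: mult.assoc)
      then show ?thesis using eps by (simp add: abs_mult add_divide_distrib power2_eq_square)
    qed
    have bi: "lint (\<lambda>x. eps / 2 * (w x)\<^sup>2 + 1 / (2 * eps) * (q x)\<^sup>2)"
      by (intro lint_add integrable_mult_right qi cont_rapid_square_integrable w)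
    have wq: "lint (\<lambda>x. w x * q x)"
      by (rule lint_bound[OF bi])
         (use qm cont_rapid_measurable[OF w] order_trans[OF bnd abs_ge_self] in \<open>auto intro!: borel_measurable_times AE_I2\<close>)
    have ws: "(LI x. w x * s x) = 0"
    proof -
      have "(LI x. w x * s x) = (LI x. (\<Sum>i\<in>A. c i * (w x * e i x)))"
        by (simp add: s_def sum_distrib_left algebra_simps)
      also have "... = (\<Sum>i\<in>A. c i * (LI x. w x * e i x))"
        by (subst LI_sum) (auto intro!: integrable_mult_right cont_rapid_integrable_mult w e)
      finally show ?thesis using 0 by simp
    qed
    have "L2_inner w g = (LI x. w x * q x + w x * s x)"
      by (simp add: L2_inner_def q_def algebra_simps)
    also have "... = (LI x. w x * q x)"
      using ws by (subst LI_add[OF wq cont_rapid_integrable_mult[OF w s]]) simp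
    finally have "\<bar>L2_inner w g\<bar> = \<bar>LI x. w x * q x\<bar>" by simp
    also have "... \<le> (LI x. \<bar>w x * q x\<bar>)" by (rule integral_abs_bound)
    also have "... \<le> (LI x. eps / 2 * (w x)\<^sup>2 + 1 / (2 * eps) * (q x)\<^sup>2)"
      by (rule integral_mono_AE[OF integrable_abs[OF wq] bi]) (rule AE_I2, rule bnd)
    also have "... = eps / 2 * I + 1 / (2 * eps) * (LI x. (q x)\<^sup>2)"
      unfolding I_def using qi cont_rapid_square_integrable[OF w] by simp
    also have "... \<le> eps / 2 * I + 1 / (2 * eps) * eps\<^sup>2"
      using q2 eps by (intro add_left_mono mult_left_mono) auto
    also have "... = eps * ((I + 1) / 2)" using eps by (simp add: power2_eq_square field_simps)
    finally show ?thesis .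
  qed
  then have "\<bar>L2_inner w g\<bar> \<le> 0 + e" if "e > 0" for e
  proof -
    have I: "I \<ge> 0" by (auto simp: I_def)
    then have p: "e / ((I + 1) / 2) > 0" using that by (intro divide_pos_pos) auto
    have "(e / ((I + 1) / 2)) * ((I + 1) / 2) = e" using I by simp
    then show ?thesis using \<open>!!eps. eps > 0 ==> \<bar>L2_inner w g\<bar> \<le> eps * ((I + 1) / 2)\<close>[OF p] by simp
  qed
  then have "\<bar>L2_inner w g\<bar> \<le> 0" by (rule field_le_epsilon)
  then show ?thesis by simp
qed

lemma spline_wavelet_W0:
  assumes n: "n \<ge> 1" shows "spline_wavelet n \<in> spline_W0 n"
proof -
  note B = B_spline_cont_rapid[OF n]
  let ?B = "\<lambda>(mu::int) x. B_spline n (x - of_int mu)"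
  have Bc: "cont_rapid (?B k)" for k by (rule cont_rapid_shift[OF B])
  define g where "g y = (\<Sum>k\<in>{- int n..int n}. \<Sum>i\<le>Suc n. (sgn_parity k * Gram n k * (sgn_parity (int i) * real (Suc n choose i)))
      * B_spline n (y - of_int (k + int n + int i)))" for y
  have "g \<in> spline_V0 n"
    unfolding spline_V0_def g_def
    by (intro closed_span_sum closed_span_cmult cont_rapid_sum cont_rapid_cmult Bc finite_atLeastAtMost_int finite_atMost closed_span_base[of ?B])
  moreover have "spline_wavelet n = (\<lambda>x. g (2 powi 1 * x))"
    unfolding spline_wavelet_eq[abs_def] g_def by (simp add: mult.assoc del: sum.atMost_Suc binomial_Suc_Suc)
  ultimately have V1: "spline_wavelet n \<in> spline_V n 1" unfolding spline_V_def by (metis image_eqI)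
  have "L2_inner (spline_wavelet n) f = 0" if "f \<in> spline_V n 0" for f
  proof -
    have "f \<in> L2_closed_span ?B" using that by (auto simp: spline_V_def spline_V0_def)
    then show ?thesis
      by (rule L2_closed_span_orthogonal[where e = ?B, OF S_space_cont_rapid[OF spline_wavelet_S_space[OF n]] Bc spline_wavelet_orthogonal_B_spline[OF n]])
  qed
  then show ?thesis using V1 by (simp add: spline_W0_def)
qed

text \<open>The wavelet is a convolution of half-integer translates of \<open>diff_spline\<close>
  with the Gram sequence multiplied by alternating signs. Such signs are multiplicative in the
  index, so the inverse sequence with the same signs undoes the convolution; the shift by
  \<open>n\<close> compensates the shift \<open>n / 2\<close> in
  \<open>spline_wavelet\<close>.\<close>

lemma diff_spline_expansion:
  assumes H: "!!m::int. (\<Sum>k\<in>{- int n..int n}. Gram n k * H (m - k)) = (if m = 0 then 1 else 0)"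
  shows "diff_spline n x = (\<Sum>\<^sub>\<infinity>k. sgn_parity (k + int n) * H (k + int n) * spline_wavelet n (x - 1/2 * of_int k))"
proof -
  let ?N = "{- int n..int n}"
  define d where "d m = diff_spline n (x - of_int m / 2)" for m :: int
  \<comment> \<open>For fixed \<open>x\<close> all translates of index beyond \<open>M\<close>
    vanish, so the sums become finite and may be rearranged freely.\<close>
  define M where "M = \<lceil>2 * \<bar>x\<bar>\<rceil> + 2 * int n + 4"
  have d0: "d m = 0" if "\<bar>m\<bar> > M" for m
  proof -
    have mM: "\<bar>real_of_int m\<bar> > 2 * \<bar>x\<bar> + 2 * real n + 4" using that unfolding M_def by linarith
    have "B_spline n (2 * (x - of_int m / 2) - real i) = 0" if "i \<le> Suc n" for i
      using that mM by (intro B_spline_outside) (auto simp: abs_if split: if_splits)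
    then show ?thesis by (simp add: d_def diff_spline_def del: sum.atMost_Suc)
  qed
  have M0: "M \<ge> 0" by (auto simp: M_def)
  have "(\<Sum>\<^sub>\<infinity>k. sgn_parity (k + int n) * H (k + int n) * spline_wavelet n (x - 1/2 * of_int k))
      = (\<Sum>\<^sub>\<infinity>k. sgn_parity k * H k * (\<Sum>i\<in>?N. sgn_parity i * Gram n i * d (k + i)))"
  proof (rule infsum_reindex_bij_witness[of _ "\<lambda>k. k - int n" "\<lambda>k. k + int n"])
    fix k :: int
    have "spline_wavelet n (x - 1/2 * of_int k) = (\<Sum>i\<in>?N. sgn_parity i * Gram n i * d (k + int n + i))"
      unfolding spline_wavelet_def d_def by (intro sum.cong refl) (simp add: add_divide_distrib algebra_simps)
    then show "sgn_parity (k + int n) * H (k + int n) * (\<Sum>i\<in>?N. sgn_parity i * Gram n i * d (k + int n + i))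
       = sgn_parity (k + int n) * H (k + int n) * spline_wavelet n (x - 1/2 * of_int k)" by simp
  qed auto
  also have "... = (\<Sum>\<^sub>\<infinity>k\<in>{-(M + int n)..M + int n}. sgn_parity k * H k * (\<Sum>i\<in>?N. sgn_parity i * Gram n i * d (k + i)))"
  proof (rule infsum_cong_neutral)
    fix k assume k: "k \<in> UNIV - {-(M + int n)..M + int n}"
    have "(\<Sum>i\<in>?N. sgn_parity i * Gram n i * d (k + i)) = 0"
      using k by (intro sum.neutral ballI) (auto intro!: d0)
    then show "sgn_parity k * H k * (\<Sum>i\<in>?N. sgn_parity i * Gram n i * d (k + i)) = 0" by simp
  qed auto
  also have "... = (\<Sum>k\<in>{-(M + int n)..M + int n}. \<Sum>i\<in>?N. sgn_parity (k + i) * d (k + i) * (Gram n i * H k))"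
    by (simp add: sum_distrib_left sgn_parity_add algebra_simps)
  also have "... = (\<Sum>i\<in>?N. \<Sum>k\<in>{-(M + int n)..M + int n}. sgn_parity (k + i) * d (k + i) * (Gram n i * H k))"
    by (rule sum.swap)
  also have "... = (\<Sum>i\<in>?N. \<Sum>m\<in>{-M..M}. sgn_parity m * d m * (Gram n i * H (m - i)))"
  proof (rule sum.cong[OF refl])
    fix i assume i: "i \<in> ?N"
    have "(\<Sum>k\<in>{-(M + int n)..M + int n}. sgn_parity (k + i) * d (k + i) * (Gram n i * H k))
       = (\<Sum>m\<in>{-(M + int n) + i..M + int n + i}. sgn_parity m * d m * (Gram n i * H (m - i)))"
      by (rule sum.reindex_bij_witness[of _ "\<lambda>m. m - i" "\<lambda>k. k + i"]) auto
    also have "... = (\<Sum>m\<in>{-M..M}. sgn_parity m * d m * (Gram n i * H (m - i)))"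
      by (rule sum.mono_neutral_right) (use i d0 in \<open>auto simp: abs_if\<close>)
    finally show "(\<Sum>k\<in>{-(M + int n)..M + int n}. sgn_parity (k + i) * d (k + i) * (Gram n i * H k))
       = (\<Sum>m\<in>{-M..M}. sgn_parity m * d m * (Gram n i * H (m - i)))" .
  qed
  also have "... = (\<Sum>m\<in>{-M..M}. \<Sum>i\<in>?N. sgn_parity m * d m * (Gram n i * H (m - i)))" by (rule sum.swap)
  also have "... = (\<Sum>m\<in>{-M..M}. if m = 0 then d m else 0)"
    by (intro sum.cong refl) (simp add: H sgn_parity_def flip: sum_distrib_left)
  also have "... = diff_spline n x" using M0 by (simp add: sum.delta d_def)
  finally show ?thesis by simp
qed

text \<open>The exponential series is used at \<open>gam * (1 + \<bar>x\<bar>)\<close>, so that one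
  term gives the weight; compared with the assumed decay this costs only the constant
  \<open>exp gam\<close>.\<close>

lemma Battle_Lemarie_S_space:
  assumes "Battle_Lemarie_system n \<psi> \<Psi>"
  shows "\<psi> \<in> S_space (n - 1)" "\<Psi> \<in> S_space (n - 1)"
proof -
  have Cr: "\<psi> \<in> Cr_functions (n - 1)" "\<Psi> \<in> Cr_functions (n - 1)"
    using assms by (auto simp: Battle_Lemarie_system_def)
  obtain C gam where C: "C > 0" "gam > 0"
    "!!k x. k \<le> n - 1 ==> \<bar>(deriv ^^ k) \<Psi> x\<bar> + \<bar>(deriv ^^ k) \<psi> x\<bar> \<le> C * exp (- gam * \<bar>x\<bar>)"
  proof -
    have "\<exists>C>0. \<exists>gam>0. \<forall>k\<le>n - 1. \<forall>x. \<bar>(deriv ^^ k) \<Psi> x\<bar> + \<bar>(deriv ^^ k) \<psi> x\<bar> \<le> C * exp (- gam * \<bar>x\<bar>)"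
      using assms unfolding Battle_Lemarie_system_def by (elim conjE)
    then show ?thesis using that by blast
  qed
  have r: "rapid f" if f: "!!x. \<bar>f x\<bar> \<le> C * exp (- gam * \<bar>x\<bar>)" for f
    unfolding rapid_def
  proof
    fix l
    have "\<bar>f x\<bar> * jb x ^ l \<le> C * (fact l / gam ^ l * exp gam)" for x
    proof -
      have "(gam * jb x) ^ l / fact l \<le> exp (gam * jb x)" using C(2) by (intro exp_ge_power_fact) auto
      then have "gam ^ l * jb x ^ l \<le> fact l * exp (gam * jb x)"
        by (simp add: pos_divide_le_eq power_mult_distrib mult.commute)
      then have "jb x ^ l \<le> fact l * exp (gam * jb x) / gam ^ l"
        using C(2) by (simp add: pos_le_divide_eq mult.commute)
      then have "\<bar>f x\<bar> * jb x ^ l \<le> (C * exp (- gam * \<bar>x\<bar>)) * (fact l * exp (gam * jb x) / gam ^ l)"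
        using f[of x] C(1) by (intro mult_mono) auto
      also have "... = C * (fact l / gam ^ l * (exp (- gam * \<bar>x\<bar>) * exp (gam * jb x)))" by simp
      also have "exp (- gam * \<bar>x\<bar>) * exp (gam * jb x) = exp gam"
        by (simp add: exp_add[symmetric] algebra_simps)
      finally show ?thesis .
    qed
    then show "\<exists>C. \<forall>x. \<bar>f x\<bar> * jb x ^ l \<le> C" by blast
  qed
  have "rapid ((deriv ^^ k) \<Psi>)" "rapid ((deriv ^^ k) \<psi>)" if "k \<le> n - 1" for k
    using C(3)[OF that] by (intro r; smt (verit) abs_ge_zero)+
  then show "\<psi> \<in> S_space (n - 1)" "\<Psi> \<in> S_space (n - 1)" using Cr by (auto simp: S_space_iff)
qed

text \<open>The scaling function controls the B-splines, integer translates of \<open>\<psi>\<close>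
  give the wavelet, and its half-integer translates give the differences. Only the last expansion
  leaves the integer grid, and it is the source of the shifted system.\<close>

lemma Battle_Lemarie_expansions:
  assumes BL: "Battle_Lemarie_system n \<psi> \<Psi>" and n: "n \<ge> 1"
  shows "\<exists>b. rapid_seq b \<and> (\<forall>x. B_spline n x = (\<Sum>\<^sub>\<infinity>k. b k * \<Psi> (x - of_int k)))"
    and "\<exists>c. rapid_seq c \<and> (\<forall>x. spline_wavelet n x = (\<Sum>\<^sub>\<infinity>k. c k * \<psi> (x - of_int k)))"
    and "\<exists>h. rapid_seq h \<and> (\<forall>x. diff_spline n x = (\<Sum>\<^sub>\<infinity>k. h k * spline_wavelet n (x - 1/2 * of_int k)))"
proof -
  note S = Battle_Lemarie_S_space[OF BL]
  have b\<Psi>: "L2_orthonormal_basis (\<lambda>(mu::int) x. \<Psi> (x - of_int mu)) (spline_V0 n)"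
    and b\<psi>: "L2_orthonormal_basis (\<lambda>(mu::int) x. \<psi> (x - of_int mu)) (spline_W0 n)"
    using BL by (auto simp: Battle_Lemarie_system_def)
  have "B_spline n \<in> L2_closed_span (\<lambda>(mu::int) x. B_spline n (x - of_int mu))"
    using closed_span_base[of "\<lambda>(mu::int) x. B_spline n (x - of_int mu)" 0] cont_rapid_shift[OF B_spline_cont_rapid[OF n]] by simp
  then have "B_spline n \<in> L2_closed_span (\<lambda>(mu::int) x. \<Psi> (x - of_int mu))"
    using L2_inner_orthD(2)[OF b\<Psi>] by (simp add: spline_V0_def)
  from orthonormal_expansion[OF B_spline_cont_rapid[OF n] this S_space_cont_rapid[OF S(2)] L2_inner_orthD(1)[OF b\<Psi>]]
  show "\<exists>b. rapid_seq b \<and> (\<forall>x. B_spline n x = (\<Sum>\<^sub>\<infinity>k. b k * \<Psi> (x - of_int k)))" by blast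
  have "spline_wavelet n \<in> L2_closed_span (\<lambda>(mu::int) x. \<psi> (x - of_int mu))"
    using L2_inner_orthD(2)[OF b\<psi>] spline_wavelet_W0[OF n] by simp
  from orthonormal_expansion[OF S_space_cont_rapid[OF spline_wavelet_S_space[OF n]] this S_space_cont_rapid[OF S(1)] L2_inner_orthD(1)[OF b\<psi>]]
  show "\<exists>c. rapid_seq c \<and> (\<forall>x. spline_wavelet n x = (\<Sum>\<^sub>\<infinity>k. c k * \<psi> (x - of_int k)))" by blast
  obtain H where H: "rapid_seq H" "!!m::int. (\<Sum>k\<in>{- int n..int n}. Gram n k * H (m - k)) = (if m = 0 then 1 else 0)"
    using Gram_inverse[OF n S_space_cont_rapid[OF S(2)] b\<Psi>] by blast
  have "rapid_seq (\<lambda>k. sgn_parity (k + int n) * H (k + int n))"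
    unfolding rapid_seq_def
  proof
    fix l
    obtain C where C: "C > 0" "!!nu. \<bar>H nu\<bar> * jb (of_int nu) ^ l \<le> C" using rapid_seqD[OF H(1)] by metis
    have "\<bar>sgn_parity (k + int n) * H (k + int n)\<bar> * jb (of_int k) ^ l \<le> (1 + real n) ^ l * C" for k
    proof -
      have "jb (of_int k) ^ l \<le> (jb (- real n) * jb (of_int k - (- real n))) ^ l"
        by (intro power_mono one_plus_abs_peetre) auto
      then have "\<bar>H (k + int n)\<bar> * jb (of_int k) ^ l \<le> \<bar>H (k + int n)\<bar> * ((1 + real n) * jb (of_int (k + int n))) ^ l"
        by (intro mult_left_mono) auto
      also have "... = (1 + real n) ^ l * (\<bar>H (k + int n)\<bar> * jb (of_int (k + int n)) ^ l)" by (simp add: power_mult_distrib)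
      also have "... \<le> (1 + real n) ^ l * C" using C(2)[of "k + int n"] by (intro mult_left_mono) auto
      finally show ?thesis by (simp add: abs_mult)
    qed
    then show "\<exists>C. \<forall>nu. \<bar>sgn_parity (nu + int n) * H (nu + int n)\<bar> * jb (of_int nu) ^ l \<le> C" by blast
  qed
  then show "\<exists>h. rapid_seq h \<and> (\<forall>x. diff_spline n x = (\<Sum>\<^sub>\<infinity>k. h k * spline_wavelet n (x - 1/2 * of_int k)))"
    using diff_spline_expansion[OF H(2)] by blast
qed

section \<open>Norm bounds\<close>

text \<open>A norm inequality with a real constant. Finite sums of powers avoid roots and infinite
  values and make closure under pointwise limits immediate.\<close>

definition seq_bound :: "ennreal => real => (int => real) => bool" where
  "seq_bound p K a \<longleftrightarrow> 0 \<le> K \<and>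
     (if p = \<infinity> then \<forall>m. \<bar>a m\<bar> \<le> K
      else \<forall>A. finite A --> (\<Sum>m\<in>A. \<bar>a m\<bar> powr enn2real p) \<le> K powr enn2real p)"

definition fun_bound :: "ennreal => real => (real => real) => bool" where
  "fun_bound p K g \<longleftrightarrow> g \<in> lmeas \<and> 0 \<le> K \<and>
     (if p = \<infinity> then AE x in lebesgue. \<bar>g x\<bar> \<le> K
      else (\<integral>\<^sup>+x. ennreal (\<bar>g x\<bar> powr enn2real p) \<partial>lebesgue) \<le> ennreal (K powr enn2real p))"

lemma enn2real_gt_1: "1 < p ==> p \<noteq> \<infinity> ==> 1 < enn2real p"
  by (cases p) (auto simp: one_ennreal.rep_eq ennreal_less_iff simp flip: ennreal_1)

lemma ennreal_powr_le_iff: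
  assumes q: "q > 0" and K: "K \<ge> 0"
  shows "ennreal_powr S (1 / q) \<le> ennreal K \<longleftrightarrow> S \<le> ennreal (K powr q)"
proof (cases S)
  case (real r)
  have "r powr (1 / q) \<le> K \<longleftrightarrow> r \<le> K powr q"
  proof
    assume "r powr (1 / q) \<le> K"
    then have "(r powr (1 / q)) powr q \<le> K powr q" using q by (intro powr_mono2) auto
    then show "r \<le> K powr q" using q real by (simp add: powr_powr)
  next
    assume "r \<le> K powr q"
    then have "r powr (1 / q) \<le> (K powr q) powr (1 / q)" using q real by (intro powr_mono2) auto
    then show "r powr (1 / q) \<le> K" using q K by (simp add: powr_powr)
  qed
  then show ?thesis using real K by (simp add: ennreal_powr_def ennreal_le_iff)
next
  case top
  then show ?thesis by (simp add: ennreal_powr_def top_unique)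
qed

lemma lp_seq_norm_le_iff:
  assumes p: "1 < p" and K: "K \<ge> 0"
  shows "lp_seq_norm p a \<le> ennreal K \<longleftrightarrow> seq_bound p K a"
proof (cases "p = \<infinity>")
  case True
  then show ?thesis using K by (auto simp: lp_seq_norm_def seq_bound_def SUP_le_iff ennreal_le_iff)
next
  case False
  define q where "q = enn2real p"
  have q: "q > 0" using enn2real_gt_1[OF p False] by (simp add: q_def)
  have "lp_seq_norm p a \<le> ennreal K \<longleftrightarrow> (\<Sum>\<^sub>\<infinity>mu. ennreal (\<bar>a mu\<bar> powr q)) \<le> ennreal (K powr q)"
    using False ennreal_powr_le_iff[OF q K] by (simp add: lp_seq_norm_def q_def)
  also have "... \<longleftrightarrow> (\<forall>A. finite A --> (\<Sum>mu\<in>A. ennreal (\<bar>a mu\<bar> powr q)) \<le> ennreal (K powr q))"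
    by (subst nonneg_infsum_complete) (auto simp: SUP_le_iff)
  also have "... \<longleftrightarrow> seq_bound p K a"
    using False K by (simp add: seq_bound_def q_def sum_ennreal ennreal_le_iff)
  finally show ?thesis .
qed

lemma Lp_norm_le_iff:
  assumes p: "1 < p" and K: "K \<ge> 0" and g: "g \<in> lmeas"
  shows "Lp_norm p g \<le> ennreal K \<longleftrightarrow> fun_bound p K g"
proof (cases "p = \<infinity>")
  case True
  have m: "(\<lambda>x. ennreal \<bar>g x\<bar>) \<in> lmeas" using g by measurable
  have "esssup lebesgue (\<lambda>x. ennreal \<bar>g x\<bar>) \<le> ennreal K \<longleftrightarrow> (AE x in lebesgue. ennreal \<bar>g x\<bar> \<le> ennreal K)"
  proof
    assume "esssup lebesgue (\<lambda>x. ennreal \<bar>g x\<bar>) \<le> ennreal K"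
    then show "AE x in lebesgue. ennreal \<bar>g x\<bar> \<le> ennreal K"
      using esssup_AE[of "\<lambda>x. ennreal \<bar>g x\<bar>" lebesgue] by (auto elim!: eventually_mono)
  qed (rule esssup_I[OF m])
  then show ?thesis using True K g by (simp add: Lp_norm_def fun_bound_def ennreal_le_iff)
next
  case False
  have q: "enn2real p > 0" using enn2real_gt_1[OF p False] by simp
  show ?thesis using False ennreal_powr_le_iff[OF q K] K g by (simp add: Lp_norm_def fun_bound_def)
qed

lemma Lp_space_iff:
  assumes p: "1 < p" shows "g \<in> Lp_space p \<longleftrightarrow> (\<exists>K. fun_bound p K g)"
proof
  assume g: "g \<in> Lp_space p"
  then have "Lp_norm p g = ennreal (enn2real (Lp_norm p g))" by (simp add: Lp_space_def)
  then show "\<exists>K. fun_bound p K g"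
    using Lp_norm_le_iff[OF p, of "enn2real (Lp_norm p g)" g] g by (auto simp: Lp_space_def)
next
  assume "\<exists>K. fun_bound p K g"
  then obtain K where K: "fun_bound p K g" by blast
  then have "Lp_norm p g \<le> ennreal K" using Lp_norm_le_iff[OF p, of K g] by (simp add: fun_bound_def)
  then show "g \<in> Lp_space p" using K by (auto simp: Lp_space_def fun_bound_def intro: le_less_trans)
qed

text \<open>A convex power lies above its tangents. This is Young's inequality for \<open>t\<close>
  and \<open>s powr (q - 1)\<close> with conjugate exponents, multiplied by
  \<open>q\<close>.\<close>

lemma powr_tangent:
  fixes s t q :: real
  assumes q: "q > 1" and s: "s \<ge> 0" and t: "t \<ge> 0"
  shows "s powr q + q * s powr (q - 1) * (t - s) \<le> t powr q"
proof -
  define r where "r = q / (q - 1)"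
  have r: "r > 1" "1 / q + 1 / r = 1" "(q - 1) * r = q" using q by (auto simp: r_def field_simps)
  have "t * s powr (q - 1) \<le> t powr q / q + (s powr (q - 1)) powr r / r"
    by (rule Youngs_inequality[OF q r(1,2) t]) simp
  then have "q * (t * s powr (q - 1)) \<le> q * (t powr q / q + s powr q / r)"
    using q r(3) by (intro mult_left_mono) (auto simp: powr_powr)
  also have "... = t powr q + (q - 1) * s powr q" using q by (simp add: r_def distrib_left)
  finally have "q * s powr (q - 1) * t \<le> t powr q + (q - 1) * s powr q" by (simp add: mult_ac)
  moreover have "s powr (q - 1) * s = s powr q" using powr_add[of s "q - 1" 1] s by (cases "s = 0") simp_all
  ultimately show ?thesis by (simp add: right_diff_distrib left_diff_distrib mult.assoc)
qed

lemma powr_convex_comb: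
  fixes u v a b q :: real
  assumes q: "q > 1" and nn: "u \<ge> 0" "v \<ge> 0" "a \<ge> 0" "b \<ge> 0" and ab: "a + b = 1"
  shows "(a * u + b * v) powr q \<le> a * u powr q + b * v powr q"
proof -
  define s where "s = a * u + b * v"
  define D where "D = q * s powr (q - 1)"
  have s: "s \<ge> 0" using nn by (simp add: s_def)
  have "a * (s powr q + D * (u - s)) + b * (s powr q + D * (v - s)) \<le> a * u powr q + b * v powr q"
    unfolding D_def using nn by (intro add_mono mult_left_mono powr_tangent q s)
  moreover have "a * (s powr q + D * (u - s)) + b * (s powr q + D * (v - s)) = (a + b) * s powr q + D * ((a * u + b * v) - (a + b) * s)"
    by (simp add: algebra_simps)
  ultimately show ?thesis using ab by (simp add: s_def)
qed

lemma seq_bound_nonneg: "seq_bound p K a ==> K \<ge> 0" by (simp add: seq_bound_def)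

lemma seq_bound_mono:
  assumes "1 < p" "seq_bound p K b" "!!m. \<bar>a m\<bar> \<le> \<bar>b m\<bar>" "K \<le> K'"
  shows "seq_bound p K' a"
proof (cases "p = \<infinity>")
  case True
  have "\<bar>a m\<bar> \<le> K'" for m
  proof -
    have "\<bar>b m\<bar> \<le> K" using assms(2) True by (simp add: seq_bound_def)
    with assms(3)[of m] assms(4) show ?thesis by linarith
  qed
  then show ?thesis using assms True by (auto simp: seq_bound_def)
next
  case False
  define q where "q = enn2real p"
  have q: "q > 1" using enn2real_gt_1[OF assms(1) False] by (simp add: q_def)
  have "(\<Sum>m\<in>A. \<bar>a m\<bar> powr q) \<le> K' powr q" if "finite A" for A
  proof -
    have "(\<Sum>m\<in>A. \<bar>a m\<bar> powr q) \<le> (\<Sum>m\<in>A. \<bar>b m\<bar> powr q)"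
      using assms(3) q by (intro sum_mono powr_mono2) auto
    also have "... \<le> K powr q" using assms(2) that False by (simp add: seq_bound_def q_def)
    also have "... \<le> K' powr q" using assms(4) seq_bound_nonneg[OF assms(2)] q by (intro powr_mono2) auto
    finally show ?thesis .
  qed
  then show ?thesis using assms(4) seq_bound_nonneg[OF assms(2)] False by (simp add: seq_bound_def q_def)
qed

lemma seq_bound_zero: "seq_bound p 0 (\<lambda>m. 0)"
  by (simp add: seq_bound_def)

lemma seq_bound_cmult:
  assumes "1 < p" "seq_bound p K a" shows "seq_bound p (\<bar>c\<bar> * K) (\<lambda>m. c * a m)"
proof (cases "p = \<infinity>")
  case True
  then show ?thesis using assms by (auto simp: seq_bound_def abs_mult intro: mult_left_mono)
next
  case False
  have "(\<Sum>m\<in>A. \<bar>c * a m\<bar> powr enn2real p) \<le> (\<bar>c\<bar> * K) powr enn2real p" if "finite A" for A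
  proof -
    have "(\<Sum>m\<in>A. \<bar>c * a m\<bar> powr enn2real p) = \<bar>c\<bar> powr enn2real p * (\<Sum>m\<in>A. \<bar>a m\<bar> powr enn2real p)"
      by (simp only: abs_mult powr_mult sum_distrib_left)
    also have "... \<le> \<bar>c\<bar> powr enn2real p * K powr enn2real p"
      using assms(2) False that by (intro mult_left_mono) (auto simp: seq_bound_def)
    finally show ?thesis by (simp only: powr_mult)
  qed
  then show ?thesis using assms(2) False by (simp add: seq_bound_def)
qed

lemma seq_bound_inj:
  assumes "1 < p" "seq_bound p K a" "inj f" shows "seq_bound p K (\<lambda>m. a (f m))"
proof (cases "p = \<infinity>")
  case False
  have "(\<Sum>m\<in>A. \<bar>a (f m)\<bar> powr enn2real p) \<le> K powr enn2real p" if "finite A" for A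
  proof -
    have "(\<Sum>m\<in>A. \<bar>a (f m)\<bar> powr enn2real p) = (\<Sum>m\<in>f ` A. \<bar>a m\<bar> powr enn2real p)"
      using assms(3) by (subst sum.reindex) (auto intro: inj_on_subset)
    then show ?thesis using assms(2) False that by (simp add: seq_bound_def)
  qed
  then show ?thesis using assms(2) False by (simp add: seq_bound_def)
qed (use assms in \<open>auto simp: seq_bound_def\<close>)

lemma seq_bound_shift: "1 < p ==> seq_bound p K a ==> seq_bound p K (\<lambda>m. a (m + j))"
  by (rule seq_bound_inj) (auto simp: inj_def)

text \<open>Minkowski's inequality before summation: \<open>u / K\<close> and \<open>v / L\<close>
  are combined with weights \<open>K / (K + L)\<close> and \<open>L / (K + L)\<close>, and convexity
  of the power applies. Summing makes both quotients at most 1.\<close>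

lemma powr_add_normalized:
  fixes u v K L q :: real
  assumes q: "q > 1" and nn: "u \<ge> 0" "v \<ge> 0" and K: "K > 0" "L > 0"
  shows "(u + v) powr q \<le> (K + L) powr q * (K / (K + L) * (u powr q / K powr q) + L / (K + L) * (v powr q / L powr q))"
proof -
  have KL: "K + L > 0" using K by simp
  have "((K + L) * (K / (K + L) * (u / K) + L / (K + L) * (v / L))) = u + v"
  proof -
    have "K / (K + L) * (u / K) = u / (K + L)" "L / (K + L) * (v / L) = v / (K + L)" using K by auto
    then show ?thesis using KL by (simp flip: add_divide_distrib)
  qed
  then have "(u + v) powr q = ((K + L) * (K / (K + L) * (u / K) + L / (K + L) * (v / L))) powr q" by (simp only:)
  also have "... = (K + L) powr q * (K / (K + L) * (u / K) + L / (K + L) * (v / L)) powr q"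
    by (rule powr_mult)
  also have "... \<le> (K + L) powr q * (K / (K + L) * (u / K) powr q + L / (K + L) * (v / L) powr q)"
    using K KL nn by (intro mult_left_mono powr_convex_comb q) (auto simp flip: add_divide_distrib)
  also have "... = (K + L) powr q * (K / (K + L) * (u powr q / K powr q) + L / (K + L) * (v powr q / L powr q))"
    using K nn by (simp add: powr_divide)
  finally show ?thesis .
qed

lemma seq_bound_pos: "1 < p ==> seq_bound p K a ==> K \<le> K' ==> seq_bound p K' a"
  by (rule seq_bound_mono) auto

lemma seq_bound_add_pos:
  assumes p: "1 < p" and a: "seq_bound p K a" and b: "seq_bound p L b" and pos: "K > 0" "L > 0"
  shows "seq_bound p (K + L) (\<lambda>m. a m + b m)"
proof (cases "p = \<infinity>")
  case True
  then show ?thesis using a b by (auto simp: seq_bound_def intro: order_trans[OF abs_triangle_ineq] add_mono)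
next
  case False
  define q where "q = enn2real p"
  have q: "q > 1" using enn2real_gt_1[OF p False] by (simp add: q_def)
  have "(\<Sum>m\<in>A. \<bar>a m + b m\<bar> powr q) \<le> (K + L) powr q" if A: "finite A" for A
  proof -
    have sa: "(\<Sum>m\<in>A. \<bar>a m\<bar> powr q) \<le> K powr q" and sb: "(\<Sum>m\<in>A. \<bar>b m\<bar> powr q) \<le> L powr q"
      using a b A False by (auto simp: seq_bound_def q_def)
    have "(\<Sum>m\<in>A. \<bar>a m + b m\<bar> powr q) \<le> (\<Sum>m\<in>A. (\<bar>a m\<bar> + \<bar>b m\<bar>) powr q)"
      using q by (intro sum_mono powr_mono2) auto
    also have "... \<le> (\<Sum>m\<in>A. (K + L) powr q * (K / (K + L) * (\<bar>a m\<bar> powr q / K powr q) + L / (K + L) * (\<bar>b m\<bar> powr q / L powr q)))"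
      by (intro sum_mono powr_add_normalized q pos) auto
    also have "... = (K + L) powr q * (K / (K + L) * ((\<Sum>m\<in>A. \<bar>a m\<bar> powr q) / K powr q) + L / (K + L) * ((\<Sum>m\<in>A. \<bar>b m\<bar> powr q) / L powr q))"
      by (simp only: sum_distrib_left sum_divide_distrib sum.distrib distrib_left)
    also have "... \<le> (K + L) powr q * (K / (K + L) * 1 + L / (K + L) * 1)"
      using sa sb pos by (intro mult_left_mono add_mono) (auto simp: divide_le_eq_1)
    also have "... = (K + L) powr q" using pos by (simp flip: add_divide_distrib)
    finally show ?thesis .
  qed
  then show ?thesis using pos False by (simp add: seq_bound_def q_def)
qed

text \<open>The normalisation in the triangle inequality divides by the two bounds; adding
  \<open>e\<close> makes them positive, and this removes \<open>e\<close> again.\<close>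

lemma seq_bound_eps:
  assumes p: "1 < p" and K: "K \<ge> 0" and a: "!!e. e > 0 ==> seq_bound p (K + e) a"
  shows "seq_bound p K a"
proof (cases "p = \<infinity>")
  case True
  then show ?thesis using a K by (auto simp: seq_bound_def intro: field_le_epsilon)
next
  case False
  define q where "q = enn2real p"
  have q: "q > 1" using enn2real_gt_1[OF p False] by (simp add: q_def)
  have "(\<Sum>m\<in>A. \<bar>a m\<bar> powr q) \<le> K powr q" if A: "finite A" for A
  proof (rule tendsto_lowerbound)
    have "(\<lambda>n. K + 1 / real (Suc n)) \<longlonglongrightarrow> K + 0" by (intro tendsto_intros LIMSEQ_Suc[OF lim_1_over_n])
    then show "(\<lambda>n. (K + 1 / real (Suc n)) powr q) \<longlonglongrightarrow> K powr q"
      using q K by (intro tendsto_powr') auto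
    show "\<forall>\<^sub>F n in sequentially. (\<Sum>m\<in>A. \<bar>a m\<bar> powr q) \<le> (K + 1 / real (Suc n)) powr q"
      using a A False by (auto simp: seq_bound_def q_def)
  qed auto
  then show ?thesis using K False by (simp add: seq_bound_def q_def)
qed

lemma seq_bound_add:
  assumes p: "1 < p" and a: "seq_bound p K a" and b: "seq_bound p L b"
  shows "seq_bound p (K + L) (\<lambda>m. a m + b m)"
proof (rule seq_bound_eps[OF p])
  show "K + L \<ge> 0" using seq_bound_nonneg[OF a] seq_bound_nonneg[OF b] by simp
  fix e :: real assume e: "e > 0"
  have "seq_bound p ((K + e / 2) + (L + e / 2)) (\<lambda>m. a m + b m)"
    by (intro seq_bound_add_pos p seq_bound_pos[OF p a] seq_bound_pos[OF p b])
       (use e seq_bound_nonneg[OF a] seq_bound_nonneg[OF b] in auto)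
  then show "seq_bound p (K + L + e) (\<lambda>m. a m + b m)" by (simp add: algebra_simps)
qed

lemma seq_bound_sum:
  assumes p: "1 < p" and "!!i. i \<in> I ==> seq_bound p (K i) (a i)"
  shows "seq_bound p (\<Sum>i\<in>I. K i) (\<lambda>m. \<Sum>i\<in>I. a i m)"
  using assms(2)
proof (induction I rule: infinite_finite_induct)
  case (insert i I) then show ?case by (auto intro: seq_bound_add[OF p])
qed (auto simp: seq_bound_zero)

lemma seq_bound_limit:
  assumes p: "1 < p" and a: "!!N. seq_bound p K (a N)" and lim: "!!m. (\<lambda>N. a N m) \<longlonglongrightarrow> b m"
  shows "seq_bound p K b"
proof (cases "p = \<infinity>")
  case True
  have "\<bar>b m\<bar> \<le> K" for m
    by (rule tendsto_upperbound[OF tendsto_rabs[OF lim[of m]]]) (use a True in \<open>auto simp: seq_bound_def\<close>)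
  then show ?thesis using a[of 0] True by (simp add: seq_bound_def)
next
  case False
  define q where "q = enn2real p"
  have q: "q > 1" using enn2real_gt_1[OF p False] by (simp add: q_def)
  have "(\<Sum>m\<in>A. \<bar>b m\<bar> powr q) \<le> K powr q" if A: "finite A" for A
  proof (rule tendsto_upperbound)
    show "(\<lambda>N. \<Sum>m\<in>A. \<bar>a N m\<bar> powr q) \<longlonglongrightarrow> (\<Sum>m\<in>A. \<bar>b m\<bar> powr q)"
      using q by (intro tendsto_sum tendsto_powr' tendsto_rabs lim tendsto_const) auto
    show "\<forall>\<^sub>F N in sequentially. (\<Sum>m\<in>A. \<bar>a N m\<bar> powr q) \<le> K powr q"
      using a A False by (auto simp: seq_bound_def q_def)
  qed auto
  then show ?thesis using a[of 0] False by (simp add: seq_bound_def q_def)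
qed

text \<open>The triangle inequality for infinitely many terms. The terms \<open>V k\<close> share
  one bound, so translates of a sequence and values of a functional are covered alike.\<close>

lemma seq_bound_series:
  assumes p: "1 < p" and d: "(\<lambda>k. \<bar>d k\<bar>) summable_on UNIV" and V: "!!k. seq_bound p K (V k)"
    and lim: "!!m. (\<lambda>N. \<Sum>k\<in>{- int N..int N}. d k * V k m) \<longlonglongrightarrow> a m"
  shows "seq_bound p ((\<Sum>\<^sub>\<infinity>k. \<bar>d k\<bar>) * K) a"
proof (rule seq_bound_limit[OF p _ lim])
  fix N
  have "seq_bound p (\<Sum>k\<in>{- int N..int N}. \<bar>d k\<bar> * K) (\<lambda>m. \<Sum>k\<in>{- int N..int N}. d k * V k m)"
    by (intro seq_bound_sum p seq_bound_cmult V)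
  then show "seq_bound p ((\<Sum>\<^sub>\<infinity>k. \<bar>d k\<bar>) * K) (\<lambda>m. \<Sum>k\<in>{- int N..int N}. d k * V k m)"
  proof (rule seq_bound_pos[OF p])
    have "(\<Sum>k\<in>{- int N..int N}. \<bar>d k\<bar>) \<le> (\<Sum>\<^sub>\<infinity>k. \<bar>d k\<bar>)"
      by (intro finite_sum_le_infsum d) auto
    then show "(\<Sum>k\<in>{- int N..int N}. \<bar>d k\<bar> * K) \<le> (\<Sum>\<^sub>\<infinity>k. \<bar>d k\<bar>) * K"
      using seq_bound_nonneg[OF V] by (simp add: mult_right_mono flip: sum_distrib_right)
  qed
qed

lemma seq_bound_le:
  assumes p: "1 < p" and a: "seq_bound p K a" shows "\<bar>a m\<bar> \<le> K"
proof (cases "p = \<infinity>")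
  case False
  define q where "q = enn2real p"
  have q: "q > 1" using enn2real_gt_1[OF p False] by (simp add: q_def)
  have "(\<Sum>m\<in>{m}. \<bar>a m\<bar> powr q) \<le> K powr q" using a False unfolding seq_bound_def q_def by (metis finite.emptyI finite_insert)
  then have "\<bar>a m\<bar> powr q \<le> K powr q" by simp
  then show ?thesis using q seq_bound_nonneg[OF a] by (meson not_le powr_less_mono2 less_trans zero_less_one abs_ge_zero)
qed (use a in \<open>simp add: seq_bound_def\<close>)

lemma seq_bound_convolution:
  assumes p: "1 < p" and d: "(\<lambda>k. \<bar>d k\<bar>) summable_on UNIV" and v: "seq_bound p K v"
  shows "(\<lambda>k. d k * v (m + k)) summable_on UNIV"
    and "seq_bound p ((\<Sum>\<^sub>\<infinity>k. \<bar>d k\<bar>) * K) (\<lambda>m. \<Sum>\<^sub>\<infinity>k. d k * v (m + k))"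
proof -
  show s: "(\<lambda>k. d k * v (m + k)) summable_on UNIV" for m
  proof (rule abs_summable_summable, rule summable_on_comparison_test[OF summable_on_cmult_left[OF d, of K]])
    show "norm (d k * v (m + k)) \<le> \<bar>d k\<bar> * K" for k
      using seq_bound_le[OF p v] by (simp add: abs_mult mult_left_mono)
  qed auto
  show "seq_bound p ((\<Sum>\<^sub>\<infinity>k. \<bar>d k\<bar>) * K) (\<lambda>m. \<Sum>\<^sub>\<infinity>k. d k * v (m + k))"
    by (rule seq_bound_series[OF p d seq_bound_shift[OF p v]]) (rule summable_on_int_symmetric_limit[OF s])
qed

text \<open>One spline coefficient combines an even and an odd half-integer shift. Splitting by
  parity makes the index map injective, and twice \<open>K powr q\<close> is at most
  \<open>(2 * K) powr q\<close>.\<close>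

lemma seq_bound_div2:
  assumes p: "1 < p" and a: "seq_bound p K a" shows "seq_bound p (2 * K) (\<lambda>nu. a (nu div 2))"
proof (cases "p = \<infinity>")
  case True
  then show ?thesis using a by (auto simp: seq_bound_def intro: order_trans)
next
  case False
  define q where "q = enn2real p"
  have q: "q > 1" using enn2real_gt_1[OF p False] by (simp add: q_def)
  have "(\<Sum>nu\<in>A. \<bar>a (nu div 2)\<bar> powr q) \<le> (2 * K) powr q" if A: "finite A" for A
  proof -
    have part: "(\<Sum>nu\<in>{nu\<in>A. P nu}. \<bar>a (nu div 2)\<bar> powr q) \<le> K powr q" if inj: "inj_on (\<lambda>nu. nu div 2) {nu\<in>A. P nu}" for P
    proof -
      have "(\<Sum>nu\<in>{nu\<in>A. P nu}. \<bar>a (nu div 2)\<bar> powr q) = (\<Sum>m\<in>(\<lambda>nu. nu div 2) ` {nu\<in>A. P nu}. \<bar>a m\<bar> powr q)"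
        using inj by (subst sum.reindex) auto
      then show ?thesis using a A False by (simp add: seq_bound_def q_def)
    qed
    have "inj_on (\<lambda>nu::int. nu div 2) {nu\<in>A. even nu}" "inj_on (\<lambda>nu::int. nu div 2) {nu\<in>A. odd nu}"
      by (auto simp: inj_on_def elim!: evenE oddE)
    then have "(\<Sum>nu\<in>{nu\<in>A. even nu}. \<bar>a (nu div 2)\<bar> powr q) + (\<Sum>nu\<in>{nu\<in>A. odd nu}. \<bar>a (nu div 2)\<bar> powr q) \<le> K powr q + K powr q"
      by (intro add_mono part)
    moreover have "(\<Sum>nu\<in>A. \<bar>a (nu div 2)\<bar> powr q) = (\<Sum>nu\<in>{nu\<in>A. even nu}. \<bar>a (nu div 2)\<bar> powr q) + (\<Sum>nu\<in>{nu\<in>A. odd nu}. \<bar>a (nu div 2)\<bar> powr q)"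
      using A by (subst sum.union_disjoint[symmetric]) (auto intro!: sum.cong)
    moreover have "K powr q + K powr q \<le> (2 * K) powr q"
    proof -
      have "2 powr 1 \<le> 2 powr q" using q by (intro powr_mono) auto
      then show ?thesis using seq_bound_nonneg[OF a] by (simp add: powr_mult mult_right_mono)
    qed
    ultimately show ?thesis by linarith
  qed
  then show ?thesis using seq_bound_nonneg[OF a] False by (simp add: seq_bound_def q_def)
qed

section \<open>Bounds in \<open>L\<^sub>p\<close> and their behaviour under dilation and
  localisation\<close>

lemma fun_bound_nonneg: "fun_bound p K g ==> K \<ge> 0" by (simp add: fun_bound_def)
lemma fun_bound_measurable: "fun_bound p K g ==> g \<in> lmeas" by (simp add: fun_bound_def)

lemma fun_bound_pos:
  assumes "1 < p" "fun_bound p K g" "K \<le> K'" shows "fun_bound p K' g"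
proof -
  have "K powr enn2real p \<le> K' powr enn2real p" using assms by (intro powr_mono2) (auto simp: fun_bound_def)
  then show ?thesis using assms
    by (auto simp: fun_bound_def elim!: eventually_mono intro: order_trans[OF _ ennreal_leI])
qed

lemma fun_bound_cmult:
  assumes p: "1 < p" and g: "fun_bound p K g" shows "fun_bound p (\<bar>c\<bar> * K) (\<lambda>x. c * g x)"
proof (cases "p = \<infinity>")
  case True
  then show ?thesis using g by (auto simp: fun_bound_def abs_mult elim!: eventually_mono intro!: mult_left_mono)
next
  case False
  have m: "(\<lambda>x. ennreal (\<bar>g x\<bar> powr enn2real p)) \<in> lmeas"
    using fun_bound_measurable[OF g] by measurable
  have "(\<integral>\<^sup>+x. ennreal (\<bar>c * g x\<bar> powr enn2real p) \<partial>lebesgue) = ennreal (\<bar>c\<bar> powr enn2real p) * (\<integral>\<^sup>+x. ennreal (\<bar>g x\<bar> powr enn2real p) \<partial>lebesgue)"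
    by (subst nn_integral_cmult[OF m, symmetric]) (simp add: abs_mult powr_mult ennreal_mult)
  also have "... \<le> ennreal (\<bar>c\<bar> powr enn2real p) * ennreal (K powr enn2real p)"
    using g False by (intro mult_left_mono) (auto simp: fun_bound_def)
  also have "... = ennreal ((\<bar>c\<bar> * K) powr enn2real p)"
    using fun_bound_nonneg[OF g] by (simp add: powr_mult ennreal_mult)
  finally show ?thesis using g False by (auto simp: fun_bound_def)
qed

lemma fun_bound_cong_AE:
  assumes "fun_bound p K f" "AE x in lebesgue. f x = g x" "g \<in> lmeas"
  shows "fun_bound p K g"
proof (cases "p = \<infinity>")
  case True
  have "AE x in lebesgue. \<bar>g x\<bar> \<le> K" using assms True by (auto simp: fun_bound_def elim: eventually_elim2)
  then show ?thesis using assms True by (simp add: fun_bound_def)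
next
  case False
  have "(\<integral>\<^sup>+x. ennreal (\<bar>g x\<bar> powr enn2real p) \<partial>lebesgue) = (\<integral>\<^sup>+x. ennreal (\<bar>f x\<bar> powr enn2real p) \<partial>lebesgue)"
    using assms(2) by (intro nn_integral_cong_AE) (auto elim!: eventually_mono)
  then show ?thesis using assms False by (simp add: fun_bound_def)
qed

text \<open>The exponent reads 0 for \<open>p = \<infinity>\<close>. In that case integrating the
  indicator of the exceptional set shows that its dilate is null again.\<close>

lemma fun_bound_dilate:
  assumes p: "1 < p" and g: "fun_bound p K g" and r: "r > 0"
  shows "fun_bound p (r powr (- enn2real (1 / p)) * K) (\<lambda>x. g (r * x))"
proof -
  have gm: "(\<lambda>x. g (r * x)) \<in> lmeas"
    using lmeas_affine[OF fun_bound_measurable[OF g], of r 0] r by simp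
  show ?thesis
  proof (cases "p = \<infinity>")
    case True
    define N where "N = {x. \<not> \<bar>g x\<bar> \<le> K}"
    have Nm: "(\<lambda>x. indicator N x) \<in> lmeas"
      unfolding N_def using fun_bound_measurable[OF g] by measurable
    have "AE x in lebesgue. x \<notin> N" using g True by (auto simp: fun_bound_def N_def)
    then have "(\<integral>\<^sup>+x. indicator N x \<partial>lebesgue) = (0::ennreal)"
      by (subst nn_integral_0_iff_AE[OF Nm]) (auto simp: indicator_def elim!: eventually_mono)
    then have "ennreal \<bar>r\<bar> * (\<integral>\<^sup>+x. indicator N (r * x) \<partial>lebesgue) = (0::ennreal)"
      using nn_integral_real_affine_lebesgue[OF Nm, of r 0] r by simp
    then have "(\<integral>\<^sup>+x. indicator N (r * x) \<partial>lebesgue) = (0::ennreal)" using r by simp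
    moreover have "(\<lambda>x. indicator N (r * x) :: ennreal) \<in> lmeas"
      unfolding N_def using gm by (simp add: indicator_def of_bool_def) measurable
    ultimately have "AE x in lebesgue. indicator N (r * x) = (0::ennreal)"
      using nn_integral_0_iff_AE by blast
    then have "AE x in lebesgue. \<bar>g (r * x)\<bar> \<le> K" by (auto simp: indicator_def N_def elim!: eventually_mono)
    then show ?thesis using True gm g r by (simp add: fun_bound_def)
  next
    case False
    define q where "q = enn2real p"
    have q: "q > 1" using enn2real_gt_1[OF p False] by (simp add: q_def)
    have pq: "enn2real (1 / p) = 1 / q"
    proof (cases p)
      case (real r)
      then have r: "r = q" "r > 0" using q by (auto simp: q_def)
      have "enn2real (ennreal 1 / ennreal r) = 1 / r" using r(2) by (subst divide_ennreal) auto
      then show ?thesis using real r by simp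
    qed (use False in simp)
    have m: "(\<lambda>x. ennreal (\<bar>g x\<bar> powr q)) \<in> lmeas"
      using fun_bound_measurable[OF g] by measurable
    have "(\<integral>\<^sup>+x. ennreal (\<bar>g (r * x)\<bar> powr q) \<partial>lebesgue) = ennreal (1 / r) * (ennreal r * (\<integral>\<^sup>+x. ennreal (\<bar>g (r * x)\<bar> powr q) \<partial>lebesgue))"
      using r by (simp add: mult.assoc[symmetric] flip: ennreal_mult)
    also have "ennreal r * (\<integral>\<^sup>+x. ennreal (\<bar>g (r * x)\<bar> powr q) \<partial>lebesgue) = (\<integral>\<^sup>+x. ennreal (\<bar>g x\<bar> powr q) \<partial>lebesgue)"
      using nn_integral_real_affine_lebesgue[OF m, of r 0] r by simp
    also have "ennreal (1 / r) * ... \<le> ennreal (1 / r) * ennreal (K powr q)"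
      using g False by (intro mult_left_mono) (auto simp: fun_bound_def q_def)
    also have "... = ennreal ((r powr (- (1 / q)) * K) powr q)"
    proof -
      have "(r powr (- (1 / q)) * K) powr q = 1 / r * K powr q"
      proof -
        have "(r powr (- (1 / q))) powr q = r powr (- (1 / q) * q)" by (rule powr_powr)
        also have "... = r powr (-1)" using q by simp
        also have "... = 1 / r" using r by (simp add: powr_minus_divide)
        finally show ?thesis by (simp only: powr_mult)
      qed
      then show ?thesis using r ennreal_mult[of "1 / r" "K powr q"] by simp
    qed
    finally show ?thesis using False gm fun_bound_nonneg[OF g] by (simp add: fun_bound_def q_def pq)
  qed
qed

lemma nn_integral_le_by_truncation:
  fixes f :: "real => ennreal"
  assumes f: "f \<in> lmeas" and b: "!!N::nat. (\<integral>\<^sup>+x. f x * indicator {- real N..<real N} x \<partial>lebesgue) \<le> C"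
  shows "(\<integral>\<^sup>+x. f x \<partial>lebesgue) \<le> C"
proof -
  have "(\<integral>\<^sup>+x. f x \<partial>lebesgue) = (\<integral>\<^sup>+x. liminf (\<lambda>N. f x * indicator {- real N..<real N} x) \<partial>lebesgue)"
  proof (rule nn_integral_cong)
    fix x :: real
    have "\<forall>\<^sub>F N in sequentially. f x = f x * indicator {- real N..<real N} x"
      using eventually_gt_at_top[of "nat \<lceil>\<bar>x\<bar>\<rceil>"]
    proof eventually_elim
      case (elim N) then have "\<bar>x\<bar> < real N" by linarith
      then show ?case by (auto simp: indicator_def abs_less_iff)
    qed
    then have "(\<lambda>N. f x * indicator {- real N..<real N} x) \<longlonglongrightarrow> f x"
      by (rule Lim_transform_eventually[OF tendsto_const])
    then show "f x = liminf (\<lambda>N. f x * indicator {- real N..<real N} x)"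
      by (rule lim_imp_Liminf[OF sequentially_bot, symmetric])
  qed
  also have "... \<le> liminf (\<lambda>N. \<integral>\<^sup>+x. f x * indicator {- real N..<real N} x \<partial>lebesgue)"
    using f by (intro nn_integral_liminf borel_measurable_times_ennreal borel_measurable_indicator) auto
  also have "... \<le> C" 
    by (rule order_trans[OF Liminf_le_Limsup[OF sequentially_bot] Limsup_bounded]) (use b in auto)
  finally show ?thesis .
qed

lemma floor_unit_interval: "x \<in> {of_int m..<of_int m + 1} \<longleftrightarrow> \<lfloor>x\<rfloor> = m" for x :: real
  by (auto simp: floor_eq_iff)

lemma nn_integral_le_unit_intervals:
  fixes f :: "real => ennreal"
  assumes f: "f \<in> lmeas" 
    and s: "!!m::int. (\<integral>\<^sup>+x. f x * indicator {of_int m..<of_int m + 1} x \<partial>lebesgue) \<le> ennreal (s m)"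
    and C: "!!N. (\<Sum>m\<in>{- int N..<int N}. s m) \<le> C" and nn: "!!m. s m \<ge> 0"
  shows "(\<integral>\<^sup>+x. f x \<partial>lebesgue) \<le> ennreal C"
proof (rule nn_integral_le_by_truncation[OF f])
  fix N :: nat
  have "f x * indicator {- real N..<real N} x = (\<Sum>m\<in>{- int N..<int N}. f x * indicator {of_int m..<of_int m + 1} x)" for x
  proof -
    have "(\<Sum>m\<in>{- int N..<int N}. f x * indicator {of_int m..<of_int m + 1} x) = (\<Sum>m\<in>{- int N..<int N}. if \<lfloor>x\<rfloor> = m then f x else 0)"
      unfolding indicator_def floor_unit_interval by (intro sum.cong) auto
    also have "... = (if \<lfloor>x\<rfloor> \<in> {- int N..<int N} then f x else 0)" by (simp add: sum.delta)
    also have "\<lfloor>x\<rfloor> \<in> {- int N..<int N} \<longleftrightarrow> x \<in> {- real N..<real N}"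
      by (auto simp: le_floor_iff floor_less_iff)
    finally show ?thesis by (simp add: indicator_def)
  qed
  then have "(\<integral>\<^sup>+x. f x * indicator {- real N..<real N} x \<partial>lebesgue) = (\<integral>\<^sup>+x. (\<Sum>m\<in>{- int N..<int N}. f x * indicator {of_int m..<of_int m + 1} x) \<partial>lebesgue)"
    by simp
  also have "... = (\<Sum>m\<in>{- int N..<int N}. \<integral>\<^sup>+x. f x * indicator {of_int m..<of_int m + 1} x \<partial>lebesgue)"
    using f by (intro nn_integral_sum borel_measurable_times_ennreal borel_measurable_indicator) auto
  also have "... \<le> (\<Sum>m\<in>{- int N..<int N}. ennreal (s m))" by (intro sum_mono s)
  also have "... \<le> ennreal C" using C nn by (simp add: sum_ennreal ennreal_leI)
  finally show "(\<integral>\<^sup>+x. f x * indicator {- real N..<real N} x \<partial>lebesgue) \<le> ennreal C" .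
qed

lemma fun_bound_from_seq:
  assumes p: "1 < p" and s: "seq_bound p K s" and g: "g \<in> lmeas"
    and b: "!!m x. x \<in> {of_int m..<of_int m + 1} ==> \<bar>g x\<bar> \<le> \<bar>s m\<bar>"
  shows "fun_bound p K g"
proof (cases "p = \<infinity>")
  case True
  have "\<bar>g x\<bar> \<le> K" for x
    using b[of x "\<lfloor>x\<rfloor>"] seq_bound_le[OF p s, of "\<lfloor>x\<rfloor>"] floor_unit_interval[of x "\<lfloor>x\<rfloor>"] by (meson order_trans)
  then show ?thesis using True g seq_bound_nonneg[OF s] by (simp add: fun_bound_def)
next
  case False
  define q where "q = enn2real p"
  have q: "q > 1" using enn2real_gt_1[OF p False] by (simp add: q_def)
  have "(\<integral>\<^sup>+x. ennreal (\<bar>g x\<bar> powr q) \<partial>lebesgue) \<le> ennreal (K powr q)"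
  proof (rule nn_integral_le_unit_intervals[where s = "\<lambda>m. \<bar>s m\<bar> powr q"])
    show "(\<lambda>x. ennreal (\<bar>g x\<bar> powr q)) \<in> lmeas" using g by measurable
    fix m :: int
    have "(\<integral>\<^sup>+x. ennreal (\<bar>g x\<bar> powr q) * indicator {of_int m..<of_int m + 1} x \<partial>lebesgue) \<le>
       (\<integral>\<^sup>+x. ennreal (\<bar>s m\<bar> powr q) * indicator {real_of_int m..<real_of_int m + 1} x \<partial>lebesgue)"
      using b[of _ m] q by (intro nn_integral_mono) (auto simp: indicator_def intro!: ennreal_leI powr_mono2)
    also have "... = ennreal (\<bar>s m\<bar> powr q)" by (subst nn_integral_cmult_indicator) auto
    finally show "(\<integral>\<^sup>+x. ennreal (\<bar>g x\<bar> powr q) * indicator {of_int m..<of_int m + 1} x \<partial>lebesgue) \<le> ennreal (\<bar>s m\<bar> powr q)" .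
  next
    show "(\<Sum>m\<in>{- int N..<int N}. \<bar>s m\<bar> powr q) \<le> K powr q" for N
      using s False by (simp add: seq_bound_def q_def)
  qed auto
  then show ?thesis using False g seq_bound_nonneg[OF s] by (simp add: fun_bound_def q_def)
qed

lemma fun_bound_locally_integrable:
  assumes p: "1 < p" and g: "fun_bound p K g" shows "loc_int g"
  unfolding locally_integrable_def set_integrable_def
proof (intro allI)
  fix a b :: real
  have gm: "g \<in> lmeas" by (rule fun_bound_measurable[OF g])
  have im: "(\<lambda>x. indicator {a..b} x *\<^sub>R g x) \<in> lmeas"
    by (intro borel_measurable_scaleR gm lmeas_indicator) auto
  have e: "emeasure lebesgue {a..b} < \<infinity>" by (auto simp: emeasure_lborel_Icc_eq)
  show "lint (\<lambda>x. indicator {a..b} x *\<^sub>R g x)"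
  proof (cases "p = \<infinity>")
    case True
    have "lint (\<lambda>x. K * indicator {a..b} x)"
      by (intro integrable_mult_right integrable_real_indicator e) auto
    then show ?thesis
      by (rule lint_bound[OF _ im])
         (use g True in \<open>auto simp: fun_bound_def indicator_def elim!: eventually_mono\<close>)
  next
    case False
    define q where "q = enn2real p"
    have q: "q > 1" using enn2real_gt_1[OF p False] by (simp add: q_def)
    have "lint (\<lambda>x. \<bar>g x\<bar> powr q)"
    proof (rule integrableI_bounded)
      show "(\<lambda>x. \<bar>g x\<bar> powr q) \<in> lmeas" using gm by measurable
      show "(\<integral>\<^sup>+x. ennreal (norm (\<bar>g x\<bar> powr q)) \<partial>lebesgue) < \<infinity>"
        using g False by (auto simp: fun_bound_def q_def intro: le_less_trans)
    qed
    then have "lint (\<lambda>x. indicator {a..b} x + \<bar>g x\<bar> powr q)"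
      by (intro lint_add integrable_real_indicator e) auto
    then show ?thesis
    proof (rule lint_bound[OF _ im])
      show "AE x in lebesgue. norm (indicator {a..b} x *\<^sub>R g x) \<le> norm (indicator {a..b} x + \<bar>g x\<bar> powr q)"
      proof (rule AE_I2)
        fix x
        have "\<bar>g x\<bar> \<le> 1 + \<bar>g x\<bar> powr q"
          using powr_mono[of 1 q "\<bar>g x\<bar>"] q by (cases "\<bar>g x\<bar> \<le> 1") (auto intro: order_trans)
        then show "norm (indicator {a..b} x *\<^sub>R g x) \<le> norm (indicator {a..b} x + \<bar>g x\<bar> powr q)"
          by (auto simp: indicator_def)
      qed
    qed
  qed
qed

section \<open>Masses on unit intervals\<close>

definition local_mass :: "(real => real) => int => real" where
  "local_mass g m = integral {of_int m..of_int m + 1} (\<lambda>t. \<bar>g t\<bar>)"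

lemma local_mass_nonneg: "local_mass g m \<ge> 0"
  unfolding local_mass_def
  by (cases "(\<lambda>t. \<bar>g t\<bar>) integrable_on {of_int m..of_int m + 1}")
     (auto intro: HK_integral_nonneg simp: not_integrable_integral)

lemma local_mass_LINT:
  assumes "loc_int g"
  shows "local_mass g m = (LI x. indicator {of_int m..of_int m + 1} x * \<bar>g x\<bar>)"
    and "lint (\<lambda>x. indicator {of_int m..of_int m + 1} x * \<bar>g x\<bar>)"
  using loc_int_abs[OF assms] set_lebesgue_integral_eq_integral(2)[of "{of_int m..of_int m + 1}" "\<lambda>t. \<bar>g t\<bar>"]
  by (auto simp: local_mass_def locally_integrable_def set_integrable_def set_lebesgue_integral_def)

text \<open>On each unit interval Jensen's inequality follows from the tangent line of the power at the mean.\<close>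

lemma seq_bound_local_mass:
  assumes p: "1 < p" and g: "fun_bound p K g" shows "seq_bound p K (local_mass g)"
proof -
  have li: "loc_int g" by (rule fun_bound_locally_integrable[OF p g])
  note gm = fun_bound_measurable[OF g]
  let ?I = "\<lambda>m::int. {of_int m..of_int m + 1::real}"
  have i1: "(LI x. indicator (?I m) x) = (1::real)" "lint (indicator (?I m) :: real => real)" for m
    by auto
  show ?thesis
  proof (cases "p = \<infinity>")
    case True
    have "local_mass g m \<le> K" for m
    proof -
      have "local_mass g m \<le> (LI x. indicator (?I m) x * K)"
        unfolding local_mass_LINT(1)[OF li]
        by (rule integral_mono_AE[OF local_mass_LINT(2)[OF li] integrable_mult_left[OF i1(2)]])
           (use g True in \<open>auto simp: fun_bound_def indicator_def elim!: eventually_mono\<close>)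
      also have "... = K" using i1(1)[of m] by simp
      finally show ?thesis .
    qed
    then show ?thesis using True fun_bound_nonneg[OF g] local_mass_nonneg[of g] by (simp add: seq_bound_def)
  next
    case False
    define q where "q = enn2real p"
    have q: "q > 1" using enn2real_gt_1[OF p False] by (simp add: q_def)
    define G where "G x = \<bar>g x\<bar> powr q" for x
    have Gm: "G \<in> lmeas" unfolding G_def using gm by measurable
    have Gn: "(\<integral>\<^sup>+x. ennreal (G x) \<partial>lebesgue) \<le> ennreal (K powr q)"
      using g False by (simp add: fun_bound_def q_def G_def)
    have Gi: "lint G"
      by (rule integrableI_bounded[OF Gm]) (use Gn in \<open>auto simp: G_def intro: le_less_trans\<close>)
    have jensen: "local_mass g m powr q \<le> (LI x. indicator (?I m) x * G x)" for m
    proof -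
      define A where "A = local_mass g m"
      \<comment> \<open>The slope of the tangent at the mean \<open>A\<close>. Since the interval
        has length 1, the linear term integrates to zero.\<close>
      define D where "D = q * A powr (q - 1)"
      have A: "A \<ge> 0" by (simp add: A_def local_mass_nonneg)
      have iG: "lint (\<lambda>x. indicator (?I m) x * G x)"
        using integrable_mult_indicator[OF _ Gi, of "?I m"] by simp
      have "A powr q = (LI x. indicator (?I m) x * (A powr q - D * A) + D * (indicator (?I m) x * \<bar>g x\<bar>))"
        using local_mass_LINT[OF li, of m] i1[of m]
        by (subst LI_add) (auto simp: A_def[symmetric])
      also have "... \<le> (LI x. indicator (?I m) x * G x)"
      proof (rule integral_mono_AE[OF _ iG])
        show "lint (\<lambda>x. indicator (?I m) x * (A powr q - D * A) + D * (indicator (?I m) x * \<bar>g x\<bar>))"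
          using local_mass_LINT[OF li, of m] i1[of m] by (intro lint_add integrable_mult_left integrable_mult_right)
        show "AE x in lebesgue. indicator (?I m) x * (A powr q - D * A) + D * (indicator (?I m) x * \<bar>g x\<bar>) \<le> indicator (?I m) x * G x"
        proof (rule AE_I2)
          fix x
          have "A powr q + D * (\<bar>g x\<bar> - A) \<le> G x" unfolding D_def G_def by (intro powr_tangent q A) auto
          then show "indicator (?I m) x * (A powr q - D * A) + D * (indicator (?I m) x * \<bar>g x\<bar>) \<le> indicator (?I m) x * G x"
            by (auto simp: indicator_def algebra_simps)
        qed
      qed
      finally show ?thesis by (simp add: A_def)
    qed
    have "(\<Sum>m\<in>S. \<bar>local_mass g m\<bar> powr q) \<le> K powr q" if S: "finite S" for S
    proof -
      let ?J = "\<lambda>m::int. {of_int m..<of_int m + 1::real}"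
      have iJ: "lint (\<lambda>x. indicator (?J m) x * G x)" for m
        using integrable_mult_indicator[OF _ Gi, of "?J m"] by simp
      \<comment> \<open>Half-open intervals are disjoint, so the local integrals add up; closing
        them changes only a null set.\<close>
      have IJ: "(LI x. indicator (?I m) x * G x) = (LI x. indicator (?J m) x * G x)" for m
        using AE_lebesgue_neq[of "of_int m + 1"] Gm
        by (intro integral_cong_AE borel_measurable_times lmeas_indicator)
           (auto simp: indicator_def elim!: eventually_mono)
      have "(\<Sum>m\<in>S. \<bar>local_mass g m\<bar> powr q) \<le> (\<Sum>m\<in>S. LI x. indicator (?J m) x * G x)"
        using jensen local_mass_nonneg[of g] by (intro sum_mono) (simp add: IJ)
      also have "... = (LI x. (\<Sum>m\<in>S. indicator (?J m) x * G x))"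
        by (rule LI_sum[symmetric]) (rule iJ)
      also have "... \<le> (LI x. G x)"
      proof (rule integral_mono_AE[OF _ Gi])
        show "lint (\<lambda>x. \<Sum>m\<in>S. indicator (?J m) x * G x)" by (intro lint_sum iJ)
        show "AE x in lebesgue. (\<Sum>m\<in>S. indicator (?J m) x * G x) \<le> G x"
        proof (rule AE_I2)
          fix x
          have "(\<Sum>m\<in>S. indicator (?J m) x * G x) = (\<Sum>m\<in>S. if \<lfloor>x\<rfloor> = m then G x else 0)"
            unfolding indicator_def floor_unit_interval by (intro sum.cong) auto
          also have "... \<le> G x" using S by (auto simp: sum.delta G_def)
          finally show "(\<Sum>m\<in>S. indicator (?J m) x * G x) \<le> G x" .
        qed
      qed
      also have "... \<le> K powr q"
      proof -
        have "(\<integral>\<^sup>+x. ennreal (G x) \<partial>lebesgue) = ennreal (LI x. G x)"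
          by (rule nn_integral_eq_integral[OF Gi]) (simp add: G_def)
        then show ?thesis using Gn by (simp add: ennreal_le_iff)
      qed
      finally show ?thesis .
    qed
    then show ?thesis using False fun_bound_nonneg[OF g] by (simp add: seq_bound_def q_def)
  qed
qed

text \<open>Within a unit interval \<open>jb\<close> is comparable with its value at the integer up
  to a factor 2, hence its square up to 4.\<close>

lemma nn_integral_weighted_le:
  fixes m :: int
  assumes li: "loc_int g" 
    and s: "(\<lambda>k. 1 / jb (real_of_int k) ^ 2 * local_mass g (m + k)) summable_on UNIV"
  shows "(\<integral>\<^sup>+x. ennreal (\<bar>g x\<bar> / jb (x - of_int m) ^ 2) \<partial>lebesgue)
     \<le> ennreal (4 * (\<Sum>\<^sub>\<infinity>k. 1 / jb (real_of_int k) ^ 2 * local_mass g (m + k)))"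
proof -
  note gm = loc_int_measurable[OF li]
  define w where "w k = 1 / jb (real_of_int k) ^ 2 * local_mass g (m + k)" for k
  have w0: "w k \<ge> 0" for k by (simp add: w_def local_mass_nonneg)
  have "(\<integral>\<^sup>+x. ennreal (\<bar>g x\<bar> / jb (x - of_int m) ^ 2) \<partial>lebesgue) \<le> ennreal (4 * (\<Sum>\<^sub>\<infinity>k. w k))"
  proof (rule nn_integral_le_unit_intervals[where s = "\<lambda>i. 4 * w (i - m)"])
    show "(\<lambda>x. ennreal (\<bar>g x\<bar> / jb (x - of_int m) ^ 2)) \<in> lmeas"
    proof -
      have "(\<lambda>x::real. 1 / jb (x - of_int m) ^ 2) \<in> lmeas"
        by (intro lmeas_continuous continuous_intros) (auto simp: add_nonneg_eq_0_iff)
      then have "(\<lambda>x. \<bar>g x\<bar> * (1 / jb (x - of_int m) ^ 2)) \<in> lmeas"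
        by (intro borel_measurable_times borel_measurable_abs gm)
      then show ?thesis by simp
    qed
    fix i :: int
    define k where "k = i - m"
    have "(\<integral>\<^sup>+x. ennreal (\<bar>g x\<bar> / jb (x - of_int m) ^ 2) * indicator {of_int i..<of_int i + 1} x \<partial>lebesgue)
      \<le> (\<integral>\<^sup>+x. ennreal (4 / jb (real_of_int k) ^ 2 * (indicator {of_int i..of_int i + 1} x * \<bar>g x\<bar>)) \<partial>lebesgue)"
    proof (rule nn_integral_mono)
      fix x :: real
      show "ennreal (\<bar>g x\<bar> / jb (x - of_int m) ^ 2) * indicator {of_int i..<of_int i + 1} x
         \<le> ennreal (4 / jb (real_of_int k) ^ 2 * (indicator {of_int i..of_int i + 1} x * \<bar>g x\<bar>))"
      proof (cases "x \<in> {of_int i..<of_int i + 1}")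
        case True
        have "jb (real_of_int k) \<le> 2 * jb (x - of_int m)"
          using True by (auto simp: k_def abs_if split: if_splits)
        then have "jb (real_of_int k) ^ 2 \<le> (2 * jb (x - of_int m)) ^ 2" by (intro power_mono) auto
        then have le: "jb (real_of_int k) ^ 2 \<le> 4 * jb (x - of_int m) ^ 2"
          unfolding power_mult_distrib by simp
        have pos: "jb (real_of_int k) ^ 2 > 0" "jb (x - of_int m) ^ 2 > 0" by (intro zero_less_power; linarith)+
        have "1 / jb (x - of_int m) ^ 2 \<le> 4 / jb (real_of_int k) ^ 2"
          using le pos by (simp add: divide_le_eq pos_le_divide_eq mult.commute)
        then have "\<bar>g x\<bar> * (1 / jb (x - of_int m) ^ 2) \<le> \<bar>g x\<bar> * (4 / jb (real_of_int k) ^ 2)"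
          by (intro mult_left_mono) auto
        then show ?thesis using True by (auto simp: indicator_def mult.commute intro!: ennreal_leI)
      qed auto
    qed
    also have "... = ennreal (LI x. 4 / jb (real_of_int k) ^ 2 * (indicator {of_int i..of_int i + 1} x * \<bar>g x\<bar>))"
      by (intro nn_integral_eq_integral integrable_mult_right local_mass_LINT(2)[OF li]) auto
    also have "(LI x. 4 / jb (real_of_int k) ^ 2 * (indicator {of_int i..of_int i + 1} x * \<bar>g x\<bar>)) = 4 * w (i - m)"
      unfolding integral_mult_right_zero local_mass_LINT(1)[OF li, symmetric] by (simp add: w_def k_def)
    finally show "(\<integral>\<^sup>+x. ennreal (\<bar>g x\<bar> / jb (x - of_int m) ^ 2) * indicator {of_int i..<of_int i + 1} x \<partial>lebesgue) \<le> ennreal (4 * w (i - m))" .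
  next
    fix N :: nat
    have "(\<Sum>i\<in>{- int N..<int N}. 4 * w (i - m)) = 4 * (\<Sum>k\<in>(\<lambda>i. i - m) ` {- int N..<int N}. w k)"
      by (subst sum.reindex) (auto simp: sum_distrib_left inj_on_def)
    also have "... \<le> 4 * (\<Sum>\<^sub>\<infinity>k. w k)"
      using s w0 by (intro mult_left_mono finite_sum_le_infsum) (auto simp: w_def)
    finally show "(\<Sum>i\<in>{- int N..<int N}. 4 * w (i - m)) \<le> 4 * (\<Sum>\<^sub>\<infinity>k. w k)" .
  qed (simp add: w0)
  then show ?thesis by (simp add: w_def)
qed

section \<open>Coefficients of Sobolev functions\<close>

lemma one_plus_abs_pos: "jb (x::real) ^ k > 0"
  by (intro zero_less_power) linarith

lemma borel_measurable_weight: "(\<lambda>x::real. 1 / jb (x - a) ^ 2) \<in> lmeas"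
  by (intro lmeas_continuous continuous_intros) (auto simp: add_nonneg_eq_0_iff)

text \<open>Up to a constant this dominates the integral of \<open>\<bar>g\<bar>\<close> against the
  quadratic weight centred near \<open>m\<close>. Being a convolution with a summable sequence, it
  obeys the bound of the local masses times \<open>weight_const\<close>.\<close>

definition mass_average :: "(real => real) => int => real" where
  "mass_average g m = (\<Sum>\<^sub>\<infinity>k. 1 / jb (real_of_int k) ^ 2 * local_mass g (m + k))"

definition weight_const :: real where
  "weight_const = (\<Sum>\<^sub>\<infinity>k. \<bar>1 / jb (real_of_int k) ^ 2\<bar>)"

lemma weight_const_nonneg: "weight_const \<ge> 0"
  unfolding weight_const_def by (rule infsum_nonneg) simp

lemma seq_bound_mass_average:
  assumes p: "1 < p" and g: "fun_bound p K g"
  shows "seq_bound p (weight_const * K) (mass_average g)"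
    and "(\<lambda>k. 1 / jb (real_of_int k) ^ 2 * local_mass g (m + k)) summable_on UNIV"
proof -
  have d: "(\<lambda>k. \<bar>1 / jb (real_of_int k) ^ 2\<bar>) summable_on UNIV" using summable_on_int_weight by simp
  note c = seq_bound_convolution[OF p d seq_bound_local_mass[OF p g]]
  show "seq_bound p (weight_const * K) (mass_average g)"
    using c(2) by (simp only: weight_const_def mass_average_def[abs_def])
  show "(\<lambda>k. 1 / jb (real_of_int k) ^ 2 * local_mass g (m + k)) summable_on UNIV" by (rule c(1))
qed

lemma mass_average_nonneg: "mass_average g m \<ge> 0"
  unfolding mass_average_def by (intro infsum_nonneg mult_nonneg_nonneg local_mass_nonneg) simp

text \<open>The centre may be off the integer \<open>m\<close> by up to 1, because the wavelets sit
  at half integers. Recentring the weight costs a factor 4, and so does the passage to unit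
  intervals.\<close>

lemma weighted_integral:
  fixes a :: real
  assumes p: "1 < p" and g: "fun_bound p K g" and a: "\<bar>a - of_int m\<bar> \<le> 1"
  shows "lint (\<lambda>x. \<bar>g x\<bar> / jb (x - a) ^ 2)"
    and "(LI x. \<bar>g x\<bar> / jb (x - a) ^ 2) \<le> 16 * mass_average g m"
proof -
  have gm: "g \<in> lmeas" by (rule fun_bound_measurable[OF g])
  have m: "(\<lambda>x. \<bar>g x\<bar> / jb (x - a) ^ 2) \<in> lmeas" for a
    using borel_measurable_times[OF borel_measurable_abs[OF gm] borel_measurable_weight[of a]] by simp
  have nn: "(\<integral>\<^sup>+x. ennreal (\<bar>g x\<bar> / jb (x - of_int m) ^ 2) \<partial>lebesgue) \<le> ennreal (4 * mass_average g m)"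
    using nn_integral_weighted_le[OF fun_bound_locally_integrable[OF p g] seq_bound_mass_average(2)[OF p g]]
    by (simp add: mass_average_def)
  have im: "lint (\<lambda>x. \<bar>g x\<bar> / jb (x - of_int m) ^ 2)"
    by (rule integrableI_bounded[OF m]) (use nn in \<open>auto intro: le_less_trans\<close>)
  have le: "\<bar>g x\<bar> / jb (x - a) ^ 2 \<le> 4 * (\<bar>g x\<bar> / jb (x - of_int m) ^ 2)" for x :: real
  proof -
    have t: "u \<le> v + w ==> w \<le> 1 ==> 0 \<le> v ==> 1 + u \<le> 2 * (1 + v)" for u v w :: real by simp
    have "1 + \<bar>x - of_int m\<bar> \<le> 2 * jb (x - a)" by (rule t[OF _ a]) (simp_all add: abs_triangle_ineq4 abs_diff_triangle_ineq)
    then have "jb (x - of_int m) ^ 2 \<le> (2 * jb (x - a)) ^ 2" by (intro power_mono) auto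
    then have "jb (x - of_int m) ^ 2 \<le> 4 * jb (x - a) ^ 2" unfolding power_mult_distrib by simp
    then have "1 / jb (x - a) ^ 2 \<le> 4 / jb (x - of_int m) ^ 2"
      using one_plus_abs_pos[of "x - a" 2] one_plus_abs_pos[of "x - of_int m" 2] by (simp add: divide_le_eq pos_le_divide_eq mult.commute)
    then have "\<bar>g x\<bar> * (1 / jb (x - a) ^ 2) \<le> \<bar>g x\<bar> * (4 / jb (x - of_int m) ^ 2)" by (intro mult_left_mono) auto
    then show ?thesis by (simp add: mult.commute)
  qed
  show i: "lint (\<lambda>x. \<bar>g x\<bar> / jb (x - a) ^ 2)"
  proof (rule lint_bound[OF integrable_mult_right[OF im, of 4] m])
    show "AE x in lebesgue. norm (\<bar>g x\<bar> / jb (x - a) ^ 2) \<le> norm (4 * (\<bar>g x\<bar> / jb (x - of_int m) ^ 2))"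
      using le by (intro AE_I2) simp
  qed
  have "(LI x. \<bar>g x\<bar> / jb (x - a) ^ 2) \<le> (LI x. 4 * (\<bar>g x\<bar> / jb (x - of_int m) ^ 2))"
    by (rule integral_mono_AE[OF i integrable_mult_right[OF im]]) (rule AE_I2, rule le)
  also have "... = 4 * (LI x. \<bar>g x\<bar> / jb (x - of_int m) ^ 2)" by (rule integral_mult_right_zero)
  also have "... \<le> 4 * (4 * mass_average g m)"
  proof -
    have "(\<integral>\<^sup>+x. ennreal (\<bar>g x\<bar> / jb (x - of_int m) ^ 2) \<partial>lebesgue) = ennreal (LI x. \<bar>g x\<bar> / jb (x - of_int m) ^ 2)"
      by (rule nn_integral_eq_integral[OF im]) simp
    then show ?thesis using nn mass_average_nonneg[of g m] by (simp add: ennreal_le_iff)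
  qed
  finally show "(LI x. \<bar>g x\<bar> / jb (x - a) ^ 2) \<le> 16 * mass_average g m" by simp
qed

lemma integrable_mult_rapid:
  assumes p: "1 < p" and g: "fun_bound p K g" and f: "f \<in> lmeas"
    and C: "!!x. \<bar>f x\<bar> * jb (x - a) ^ 2 \<le> C"
  shows "lint (\<lambda>x. g x * f x)"
    and "\<bar>LI x. g x * f x\<bar> \<le> C * (LI x. \<bar>g x\<bar> / jb (x - a) ^ 2)"
proof -
  have w: "lint (\<lambda>x. \<bar>g x\<bar> / jb (x - a) ^ 2)"
    by (rule weighted_integral(1)[OF p g, of a "\<lfloor>a\<rfloor>"]) (simp add: abs_le_iff; linarith)
  have le: "\<bar>g x * f x\<bar> \<le> C * (\<bar>g x\<bar> / jb (x - a) ^ 2)" for x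
  proof -
    have "\<bar>f x\<bar> \<le> C / jb (x - a) ^ 2" using C[of x] one_plus_abs_pos[of "x - a" 2] by (simp add: pos_le_divide_eq)
    then have "\<bar>g x\<bar> * \<bar>f x\<bar> \<le> \<bar>g x\<bar> * (C / jb (x - a) ^ 2)" by (intro mult_left_mono) auto
    then show ?thesis by (simp add: abs_mult mult.commute)
  qed
  show i: "lint (\<lambda>x. g x * f x)"
  proof (rule lint_bound[OF integrable_mult_right[OF w, of C]])
    show "(\<lambda>x. g x * f x) \<in> lmeas" by (intro borel_measurable_times fun_bound_measurable[OF g] f)
    show "AE x in lebesgue. norm (g x * f x) \<le> norm (C * (\<bar>g x\<bar> / jb (x - a) ^ 2))"
      using order_trans[OF le abs_ge_self] by (intro AE_I2) (simp only: real_norm_def)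
  qed
  have "\<bar>LI x. g x * f x\<bar> \<le> (LI x. \<bar>g x * f x\<bar>)" by (rule integral_abs_bound)
  also have "... \<le> (LI x. C * (\<bar>g x\<bar> / jb (x - a) ^ 2))"
    by (rule integral_mono_AE[OF integrable_abs[OF i] integrable_mult_right[OF w]]) (rule AE_I2, rule le)
  also have "... = C * (LI x. \<bar>g x\<bar> / jb (x - a) ^ 2)" by (rule integral_mult_right_zero)
  finally show "\<bar>LI x. g x * f x\<bar> \<le> C * (LI x. \<bar>g x\<bar> / jb (x - a) ^ 2)" .
qed

text \<open>Convergence in the test space is uniform after multiplication by the square of the
  weight, and \<open>g\<close> divided by that square is integrable.\<close>

lemma regular_functional_S_dual:
  assumes p: "1 < p" and g: "fun_bound p K g"
  shows "regular_functional r g \<in> S_dual r"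
proof -
  define W where "W = (LI x. \<bar>g x\<bar> / jb (x - 0) ^ 2)"
  have W: "W \<ge> 0" unfolding W_def by (intro integral_nonneg_AE AE_I2) auto
  have i: "lint (\<lambda>x. g x * phi x)" if phi: "phi \<in> S_space r" for phi
  proof -
    obtain C where "!!x. \<bar>phi x\<bar> * jb x ^ 2 \<le> C" using rapidD[OF S_space_rapid0[OF phi]] by metis
    then show ?thesis
      using integrable_mult_rapid(1)[OF p g lmeas_continuous[OF S_space_continuous[OF phi]], of 0 C] by simp
  qed
  have "(\<lambda>m. regular_functional r g (Phi m)) \<longlonglongrightarrow> regular_functional r g phi"
    if Phi: "!!m. Phi m \<in> S_space r" and phi: "phi \<in> S_space r" and lim: "S_tendsto r Phi phi" for Phi phi
  proof (rule LIMSEQ_I)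
    fix e :: real assume e: "e > 0"
    have "e / (W + 1) > 0" using e W by simp
    moreover have "uniform_limit UNIV (\<lambda>m x. jb x ^ 2 * Phi m x) (\<lambda>x. jb x ^ 2 * phi x) sequentially"
      using S_tendstoD[OF lim, of 0 2] by simp
    ultimately have "\<forall>\<^sub>F m in sequentially. \<forall>x\<in>UNIV. dist (jb x ^ 2 * Phi m x) (jb x ^ 2 * phi x) < e / (W + 1)"
      unfolding uniform_limit_iff by blast
    then obtain M where M: "!!m x. m \<ge> M ==> dist (jb x ^ 2 * Phi m x) (jb x ^ 2 * phi x) < e / (W + 1)"
      unfolding eventually_sequentially by blast
    have "norm (regular_functional r g (Phi m) - regular_functional r g phi) < e" if m: "m \<ge> M" for m
    proof -
      have d: "(\<lambda>x. Phi m x - phi x) \<in> lmeas"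
        by (intro lmeas_continuous continuous_on_diff S_space_continuous[OF Phi] S_space_continuous[OF phi])
      have b: "\<bar>Phi m x - phi x\<bar> * jb (x - 0) ^ 2 \<le> e / (W + 1)" for x
      proof -
        have "dist (jb x ^ 2 * Phi m x) (jb x ^ 2 * phi x) = jb x ^ 2 * \<bar>Phi m x - phi x\<bar>"
          by (simp add: dist_real_def abs_mult flip: right_diff_distrib)
        then show ?thesis using M[OF m, of x] by (simp add: mult.commute)
      qed
      have "regular_functional r g (Phi m) - regular_functional r g phi = (LI x. g x * (Phi m x - phi x))"
        using i[OF Phi] i[OF phi] Phi phi by (simp add: regular_functional_def right_diff_distrib)
      then have "norm (regular_functional r g (Phi m) - regular_functional r g phi) \<le> e / (W + 1) * W"
        using integrable_mult_rapid(2)[OF p g d b] by (simp add: W_def)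
      also have "... < e" using e W by (simp add: pos_divide_less_eq)
      finally show ?thesis .
    qed
    then show "\<exists>M. \<forall>m\<ge>M. norm (regular_functional r g (Phi m) - regular_functional r g phi) < e" by blast
  qed
  then have "\<forall>Phi phi. (\<forall>m. Phi m \<in> S_space r) \<and> phi \<in> S_space r \<and> S_tendsto r Phi phi -->
        (\<lambda>m. regular_functional r g (Phi m)) \<longlonglongrightarrow> regular_functional r g phi" by blast
  moreover have "regular_functional r g (\<lambda>x. phi x + eta x) = regular_functional r g phi + regular_functional r g eta"
    if "phi \<in> S_space r" "eta \<in> S_space r" for phi eta
    using that i[OF that(1)] i[OF that(2)] S_space_add[OF that] by (simp add: regular_functional_def distrib_left)
  moreover have "regular_functional r g (\<lambda>x. c * phi x) = c * regular_functional r g phi" if "phi \<in> S_space r" for c phi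
  proof -
    have "(LI x. g x * (c * phi x)) = (LI x. c * (g x * phi x))" by (simp add: mult.left_commute)
    then show ?thesis using that S_space_cmult[OF that, of c] by (simp add: regular_functional_def)
  qed
  ultimately show ?thesis unfolding S_dual_def by (simp add: regular_functional_def)
qed

text \<open>Between \<open>a\<close> and \<open>x\<close> the weight is smallest at
  \<open>x\<close>, so the weighted integral controls the primitive at the price of quadratic
  growth.\<close>

lemma prim_weight_bound:
  assumes li: "loc_int F" and w: "lint (\<lambda>x. \<bar>F x\<bar> / jb (x - a) ^ 2)"
  shows "\<bar>prim (\<lambda>t. \<bar>F t\<bar>) a x\<bar> \<le> jb (x - a) ^ 2 * (LI x. \<bar>F x\<bar> / jb (x - a) ^ 2)"
proof -
  have key: "integral {c..d} (\<lambda>t. \<bar>F t\<bar>) \<le> jb (x - a) ^ 2 * (LI x. \<bar>F x\<bar> / jb (x - a) ^ 2)"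
    if cd: "!!t. t \<in> {c..d} ==> \<bar>t - a\<bar> \<le> \<bar>x - a\<bar>" for c d
  proof -
    have si: "set_integrable lebesgue {c..d} (\<lambda>t. \<bar>F t\<bar>)" using loc_int_abs[OF li] by (simp add: locally_integrable_def)
    have "integral {c..d} (\<lambda>t. \<bar>F t\<bar>) = (LI t. indicator {c..d} t * \<bar>F t\<bar>)"
      using set_lebesgue_integral_eq_integral(2)[OF si] by (simp add: set_lebesgue_integral_def)
    also have "... \<le> (LI t. jb (x - a) ^ 2 * (\<bar>F t\<bar> / jb (t - a) ^ 2))"
    proof (rule integral_mono_AE)
      show "lint (\<lambda>t. indicator {c..d} t * \<bar>F t\<bar>)" using si by (simp add: set_integrable_def)
      show "lint (\<lambda>t. jb (x - a) ^ 2 * (\<bar>F t\<bar> / jb (t - a) ^ 2))" by (rule integrable_mult_right[OF w])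
      show "AE t in lebesgue. indicator {c..d} t * \<bar>F t\<bar> \<le> jb (x - a) ^ 2 * (\<bar>F t\<bar> / jb (t - a) ^ 2)"
      proof (rule AE_I2)
        fix t show "indicator {c..d} t * \<bar>F t\<bar> \<le> jb (x - a) ^ 2 * (\<bar>F t\<bar> / jb (t - a) ^ 2)"
        proof (cases "t \<in> {c..d}")
          case True
          have "jb (t - a) ^ 2 \<le> jb (x - a) ^ 2" using cd[OF True] by (intro power_mono) auto
          then have "1 \<le> jb (x - a) ^ 2 / jb (t - a) ^ 2"
            using one_plus_abs_pos[of "t - a" 2] by (simp add: pos_le_divide_eq)
          then have "1 * \<bar>F t\<bar> \<le> jb (x - a) ^ 2 / jb (t - a) ^ 2 * \<bar>F t\<bar>" by (intro mult_right_mono) auto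
          then show ?thesis using True by simp
        qed simp
      qed
    qed
    also have "... = jb (x - a) ^ 2 * (LI x. \<bar>F x\<bar> / jb (x - a) ^ 2)" by (rule integral_mult_right_zero)
    finally show ?thesis .
  qed
  have nn: "integral {c..d} (\<lambda>t. \<bar>F t\<bar>) \<ge> 0" for c d
    by (intro HK_integral_nonneg loc_int_integrable_on loc_int_abs li) auto
  show ?thesis
  proof (cases "a \<le> x")
    case True
    then show ?thesis using key[of a x] nn[of a x] by (simp add: prim_le)
  next
    case False
    then have "prim (\<lambda>t. \<bar>F t\<bar>) a x = - integral {x..a} (\<lambda>t. \<bar>F t\<bar>)" by (simp add: prim_def)
    then show ?thesis using key[of x a] nn[of x a] False by simp
  qed
qed

lemma cont_rapid_power_mult: "cont_rapid f ==> cont_rapid (\<lambda>x. x ^ k * f x)"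
proof -
  assume f: "cont_rapid f"
  have "rapid (\<lambda>x. x ^ k * f x)" unfolding rapid_def
  proof
    fix l
    obtain C where C: "!!x. \<bar>f x\<bar> * jb x ^ (k + l) \<le> C" using rapidD[OF cont_rapid_rapid[OF f]] by metis
    have "\<bar>x ^ k * f x\<bar> * jb x ^ l \<le> C" for x
    proof -
      have "\<bar>x\<bar> ^ k * (\<bar>f x\<bar> * jb x ^ l) \<le> jb x ^ k * (\<bar>f x\<bar> * jb x ^ l)"
        by (intro mult_right_mono power_mono) auto
      also have "... \<le> C" using C[of x] by (simp add: power_add algebra_simps)
      finally show ?thesis by (simp add: abs_mult power_abs mult.assoc)
    qed
    then show "\<exists>C. \<forall>x. \<bar>x ^ k * f x\<bar> * jb x ^ l \<le> C" by blast
  qed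
  then show ?thesis using f by (auto simp: cont_rapid_def intro!: continuous_intros)
qed

lemma poly_sum_upto: "(!!i. i > n ==> coeff P i = 0) ==> poly P x = (\<Sum>i\<le>n. coeff P i * x ^ i)" for x :: real
proof -
  assume "!!i. i > n ==> coeff P i = 0"
  then have d: "degree P \<le> n" by (intro degree_le) auto
  have "poly P x = (\<Sum>i\<le>degree P. coeff P i * x ^ i)" by (rule poly_altdef)
  also have "... = (\<Sum>i\<le>n. coeff P i * x ^ i)"
    by (rule sum.mono_neutral_left) (use d in \<open>auto simp: coeff_eq_0\<close>)
  finally show ?thesis .
qed

text \<open>Recentring the polynomial at \<open>a\<close> preserves its degree, so moments of
  \<open>zeta\<close> about 0 are enough.\<close>

lemma integral_poly_vanishing_moments:
  assumes zeta: "cont_rapid zeta" and mom: "!!\<kappa>. \<kappa> \<le> n ==> (LI x. x ^ \<kappa> * zeta x) = 0"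
    and P: "degree P \<le> n"
  shows "lint (\<lambda>x. poly P x * zeta (x - a))" "(LI x. poly P x * zeta (x - a)) = 0"
proof -
  define Q where "Q = pcompose P [:a, 1:]"
  have dQ: "degree Q \<le> n" using P degree_pcompose_le[of P "[:a, 1:]"] by (simp add: Q_def)
  have Q: "poly Q x = (\<Sum>i\<le>n. coeff Q i * x ^ i)" for x
    by (rule poly_sum_upto) (use dQ in \<open>auto intro: coeff_eq_0\<close>)
  have PQ: "poly P x = poly Q (x - a)" for x by (simp add: Q_def poly_pcompose)
  have c: "cont_rapid (\<lambda>x. poly Q x * zeta x)"
    unfolding Q sum_distrib_right mult.assoc by (intro cont_rapid_sum cont_rapid_cmult cont_rapid_power_mult zeta)
  show "lint (\<lambda>x. poly P x * zeta (x - a))"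
    unfolding PQ by (rule cont_rapid_integrable[OF cont_rapid_shift[OF c]])
  have "(LI x. poly P x * zeta (x - a)) = (LI x. poly Q x * zeta x)"
    unfolding PQ by (rule LINT_shift[of "\<lambda>x. poly Q x * zeta x"])
  also have "... = (LI x. (\<Sum>i\<le>n. coeff Q i * (x ^ i * zeta x)))"
    by (simp only: Q sum_distrib_right mult.assoc)
  also have "... = (\<Sum>i\<le>n. coeff Q i * (LI x. x ^ i * zeta x))"
    by (subst LI_sum)
       (auto intro!: integrable_mult_right cont_rapid_integrable cont_rapid_power_mult zeta)
  also have "... = 0" using mom by (intro sum.neutral) auto
  finally show "(LI x. poly P x * zeta (x - a)) = 0" .
qed

lemma prim_dilate:
  assumes li: "loc_int u" and r: "r > 0"
  shows "prim u (r * a) (r * x) = r * prim (\<lambda>t. u (r * t)) a x"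
proof -
  have "integral {r * c..r * d} u = r * integral {c..d} (\<lambda>t. u (r * t))" for c d
  proof (cases "c \<le> d")
    case True
    have li': "loc_int (\<lambda>t. u (r * t))" using loc_int_affine[OF li, of r 0] r by simp
    have "integral {r * c..r * d} u = (LI t. u t * indicator {r * c<..r * d} t)" by (rule LINT_eq_integral_Ioc[OF li, symmetric])
    also have "... = r * (LI t. u (r * t) * indicator {r * c<..r * d} (r * t))"
      using lebesgue_integral_real_affine[of r "\<lambda>t. u t * indicator {r * c<..r * d} t" 0] r by simp
    also have "(LI t. u (r * t) * indicator {r * c<..r * d} (r * t)) = (LI t. u (r * t) * indicator {c<..d} t)"
      using r by (intro LI_cong refl) (auto simp: indicator_def)
    also have "... = integral {c..d} (\<lambda>t. u (r * t))" by (rule LINT_eq_integral_Ioc[OF li'])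
    finally show ?thesis .
  next
    case False
    then show ?thesis using r by simp
  qed
  then show ?thesis by (simp add: prim_def right_diff_distrib)
qed

text \<open>Taylor's formula at \<open>r * y0\<close> leaves a polynomial of degree at most
  \<open>n\<close>, which the moments annihilate. The remainder carries \<open>r ^ (n + 1)\<close>,
  one factor for each primitive, and grows polynomially in \<open>y - y0\<close>, which the decay of
  \<open>zeta\<close> absorbs.\<close>

lemma wavelet_pairing_bound:
  assumes p: "1 < p" and F: "fun_bound p L F" and gF: "has_weak_deriv (n + 1) g F"
    and zeta: "cont_rapid zeta" and mom: "!!\<kappa>. \<kappa> \<le> n ==> (LI x. x ^ \<kappa> * zeta x) = 0" and r: "r > 0"
    and y0: "\<bar>y0 - of_int m\<bar> \<le> 1"
  shows "\<bar>LI y. g (r * y) * zeta (y - y0)\<bar>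
     \<le> r ^ (n + 1) * (16 * (LI y. \<bar>y\<bar> ^ n * jb y ^ 2 * \<bar>zeta y\<bar>)) * mass_average (\<lambda>t. F (r * t)) m"
proof -
  define Fr where "Fr t = F (r * t)" for t
  define V where "V = (LI y. \<bar>y\<bar> ^ n * jb y ^ 2 * \<bar>zeta y\<bar>)"
  have liF: "loc_int F" and lig: "loc_int g" using gF by (auto simp: has_weak_deriv_def)
  have Frb: "fun_bound p (r powr (- enn2real (1 / p)) * L) Fr" unfolding Fr_def by (rule fun_bound_dilate[OF p F r])
  have liFr: "loc_int Fr" by (rule fun_bound_locally_integrable[OF p Frb])
  define W where "W = (LI t. \<bar>Fr t\<bar> / jb (t - y0) ^ 2)"
  note wi = weighted_integral[OF p Frb y0, folded W_def]
  have W0: "W \<ge> 0" unfolding W_def by (intro integral_nonneg_AE AE_I2) auto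
  obtain T where T: "\<forall>i\<ge>n+1. coeff T i = 0" "AE x in lebesgue. g x = poly T x + iprim (n + 1) F (r * y0) x"
    using has_weak_deriv_imp_iprim[OF gF] by blast
  have dT: "degree T \<le> n" using T(1) by (intro degree_le) auto
  define P where "P = pcompose T [:0, r:]"
  have dP: "degree P \<le> n" using dT r degree_pcompose_le[of T "[:0, r:]"] by (simp add: P_def)
  have PT: "poly P y = poly T (r * y)" for y by (simp add: P_def poly_pcompose mult.commute)
  define h where "h y = iprim (n + 1) F (r * y0) (r * y)" for y
  have hm: "h \<in> lmeas"
  proof (rule lmeas_continuous)
    have "cont (iprim (Suc n) F (r * y0))" by (rule iprim_continuous[OF liF])
    then show "cont h" unfolding h_def
      by (auto intro!: continuous_on_compose2[of UNIV "iprim (Suc n) F (r * y0)"] continuous_intros)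
  qed
  have hb: "\<bar>h y\<bar> \<le> (r ^ (n + 1) * W) * (\<bar>y - y0\<bar> ^ n * jb (y - y0) ^ 2)" for y
  proof -
    have "\<bar>h y\<bar> \<le> \<bar>r * y - r * y0\<bar> ^ n * \<bar>prim (\<lambda>t. \<bar>F t\<bar>) (r * y0) (r * y)\<bar>"
      unfolding h_def using iprim_bound[OF liF, of n "r * y0" "r * y"] by simp
    also have "\<bar>r * y - r * y0\<bar> = r * \<bar>y - y0\<bar>" using r by (simp add: abs_mult flip: right_diff_distrib)
    also have "prim (\<lambda>t. \<bar>F t\<bar>) (r * y0) (r * y) = r * prim (\<lambda>t. \<bar>Fr t\<bar>) y0 y"
      unfolding Fr_def by (rule prim_dilate[OF loc_int_abs[OF liF] r])
    also have "\<bar>r * prim (\<lambda>t. \<bar>Fr t\<bar>) y0 y\<bar> \<le> r * (jb (y - y0) ^ 2 * W)"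
      using prim_weight_bound[OF liFr wi(1), of y] r by (simp add: abs_mult W_def)
    then have "(r * \<bar>y - y0\<bar>) ^ n * \<bar>r * prim (\<lambda>t. \<bar>Fr t\<bar>) y0 y\<bar> \<le> (r * \<bar>y - y0\<bar>) ^ n * (r * (jb (y - y0) ^ 2 * W))"
      using r by (intro mult_left_mono) auto
    also have "... = (r ^ (n + 1) * W) * (\<bar>y - y0\<bar> ^ n * jb (y - y0) ^ 2)" by (simp add: power_mult_distrib)
    finally show ?thesis .
  qed
  define k where "k y = \<bar>y\<bar> ^ n * jb y ^ 2 * \<bar>zeta y\<bar>" for y
  have k: "lint k"
  proof -
    have "rapid (\<lambda>y. zeta y * jb y ^ 2)" by (rule rapid_weight[OF cont_rapid_rapid[OF zeta]])
    then have "cont_rapid (\<lambda>y. zeta y * jb y ^ 2)" using cont_rapid_continuous[OF zeta]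
      by (auto simp: cont_rapid_def intro!: continuous_intros)
    then have "lint (\<lambda>y. \<bar>y ^ n * (zeta y * jb y ^ 2)\<bar>)"
      by (intro integrable_abs cont_rapid_integrable cont_rapid_power_mult)
    moreover have "(\<lambda>y. \<bar>y ^ n * (zeta y * jb y ^ 2)\<bar>) = k"
      by (auto simp: k_def abs_mult power_abs fun_eq_iff)
    ultimately show ?thesis by simp
  qed
  have ks: "lint (\<lambda>y. k (y - y0))"
    using lebesgue_integrable_real_affine_iff[of 1 k "- y0"] k by simp
  have hz: "\<bar>h y * zeta (y - y0)\<bar> \<le> (r ^ (n + 1) * W) * k (y - y0)" for y
    using mult_right_mono[OF hb[of y], of "\<bar>zeta (y - y0)\<bar>"] by (simp add: k_def abs_mult mult.assoc)
  have zm: "(\<lambda>y. zeta (y - y0)) \<in> lmeas" by (intro cont_rapid_measurable cont_rapid_shift zeta)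
  have hi: "lint (\<lambda>y. h y * zeta (y - y0))"
  proof (rule lint_bound[OF integrable_mult_right[OF ks, of "r ^ (n + 1) * W"]])
    show "(\<lambda>y. h y * zeta (y - y0)) \<in> lmeas" by (intro borel_measurable_times hm zm)
    show "AE y in lebesgue. norm (h y * zeta (y - y0)) \<le> norm ((r ^ (n + 1) * W) * k (y - y0))"
      using order_trans[OF hz abs_ge_self] by (intro AE_I2) (simp only: real_norm_def)
  qed
  have pz: "lint (\<lambda>y. poly P y * zeta (y - y0))" "(LI y. poly P y * zeta (y - y0)) = 0"
    by (rule integral_poly_vanishing_moments[OF zeta _ dP], rule mom, assumption)+
  have "AE y in lebesgue. g (r * y) = poly P y + h y"
  proof -
    have m: "(\<lambda>x. g x - (poly T x + iprim (n + 1) F (r * y0) x)) \<in> lmeas"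
      by (intro borel_measurable_diff borel_measurable_add loc_int_measurable lig loc_int_poly loc_int_iprim liF)
    \<comment> \<open>A function that vanishes almost everywhere has bound 0 for the infinite
      exponent, so the dilation lemma carries the almost everywhere identity to the points
      \<open>r * y\<close>.\<close>
    have "fun_bound \<infinity> 0 (\<lambda>x. g x - (poly T x + iprim (n + 1) F (r * y0) x))"
      using m T(2) by (auto simp: fun_bound_def elim!: eventually_mono)
    from fun_bound_dilate[OF _ this r] have "AE y in lebesgue. \<bar>g (r * y) - (poly T (r * y) + iprim (n + 1) F (r * y0) (r * y))\<bar> \<le> 0"
      by (simp add: fun_bound_def)
    then show ?thesis by eventually_elim (simp add: PT h_def)
  qed
  then have "(LI y. g (r * y) * zeta (y - y0)) = (LI y. poly P y * zeta (y - y0) + h y * zeta (y - y0))"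
    using lmeas_affine[OF loc_int_measurable[OF lig], of r 0] r zm pz(1) hi
    by (intro integral_cong_AE borel_measurable_times) (auto simp: distrib_right elim!: eventually_mono)
  also have "... = (LI y. h y * zeta (y - y0))"
    using LI_add[OF pz(1) hi] pz(2) by simp
  finally have "\<bar>LI y. g (r * y) * zeta (y - y0)\<bar> = \<bar>LI y. h y * zeta (y - y0)\<bar>" by simp
  also have "... \<le> (LI y. \<bar>h y * zeta (y - y0)\<bar>)" by (rule integral_abs_bound)
  also have "... \<le> (LI y. (r ^ (n + 1) * W) * k (y - y0))"
    by (rule integral_mono_AE[OF integrable_abs[OF hi] integrable_mult_right[OF ks]]) (rule AE_I2, rule hz)
  also have "... = (r ^ (n + 1) * W) * V" unfolding integral_mult_right_zero LINT_shift by (simp only: V_def k_def[abs_def])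
  also have "... \<le> (r ^ (n + 1) * (16 * mass_average Fr m)) * V"
  proof -
    have "V \<ge> 0" unfolding V_def by (intro integral_nonneg_AE AE_I2) auto
    then show ?thesis using wi(2) r by (intro mult_right_mono mult_left_mono) auto
  qed
  also have "... = r ^ (n + 1) * (16 * V) * mass_average Fr m" by simp
  finally show ?thesis by (simp only: V_def Fr_def[abs_def] k_def)
qed

lemma enn2real_inverse_bounds: assumes "1 < p" shows "0 \<le> enn2real (1 / p)" "enn2real (1 / p) \<le> 1"
proof -
  show "0 \<le> enn2real (1 / p)" by simp
  have "1 / p \<le> 1"
  proof (cases "p = \<infinity>")
    case False
    then have "1 / p \<le> p / p" using assms by (intro divide_right_mono_ennreal) simp
    moreover have "p / p = 1" using False assms by (intro ennreal_divide_self) (auto simp: top.not_eq_extremum)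
    ultimately show ?thesis by simp
  qed simp
  then show "enn2real (1 / p) \<le> 1" using enn2real_mono[of "1 / p" 1] by simp
qed

lemma spline_quantity_le:
  assumes p: "1 < p" and Q: "Q \<ge> 0"
    and b: "!!j. j \<ge> -1 ==> seq_bound p (2 powr (- (of_int j * (real n + 1 - enn2real (1 / p)))) * Q) (spline_coeff \<psi> \<Psi> f j)"
  shows "spline_quantity n p \<psi> \<Psi> f \<le> ennreal Q"
  unfolding spline_quantity_def
proof (rule SUP_least)
  fix j :: int assume "j \<in> {-1..}"
  then have j: "j \<ge> -1" by simp
  let ?e = "of_int j * (real n + 1 - enn2real (1 / p))"
  have "lp_seq_norm p (spline_coeff \<psi> \<Psi> f j) \<le> ennreal (2 powr (- ?e) * Q)"
    using lp_seq_norm_le_iff[OF p] b[OF j] Q by simp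
  then have "ennreal (2 powr ?e) * lp_seq_norm p (spline_coeff \<psi> \<Psi> f j) \<le> ennreal (2 powr ?e) * ennreal (2 powr (- ?e) * Q)"
    by (rule mult_left_mono) simp
  also have "... = ennreal Q"
    using Q by (subst ennreal_mult[symmetric]) (auto simp: powr_minus)
  finally show "ennreal (2 powr ?e) * lp_seq_norm p (spline_coeff \<psi> \<Psi> f j) \<le> ennreal Q" .
qed

lemma spline_quantity_ge:
  assumes p: "1 < p" and q: "spline_quantity n p \<psi> \<Psi> f \<le> ennreal Q" and Q: "Q \<ge> 0" and j: "j \<ge> -1"
  shows "seq_bound p (2 powr (- (of_int j * (real n + 1 - enn2real (1 / p)))) * Q) (spline_coeff \<psi> \<Psi> f j)"
proof -
  let ?e = "of_int j * (real n + 1 - enn2real (1 / p))"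
  have "ennreal (2 powr ?e) * lp_seq_norm p (spline_coeff \<psi> \<Psi> f j) \<le> spline_quantity n p \<psi> \<Psi> f"
    unfolding spline_quantity_def using j by (intro SUP_upper2[of j]) auto
  then have le: "ennreal (2 powr ?e) * lp_seq_norm p (spline_coeff \<psi> \<Psi> f j) \<le> ennreal Q" using q by (rule order_trans)
  have "lp_seq_norm p (spline_coeff \<psi> \<Psi> f j) = ennreal (2 powr (- ?e)) * (ennreal (2 powr ?e) * lp_seq_norm p (spline_coeff \<psi> \<Psi> f j))"
    by (simp add: powr_minus flip: mult.assoc ennreal_mult)
  also have "... \<le> ennreal (2 powr (- ?e)) * ennreal Q" using le by (rule mult_left_mono) simp
  also have "... = ennreal (2 powr (- ?e) * Q)" using Q by (subst ennreal_mult) auto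
  finally show ?thesis using lp_seq_norm_le_iff[OF p] Q by simp
qed

text \<open>For r = 2^(-j) the factor 2^j in the coefficients is the Jacobian of the change of
  variable, the Taylor remainder gives r^(n+1), and dilating \<open>F\<close> gives r^(-1/p):
  exactly the decay that the supremum compensates. Level -1 uses only the decay of
  \<open>\<Psi>\<close>.\<close>

lemma spline_quantity_Sobolev_le:
  assumes BL: "Battle_Lemarie_system n \<psi> \<Psi>" and n: "n \<ge> 1" and p: "1 < p"
  shows "\<exists>C>0. \<forall>g F K L. has_weak_deriv (n + 1) g F --> fun_bound p K g --> fun_bound p L F -->
     spline_quantity n p \<psi> \<Psi> (regular_functional (n - 1) g) \<le> ennreal (C * (K + L))"
proof -
  note S = Battle_Lemarie_S_space[OF BL]
  have mom: "(LI x. x ^ \<kappa> * \<psi> x) = 0" if "\<kappa> \<le> n" for \<kappa>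
    using BL that by (auto simp: Battle_Lemarie_system_def)
  define V where "V = 16 * (LI y. \<bar>y\<bar> ^ n * jb y ^ 2 * \<bar>\<psi> y\<bar>)"
  have V0: "V \<ge> 0" unfolding V_def by (intro mult_nonneg_nonneg integral_nonneg_AE AE_I2) auto
  obtain D where D: "D > 0" "!!x. \<bar>\<Psi> x\<bar> * jb x ^ 2 \<le> D" using rapidD[OF S_space_rapid0[OF S(2)]] by metis
  \<comment> \<open>One summand for the levels \<open>j \<ge> 0\<close>, one for level -1, and 1 for
    positivity.\<close>
  define C where "C = (2 * V + 2 powr (real n + 1) * 16 * D) * weight_const + 1"
  have C0: "C > 0" using V0 D(1) weight_const_nonneg by (simp add: C_def add_nonneg_pos)
  have "spline_quantity n p \<psi> \<Psi> (regular_functional (n - 1) g) \<le> ennreal (C * (K + L))"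
    if gF: "has_weak_deriv (n + 1) g F" and g: "fun_bound p K g" and F: "fun_bound p L F" for g F K L
  proof (rule spline_quantity_le[OF p])
    have K0: "K \<ge> 0" "L \<ge> 0" using fun_bound_nonneg[OF g] fun_bound_nonneg[OF F] by auto
    then show "C * (K + L) \<ge> 0" using C0 by simp
    fix j :: int assume j: "j \<ge> -1"
    let ?f = "regular_functional (n - 1) g"
    let ?e = "of_int j * (real n + 1 - enn2real (1 / p))"
    show "seq_bound p (2 powr (- ?e) * (C * (K + L))) (spline_coeff \<psi> \<Psi> ?f j)"
    proof (cases "j \<ge> 0")
      case True
      define r :: real where "r = 2 powi (- j)"
      have r: "r > 0" by (simp add: r_def)
      have pj: "2 powi j = 1 / r" by (simp add: r_def power_int_minus inverse_eq_divide)
      have co: "2 powi j * \<bar>?f (shifted_system \<psi> \<Psi> j nu)\<bar> \<le> r ^ (n + 1) * V * mass_average (\<lambda>t. F (r * t)) (nu div 2)" for nu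
      proof -
        have sh: "shifted_system \<psi> \<Psi> j nu = (\<lambda>x. \<psi> (2 powi j * x - of_int nu / 2))" using True by (simp add: shifted_system_def)
        have inS: "(\<lambda>x. \<psi> (2 powi j * x - of_int nu / 2)) \<in> S_space (n - 1)"
          by (rule S_space_affine'[OF S(1)]) simp
        have "?f (shifted_system \<psi> \<Psi> j nu) = (LI x. g x * \<psi> (2 powi j * x - of_int nu / 2))"
          using inS by (simp add: sh regular_functional_def)
        also have "... = r * (LI y. g (r * y) * \<psi> (2 powi j * (r * y) - of_int nu / 2))"
          using lebesgue_integral_real_affine[of r "\<lambda>x. g x * \<psi> (2 powi j * x - of_int nu / 2)" 0] r by simp
        also have "... = r * (LI y. g (r * y) * \<psi> (y - of_int nu / 2))"
          using r by (simp add: pj)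
        finally have "2 powi j * \<bar>?f (shifted_system \<psi> \<Psi> j nu)\<bar> = \<bar>LI y. g (r * y) * \<psi> (y - of_int nu / 2)\<bar>"
          using r by (simp add: pj abs_mult)
        also have "... \<le> r ^ (n + 1) * V * mass_average (\<lambda>t. F (r * t)) (nu div 2)"
          unfolding V_def
        proof (rule wavelet_pairing_bound[OF p F gF S_space_cont_rapid[OF S(1)] mom r])
          have "real_of_int nu = 2 * real_of_int (nu div 2) + real_of_int (nu mod 2)"
            by (metis mult_div_mod_eq of_int_add of_int_mult of_int_numeral)
          moreover have "0 \<le> real_of_int (nu mod 2)" "real_of_int (nu mod 2) \<le> 1" by auto
          ultimately show "\<bar>of_int nu / 2 - real_of_int (nu div 2)\<bar> \<le> 1" unfolding abs_le_iff by linarith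
        qed
        finally show ?thesis .
      qed
      have cb: "\<bar>spline_coeff \<psi> \<Psi> ?f j mu\<bar> \<le> \<bar>(2 * (r ^ (n + 1) * V)) * mass_average (\<lambda>t. F (r * t)) mu\<bar>" for mu
        using co[of "2 * mu"] co[of "2 * mu + 1"] True r V0 mass_average_nonneg[of "\<lambda>t. F (r * t)" mu]
        by (simp add: spline_coeff_def)
      have sb: "seq_bound p (\<bar>2 * (r ^ (n + 1) * V)\<bar> * (weight_const * (r powr (- enn2real (1 / p)) * L)))
         (\<lambda>mu. (2 * (r ^ (n + 1) * V)) * mass_average (\<lambda>t. F (r * t)) mu)"
        by (intro seq_bound_cmult[OF p] seq_bound_mass_average(1)[OF p] fun_bound_dilate[OF p F r])
      have "\<bar>2 * (r ^ (n + 1) * V)\<bar> * (weight_const * (r powr (- enn2real (1 / p)) * L)) = 2 powr (- ?e) * (2 * V * weight_const * L)"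
      proof -
        have r2: "r = 2 powr (- of_int j)" unfolding r_def by (simp add: powr_real_of_int' flip: of_int_minus)
        have "r ^ (n + 1) * r powr (- enn2real (1 / p)) = r powr (real (n + 1)) * r powr (- enn2real (1 / p))"
          using r by (simp only: powr_realpow)
        also have "... = r powr (real n + 1 - enn2real (1 / p))" by (simp add: powr_add[symmetric] add.commute)
        also have "... = 2 powr (- ?e)" unfolding r2 powr_powr by simp
        finally have e: "r ^ (n + 1) * r powr (- enn2real (1 / p)) = 2 powr (- ?e)" .
        have "\<bar>2 * (r ^ (n + 1) * V)\<bar> * (weight_const * (r powr (- enn2real (1 / p)) * L))
           = (r ^ (n + 1) * r powr (- enn2real (1 / p))) * (2 * V * weight_const * L)" using r V0 by simp
        then show ?thesis unfolding e .
      qed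
      moreover have "2 * V * weight_const * L \<le> C * (K + L)"
      proof -
        have "2 * V * weight_const * L \<le> C * L"
          using K0 V0 D(1) weight_const_nonneg by (intro mult_right_mono) (auto simp: C_def distrib_right add_increasing2)
        also have "... \<le> C * (K + L)" using C0 K0 by (intro mult_left_mono) auto
        finally show ?thesis .
      qed
      ultimately have "\<bar>2 * (r ^ (n + 1) * V)\<bar> * (weight_const * (r powr (- enn2real (1 / p)) * L)) \<le> 2 powr (- ?e) * (C * (K + L))"
        by (simp only: mult_left_mono powr_ge_zero)
      then show ?thesis by (rule seq_bound_mono[OF p sb cb])
    next
      case False
      then have j1: "j = -1" using j by simp
      have cb: "\<bar>spline_coeff \<psi> \<Psi> ?f j mu\<bar> \<le> \<bar>(16 * D) * mass_average g mu\<bar>" for mu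
      proof -
        have inS: "(\<lambda>x. \<Psi> (x - of_int mu)) \<in> S_space (n - 1)" by (rule S_space_shift[OF S(2)])
        have "\<bar>LI x. g x * \<Psi> (x - of_int mu)\<bar> \<le> D * (LI x. \<bar>g x\<bar> / jb (x - of_int mu) ^ 2)"
          by (rule integrable_mult_rapid(2)[OF p g lmeas_continuous[OF S_space_continuous[OF inS]] D(2)])
        also have "... \<le> D * (16 * mass_average g mu)"
          using D(1) by (intro mult_left_mono weighted_integral(2)[OF p g]) auto
        finally show ?thesis using inS D(1) mass_average_nonneg[of g mu] j1
          by (simp add: spline_coeff_def shifted_system_def regular_functional_def)
      qed
      have sb: "seq_bound p (\<bar>16 * D\<bar> * (weight_const * K)) (\<lambda>mu. (16 * D) * mass_average g mu)"
        by (intro seq_bound_cmult[OF p] seq_bound_mass_average(1)[OF p] g)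
      have "\<bar>16 * D\<bar> * (weight_const * K) \<le> 2 powr (- ?e) * (C * (K + L))"
      proof -
        have e: "- ?e \<ge> 0" using j1 enn2real_inverse_bounds[OF p] by simp
        have "\<bar>16 * D\<bar> * (weight_const * K) = 1 * (16 * D * weight_const * K)" using D(1) by simp
        also have "... \<le> 2 powr (real n + 1) * (16 * D * weight_const * K)"
          using D(1) weight_const_nonneg K0 by (intro mult_right_mono ge_one_powr_ge_zero) auto
        also have "... \<le> C * K"
        proof -
          have "2 powr (real n + 1) * 16 * D * weight_const \<le> C"
            using V0 weight_const_nonneg by (simp add: C_def distrib_right)
          then have "2 powr (real n + 1) * 16 * D * weight_const * K \<le> C * K" using K0 by (intro mult_right_mono) auto
          then show ?thesis by (simp add: mult.assoc)
        qed
        also have "... \<le> C * (K + L)" using C0 K0 by (intro mult_left_mono) auto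
        also have "... = 1 * (C * (K + L))" by simp
        also have "... \<le> 2 powr (- ?e) * (C * (K + L))"
          using C0 K0 e by (intro mult_right_mono ge_one_powr_ge_zero) auto
        finally show ?thesis .
      qed
      then show ?thesis by (rule seq_bound_mono[OF p sb cb])
    qed
  qed
  then show ?thesis using C0 by blast
qed

section \<open>Quasi-interpolation by splines\<close>

text \<open>Averages against B_(n+1), one degree above the splines that carry them. This raises the
  transposed approximation to degree n + 1, so that its (n+1)-st derivative is a step
  function.\<close>

definition qi_coeff :: "nat => real => (real => real) => int => real" where
  "qi_coeff n a phi k = (LI x. phi (x / a) * B_spline (Suc n) (x - of_int k))"

definition back_diff :: "real => (real => real) => real => real" where
  "back_diff h u x = u x - u (x - h)"

lemma qi_coeff_shift: "qi_coeff n a phi k = (LI x. phi ((x + of_int k) / a) * B_spline (Suc n) x)"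
  unfolding qi_coeff_def using LINT_shift[of "\<lambda>x. phi ((x + of_int k) / a) * B_spline (Suc n) x" "of_int k"]
  by simp

lemma integrable_mult_B_spline:
  assumes "cont u" shows "lint (\<lambda>x. u x * B_spline (Suc n) x)"
  by (rule loc_int_mult_continuous[OF loc_int_continuous[OF assms] B_spline_continuous, of 0 "real n + 2"])
     (auto intro: B_spline_outside)

lemma continuous_qi_arg: "cont phi ==> cont (\<lambda>x. phi ((x + b) / a))" for phi :: "real => real"
  unfolding divide_inverse by (auto intro!: continuous_on_compose2[of UNIV phi] continuous_intros)

lemma Cr_functions_back_diff:
  assumes "phi \<in> Cr_functions r" shows "back_diff h phi \<in> Cr_functions r"
    and "k \<le> r ==> (deriv ^^ k) (back_diff h phi) x = back_diff h ((deriv ^^ k) phi) x"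
proof -
  have e: "back_diff h phi = (\<lambda>x. phi x + (-1) * phi (1 * x + (- h)))" by (simp add: back_diff_def fun_eq_iff)
  have a: "(\<lambda>x. phi (1 * x + (- h))) \<in> Cr_functions r" by (rule Cr_functions_affine[OF assms])
  show "back_diff h phi \<in> Cr_functions r" unfolding e by (rule Cr_functions_add[OF assms Cr_functions_cmult[OF a]])
  show "(deriv ^^ k) (back_diff h phi) x = back_diff h ((deriv ^^ k) phi) x" if "k \<le> r"
    unfolding e higher_deriv_add[OF assms Cr_functions_cmult[OF a] that] higher_deriv_cmult[OF a that] higher_deriv_affine[OF assms that]
    by (simp add: back_diff_def)
qed

lemma back_diff_mean_value:
  assumes "phi \<in> Cr_functions r" "k \<le> r" "h > 0"
  shows "\<exists>s. y - real k * h \<le> s \<and> s \<le> y \<and> (back_diff h ^^ k) phi y = h ^ k * (deriv ^^ k) phi s"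
  using assms(1,2)
proof (induction k arbitrary: phi)
  case 0
  then show ?case by (intro exI[of _ y]) simp
next
  case (Suc k)
  have k: "k \<le> r" "k < r" using Suc.prems(2) by auto
  obtain s where s: "y - real k * h \<le> s" "s \<le> y" "(back_diff h ^^ k) (back_diff h phi) y = h ^ k * (deriv ^^ k) (back_diff h phi) s"
    using Suc.IH[OF Cr_functions_back_diff(1)[OF Suc.prems(1)] k(1)] by blast
  have "((deriv ^^ k) phi has_real_derivative (deriv ^^ Suc k) phi x) (at x)" for x
    using Suc.prems(1) k(2) by (simp add: Cr_functions_def DERIV_deriv_iff_real_differentiable)
  then obtain z where z: "s - h < z" "z < s" "(deriv ^^ k) phi s - (deriv ^^ k) phi (s - h) = (s - (s - h)) * (deriv ^^ Suc k) phi z"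
    using MVT2[of "s - h" s "(deriv ^^ k) phi" "(deriv ^^ Suc k) phi"] assms(3) by auto
  have "(back_diff h ^^ Suc k) phi y = h ^ k * (deriv ^^ k) (back_diff h phi) s" using s(3) by (simp add: funpow_swap1)
  also have "... = h ^ Suc k * (deriv ^^ Suc k) phi z"
    using z(3) by (simp add: Cr_functions_back_diff(2)[OF Suc.prems(1) k(1)] back_diff_def)
  finally show ?case using z s by (intro exI[of _ z]) (simp add: distrib_right)
qed

lemma nabla_qi_coeff:
  assumes "cont phi"
  shows "(nabla ^^ k) (qi_coeff n a phi) = qi_coeff n a ((back_diff (1 / a) ^^ k) phi)"
  using assms
proof (induction k arbitrary: phi)
  case (Suc k)
  have c: "cont (back_diff (1 / a) phi)"
    unfolding back_diff_def[abs_def] using Suc.prems by (auto intro!: continuous_intros continuous_on_compose2[of UNIV phi])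
  have "nabla (qi_coeff n a phi) nu = qi_coeff n a (back_diff (1 / a) phi) nu" for nu
  proof -
    have "nabla (qi_coeff n a phi) nu = (LI x. phi ((x + of_int nu) / a) * B_spline (Suc n) x - phi ((x + of_int (nu - 1)) / a) * B_spline (Suc n) x)"
      unfolding nabla_def qi_coeff_shift
      by (rule LI_diff[symmetric]) (intro integrable_mult_B_spline continuous_qi_arg Suc.prems)+
    also have "... = qi_coeff n a (back_diff (1 / a) phi) nu"
      unfolding qi_coeff_shift back_diff_def
    proof (rule LI_cong[OF refl])
      fix x
      have "(x + of_int (nu - 1)) / a = (x + of_int nu) / a - 1 / a" by (simp add: diff_divide_distrib add_divide_distrib)
      then show "phi ((x + of_int nu) / a) * B_spline (Suc n) x - phi ((x + of_int (nu - 1)) / a) * B_spline (Suc n) x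
          = (phi ((x + of_int nu) / a) - phi ((x + of_int nu) / a - 1 / a)) * B_spline (Suc n) x"
        by (simp only: left_diff_distrib)
    qed
    finally show ?thesis .
  qed
  then have "nabla (qi_coeff n a phi) = qi_coeff n a (back_diff (1 / a) phi)" by blast
  then show ?case using Suc.IH[OF c] by (simp add: funpow_swap1)
qed simp

lemma qi_coeff_bound:
  assumes u: "cont u" and e: "!!z. 0 \<le> z ==> z \<le> real n + 2 ==> \<bar>d * u ((z + of_int k) / a) - c\<bar> \<le> e"
  shows "\<bar>d * qi_coeff n a u k - c\<bar> \<le> e"
proof -
  have i: "lint (\<lambda>x. u ((x + of_int k) / a) * B_spline (Suc n) x)" "lint (B_spline (Suc n))"
    "lint (\<lambda>x. (d * u ((x + of_int k) / a) - c) * B_spline (Suc n) x)"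
    using integrable_mult_B_spline[of "\<lambda>x. 1" n]
    by (simp_all add: integrable_mult_B_spline continuous_qi_arg[OF u] continuous_on_mult_left continuous_on_diff continuous_on_const)
  have "(LI x. (d * u ((x + of_int k) / a) - c) * B_spline (Suc n) x)
     = (LI x. d * (u ((x + of_int k) / a) * B_spline (Suc n) x) - c * B_spline (Suc n) x)"
    by (rule LI_cong[OF refl]) (simp add: left_diff_distrib)
  also have "... = d * qi_coeff n a u k - c"
    using i by (simp add: qi_coeff_shift B_spline_LINT_1)
  finally have "\<bar>d * qi_coeff n a u k - c\<bar> = \<bar>LI x. (d * u ((x + of_int k) / a) - c) * B_spline (Suc n) x\<bar>" by simp
  also have "... \<le> (LI x. \<bar>(d * u ((x + of_int k) / a) - c) * B_spline (Suc n) x\<bar>)" by (rule integral_abs_bound)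
  also have "... \<le> (LI x. e * B_spline (Suc n) x)"
  proof (rule integral_mono)
    show "\<bar>(d * u ((x + of_int k) / a) - c) * B_spline (Suc n) x\<bar> \<le> e * B_spline (Suc n) x" for x
    proof (cases "0 \<le> x \<and> x \<le> real n + 2")
      case True
      then show ?thesis using e[of x] B_spline_nonneg[of "Suc n" x] by (simp add: abs_mult mult_right_mono)
    next
      case False
      then show ?thesis using B_spline_outside[of x "Suc n"] by auto
    qed
  qed (use i in \<open>auto intro: integrable_abs\<close>)
  also have "... = e" by (simp add: B_spline_LINT_1)
  finally show ?thesis .
qed

text \<open>The \<open>k\<close>-th derivative of the quasi-interpolant is a spline whose
  coefficients average scaled \<open>k\<close>-th differences of \<open>phi\<close>, hence values of
  the \<open>k\<close>-th derivative at nearby points. The spline window, the support of B_(n+1) and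
  the span of the differences keep these points within \<open>(2 * n + 2) / a\<close> of
  \<open>x\<close>.\<close>

lemma qi_deriv_bound:
  assumes phi: "phi \<in> Cr_functions (n - 1)" and k: "k < n" and a: "a > 0"
    and e: "!!s. \<bar>s - x\<bar> \<le> (2 * real n + 2) / a ==> \<bar>(deriv ^^ k) phi s - (deriv ^^ k) phi x\<bar> \<le> e"
  shows "\<bar>(deriv ^^ k) (\<lambda>x. spline n (qi_coeff n a phi) (a * x)) x - (deriv ^^ k) phi x\<bar> \<le> e"
proof -
  have n: "Suc (n - 1) = n" and kn: "k \<le> n - 1" using k by auto
  let ?c = "qi_coeff n a phi" and ?D = "(back_diff (1 / a) ^^ k) phi"
  have c: "cont phi" using Cr_functions_antimono[OF _ phi, of 0] by (simp add: Cr_functions_0)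
  have cb: "cont (back_diff (1 / a) u)" if "cont u" for u
    unfolding back_diff_def[abs_def] using that by (auto intro!: continuous_intros continuous_on_compose2[of UNIV u])
  have cD: "cont ((back_diff (1 / a) ^^ k) u)" if "cont u" for u and k
    by (induction k) (use that cb in auto)
  have "(deriv ^^ k) (\<lambda>x. spline n ?c (a * x)) x = a ^ k * (deriv ^^ k) (spline n ?c) (a * x)"
    using higher_deriv_affine[OF spline_Cr[of "n - 1" ?c, unfolded n] kn, of a 0] by simp
  also have "... = spline (n - k) (\<lambda>nu. a ^ k * (nabla ^^ k) ?c nu) (a * x)"
    by (simp add: spline_higher_deriv[OF k] spline_def sum_distrib_left mult.assoc)
  also have "\<bar>... - (deriv ^^ k) phi x\<bar> \<le> e"
  proof (rule spline_bound)
    fix nu assume nu: "nu \<in> {\<lfloor>a * x\<rfloor> - int (n - k)..\<lfloor>a * x\<rfloor>}"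
    have nu1: "real_of_int nu \<le> a * x" using nu by (simp add: le_floor_iff)
    have "real_of_int \<lfloor>a * x\<rfloor> \<le> real_of_int (nu + int (n - k))" using nu by (subst of_int_le_iff) auto
    then have nu2: "a * x - 1 - real n \<le> of_int nu" using real_of_int_floor_add_one_gt[of "a * x"] k by (simp add: of_nat_diff; linarith)
    show "\<bar>a ^ k * (nabla ^^ k) ?c nu - (deriv ^^ k) phi x\<bar> \<le> e"
      unfolding nabla_qi_coeff[OF c]
    proof (rule qi_coeff_bound[OF cD[OF c]])
      fix z :: real assume z: "0 \<le> z" "z \<le> real n + 2"
      obtain s where s: "(z + of_int nu) / a - real k * (1 / a) \<le> s" "s \<le> (z + of_int nu) / a"
        "?D ((z + of_int nu) / a) = (1 / a) ^ k * (deriv ^^ k) phi s"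
        using back_diff_mean_value[OF phi kn, of "1 / a"] a by auto
      have "a * s \<le> z + of_int nu" using s(2) a by (simp add: pos_le_divide_eq mult.commute)
      moreover have "z + of_int nu - real k \<le> a * s" using s(1) a
        by (simp add: pos_divide_le_eq mult.commute flip: diff_divide_distrib)
      ultimately have "\<bar>a * s - a * x\<bar> \<le> 2 * real n + 2" using nu1 nu2 z k by (simp add: abs_le_iff)
      then have "\<bar>s - x\<bar> \<le> (2 * real n + 2) / a"
        using a by (simp add: pos_le_divide_eq abs_mult mult.commute flip: right_diff_distrib)
      then have "\<bar>(deriv ^^ k) phi s - (deriv ^^ k) phi x\<bar> \<le> e" by (rule e)
      moreover have "a ^ k * ?D ((z + of_int nu) / a) = (deriv ^^ k) phi s" using s(3) a by (simp add: power_one_over)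
      ultimately show "\<bar>a ^ k * ?D ((z + of_int nu) / a) - (deriv ^^ k) phi x\<bar> \<le> e" by simp
    qed
  qed
  finally show ?thesis .
qed

lemma rapid_oscillation_bounded:
  assumes "rapid u" "dl \<ge> 0"
  obtains C where "!!x s. \<bar>s - x\<bar> \<le> dl ==> \<bar>u s\<bar> * jb x ^ l \<le> C"
proof -
  obtain C where C: "C > 0" "!!x. \<bar>u x\<bar> * jb x ^ l \<le> C" using rapidD[OF assms(1)] by metis
  have "\<bar>u s\<bar> * jb x ^ l \<le> C * (1 + dl) ^ l" if "\<bar>s - x\<bar> \<le> dl" for x s
  proof -
    have "1 + \<bar>x\<bar> \<le> jb s * jb (x - s)" by (rule one_plus_abs_peetre)
    also have "... \<le> jb s * (1 + dl)" using that by (intro mult_left_mono) (auto simp: abs_minus_commute)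
    finally have "jb x ^ l \<le> (jb s * (1 + dl)) ^ l" by (intro power_mono) auto
    then have "\<bar>u s\<bar> * jb x ^ l \<le> \<bar>u s\<bar> * (jb s * (1 + dl)) ^ l" by (intro mult_left_mono) auto
    also have "... = (\<bar>u s\<bar> * jb s ^ l) * (1 + dl) ^ l" by (simp add: power_mult_distrib)
    also have "... \<le> C * (1 + dl) ^ l" using C(2) assms(2) by (intro mult_right_mono) auto
    finally show ?thesis .
  qed
  then show ?thesis using that by blast
qed

text \<open>Uniform continuity that survives a polynomial weight. On a compact interval the weight
  is bounded; outside it one spare power of decay makes the weighted values themselves
  small.\<close>

lemma rapid_oscillation_small:
  assumes r: "rapid u" and c: "cont u" and e: "e > 0"
  obtains dl where "dl > 0" "!!x s. \<bar>s - x\<bar> \<le> dl ==> \<bar>u s - u x\<bar> * jb x ^ l \<le> e"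
proof -
  obtain C where C: "!!x s. \<bar>s - x\<bar> \<le> 1 ==> \<bar>u s\<bar> * jb x ^ (l + 1) \<le> C"
    using rapid_oscillation_bounded[OF r, of 1 "l + 1"] by auto
  have C0: "C \<ge> 0" using C[of 0 0] by (auto intro: order_trans[rotated])
  \<comment> \<open>With one extra power of the weight the oscillation is at most
    \<open>2 * C = e * X\<close>, and beyond \<open>X\<close> that extra factor exceeds
    \<open>X\<close>.\<close>
  define X where "X = 2 * C / e"
  have X: "X \<ge> 0" using C0 e by (simp add: X_def)
  have "uniformly_continuous_on {- X - 1..X + 1} u"
    using c by (intro compact_uniformly_continuous) (auto intro: continuous_on_subset)
  moreover have "e / (1 + X) ^ l > 0" using e X by simp
  ultimately obtain dl where d: "dl > 0" "!!x s. x \<in> {- X - 1..X + 1} ==> s \<in> {- X - 1..X + 1} ==> dist s x < dl ==> dist (u s) (u x) < e / (1 + X) ^ l"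
    unfolding uniformly_continuous_on_def by metis
  define eta where "eta = min 1 (dl / 2)"
  have "\<bar>u s - u x\<bar> * jb x ^ l \<le> e" if sx: "\<bar>s - x\<bar> \<le> eta" for x s
  proof (cases "\<bar>x\<bar> \<le> X")
    case True
    have "dist (u s) (u x) < e / (1 + X) ^ l"
      using sx True d(1) by (intro d(2)) (auto simp: eta_def dist_real_def abs_le_iff min_def split: if_splits)
    then have "\<bar>u s - u x\<bar> * (1 + X) ^ l \<le> e" using X by (simp add: dist_real_def pos_less_divide_eq)
    moreover have "\<bar>u s - u x\<bar> * jb x ^ l \<le> \<bar>u s - u x\<bar> * (1 + X) ^ l"
      using True by (intro mult_left_mono power_mono) auto
    ultimately show ?thesis by simp
  next
    case False
    have "\<bar>u s - u x\<bar> * jb x ^ (l + 1) \<le> (\<bar>u s\<bar> + \<bar>u x\<bar>) * jb x ^ (l + 1)" by (intro mult_right_mono) auto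
    also have "... \<le> 2 * C" using C[of s x] C[of x x] sx by (simp add: eta_def distrib_right)
    also have "... = e * X" using e by (simp add: X_def)
    also have "... \<le> e * jb x" using False e by (intro mult_left_mono) auto
    finally have "(\<bar>u s - u x\<bar> * jb x ^ l) * jb x \<le> e * jb x" by (simp add: mult_ac)
    then show ?thesis by (rule mult_right_le_imp_le) auto
  qed
  moreover have "eta > 0" using d(1) by (simp add: eta_def)
  ultimately show ?thesis using that by blast
qed

lemma S_tendstoI_eps:
  assumes "!!k l e. k \<le> r ==> e > 0 ==> \<exists>M. \<forall>m\<ge>M. \<forall>x. \<bar>(deriv ^^ k) (Phi m) x - (deriv ^^ k) phi x\<bar> * jb x ^ l \<le> e"
  shows "S_tendsto r Phi phi"
  unfolding S_tendsto_def uniform_limit_iff eventually_sequentially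
proof (intro allI impI)
  fix k l and e :: real assume k: "k \<le> r" and e: "0 < e"
  obtain M where M: "!!m x. m \<ge> M ==> \<bar>(deriv ^^ k) (Phi m) x - (deriv ^^ k) phi x\<bar> * jb x ^ nat l \<le> e / 2"
    using assms[OF k, of "e / 2" "nat l"] e by auto
  have "dist (jb x powi l * (deriv ^^ k) (Phi m) x) (jb x powi l * (deriv ^^ k) phi x) < e" if "m \<ge> M" for m x
  proof -
    have "dist (jb x powi l * (deriv ^^ k) (Phi m) x) (jb x powi l * (deriv ^^ k) phi x)
       = \<bar>(deriv ^^ k) (Phi m) x - (deriv ^^ k) phi x\<bar> * jb x powi l"
      unfolding dist_real_def right_diff_distrib[symmetric] abs_mult by (simp add: mult.commute)
    also have "... \<le> \<bar>(deriv ^^ k) (Phi m) x - (deriv ^^ k) phi x\<bar> * jb x powi (int (nat l))"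
      by (intro mult_left_mono power_int_increasing) auto
    also have "... \<le> e / 2" using M[OF that, of x] by (simp del: int_nat_eq)
    finally show ?thesis using e by simp
  qed
  then show "\<exists>N. \<forall>m\<ge>N. \<forall>x\<in>UNIV. dist (jb x powi l * (deriv ^^ k) (Phi m) x) (jb x powi l * (deriv ^^ k) phi x) < e" by blast
qed

lemma spline_Cr': "n \<ge> 1 ==> spline n c \<in> Cr_functions (n - 1)"
  using spline_Cr[of "n - 1" c] by simp

lemma qi_S_space:
  assumes phi: "phi \<in> S_space (n - 1)" and n: "n \<ge> 1" and a: "a > 0"
  shows "(\<lambda>x. spline n (qi_coeff n a phi) (a * x)) \<in> S_space (n - 1)"
  unfolding S_space_iff
proof (intro conjI allI impI)
  show "(\<lambda>x. spline n (qi_coeff n a phi) (a * x)) \<in> Cr_functions (n - 1)"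
    using Cr_functions_affine[OF spline_Cr'[OF n], of _ a 0] by simp
  fix k assume k: "k \<le> n - 1"
  let ?T = "(deriv ^^ k) (\<lambda>x. spline n (qi_coeff n a phi) (a * x))" and ?u = "(deriv ^^ k) phi"
  show "rapid ?T" unfolding rapid_def
  proof
    fix l
    obtain C where C: "!!x s. \<bar>s - x\<bar> \<le> (2 * real n + 2) / a ==> \<bar>?u s\<bar> * jb x ^ l \<le> C"
      using rapid_oscillation_bounded[OF S_space_rapid[OF phi k], of "(2 * real n + 2) / a" l] a by auto
    have "\<bar>?T x\<bar> * jb x ^ l \<le> 3 * C" for x
    proof -
      have C': "\<bar>?u s\<bar> \<le> C / jb x ^ l" if "\<bar>s - x\<bar> \<le> (2 * real n + 2) / a" for s
        using C[OF that] one_plus_abs_pos[of x l] by (simp add: pos_le_divide_eq)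
      have x0: "\<bar>x - x\<bar> \<le> (2 * real n + 2) / a" using a by simp
      have "\<bar>?T x - ?u x\<bar> \<le> 2 * (C / jb x ^ l)"
      proof (rule qi_deriv_bound[OF S_space_Cr[OF phi] _ a])
        show "k < n" using k n by simp
        fix s assume s: "\<bar>s - x\<bar> \<le> (2 * real n + 2) / a"
        show "\<bar>?u s - ?u x\<bar> \<le> 2 * (C / jb x ^ l)" using C'[OF s] C'[OF x0] by linarith
      qed
      then have "\<bar>?T x\<bar> \<le> 3 * C / jb x ^ l" using C'[OF x0] by linarith
      then show ?thesis using one_plus_abs_pos[of x l] by (simp add: pos_le_divide_eq)
    qed
    then show "\<exists>C. \<forall>x. \<bar>?T x\<bar> * jb x ^ l \<le> C" by blast
  qed
qed

lemma qi_tendsto: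
  assumes phi: "phi \<in> S_space (n - 1)" and n: "n \<ge> 1"
  shows "S_tendsto (n - 1) (\<lambda>J x. spline n (qi_coeff n (2 ^ J) phi) (2 ^ J * x)) phi"
proof (rule S_tendstoI_eps)
  fix k l and e :: real assume k: "k \<le> n - 1" and e: "e > 0"
  let ?u = "(deriv ^^ k) phi"
  have "cont ?u" using S_space_Cr[OF phi] k by (simp add: Cr_functions_def)
  then obtain dl where d: "dl > 0" "!!x s. \<bar>s - x\<bar> \<le> dl ==> \<bar>?u s - ?u x\<bar> * jb x ^ l \<le> e"
    using rapid_oscillation_small[OF S_space_rapid[OF phi k] _ e, of l] by blast
  have lim: "(\<lambda>J. (2 * real n + 2) / 2 ^ J) \<longlonglongrightarrow> 0" by real_asymp
  then obtain M where M: "!!J. J \<ge> M ==> (2 * real n + 2) / 2 ^ J < dl"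
    using order_tendstoD(2)[OF lim d(1)] by (auto simp: eventually_sequentially)
  have "\<bar>(deriv ^^ k) (\<lambda>x. spline n (qi_coeff n (2 ^ J) phi) (2 ^ J * x)) x - ?u x\<bar> * jb x ^ l \<le> e" if J: "J \<ge> M" for J x
  proof -
    have "\<bar>(deriv ^^ k) (\<lambda>x. spline n (qi_coeff n (2 ^ J) phi) (2 ^ J * x)) x - ?u x\<bar> \<le> e / jb x ^ l"
    proof (rule qi_deriv_bound[OF S_space_Cr[OF phi]])
      show "k < n" using k n by simp
      fix s assume "\<bar>s - x\<bar> \<le> (2 * real n + 2) / 2 ^ J"
      then have "\<bar>s - x\<bar> \<le> dl" using M[OF J] by simp
      then show "\<bar>?u s - ?u x\<bar> \<le> e / jb x ^ l" using d(2) one_plus_abs_pos[of x l] by (simp add: pos_le_divide_eq)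
    qed simp
    then show ?thesis using one_plus_abs_pos[of x l] by (simp add: pos_le_divide_eq)
  qed
  then show "\<exists>M. \<forall>m\<ge>M. \<forall>x. \<bar>(deriv ^^ k) (\<lambda>x. spline n (qi_coeff n (2 ^ m) phi) (2 ^ m * x)) x - ?u x\<bar> * jb x ^ l \<le> e" by blast
qed

lemma spline_infsum: "spline n c x = (\<Sum>\<^sub>\<infinity>k. c k * B_spline n (x - 1 * of_int k))"
proof -
  have "spline n c x = (\<Sum>\<^sub>\<infinity>k\<in>{\<lfloor>x\<rfloor> - int n..\<lfloor>x\<rfloor>}. c k * B_spline n (x - 1 * of_int k))" by (simp add: spline_def)
  also have "... = (\<Sum>\<^sub>\<infinity>k. c k * B_spline n (x - 1 * of_int k))"
    by (rule infsum_cong_neutral) (use B_spline_int_outside[of _ x n] in auto)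
  finally show ?thesis .
qed

lemma S_dual_qi:
  assumes f: "f \<in> S_dual (n - 1)" and phi: "phi \<in> S_space (n - 1)" and n: "n \<ge> 1" and a: "a > 0"
  shows "(\<lambda>N. \<Sum>k\<in>{- int N..int N}. qi_coeff n a phi k * f (\<lambda>x. B_spline n (a * x - of_int k)))
     \<longlonglongrightarrow> f (\<lambda>x. spline n (qi_coeff n a phi) (a * x))"
proof -
  have "rapid (\<lambda>x. phi (1 / a * x + 0))" using rapid_affine[OF S_space_rapid0[OF phi], of "1 / a" 0] a by simp
  moreover have "cont (\<lambda>x. phi (1 / a * x + 0))"
    using a by (auto intro!: continuous_on_compose2[OF S_space_continuous[OF phi, of UNIV]] continuous_intros)
  ultimately have r: "rapid_seq (qi_coeff n a phi)"
    using rapid_seq_inner[of "\<lambda>x. phi (1 / a * x + 0)" "B_spline (Suc n)"] cont_rapid_rapid[OF B_spline_cont_rapid[of "Suc n"]] B_spline_continuous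
    by (simp add: qi_coeff_def[abs_def])
  have "(\<lambda>x. spline n (qi_coeff n a phi) (a * (1 / a * x + 0))) \<in> S_space (n - 1)"
    using S_space_affine[OF qi_S_space[OF phi n a], of "1 / a" 0] a by simp
  then have s: "spline n (qi_coeff n a phi) \<in> S_space (n - 1)" using a by simp
  show ?thesis
    using S_dual_series[OF f r B_spline_S_space'[OF n] _ s spline_infsum, of a 0] a by simp
qed

text \<open>Quasi-interpolants converge in the test space and are rapidly convergent series of
  dyadic B-splines, so these B-splines determine a functional.\<close>

lemma S_dual_eqI:
  assumes f: "f \<in> S_dual (n - 1)" "g \<in> S_dual (n - 1)" and n: "n \<ge> 1"
    and eq: "!!J k. f (\<lambda>x. B_spline n (2 ^ J * x - of_int k)) = g (\<lambda>x. B_spline n (2 ^ J * x - of_int k))"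
  shows "f = g"
proof (rule extensionalityI)
  show "f \<in> extensional (S_space (n - 1))" "g \<in> extensional (S_space (n - 1))" using f by (auto simp: S_dual_def)
  fix phi assume phi: "phi \<in> S_space (n - 1)"
  have "f (\<lambda>x. spline n (qi_coeff n (2 ^ J) phi) (2 ^ J * x)) = g (\<lambda>x. spline n (qi_coeff n (2 ^ J) phi) (2 ^ J * x))" for J :: nat
    using S_dual_qi[OF f(1) phi n, of "2 ^ J"] S_dual_qi[OF f(2) phi n, of "2 ^ J"] by (intro LIMSEQ_unique) (auto simp: eq)
  moreover have "(\<lambda>J. h (\<lambda>x. spline n (qi_coeff n (2 ^ J) phi) (2 ^ J * x))) \<longlonglongrightarrow> h phi" if "h \<in> S_dual (n - 1)" for h
    by (rule S_dual_tendsto[OF that qi_S_space[OF phi n] phi qi_tendsto[OF phi n]]) simp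
  from this[OF f(1)] this[OF f(2)] calculation show "f phi = g phi" by (intro LIMSEQ_unique[of _ "f phi" "g phi"]) simp_all
qed

text \<open>The transpose of quasi-interpolation at scale \<open>a\<close>: values of
  \<open>f\<close> on B-splines of degree \<open>n\<close> become coefficients of a spline of degree
  \<open>n + 1\<close>. The leading \<open>a\<close> is the Jacobian.\<close>

definition spline_approx :: "nat => ((real => real) => real) => real => real => real" where
  "spline_approx n f a x = a * spline (Suc n) (\<lambda>k. f (\<lambda>x. B_spline n (a * x - of_int k))) (a * x)"

text \<open>A compactly supported \<open>phi\<close> meets only finitely many translates, so sum and
  integral are interchanged without any information on the growth of the coefficients.\<close>

lemma integral_spline_approx:
  assumes f: "f \<in> S_dual (n - 1)" and phi: "phi \<in> S_space (n - 1)" and n: "n \<ge> 1" and a: "a > 0"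
    and X: "!!x. \<bar>x\<bar> > X ==> phi x = 0"
  shows "(LI x. spline_approx n f a x * phi x) = f (\<lambda>x. spline n (qi_coeff n a phi) (a * x))"
proof -
  define b where "b k = f (\<lambda>x. B_spline n (a * x - of_int k))" for k :: int
  define c where "c = qi_coeff n a phi"
  \<comment> \<open>Large enough that for indices outside \<open>{- N0..N0}\<close> the dilated
    support of \<open>phi\<close> misses the translate, with room for the spline windows.\<close>
  obtain N0 :: nat where N0: "a * \<bar>X\<bar> + real n + 3 \<le> real N0" using real_arch_simple by blast
  have c0: "c k = 0" if k: "k \<notin> {- int N0..int N0}" for k
  proof -
    have "phi (x / a) * B_spline (Suc n) (x - of_int k) = 0" for x
    proof (cases "\<bar>x\<bar> \<le> a * \<bar>X\<bar>")
      case True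
      have "\<bar>real_of_int k\<bar> > real N0" using k by (auto simp: abs_if)
      then have "x - of_int k < 0 \<or> x - of_int k \<ge> real (Suc n) + 1" using True N0 by (auto simp: abs_if split: if_splits)
      then show ?thesis by (simp add: B_spline_outside)
    next
      case False
      then have "\<bar>x / a\<bar> > \<bar>X\<bar>" using a by (simp add: pos_less_divide_eq abs_divide mult.commute)
      then show ?thesis using X by simp
    qed
    then have "(\<lambda>x. phi (x / a) * B_spline (Suc n) (x - of_int k)) = (\<lambda>x. 0)" by blast
    then show ?thesis by (simp add: c_def qi_coeff_def)
  qed
  have i: "lint (\<lambda>x. phi x * (a * B_spline (Suc n) (a * x - of_int k)))" for k
  proof (rule loc_int_mult_continuous)
    show "loc_int phi" by (intro loc_int_continuous S_space_continuous[OF phi])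
    show "cont (\<lambda>x. a * B_spline (Suc n) (a * x - of_int k))"
      by (intro continuous_intros continuous_on_compose2[OF B_spline_continuous]) auto
    fix x assume x: "x \<notin> {of_int k / a..(of_int k + real n + 2) / a}"
    then have "a * x - of_int k < 0 \<or> a * x - of_int k \<ge> real (Suc n) + 1"
      using a by (auto simp: pos_le_divide_eq pos_divide_le_eq mult.commute)
    then show "a * B_spline (Suc n) (a * x - of_int k) = 0" by (simp add: B_spline_outside)
  qed
  have ck: "(LI x. phi x * (a * B_spline (Suc n) (a * x - of_int k))) = c k" for k
  proof -
    have "(LI x. phi (x / a) * B_spline (Suc n) (x - of_int k)) = a * (LI x. phi (a * x / a) * B_spline (Suc n) (a * x - of_int k))"
      using lebesgue_integral_real_affine[of a "\<lambda>x. phi (x / a) * B_spline (Suc n) (x - of_int k)" 0] a by simp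
    also have "... = (LI x. a * (phi x * B_spline (Suc n) (a * x - of_int k)))"
      using a by simp
    finally show ?thesis by (simp add: c_def qi_coeff_def mult.left_commute)
  qed
  have "spline_approx n f a x * phi x = (\<Sum>k\<in>{- int N0..int N0}. b k * (phi x * (a * B_spline (Suc n) (a * x - of_int k))))" for x
  proof (cases "\<bar>x\<bar> \<le> \<bar>X\<bar>")
    case True
    have "a * \<bar>x\<bar> \<le> a * \<bar>X\<bar>" using True a by (intro mult_left_mono) auto
    then have ax: "\<bar>a * x\<bar> + real n + 3 \<le> real N0" using N0 a by (simp add: abs_mult; linarith)
    have "{\<lfloor>a * x\<rfloor> - int (Suc n)..\<lfloor>a * x\<rfloor>} \<subseteq> {- int N0..int N0}"
      using ax floor_correct[of "a * x"] by (auto simp: abs_if split: if_splits; linarith)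
    then have "spline (Suc n) b (a * x) = (\<Sum>k\<in>{- int N0..int N0}. b k * B_spline (Suc n) (a * x - of_int k))"
      by (intro spline_eq_sum) auto
    then show ?thesis by (simp add: spline_approx_def b_def[abs_def] sum_distrib_left sum_distrib_right mult_ac)
  next
    case False
    then show ?thesis using X[of x] by simp
  qed
  then have "(LI x. spline_approx n f a x * phi x) = (\<Sum>k\<in>{- int N0..int N0}. b k * c k)"
    using i by (simp add: LI_sum ck)
  moreover have "(\<lambda>N. \<Sum>k\<in>{- int N..int N}. c k * b k) \<longlonglongrightarrow> (\<Sum>k\<in>{- int N0..int N0}. b k * c k)"
  proof (rule tendsto_eventually, unfold eventually_sequentially, intro exI[of _ N0] allI impI)
    fix N assume "N0 \<le> N"
    then have "(\<Sum>k\<in>{- int N..int N}. c k * b k) = (\<Sum>k\<in>{- int N0..int N0}. c k * b k)"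
      using c0 by (intro sum.mono_neutral_right) auto
    then show "(\<Sum>k\<in>{- int N..int N}. c k * b k) = (\<Sum>k\<in>{- int N0..int N0}. b k * c k)" by (simp add: mult.commute)
  qed
  moreover have "(\<lambda>N. \<Sum>k\<in>{- int N..int N}. c k * b k) \<longlonglongrightarrow> f (\<lambda>x. spline n c (a * x))"
    using S_dual_qi[OF f phi n a] by (simp add: c_def b_def)
  ultimately show ?thesis unfolding c_def[symmetric] by (simp only: LIMSEQ_unique)
qed

lemma integral_spline_approx_tendsto:
  assumes f: "f \<in> S_dual (n - 1)" and phi: "phi \<in> S_space (n - 1)" and n: "n \<ge> 1"
    and X: "!!x. \<bar>x\<bar> > X ==> phi x = 0"
  shows "(\<lambda>J. LI x. spline_approx n f (2 ^ J) x * phi x) \<longlonglongrightarrow> f phi"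
  using S_dual_tendsto[OF f qi_S_space[OF phi n] phi qi_tendsto[OF phi n]] by (simp add: integral_spline_approx[OF f phi n _ X])

section \<open>Convergent convex combinations of bounded sequences\<close>

text \<open>The square makes the weight integrable and, through the local masses, embeds
  \<open>L\<^sub>p\<close> for every \<open>p > 1\<close> in one weighted
  \<open>L\<^sub>1\<close>.\<close>

definition wt :: "real => real" where "wt x = 1 / jb x ^ 2"

lemma wt_pos: "wt x > 0" and wt_le_1: "wt x \<le> 1"
  using one_plus_abs_pos[of x 2] one_le_power[of "1 + \<bar>x\<bar>" 2] by (auto simp: wt_def divide_le_eq)

lemma integrable_wt: "lint wt" using integrable_weight by (simp add: wt_def[abs_def])

lemma integrable_wt_mult_bounded:
  assumes v: "lint (\<lambda>x. \<bar>v x\<bar> * wt x)" and f: "f \<in> lmeas" and b: "!!x. \<bar>f x\<bar> \<le> A + B * \<bar>v x\<bar>"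
  shows "lint (\<lambda>x. f x * wt x)"
proof (rule lint_bound)
  show "lint (\<lambda>x. A * wt x + B * (\<bar>v x\<bar> * wt x))" using v integrable_wt by simp
  show "(\<lambda>x. f x * wt x) \<in> lmeas" using f integrable_wt by (intro borel_measurable_times) auto
  show "AE x in lebesgue. norm (f x * wt x) \<le> norm (A * wt x + B * (\<bar>v x\<bar> * wt x))"
  proof (rule AE_I2)
    fix x
    have "\<bar>f x\<bar> * wt x \<le> (A + B * \<bar>v x\<bar>) * wt x" using b wt_pos[of x] by (intro mult_right_mono) auto
    then show "norm (f x * wt x) \<le> norm (A * wt x + B * (\<bar>v x\<bar> * wt x))"
      using wt_pos[of x] by (simp add: abs_mult distrib_right mult.assoc)
  qed
qed

lemma fun_bound_wt:
  assumes p: "1 < p" and v: "fun_bound p K v"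
  shows "lint (\<lambda>x. \<bar>v x\<bar> * wt x)" "(LI x. \<bar>v x\<bar> * wt x) \<le> 16 * (weight_const * K)"
proof -
  have e: "\<bar>v x\<bar> * wt x = \<bar>v x\<bar> / jb (x - 0) ^ 2" for x by (simp add: wt_def)
  show "lint (\<lambda>x. \<bar>v x\<bar> * wt x)" unfolding e by (rule weighted_integral(1)[OF p v, of 0 0]) simp
  have "(LI x. \<bar>v x\<bar> * wt x) \<le> 16 * mass_average v 0" unfolding e by (rule weighted_integral(2)[OF p v, of 0 0]) simp
  also have "... \<le> 16 * (weight_const * K)" using seq_bound_le[OF p seq_bound_mass_average(1)[OF p v], of 0] by simp
  finally show "(LI x. \<bar>v x\<bar> * wt x) \<le> 16 * (weight_const * K)" .
qed

text \<open>Convexity of the power keeps the constant unchanged, so that repeated midpoints of any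
  depth obey the same bound.\<close>

lemma fun_bound_midpoint:
  assumes p: "1 < p" and u: "fun_bound p K u" and v: "fun_bound p K v"
  shows "fun_bound p K (\<lambda>x. (u x + v x) / 2)"
proof -
  note m = fun_bound_measurable[OF u] fun_bound_measurable[OF v]
  have mm: "(\<lambda>x. (u x + v x) / 2) \<in> lmeas" using m by simp
  show ?thesis
  proof (cases "p = \<infinity>")
    case True
    have "AE x in lebesgue. \<bar>u x\<bar> \<le> K" "AE x in lebesgue. \<bar>v x\<bar> \<le> K" using u v True by (auto simp: fun_bound_def)
    then have "AE x in lebesgue. \<bar>(u x + v x) / 2\<bar> \<le> K" 
    proof eventually_elim
      case (elim x)
      then show ?case using abs_triangle_ineq[of "u x" "v x"] by simp
    qed
    then show ?thesis using True mm fun_bound_nonneg[OF u] by (simp add: fun_bound_def)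
  next
    case False
    define q where "q = enn2real p"
    have q: "q > 1" unfolding q_def by (rule enn2real_gt_1[OF p False])
    have pw: "\<bar>(u x + v x) / 2\<bar> powr q \<le> 1/2 * \<bar>u x\<bar> powr q + 1/2 * \<bar>v x\<bar> powr q" for x
    proof -
      have "\<bar>(u x + v x) / 2\<bar> powr q \<le> (1/2 * \<bar>u x\<bar> + 1/2 * \<bar>v x\<bar>) powr q" using q by (intro powr_mono2) auto
      also have "... \<le> 1/2 * \<bar>u x\<bar> powr q + 1/2 * \<bar>v x\<bar> powr q" by (rule powr_convex_comb[OF q]) auto
      finally show ?thesis .
    qed
    have "(\<integral>\<^sup>+x. ennreal (\<bar>(u x + v x) / 2\<bar> powr q) \<partial>lebesgue)
        \<le> (\<integral>\<^sup>+x. ennreal (1/2) * ennreal (\<bar>u x\<bar> powr q) + ennreal (1/2) * ennreal (\<bar>v x\<bar> powr q) \<partial>lebesgue)"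
    proof (rule nn_integral_mono)
      fix x
      have "ennreal (\<bar>(u x + v x) / 2\<bar> powr q) \<le> ennreal (1/2 * \<bar>u x\<bar> powr q + 1/2 * \<bar>v x\<bar> powr q)" by (rule ennreal_leI[OF pw])
      also have "... = ennreal (1/2 * \<bar>u x\<bar> powr q) + ennreal (1/2 * \<bar>v x\<bar> powr q)" by (intro ennreal_plus) auto
      finally show "ennreal (\<bar>(u x + v x) / 2\<bar> powr q) \<le> ennreal (1/2) * ennreal (\<bar>u x\<bar> powr q) + ennreal (1/2) * ennreal (\<bar>v x\<bar> powr q)"
        by (simp only: ennreal_mult'[of "1/2"] divide_nonneg_nonneg zero_le_one zero_le_numeral)
    qed
    also have "... = ennreal (1/2) * (\<integral>\<^sup>+x. ennreal (\<bar>u x\<bar> powr q) \<partial>lebesgue) + ennreal (1/2) * (\<integral>\<^sup>+x. ennreal (\<bar>v x\<bar> powr q) \<partial>lebesgue)"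
      using m by (simp add: nn_integral_add nn_integral_cmult)
    also have "... \<le> ennreal (1/2) * ennreal (K powr q) + ennreal (1/2) * ennreal (K powr q)"
      using u v False by (intro add_mono mult_left_mono) (auto simp: fun_bound_def q_def)
    also have "... = (ennreal (1/2) + ennreal (1/2)) * ennreal (K powr q)" by (simp only: distrib_right)
    also have "ennreal (1/2) + ennreal (1/2) = 1" by (subst ennreal_plus[symmetric]) (auto simp del: ennreal_plus)
    finally show ?thesis using False mm fun_bound_nonneg[OF u] by (simp add: fun_bound_def q_def)
  qed
qed

lemma fun_bound_limit_AE:
  assumes p: "1 < p" and v: "!!i. fun_bound p K (v i)" and F: "F \<in> lmeas"
    and lim: "AE x in lebesgue. (\<lambda>i::nat. v i x) \<longlonglongrightarrow> F x"
  shows "fun_bound p K F"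
proof (cases "p = \<infinity>")
  case True
  have "AE x in lebesgue. \<forall>i. \<bar>v i x\<bar> \<le> K" using v True by (subst AE_all_countable) (auto simp: fun_bound_def)
  with lim have "AE x in lebesgue. \<bar>F x\<bar> \<le> K"
  proof eventually_elim
    case (elim x)
    then show ?case by (intro LIMSEQ_le_const2[OF tendsto_rabs[OF elim(1)]]) auto
  qed
  then show ?thesis using True F fun_bound_nonneg[OF v] by (simp add: fun_bound_def)
next
  case False
  define q where "q = enn2real p"
  have q: "q > 1" unfolding q_def by (rule enn2real_gt_1[OF p False])
  have "(\<integral>\<^sup>+x. ennreal (\<bar>F x\<bar> powr q) \<partial>lebesgue) = (\<integral>\<^sup>+x. liminf (\<lambda>i. ennreal (\<bar>v i x\<bar> powr q)) \<partial>lebesgue)"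
  proof (rule nn_integral_cong_AE, use lim in eventually_elim)
    case (elim x)
    have "(\<lambda>i. \<bar>v i x\<bar> powr q) \<longlonglongrightarrow> \<bar>F x\<bar> powr q" using q by (intro tendsto_powr' tendsto_rabs elim tendsto_const) auto
    then show ?case by (intro lim_imp_Liminf[symmetric] tendsto_ennrealI) auto
  qed
  also have "... \<le> liminf (\<lambda>i. \<integral>\<^sup>+x. ennreal (\<bar>v i x\<bar> powr q) \<partial>lebesgue)"
    using fun_bound_measurable[OF v] by (intro nn_integral_liminf) simp
  also have "... \<le> ennreal (K powr q)"
    by (rule Liminf_le) (use v False in \<open>auto simp: fun_bound_def q_def\<close>)
  finally show ?thesis using False F fun_bound_nonneg[OF v] by (simp add: fun_bound_def q_def)
qed

text \<open>Where |v| > R one has |v| <= R^(1-q) |v|^q, and the factor tends to 0 because q > 1. For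
  the infinite exponent any level above \<open>K\<close> will do.\<close>

lemma fun_bound_uniformly_integrable:
  assumes p: "1 < p" and e: "e > 0"
  obtains R where "R \<ge> 1" "!!v. fun_bound p K v ==> (LI x. (if \<bar>v x\<bar> > R then \<bar>v x\<bar> else 0) * wt x) \<le> e"
proof (cases "p = \<infinity>")
  case True
  show ?thesis
  proof (rule that[of "max 1 K"])
    fix v assume v: "fun_bound p K v"
    have "AE x in lebesgue. \<bar>v x\<bar> \<le> K" using v True by (simp add: fun_bound_def)
    then have "AE x in lebesgue. (if \<bar>v x\<bar> > max 1 K then \<bar>v x\<bar> else 0) * wt x = 0" by eventually_elim auto
    then show "(LI x. (if \<bar>v x\<bar> > max 1 K then \<bar>v x\<bar> else 0) * wt x) \<le> e"
      using integral_eq_zero_AE e by (metis less_imp_le)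
  qed simp
next
  case False
  define q where "q = enn2real p"
  have q: "q > 1" unfolding q_def by (rule enn2real_gt_1[OF p False])
  have "((\<lambda>R. R powr (1 - q) * K powr q) \<longlongrightarrow> 0) at_top" using q by real_asymp
  then have "\<forall>\<^sub>F R in at_top. R powr (1 - q) * K powr q < e \<and> R \<ge> 1"
    by (intro eventually_conj order_tendstoD(2)[OF _ e] eventually_ge_at_top)
  then obtain R where R: "R powr (1 - q) * K powr q < e" "R \<ge> 1" by (auto simp: eventually_at_top_linorder)
  show ?thesis
  proof (rule that[OF R(2)])
    fix v assume v: "fun_bound p K v"
    have pw: "(if \<bar>v x\<bar> > R then \<bar>v x\<bar> else 0) * wt x \<le> R powr (1 - q) * \<bar>v x\<bar> powr q" for x
    proof (cases "\<bar>v x\<bar> > R")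
      case True
      have "\<bar>v x\<bar> * wt x \<le> \<bar>v x\<bar> * 1" using wt_le_1 by (intro mult_left_mono) auto
      also have "... = \<bar>v x\<bar> powr (1 - q) * \<bar>v x\<bar> powr q" using True R(2) by (simp flip: powr_add)
      also have "... \<le> R powr (1 - q) * \<bar>v x\<bar> powr q" using True R(2) q by (intro mult_right_mono powr_mono2') auto
      finally show ?thesis using True by simp
    qed simp
    have "(\<integral>\<^sup>+x. ennreal ((if \<bar>v x\<bar> > R then \<bar>v x\<bar> else 0) * wt x) \<partial>lebesgue)
       \<le> (\<integral>\<^sup>+x. ennreal (R powr (1 - q)) * ennreal (\<bar>v x\<bar> powr q) \<partial>lebesgue)"
      using pw by (intro nn_integral_mono) (simp add: ennreal_leI flip: ennreal_mult)
    also have "... = ennreal (R powr (1 - q)) * (\<integral>\<^sup>+x. ennreal (\<bar>v x\<bar> powr q) \<partial>lebesgue)"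
      using fun_bound_measurable[OF v] by (intro nn_integral_cmult) simp
    also have "... \<le> ennreal (R powr (1 - q)) * ennreal (K powr q)"
      using v False by (intro mult_left_mono) (auto simp: fun_bound_def q_def)
    also have "... \<le> ennreal e" using R(1) by (simp flip: ennreal_mult add: ennreal_leI)
    finally show "(LI x. (if \<bar>v x\<bar> > R then \<bar>v x\<bar> else 0) * wt x) \<le> e"
      by (intro integral_real_bounded) (use e in auto)
  qed
qed

text \<open>Strictly convex, so that midpoints lower the energy, yet of linear growth, so that the
  energy is finite on the whole weighted \<open>L\<^sub>1\<close>, whatever \<open>p\<close>
  is.\<close>

definition hyp :: "real => real" where "hyp t = sqrt (1 + t\<^sup>2)"

definition convexity_gap :: "real => real => real" where
  "convexity_gap a b = hyp a + hyp b - 2 * hyp ((a + b) / 2)"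

lemma hyp_bounds: "hyp t \<ge> 1" "hyp t \<le> 1 + \<bar>t\<bar>"
proof -
  show "hyp t \<ge> 1" by (simp add: hyp_def)
  have "1 + t\<^sup>2 \<le> (jb t)\<^sup>2" by (simp add: power2_sum)
  then show "hyp t \<le> 1 + \<bar>t\<bar>" unfolding hyp_def by (intro real_le_lsqrt) auto
qed

text \<open>Let A, B be the values at the end points, S twice the value at the midpoint and d = A B
  - 1 - a b. Multiplying the gap A + B - S by A + B + S gives 2 d, while (a - b)^2 = d (A B + 1 + a
  b). Eliminating d bounds the squared distance by the gap.\<close>

lemma convexity_gap:
  "convexity_gap a b \<ge> 0" "(a - b)\<^sup>2 \<le> 2 * hyp a * hyp b * (hyp a + hyp b) * convexity_gap a b"
proof -
  define A B S d where "A = hyp a" and "B = hyp b" and "S = 2 * hyp ((a + b) / 2)" and "d = A * B - (1 + a * b)"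
  have AB: "A \<ge> 1" "B \<ge> 1" by (auto simp: A_def B_def hyp_bounds)
  have S: "S \<ge> 0" using hyp_bounds(1)[of "(a + b) / 2"] by (simp add: S_def)
  have A2: "A\<^sup>2 = 1 + a\<^sup>2" and B2: "B\<^sup>2 = 1 + b\<^sup>2" and S2: "S\<^sup>2 = 4 + (a + b)\<^sup>2"
    by (simp_all add: A_def B_def S_def hyp_def power_mult_distrib power_divide add_nonneg_nonneg)
  have sq: "(a - b)\<^sup>2 = (A * B)\<^sup>2 - (1 + a * b)\<^sup>2" unfolding power_mult_distrib A2 B2 by (simp add: power2_eq_square algebra_simps)
  have "(1 + a * b)\<^sup>2 \<le> (A * B)\<^sup>2" using sq zero_le_power2[of "a - b"] by linarith
  then have d0: "d \<ge> 0" unfolding d_def using power2_le_imp_le[of "1 + a * b" "A * B"] AB by simp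
  have g: "(A + B - S) * (A + B + S) = 2 * d"
  proof -
    have "(A + B - S) * (A + B + S) = A\<^sup>2 + B\<^sup>2 + 2 * (A * B) - S\<^sup>2" by (simp add: power2_eq_square algebra_simps)
    also have "... = 2 * d" unfolding A2 B2 S2 d_def by (simp add: power2_eq_square algebra_simps)
    finally show ?thesis .
  qed
  have g0: "A + B - S \<ge> 0"
  proof (rule ccontr)
    assume "\<not> A + B - S \<ge> 0"
    then have "(A + B - S) * (A + B + S) < 0" using AB S by (intro mult_neg_pos) auto
    then show False using g d0 by simp
  qed
  then show "convexity_gap a b \<ge> 0" by (simp add: convexity_gap_def A_def B_def S_def)
  have "2 * d \<le> (A + B - S) * (2 * (A + B))" unfolding g[symmetric] using g0 by (intro mult_left_mono) auto
  then have dle: "d \<le> (A + B - S) * (A + B)" by (simp add: algebra_simps)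
  have "(a - b)\<^sup>2 = d * (A * B + (1 + a * b))" unfolding sq d_def by (simp add: power2_eq_square algebra_simps)
  also have "... \<le> d * (2 * (A * B))" using d0 by (intro mult_left_mono) (auto simp: d_def)
  also have "... \<le> ((A + B - S) * (A + B)) * (2 * (A * B))" using dle AB by (intro mult_right_mono) auto
  finally show "(a - b)\<^sup>2 \<le> 2 * hyp a * hyp b * (hyp a + hyp b) * convexity_gap a b"
    unfolding convexity_gap_def A_def[symmetric] B_def[symmetric] S_def[symmetric] by (simp only: mult_ac)
qed

text \<open>The convexity of \<open>hyp\<close> degenerates at infinity, so values above
  \<open>R\<close> are set aside. Below \<open>R\<close> each factor \<open>hyp\<close> is at most
  \<open>2 * R\<close>, whence \<open>32 * R ^ 3\<close>, and t <= e + t^2 / e for t >= 0 passes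
  from the square to the first power.\<close>

lemma abs_diff_le_convexity_gap:
  assumes R: "R \<ge> 1" and e: "e > 0"
  shows "\<bar>a - b\<bar> \<le> e + (32 * R ^ 3 / e) * convexity_gap a b
     + 2 * ((if \<bar>a\<bar> > R then \<bar>a\<bar> else 0) + (if \<bar>b\<bar> > R then \<bar>b\<bar> else 0))"
proof (cases "\<bar>a\<bar> > R \<or> \<bar>b\<bar> > R")
  case True
  have "0 \<le> (32 * R ^ 3 / e) * convexity_gap a b" using R e convexity_gap(1) by (intro mult_nonneg_nonneg) auto
  then show ?thesis using True e by (auto simp: abs_if split: if_splits)
next
  case False
  have h: "0 \<le> hyp a" "0 \<le> hyp b" "hyp a \<le> 2 * R" "hyp b \<le> 2 * R"
    using hyp_bounds[of a] hyp_bounds[of b] False R by linarith+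
  have "(a - b)\<^sup>2 \<le> 2 * hyp a * hyp b * (hyp a + hyp b) * convexity_gap a b" by (rule convexity_gap)
  also have "... \<le> 2 * (2 * R) * (2 * R) * (2 * R + 2 * R) * convexity_gap a b"
    using h R convexity_gap(1) by (intro mult_mono add_mono order_refl mult_nonneg_nonneg add_nonneg_nonneg) auto
  also have "... = 32 * R ^ 3 * convexity_gap a b" by (simp add: power3_eq_cube)
  finally have sq: "(a - b)\<^sup>2 \<le> 32 * R ^ 3 * convexity_gap a b" .
  have "\<bar>a - b\<bar> \<le> e + (a - b)\<^sup>2 / e"
  proof (cases "\<bar>a - b\<bar> \<le> e")
    case False
    then have "\<bar>a - b\<bar> * e \<le> \<bar>a - b\<bar> * \<bar>a - b\<bar>" by (intro mult_left_mono) auto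
    then have "\<bar>a - b\<bar> * e \<le> (a - b)\<^sup>2" by (simp add: power2_eq_square)
    then show ?thesis using e by (simp add: pos_le_divide_eq add_increasing)
  qed (use e in \<open>simp add: add_increasing2\<close>)
  also have "(a - b)\<^sup>2 / e \<le> 32 * R ^ 3 * convexity_gap a b / e" using sq e by (intro divide_right_mono) auto
  finally show ?thesis using False by simp
qed

text \<open>Pairs keep a spline approximation together with its top derivative, so that both undergo
  the same convex combination. The convexity argument compares two elements only with their
  midpoint, so dyadic combinations are enough.\<close>

inductive_set midpoint_hull :: "(nat => (real => real) \<times> (real => real)) => nat => ((real => real) \<times> (real => real)) set"
  for s N where
  base: "J \<ge> N ==> s J \<in> midpoint_hull s N"
| mid: "t \<in> midpoint_hull s N ==> t' \<in> midpoint_hull s N ==>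
    (\<lambda>x. (fst t x + fst t' x) / 2, \<lambda>x. (snd t x + snd t' x) / 2) \<in> midpoint_hull s N"

lemma midpoint_hull_antimono: "N \<le> M ==> midpoint_hull s M \<subseteq> midpoint_hull s N"
proof
  fix t assume "N \<le> M" "t \<in> midpoint_hull s M"
  from this(2,1) show "t \<in> midpoint_hull s N"
    by (induction rule: midpoint_hull.induct) (auto intro: midpoint_hull.intros)
qed

definition energy :: "(real => real) => real" where "energy v = (LI x. hyp (v x) * wt x)"

lemma energy:
  assumes p: "1 < p" and v: "fun_bound p K v"
  shows "lint (\<lambda>x. hyp (v x) * wt x)" "0 \<le> energy v" "energy v \<le> (LI x. wt x) + 16 * (weight_const * K)"
proof -
  show i: "lint (\<lambda>x. hyp (v x) * wt x)"
    by (rule integrable_wt_mult_bounded[OF fun_bound_wt(1)[OF p v], of _ 1 1])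
       (use fun_bound_measurable[OF v] hyp_bounds in \<open>auto simp: hyp_def abs_of_nonneg\<close>)
  show "0 \<le> energy v" unfolding energy_def using wt_pos hyp_bounds(1)
    by (intro integral_nonneg_AE AE_I2 mult_nonneg_nonneg) (auto intro: less_imp_le order_trans[of 0 1])
  have "energy v \<le> (LI x. wt x + \<bar>v x\<bar> * wt x)" unfolding energy_def
  proof (rule integral_mono[OF i])
    show "lint (\<lambda>x. wt x + \<bar>v x\<bar> * wt x)" using integrable_wt fun_bound_wt(1)[OF p v] by simp
    show "hyp (v x) * wt x \<le> wt x + \<bar>v x\<bar> * wt x" for x
      using mult_right_mono[OF hyp_bounds(2)[of "v x"], of "wt x"] wt_pos[of x] by (simp add: distrib_right)
  qed
  also have "... = (LI x. wt x) + (LI x. \<bar>v x\<bar> * wt x)" using integrable_wt fun_bound_wt(1)[OF p v] by simp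
  finally show "energy v \<le> (LI x. wt x) + 16 * (weight_const * K)" using fun_bound_wt(2)[OF p v] by simp
qed

lemma integrable_convexity_gap:
  assumes p: "1 < p" and u: "fun_bound p K u" and v: "fun_bound p K v"
  shows "lint (\<lambda>x. convexity_gap (u x) (v x) * wt x)"
    and "(LI x. convexity_gap (u x) (v x) * wt x) = energy u + energy v - 2 * energy (\<lambda>x. (u x + v x) / 2)"
  using energy(1)[OF p u] energy(1)[OF p v] energy(1)[OF p fun_bound_midpoint[OF p u v]]
  by (simp_all add: convexity_gap_def energy_def left_diff_distrib distrib_right mult.assoc)

text \<open>Uniform convexity of the energy on bounded sets of \<open>L\<^sub>p\<close>, measured in
  weighted \<open>L\<^sub>1\<close>: \<open>dl\<close> is the same for all \<open>u\<close> and
  \<open>v\<close> with bound \<open>K\<close>.\<close>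

lemma L1_wt_diff_le_energy:
  assumes p: "1 < p" and e: "e > 0"
  shows "\<exists>dl>0. \<forall>u v. fun_bound p K u --> fun_bound p K v -->
    energy u + energy v - 2 * energy (\<lambda>x. (u x + v x) / 2) \<le> dl --> (LI x. \<bar>u x - v x\<bar> * wt x) \<le> e"
proof -
  define W where "W = (LI x. wt x)"
  have W: "W \<ge> 0" unfolding W_def by (intro integral_nonneg_AE AE_I2) (simp add: wt_pos less_imp_le)
  \<comment> \<open>Shares of \<open>e\<close>: at most a quarter for \<open>eta\<close> times the
    total weight, a quarter for the gap through the final choice of \<open>dl\<close>, and
    \<open>e / 8\<close> for each of the two truncated tails, which count twice.\<close>
  define eta where "eta = e / (4 * (W + 1))"
  have eta: "eta > 0" using e W by (simp add: eta_def)
  obtain R where R: "R \<ge> 1" "!!v. fun_bound p K v ==> (LI x. (if \<bar>v x\<bar> > R then \<bar>v x\<bar> else 0) * wt x) \<le> e / 8"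
    using fun_bound_uniformly_integrable[OF p, of "e / 8" K] e by auto
  define D where "D = 32 * R ^ 3 / eta"
  have D: "D > 0" using R(1) eta by (simp add: D_def)
  have "(LI x. \<bar>u x - v x\<bar> * wt x) \<le> e"
    if u: "fun_bound p K u" and v: "fun_bound p K v" and gap: "energy u + energy v - 2 * energy (\<lambda>x. (u x + v x) / 2) \<le> e / (4 * D)" for u v
  proof -
    let ?t = "\<lambda>a. if \<bar>a\<bar> > R then \<bar>a\<bar> else (0::real)"
    have it: "lint (\<lambda>x. ?t (v x) * wt x)" if v: "fun_bound p K v" for v
      by (rule integrable_wt_mult_bounded[OF fun_bound_wt(1)[OF p v], of _ 0 1]) (use fun_bound_measurable[OF v] in auto)
    have iuv: "lint (\<lambda>x. \<bar>u x - v x\<bar> * wt x)"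
    proof (rule lint_bound)
      show "lint (\<lambda>x. \<bar>u x\<bar> * wt x + \<bar>v x\<bar> * wt x)" using fun_bound_wt(1)[OF p u] fun_bound_wt(1)[OF p v] by simp
      show "(\<lambda>x. \<bar>u x - v x\<bar> * wt x) \<in> lmeas"
        using fun_bound_measurable[OF u] fun_bound_measurable[OF v] integrable_wt by (intro borel_measurable_times) auto
      have "\<bar>u x - v x\<bar> * wt x \<le> (\<bar>u x\<bar> + \<bar>v x\<bar>) * wt x" for x using wt_pos[of x] by (intro mult_right_mono) auto
      then show "AE x in lebesgue. norm (\<bar>u x - v x\<bar> * wt x) \<le> norm (\<bar>u x\<bar> * wt x + \<bar>v x\<bar> * wt x)"
        using wt_pos by (intro AE_I2) (simp add: abs_mult distrib_right less_imp_le)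
    qed
    note ig = integrable_convexity_gap[OF p u v]
    have "(LI x. \<bar>u x - v x\<bar> * wt x) \<le> (LI x. eta * wt x + D * (convexity_gap (u x) (v x) * wt x) + 2 * (?t (u x) * wt x + ?t (v x) * wt x))"
    proof (rule integral_mono[OF iuv])
      show "lint (\<lambda>x. eta * wt x + D * (convexity_gap (u x) (v x) * wt x) + 2 * (?t (u x) * wt x + ?t (v x) * wt x))"
        by (intro lint_add integrable_mult_right integrable_wt ig(1) it u v)
      show "\<bar>u x - v x\<bar> * wt x \<le> eta * wt x + D * (convexity_gap (u x) (v x) * wt x) + 2 * (?t (u x) * wt x + ?t (v x) * wt x)" for x
        using mult_right_mono[OF abs_diff_le_convexity_gap[OF R(1) eta, of "u x" "v x"], of "wt x"] wt_pos[of x]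
        by (simp only: D_def distrib_right distrib_left mult.assoc less_imp_le)
    qed
    also have "... = eta * W + D * (LI x. convexity_gap (u x) (v x) * wt x) + 2 * ((LI x. ?t (u x) * wt x) + (LI x. ?t (v x) * wt x))"
      unfolding W_def using integrable_wt ig(1) it[OF u] it[OF v] by simp
    also have "... \<le> e / 4 + e / 4 + 2 * (e / 8 + e / 8)"
    proof (intro add_mono mult_left_mono R u v)
      have "eta * W \<le> eta * (W + 1)" using eta by simp
      also have "... = e / 4" using W by (simp add: eta_def field_simps)
      finally show "eta * W \<le> e / 4" .
      have "D * (LI x. convexity_gap (u x) (v x) * wt x) \<le> D * (e / (4 * D))" unfolding ig(2) using gap D by (intro mult_left_mono) auto
      then show "D * (LI x. convexity_gap (u x) (v x) * wt x) \<le> e / 4" using D by simp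
    qed simp
    also have "... = e" by simp
    finally show ?thesis .
  qed
  moreover have "e / (4 * D) > 0" using e D by simp
  ultimately show ?thesis by blast
qed

text \<open>Riesz-Fischer for the weighted norm: a subsequence converges almost everywhere, and the
  positive weight is divided out pointwise. Fatou's lemma carries both the \<open>L\<^sub>p\<close>
  bound and the Cauchy estimate to the limit.\<close>

lemma L1_wt_complete:
  assumes p: "1 < p" and v: "!!N. fun_bound p K (v N)"
    and C: "!!e. e > 0 ==> \<exists>N0. \<forall>N\<ge>N0. \<forall>M\<ge>N. (LI x. \<bar>v N x - v M x\<bar> * wt x) \<le> e"
  shows "\<exists>F. fun_bound p K F \<and> (\<lambda>N. LI x. \<bar>v N x - F x\<bar> * wt x) \<longlonglongrightarrow> 0"
proof -
  have m: "v N \<in> lmeas" for N by (rule fun_bound_measurable[OF v])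
  have wm: "wt \<in> lmeas" using integrable_wt by auto
  have i: "lint (\<lambda>x. v N x * wt x)" for N
    by (rule integrable_wt_mult_bounded[OF fun_bound_wt(1)[OF p v[of N]] m[of N], of 0 1]) simp
  have dn: "norm (v N x * wt x - v M x * wt x) = \<bar>v N x - v M x\<bar> * wt x" for N M x
    using wt_pos[of x] by (simp add: abs_mult flip: left_diff_distrib)
  have cau: "\<exists>N0. \<forall>i\<ge>N0. \<forall>j\<ge>N0. (LI x. norm (v i x * wt x - v j x * wt x)) < e" if e: "e > 0" for e
  proof -
    obtain N0 where N0: "!!N M. N \<ge> N0 ==> M \<ge> N ==> (LI x. \<bar>v N x - v M x\<bar> * wt x) \<le> e / 2" using C[of "e / 2"] e by auto
    have "(LI x. norm (v i x * wt x - v j x * wt x)) < e" if ij: "i \<ge> N0" "j \<ge> N0" for i j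
      using N0[of i j] N0[of j i] ij e unfolding dn by (cases "i \<le> j") (auto simp: abs_minus_commute)
    then show ?thesis by blast
  qed
  obtain r where r: "strict_mono r" "AE x in lebesgue. Cauchy (\<lambda>i. v (r i) x * wt x)"
    by (rule cauchy_L1_AE_cauchy_subseq[of lebesgue "\<lambda>N x. v N x * wt x", OF i cau])
  define F where "F x = lim (\<lambda>i. v (r i) x)" for x
  have F: "F \<in> lmeas" unfolding F_def[abs_def] by (rule borel_measurable_lim_metric) (rule m)
  have lim: "AE x in lebesgue. (\<lambda>i. v (r i) x) \<longlonglongrightarrow> F x"
    using r(2)
  proof eventually_elim
    case (elim x)
    then obtain l where "(\<lambda>i. v (r i) x * wt x) \<longlonglongrightarrow> l" unfolding Cauchy_convergent_iff convergent_def by blast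
    then have "(\<lambda>i. v (r i) x * wt x * (1 / wt x)) \<longlonglongrightarrow> l * (1 / wt x)" by (rule tendsto_mult) simp
    then have "(\<lambda>i. v (r i) x) \<longlonglongrightarrow> l * (1 / wt x)" using wt_pos[of x] by simp
    then show ?case unfolding F_def using limI by metis
  qed
  have Fb: "fun_bound p K F" by (rule fun_bound_limit_AE[OF p v F lim])
  have "\<exists>N0. \<forall>N\<ge>N0. norm ((LI x. \<bar>v N x - F x\<bar> * wt x) - 0) < e" if e: "e > 0" for e
  proof -
    obtain N0 where N0: "!!N M. N \<ge> N0 ==> M \<ge> N ==> (LI x. \<bar>v N x - v M x\<bar> * wt x) \<le> e / 2" using C[of "e / 2"] e by auto
    have "(LI x. \<bar>v N x - F x\<bar> * wt x) \<le> e / 2" if N: "N \<ge> N0" for N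
    proof (rule integral_real_bounded)
      have "(\<integral>\<^sup>+x. ennreal (\<bar>v N x - F x\<bar> * wt x) \<partial>lebesgue) = (\<integral>\<^sup>+x. liminf (\<lambda>i. ennreal (\<bar>v N x - v (r i) x\<bar> * wt x)) \<partial>lebesgue)"
      proof (rule nn_integral_cong_AE, use lim in eventually_elim)
        case (elim x)
        have "(\<lambda>i. \<bar>v N x - v (r i) x\<bar> * wt x) \<longlonglongrightarrow> \<bar>v N x - F x\<bar> * wt x" by (intro tendsto_intros elim)
        then show ?case by (intro lim_imp_Liminf[symmetric] tendsto_ennrealI) auto
      qed
      also have "... \<le> liminf (\<lambda>i. \<integral>\<^sup>+x. ennreal (\<bar>v N x - v (r i) x\<bar> * wt x) \<partial>lebesgue)"
        using m wm by (intro nn_integral_liminf) simp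
      also have "... \<le> ennreal (e / 2)"
      proof (rule Liminf_le)
        have "(\<integral>\<^sup>+x. ennreal (\<bar>v N x - v (r i) x\<bar> * wt x) \<partial>lebesgue) \<le> ennreal (e / 2)" if "i \<ge> N" for i
        proof -
          have "lint (\<lambda>x. norm (v N x * wt x - v (r i) x * wt x))" using i by (intro integrable_norm) simp
          then have "(\<integral>\<^sup>+x. ennreal (\<bar>v N x - v (r i) x\<bar> * wt x) \<partial>lebesgue) = ennreal (LI x. \<bar>v N x - v (r i) x\<bar> * wt x)"
            unfolding dn using wt_pos by (intro nn_integral_eq_integral) (auto simp: less_imp_le)
          also have "... \<le> ennreal (e / 2)" using N0[OF N, of "r i"] seq_suble[OF r(1), of i] that by (intro ennreal_leI) simp
          finally show ?thesis .
        qed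
        then show "\<forall>\<^sub>F i in sequentially. (\<integral>\<^sup>+x. ennreal (\<bar>v N x - v (r i) x\<bar> * wt x) \<partial>lebesgue) \<le> ennreal (e / 2)"
          unfolding eventually_sequentially by blast
      qed simp
      finally show "(\<integral>\<^sup>+x. ennreal (\<bar>v N x - F x\<bar> * wt x) \<partial>lebesgue) \<le> ennreal (e / 2)" .
    qed (use e in simp)
    moreover have "(LI x. \<bar>v N x - F x\<bar> * wt x) \<ge> 0" for N
      using wt_pos by (intro integral_nonneg_AE AE_I2 mult_nonneg_nonneg) (auto simp: less_imp_le)
    ultimately show ?thesis using e by (intro exI[of _ N0]) (auto intro: le_less_trans[of _ "e / 2"])
  qed
  then have "(\<lambda>N. LI x. \<bar>v N x - F x\<bar> * wt x) \<longlonglongrightarrow> 0" unfolding LIMSEQ_iff by blast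
  then show ?thesis using Fb by blast
qed

lemma midpoint_hull_fun_bound:
  assumes p: "1 < p" and s: "!!J. fun_bound p K (snd (s J))" and t: "t \<in> midpoint_hull s N"
  shows "fun_bound p K (snd t)"
  using t by induction (auto intro: s fun_bound_midpoint[OF p])

text \<open>A Komlos-type argument: near-minimisers of a uniformly convex energy over the hulls of the tails form a
  Cauchy sequence, because midpoints stay in the hull. This replaces weak compactness.\<close>
lemma midpoint_hull_limit:
  assumes p: "1 < p" and s: "!!J. fun_bound p K (snd (s J))"
  shows "\<exists>t F. (\<forall>N. t N \<in> midpoint_hull s N) \<and> fun_bound p K F \<and> (\<lambda>N. LI x. \<bar>snd (t N) x - F x\<bar> * wt x) \<longlonglongrightarrow> 0"
proof -
  define En where "En N = (\<lambda>t. energy (snd t)) ` midpoint_hull s N" for N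
  note fb = midpoint_hull_fun_bound[OF p s]
  have ne: "En N \<noteq> {}" and mem: "energy (snd (s N)) \<in> En N" for N
    using midpoint_hull.base[of N N s] by (auto simp: En_def)
  have bb: "bdd_below (En N)" for N by (rule bdd_belowI[of _ 0]) (auto simp: En_def intro: energy(2)[OF p fb])
  have inc: "incseq (\<lambda>N. Inf (En N))"
    unfolding En_def by (intro monoI cInf_superset_mono ne[unfolded En_def] bb[unfolded En_def] image_mono midpoint_hull_antimono)
  have ub: "Inf (En N) \<le> (LI x. wt x) + 16 * (weight_const * K)" for N
    using cInf_lower[OF mem bb] energy(3)[OF p s, of N] by (rule order_trans)
  obtain L where L: "(\<lambda>N. Inf (En N)) \<longlonglongrightarrow> L" "!!N. Inf (En N) \<le> L"
    using incseq_convergent[OF inc, of "(LI x. wt x) + 16 * (weight_const * K)"] ub by metis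
  have "\<exists>t\<in>midpoint_hull s N. energy (snd t) < Inf (En N) + 1 / real (Suc N)" for N
    using cInf_lessD[OF ne[of N], of "Inf (En N) + 1 / real (Suc N)"] by (auto simp: En_def)
  then obtain t where t: "!!N. t N \<in> midpoint_hull s N" "!!N. energy (snd (t N)) < Inf (En N) + 1 / real (Suc N)" by metis
  \<comment> \<open>Both elements lie in the hull of the tail from \<open>N\<close>, hence so does
    their midpoint, whose energy is at least the infimum there. The infima increase to
    \<open>L\<close>, so the right-hand side tends to 0.\<close>
  have gap: "energy (snd (t N)) + energy (snd (t M)) - 2 * energy (\<lambda>x. (snd (t N) x + snd (t M) x) / 2) \<le> (L - Inf (En N)) + 2 * (1 / real (Suc N))"
    if "N \<le> M" for N M
  proof -
    have "t M \<in> midpoint_hull s N" using t(1)[of M] midpoint_hull_antimono[OF that] by blast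
    then have "energy (\<lambda>x. (snd (t N) x + snd (t M) x) / 2) \<in> En N"
      unfolding En_def by (intro image_eqI[OF _ midpoint_hull.mid[OF t(1)[of N]]]) simp_all
    then have "Inf (En N) \<le> energy (\<lambda>x. (snd (t N) x + snd (t M) x) / 2)" using bb by (rule cInf_lower)
    moreover have "1 / real (Suc M) \<le> 1 / real (Suc N)" using that by (intro divide_left_mono) auto
    ultimately show ?thesis using t(2)[of N] t(2)[of M] L(2)[of M] by linarith
  qed
  have lim0: "(\<lambda>N. (L - Inf (En N)) + 2 * (1 / real (Suc N))) \<longlonglongrightarrow> 0"
    using tendsto_add[OF tendsto_diff[OF tendsto_const[of L] L(1)] tendsto_mult[OF tendsto_const[of 2] LIMSEQ_inverse_real_of_nat]]
    by (simp add: inverse_eq_divide)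
  have "\<exists>N0. \<forall>N\<ge>N0. \<forall>M\<ge>N. (LI x. \<bar>snd (t N) x - snd (t M) x\<bar> * wt x) \<le> e" if e: "e > 0" for e
  proof -
    obtain dl where d: "dl > 0" "\<forall>u v. fun_bound p K u --> fun_bound p K v -->
      energy u + energy v - 2 * energy (\<lambda>x. (u x + v x) / 2) \<le> dl --> (LI x. \<bar>u x - v x\<bar> * wt x) \<le> e"
      using L1_wt_diff_le_energy[OF p e, of K] by blast
    obtain N0 where "!!N. N \<ge> N0 ==> (L - Inf (En N)) + 2 * (1 / real (Suc N)) < dl"
      using order_tendstoD(2)[OF lim0 d(1)] by (auto simp: eventually_sequentially)
    then have "(LI x. \<bar>snd (t N) x - snd (t M) x\<bar> * wt x) \<le> e" if "N \<ge> N0" "M \<ge> N" for N M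
      using that by (intro d(2)[rule_format] fb[OF t(1)] order_trans[OF gap[OF that(2)]] less_imp_le)
    then show ?thesis by blast
  qed
  from L1_wt_complete[OF p fb[OF t(1)] this] show ?thesis using t(1) by blast
qed

section \<open>Sobolev bounds from spline moments\<close>

lemma integrable_mult_B_spline_shift:
  assumes u: "loc_int u" and n: "n \<ge> 1"
  shows "lint (\<lambda>x. u x * B_spline n (x - a))"
proof (rule loc_int_mult_continuous[OF u])
  show "cont (\<lambda>x. B_spline n (x - a))"
    using cont_rapid_continuous[OF cont_rapid_shift[OF B_spline_cont_rapid[OF n]]] .
  show "x \<notin> {a..a + real n + 1} ==> B_spline n (x - a) = 0" for x by (intro B_spline_outside) auto
qed

section \<open>Recovering a polynomial from finitely many B-spline moments\<close>

definition poly_moment :: "nat => nat => real poly => real" where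
  "poly_moment n nu P = (LI x. poly P x * B_spline n (x - real nu))"

lemma poly_moment_linear:
  assumes n: "n \<ge> 1"
  shows "poly_moment n nu (P - Q) = poly_moment n nu P - poly_moment n nu Q" "poly_moment n nu (smult c P) = c * poly_moment n nu P"
  using integrable_mult_B_spline_shift[OF loc_int_poly n]
  by (simp_all add: poly_moment_def left_diff_distrib mult.assoc)

lemma poly_moment_shift: "poly_moment n nu (pcompose P [:1, 1:]) = poly_moment n (Suc nu) P"
  using LINT_shift[of "\<lambda>x. poly (pcompose P [:1, 1:]) x * B_spline n (x - real nu)" 1]
  by (simp add: poly_moment_def poly_pcompose algebra_simps)

text \<open>Differencing kills the top coefficient and puts \<open>d\<close> times it one place
  lower. The condition \<open>Suc k \<ge> d\<close> covers that place and all above it, so the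
  degree bound is included.\<close>

lemma coeff_poly_difference:
  fixes P :: "real poly"
  assumes "!!k. k > d ==> coeff P k = 0" "Suc k \<ge> d"
  shows "coeff (pcompose P [:1, 1:] - P) k = (if Suc k = d then real d * coeff P d else 0)"
  using assms
proof (induction d arbitrary: P k)
  case 0
  obtain a R where P: "P = pCons a R" by (cases P)
  have "coeff R i = 0" for i using 0(1)[of "Suc i"] by (simp add: P)
  then have "R = 0" by (simp add: poly_eq_iff)
  then show ?case by (simp add: P)
next
  case (Suc d)
  obtain a R where P: "P = pCons a R" by (cases P)
  have R: "coeff R i = 0" if "i > d" for i using Suc.prems(1)[of "Suc i"] that by (simp add: P)
  let ?Q = "pcompose R [:1, 1:] - R"
  have "pcompose P [:1, 1:] - P = pCons 0 ?Q + ?Q + R" by (simp add: P pcompose_pCons algebra_simps)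
  then have e: "coeff (pcompose P [:1, 1:] - P) k = coeff (pCons 0 ?Q) k + coeff ?Q k + coeff R k"
    by (simp only: coeff_add)
  have 1: "coeff (pCons 0 ?Q) k = (if k = d then real d * coeff R d else 0)"
  proof (cases k)
    case 0
    then show ?thesis using Suc.prems(2) by simp
  next
    case (Suc k')
    then show ?thesis using Suc.IH[OF R, of k'] Suc.prems(2) by (simp only: coeff_pCons_Suc Suc_le_mono)
  qed
  have 2: "coeff ?Q k = 0" using Suc.IH[OF R, of k] Suc.prems(2) by simp
  show ?case unfolding e 1 2 using Suc.prems(2) R[of k] by (auto simp: P distrib_right)
qed

text \<open>Differencing a polynomial lowers its degree and turns each moment into a difference with
  its right neighbour. So the functional for degree d + 1 is the difference of the one for degree d,
  divided by d + 1.\<close>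

lemma top_coeff_from_moments:
  assumes n: "n \<ge> 1"
  shows "\<exists>c. \<forall>P. degree P \<le> d --> coeff P d = (\<Sum>nu\<le>d. c nu * poly_moment n nu P)"
proof (induction d)
  case 0
  have "coeff P 0 = poly_moment n 0 P" if "degree P \<le> 0" for P
  proof -
    obtain a where "P = [:a:]" using \<open>degree P \<le> 0\<close> degree_eq_zeroE by blast
    then show ?thesis by (simp add: poly_moment_def B_spline_LINT_1)
  qed
  then show ?case by (intro exI[of _ "\<lambda>_. 1"]) simp
next
  case (Suc d)
  then obtain c where c: "!!P. degree P \<le> d ==> coeff P d = (\<Sum>nu\<le>d. c nu * poly_moment n nu P)" by blast
  define e where "e nu = ((if nu = 0 then 0 else c (nu - 1)) - (if nu \<le> d then c nu else 0)) / real (Suc d)" for nu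
  have "coeff P (Suc d) = (\<Sum>nu\<le>Suc d. e nu * poly_moment n nu P)" if P: "degree P \<le> Suc d" for P
  proof -
    let ?Q = "pcompose P [:1, 1:] - P" and ?M = "\<lambda>nu. poly_moment n nu P"
    have z: "coeff P k = 0" if "k > Suc d" for k using P that by (intro coeff_eq_0) simp
    have dQ: "degree ?Q \<le> d" by (rule degree_le) (use coeff_poly_difference[of "Suc d" P, OF z] in auto)
    have "real (Suc d) * coeff P (Suc d) = coeff ?Q d" using coeff_poly_difference[of "Suc d" P d, OF z] by simp
    also have "... = (\<Sum>nu\<le>d. c nu * ?M (Suc nu)) - (\<Sum>nu\<le>d. c nu * ?M nu)"
      unfolding c[OF dQ] by (simp add: poly_moment_linear[OF n] poly_moment_shift right_diff_distrib sum_subtractf)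
    also have "(\<Sum>nu\<le>d. c nu * ?M (Suc nu)) = (\<Sum>nu\<le>Suc d. (if nu = 0 then 0 else c (nu - 1)) * ?M nu)"
      by (subst sum.atMost_Suc_shift) simp
    also have "(\<Sum>nu\<le>d. c nu * ?M nu) = (\<Sum>nu\<le>Suc d. (if nu \<le> d then c nu else 0) * ?M nu)" by simp
    finally have "real (Suc d) * coeff P (Suc d) = (\<Sum>nu\<le>Suc d. real (Suc d) * (e nu * ?M nu))"
      by (simp only: sum_subtractf[symmetric] left_diff_distrib[symmetric]) (simp add: e_def del: sum.atMost_Suc of_nat_Suc)
    then show ?thesis unfolding sum_distrib_left[symmetric] by (simp del: sum.atMost_Suc)
  qed
  then show ?case by blast
qed

text \<open>Once the leading coefficient is read off from the moments, subtracting the leading term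
  leaves a polynomial of smaller degree.\<close>

lemma coeffs_from_moments:
  assumes n: "n \<ge> 1"
  shows "\<exists>c. \<forall>P. degree P \<le> d --> (\<forall>i\<le>d. coeff P i = (\<Sum>nu\<le>d. c i nu * poly_moment n nu P))"
proof (induction d)
  case 0
  obtain c where "\<forall>P. degree P \<le> 0 --> coeff P 0 = (\<Sum>nu\<le>0. c nu * poly_moment n nu P)"
    using top_coeff_from_moments[OF n, of 0] by blast
  then show ?case by (intro exI[of _ "\<lambda>_. c"]) simp
next
  case (Suc d)
  then obtain c where c: "!!P i. degree P \<le> d ==> i \<le> d ==> coeff P i = (\<Sum>nu\<le>d. c i nu * poly_moment n nu P)" by blast
  obtain e where e: "!!P. degree P \<le> Suc d ==> coeff P (Suc d) = (\<Sum>nu\<le>Suc d. e nu * poly_moment n nu P)"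
    using top_coeff_from_moments[OF n, of "Suc d"] by blast
  define X where "X i = (\<Sum>nu\<le>d. c i nu * poly_moment n nu (monom 1 (Suc d)))" for i
  define c' where "c' i nu = (if i \<le> d then (if nu \<le> d then c i nu else 0) - X i * e nu else e nu)" for i nu
  have "coeff P i = (\<Sum>nu\<le>Suc d. c' i nu * poly_moment n nu P)" if P: "degree P \<le> Suc d" and i: "i \<le> Suc d" for P i
  proof (cases "i \<le> d")
    case True
    define a where "a = coeff P (Suc d)"
    define R where "R = P - smult a (monom 1 (Suc d))"
    have "degree R \<le> d"
    proof (rule degree_le, intro allI impI)
      fix k assume "d < k"
      then show "coeff R k = 0" using coeff_eq_0[of P k] P by (cases "k = Suc d") (auto simp: R_def a_def)
    qed
    from c[OF this True] have "coeff R i = (\<Sum>nu\<le>d. c i nu * poly_moment n nu P) - a * X i"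
      by (simp add: R_def poly_moment_linear[OF n] right_diff_distrib sum_subtractf X_def sum_distrib_left mult.left_commute)
    moreover have "coeff R i = coeff P i" using True by (simp add: R_def)
    moreover have "(\<Sum>nu\<le>d. c i nu * poly_moment n nu P) = (\<Sum>nu\<le>Suc d. (if nu \<le> d then c i nu else 0) * poly_moment n nu P)" by simp
    moreover have "a * X i = (\<Sum>nu\<le>Suc d. (X i * e nu) * poly_moment n nu P)"
      unfolding a_def e[OF P] by (simp add: sum_distrib_left sum_distrib_right mult_ac del: sum.atMost_Suc)
    ultimately show ?thesis using True by (simp add: c'_def left_diff_distrib sum_subtractf del: sum.atMost_Suc)
  next
    case False
    then have "i = Suc d" using i by simp
    then show ?thesis using e[OF P] by (simp add: c'_def del: sum.atMost_Suc)
  qed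
  then show ?case by blast
qed

definition coeff_size :: "nat => real poly => real" where "coeff_size n P = (\<Sum>i\<le>n. \<bar>coeff P i\<bar>)"

lemma coeff_size_nonneg: "coeff_size n P \<ge> 0" by (simp add: coeff_size_def sum_nonneg)

lemma coeff_size_bound:
  assumes n: "n \<ge> 1"
  shows "\<exists>C\<ge>0. \<forall>P. degree P \<le> n --> coeff_size n P \<le> C * (\<Sum>nu\<le>n. \<bar>poly_moment n nu P\<bar>)"
proof -
  obtain c where c: "!!P i. degree P \<le> n ==> i \<le> n ==> coeff P i = (\<Sum>nu\<le>n. c i nu * poly_moment n nu P)"
    using coeffs_from_moments[OF n, of n] by blast
  define C where "C = (\<Sum>i\<le>n. \<Sum>nu\<le>n. \<bar>c i nu\<bar>)"
  have "coeff_size n P \<le> C * (\<Sum>nu\<le>n. \<bar>poly_moment n nu P\<bar>)" if P: "degree P \<le> n" for P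
  proof -
    have "\<bar>coeff P i\<bar> \<le> (\<Sum>nu\<le>n. \<bar>c i nu\<bar>) * (\<Sum>nu\<le>n. \<bar>poly_moment n nu P\<bar>)" if i: "i \<le> n" for i
    proof -
      have "\<bar>coeff P i\<bar> \<le> (\<Sum>nu\<le>n. \<bar>c i nu\<bar> * \<bar>poly_moment n nu P\<bar>)"
        unfolding c[OF P i] by (rule order_trans[OF sum_abs]) (simp add: abs_mult)
      also have "... \<le> (\<Sum>nu\<le>n. \<bar>c i nu\<bar> * (\<Sum>nu\<le>n. \<bar>poly_moment n nu P\<bar>))"
        by (intro sum_mono mult_left_mono member_le_sum) auto
      finally show ?thesis by (simp add: sum_distrib_right)
    qed
    then have "coeff_size n P \<le> (\<Sum>i\<le>n. (\<Sum>nu\<le>n. \<bar>c i nu\<bar>) * (\<Sum>nu\<le>n. \<bar>poly_moment n nu P\<bar>))"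
      unfolding coeff_size_def by (intro sum_mono) auto
    then show ?thesis by (simp add: C_def sum_distrib_right)
  qed
  moreover have "C \<ge> 0" unfolding C_def by (intro sum_nonneg) auto
  ultimately show ?thesis by blast
qed

lemma poly_le_coeff_size:
  assumes P: "degree P \<le> n" and t: "\<bar>t\<bar> \<le> 1"
  shows "\<bar>poly P t\<bar> \<le> coeff_size n P"
proof -
  have "poly P t = (\<Sum>i\<le>n. coeff P i * t ^ i)" by (rule poly_sum_upto) (use P in \<open>auto intro: coeff_eq_0\<close>)
  also have "\<bar>...\<bar> \<le> (\<Sum>i\<le>n. \<bar>coeff P i * t ^ i\<bar>)" by (rule sum_abs)
  also have "... \<le> coeff_size n P"
    unfolding coeff_size_def
  proof (rule sum_mono)
    fix i
    have "\<bar>coeff P i\<bar> * \<bar>t\<bar> ^ i \<le> \<bar>coeff P i\<bar> * 1" using t by (intro mult_left_mono power_le_one) auto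
    then show "\<bar>coeff P i * t ^ i\<bar> \<le> \<bar>coeff P i\<bar>" by (simp add: abs_mult power_abs)
  qed
  finally show ?thesis .
qed

lemma higher_pderiv_coeff_size:
  assumes P: "degree P \<le> n"
  shows "degree ((pderiv ^^ i) P) \<le> n" "coeff_size n ((pderiv ^^ i) P) \<le> real n ^ i * coeff_size n P"
proof (induction i)
  case (Suc i)
  let ?R = "(pderiv ^^ i) P"
  case 1
  show ?case using Suc.IH(1) degree_pderiv[of ?R] by simp
  case 2
  have "coeff_size n (pderiv ?R) \<le> (\<Sum>i\<le>n. real n * \<bar>coeff ?R (Suc i)\<bar>)"
    unfolding coeff_size_def
  proof (rule sum_mono)
    fix k assume "k \<in> {..n}"
    show "\<bar>coeff (pderiv ?R) k\<bar> \<le> real n * \<bar>coeff ?R (Suc k)\<bar>"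
    proof (cases "Suc k \<le> n")
      case True
      then have "real (Suc k) * \<bar>coeff ?R (Suc k)\<bar> \<le> real n * \<bar>coeff ?R (Suc k)\<bar>" by (intro mult_right_mono) auto
      then show ?thesis by (simp add: coeff_pderiv abs_mult)
    next
      case False
      then have "coeff ?R (Suc k) = 0" using Suc.IH(1) by (intro coeff_eq_0) simp
      then show ?thesis by (simp add: coeff_pderiv)
    qed
  qed
  also have "... = real n * (\<Sum>i\<in>Suc ` {..n}. \<bar>coeff ?R i\<bar>)" by (simp add: sum_distrib_left sum.reindex)
  also have "... \<le> real n * coeff_size n ?R"
  proof (intro mult_left_mono)
    have "(\<Sum>i\<in>Suc ` {..n}. \<bar>coeff ?R i\<bar>) = (\<Sum>i\<in>Suc ` {..n} \<inter> {..n}. \<bar>coeff ?R i\<bar>)"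
      using Suc.IH(1) by (intro sum.mono_neutral_right) (auto intro!: coeff_eq_0)
    also have "... \<le> coeff_size n ?R" unfolding coeff_size_def by (intro sum_mono2) auto
    finally show "(\<Sum>i\<in>Suc ` {..n}. \<bar>coeff ?R i\<bar>) \<le> coeff_size n ?R" .
  qed simp
  also have "... \<le> real n * (real n ^ i * coeff_size n P)" by (intro mult_left_mono Suc.IH(2)) simp
  finally show ?case by (simp add: mult.assoc)
qed (use P in simp_all)

lemma higher_pderiv_pcompose_shift: "(pderiv ^^ i) (pcompose P [:a, 1:]) = pcompose ((pderiv ^^ i) P) [:a, 1:]"
  by (induction i) (simp_all add: pderiv_pcompose pderiv_pCons)

lemma has_weak_deriv_cong_AE:
  assumes "has_weak_deriv i g h" "AE x in lebesgue. g x = g' x" "loc_int g'"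
  shows "has_weak_deriv i g' h"
proof -
  have "(LI x. g x * (deriv ^^ i) phi x) = (LI x. g' x * (deriv ^^ i) phi x)" if "phi \<in> test_funs" for phi
  proof (rule integral_cong_AE)
    have "(deriv ^^ i) phi \<in> lmeas"
      by (intro lmeas_continuous scs_continuous scs_higher_deriv that)
    then show "(\<lambda>x. g x * (deriv ^^ i) phi x) \<in> lmeas" "(\<lambda>x. g' x * (deriv ^^ i) phi x) \<in> lmeas"
      using assms by (auto simp: has_weak_deriv_def dest!: loc_int_measurable)
    show "AE x in lebesgue. g x * (deriv ^^ i) phi x = g' x * (deriv ^^ i) phi x" using assms(2) by eventually_elim simp
  qed
  then show ?thesis using assms by (simp add: has_weak_deriv_def)
qed

lemma local_mass_sum:
  assumes F: "loc_int F"
  shows "integral {of_int m..of_int m + real k} (\<lambda>t. \<bar>F t\<bar>) = (\<Sum>i<k. local_mass F (m + int i))"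
proof (induction k)
  case (Suc k)
  have "integral {of_int m..of_int m + real (Suc k)} (\<lambda>t. \<bar>F t\<bar>) =
     integral {of_int m..of_int m + real k} (\<lambda>t. \<bar>F t\<bar>) + integral {of_int m + real k..of_int m + real (Suc k)} (\<lambda>t. \<bar>F t\<bar>)"
    by (rule HK_integral_combine[symmetric])
       (auto intro: loc_int_integrable_on loc_int_abs F)
  then show ?case using Suc by (simp add: local_mass_def add_ac)
qed simp

lemma iprim_local_bound:
  assumes F: "loc_int F" and x: "of_int m \<le> x" "x \<le> of_int m + real k" and r: "k \<le> r" "r \<ge> 1"
  shows "\<bar>iprim (Suc j) F (of_int m) x\<bar> \<le> real r ^ j * (\<Sum>i<k. local_mass F (m + int i))"
proof -
  have "\<bar>iprim (Suc j) F (of_int m) x\<bar> \<le> \<bar>x - of_int m\<bar> ^ j * \<bar>prim (\<lambda>t. \<bar>F t\<bar>) (of_int m) x\<bar>" by (rule iprim_bound[OF F])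
  also have "... \<le> real r ^ j * (\<Sum>i<k. local_mass F (m + int i))"
  proof (rule mult_mono)
    show "\<bar>x - of_int m\<bar> ^ j \<le> real r ^ j" using x r by (intro power_mono) auto
    have i: "(\<lambda>t. \<bar>F t\<bar>) integrable_on {a..b}" for a b by (intro loc_int_integrable_on loc_int_abs F)
    have "0 \<le> integral {of_int m..x} (\<lambda>t. \<bar>F t\<bar>)" by (intro HK_integral_nonneg i) auto
    moreover have "integral {of_int m..x} (\<lambda>t. \<bar>F t\<bar>) \<le> integral {of_int m..of_int m + real k} (\<lambda>t. \<bar>F t\<bar>)"
      using x by (intro integral_subset_le i) auto
    ultimately show "\<bar>prim (\<lambda>t. \<bar>F t\<bar>) (of_int m) x\<bar> \<le> (\<Sum>i<k. local_mass F (m + int i))"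
      using x by (simp add: prim_le local_mass_sum[OF F])
  qed simp_all
  finally show ?thesis .
qed

lemma LINT_mult_B_spline_bound:
  assumes n: "n \<ge> 1" and u: "loc_int u" and b: "!!x. a \<le> x ==> x \<le> a + real n + 1 ==> \<bar>u x\<bar> \<le> B"
  shows "\<bar>LI x. u x * B_spline n (x - a)\<bar> \<le> B"
proof -
  note i = integrable_mult_B_spline_shift[OF u n, of a]
  have iB: "lint (\<lambda>x. B_spline n (x - a))"
    using integrable_mult_B_spline_shift[OF loc_int_continuous[of "\<lambda>x. 1"] n, of a] by simp
  have "\<bar>LI x. u x * B_spline n (x - a)\<bar> \<le> (LI x. \<bar>u x * B_spline n (x - a)\<bar>)" by (rule integral_abs_bound)
  also have "... \<le> (LI x. B * B_spline n (x - a))"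
  proof (rule integral_mono[OF integrable_abs[OF i] integrable_mult_right[OF iB]])
    show "\<bar>u x * B_spline n (x - a)\<bar> \<le> B * B_spline n (x - a)" for x
    proof (cases "a \<le> x \<and> x \<le> a + real n + 1")
      case True
      then show ?thesis using b[of x] B_spline_nonneg[of n "x - a"] by (simp add: abs_mult mult_right_mono)
    next
      case False
      then show ?thesis using B_spline_outside[of "x - a" n] by auto
    qed
  qed
  also have "... = B" using LINT_shift[of "B_spline n" a] by (simp add: B_spline_LINT_1)
  finally show ?thesis .
qed

text \<open>On each unit interval Taylor's formula at the left end splits \<open>g\<close> into
  polynomial and remainder. Local masses of \<open>F\<close> control the remainder and its moments;
  with the moments of \<open>g\<close> this bounds the moments of the polynomial, hence its
  coefficients. All these bounds are sequences in \<open>m\<close>, so they combine to an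
  \<open>L\<^sub>p\<close> bound.\<close>

lemma Sobolev_from_moments:
  assumes n: "n \<ge> 1" and p: "1 < p"
  shows "\<exists>C>0. \<forall>g F K L. has_weak_deriv (n + 1) g F --> fun_bound p L F -->
     seq_bound p K (\<lambda>m. LI x. g x * B_spline n (x - of_int m)) -->
     (\<forall>i\<le>n. \<exists>h. has_weak_deriv i g h \<and> fun_bound p (C * (K + L)) h)"
proof -
  obtain C0 where C0: "C0 \<ge> 0" "!!P. degree P \<le> n ==> coeff_size n P \<le> C0 * (\<Sum>nu\<le>n. \<bar>poly_moment n nu P\<bar>)"
    using coeff_size_bound[OF n] by blast
  \<comment> \<open>The B-splines shifted by 0 to \<open>n\<close> from \<open>m\<close> are
    supported in \<open>[m, m + 2 * n + 1]\<close>, that is in \<open>r\<close> unit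
    intervals.\<close>
  define r where "r = 2 * n + 1"
  define A where "A = real n ^ n * (C0 * (1 + real (n + 1) * real r ^ n)) + 1"
  have A1: "A \<ge> 1" using C0(1) by (simp add: A_def)
  have "\<exists>h. has_weak_deriv i g h \<and> fun_bound p (A * real r * (K + L)) h"
    if gF: "has_weak_deriv (n + 1) g F" and F: "fun_bound p L F"
      and b: "seq_bound p K (\<lambda>m. LI x. g x * B_spline n (x - of_int m))" and i: "i \<le> n" for g F K L i
  proof -
    have liF: "loc_int F" and lig: "loc_int g" using gF by (auto simp: has_weak_deriv_def)
    define beta where "beta m = (LI x. g x * B_spline n (x - of_int m))" for m :: int
    define S where "S m = (\<Sum>nu<r. \<bar>beta (m + int nu)\<bar> + local_mass F (m + int nu))" for m
    define Lam where "Lam m = (\<Sum>nu<r. local_mass F (m + int nu))" for m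
    have LamS: "Lam m \<le> S m" "0 \<le> Lam m" for m
      unfolding Lam_def S_def by (auto intro!: sum_mono sum_nonneg local_mass_nonneg)
    have ex: "\<exists>T. (\<forall>i\<ge>n+1. coeff T i = 0) \<and> (AE x in lebesgue. g x = poly T x + iprim (n + 1) F (of_int m) x)" for m :: int
      by (rule has_weak_deriv_imp_iprim[OF gF])
    then obtain T where T: "!!m i. i \<ge> n + 1 ==> coeff (T m) i = 0"
      "!!m. AE x in lebesgue. g x = poly (T m) x + iprim (n + 1) F (of_int m) x" by metis
    define P where "P m = pcompose (T m) [:of_int m, 1:]" for m
    have dP: "degree (P m) \<le> n" for m
    proof -
      have "degree (T m) \<le> n" using T(1) by (intro degree_le) auto
      then show ?thesis using degree_pcompose_le[of "T m" "[:of_int m, 1:]"] by (simp add: P_def)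
    qed
    have PT: "poly ((pderiv ^^ i) (T m)) x = poly ((pderiv ^^ i) (P m)) (x - of_int m)" for i m x
      by (simp add: P_def higher_pderiv_pcompose_shift poly_pcompose)
    have mom: "\<bar>poly_moment n nu (P m)\<bar> \<le> \<bar>beta (m + int nu)\<bar> + real r ^ n * Lam m" if nu: "nu \<le> n" for nu m
    proof -
      let ?I = "iprim (n + 1) F (of_int m)" and ?B = "\<lambda>x. B_spline n (x - of_int (m + int nu))"
      have li: "loc_int ?I" "loc_int (poly (T m))" by (intro loc_int_iprim liF loc_int_poly)+
      note ig = integrable_mult_B_spline_shift[OF li(2) n, of "of_int (m + int nu)"] integrable_mult_B_spline_shift[OF li(1) n, of "of_int (m + int nu)"]
      have "beta (m + int nu) = (LI x. poly (T m) x * ?B x + ?I x * ?B x)"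
        unfolding beta_def
      proof (rule integral_cong_AE)
        show "(\<lambda>x. g x * ?B x) \<in> lmeas" using integrable_mult_B_spline_shift[OF lig n] by blast
        show "(\<lambda>x. poly (T m) x * ?B x + ?I x * ?B x) \<in> lmeas" using lint_add[OF ig] by blast
        show "AE x in lebesgue. g x * ?B x = poly (T m) x * ?B x + ?I x * ?B x"
          using T(2)[of m] by eventually_elim (simp only: distrib_right)
      qed
      also have "... = (LI x. poly (T m) x * ?B x) + (LI x. ?I x * ?B x)" by (rule LI_add[OF ig])
      also have "(LI x. poly (T m) x * ?B x) = poly_moment n nu (P m)"
        using LINT_shift[of "\<lambda>x. poly (P m) x * B_spline n (x - real nu)" "of_int m"] PT[of 0 m]
        by (simp add: poly_moment_def diff_diff_eq)
      finally have e: "poly_moment n nu (P m) = beta (m + int nu) - (LI x. ?I x * ?B x)" by simp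
      have "\<bar>LI x. ?I x * ?B x\<bar> \<le> real r ^ n * Lam m"
      proof (rule LINT_mult_B_spline_bound[OF n li(1)])
        fix x :: real assume "of_int (m + int nu) \<le> x" "x \<le> of_int (m + int nu) + real n + 1"
        then show "\<bar>?I x\<bar> \<le> real r ^ n * Lam m"
          using iprim_local_bound[OF liF, of m x r r n] nu by (simp add: Lam_def r_def)
      qed
      then show ?thesis unfolding e by linarith
    qed
    have cs: "coeff_size n (P m) \<le> C0 * (1 + real (n + 1) * real r ^ n) * S m" for m
    proof -
      have "(\<Sum>nu\<le>n. \<bar>poly_moment n nu (P m)\<bar>) \<le> (\<Sum>nu\<le>n. \<bar>beta (m + int nu)\<bar> + real r ^ n * Lam m)" by (intro sum_mono mom) auto
      also have "... = (\<Sum>nu\<le>n. \<bar>beta (m + int nu)\<bar>) + real (n + 1) * real r ^ n * Lam m" by (simp add: sum.distrib)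
      also have "... \<le> S m + real (n + 1) * real r ^ n * S m"
      proof (intro add_mono mult_left_mono LamS)
        have "(\<Sum>nu\<le>n. \<bar>beta (m + int nu)\<bar>) \<le> (\<Sum>nu<r. \<bar>beta (m + int nu)\<bar>)" by (intro sum_mono2) (auto simp: r_def)
        also have "... \<le> S m" unfolding S_def by (intro sum_mono) (simp add: local_mass_nonneg)
        finally show "(\<Sum>nu\<le>n. \<bar>beta (m + int nu)\<bar>) \<le> S m" .
      qed simp
      also have "... = (1 + real (n + 1) * real r ^ n) * S m" by (simp add: distrib_right)
      finally show ?thesis using order_trans[OF C0(2)[OF dP] mult_left_mono[OF _ C0(1)]] by (simp only: mult.assoc)
    qed
    define h where "h m x = poly ((pderiv ^^ i) (T m)) x + iprim (n + 1 - i) F (of_int m) x" for m :: int and x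
    have ni: "n + 1 = i + (n + 1 - i)" "n + 1 - i = Suc (n - i)" using i by auto
    have wd: "has_weak_deriv i (\<lambda>x. poly (T m) x + iprim (n + 1) F (of_int m) x) (h m)" for m
      using has_weak_deriv_iprim[OF liF refl, of i "T m" "n + 1 - i" "of_int m"] unfolding h_def[abs_def] ni(1)[symmetric] .
    have wg: "has_weak_deriv i g (h m)" for m
      by (rule has_weak_deriv_cong_AE[OF wd _ lig]) (use T(2)[of m] in \<open>eventually_elim; simp\<close>)
    have hc: "cont (h m)" for m
      unfolding h_def ni(2) using iprim_continuous[OF liF] by (intro continuous_on_add continuous_on_poly continuous_on_id) auto
    \<comment> \<open>The candidates from different base points are weak derivatives of the same
      \<open>g\<close>, so they agree almost everywhere and, being continuous, everywhere. Thus one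
      function obeys all the local estimates.\<close>
    have h0: "h 0 x = h m x" for m x
    proof -
      have "AE x in lebesgue. h 0 x = h m x" by (rule has_weak_deriv_unique[OF wg wg]) simp
      then have "AE x in lebesgue. h 0 x - h m x = 0" by eventually_elim simp
      from continuous_AE_zero[OF continuous_on_diff[OF hc hc] this, of x] show ?thesis by simp
    qed
    have hb: "\<bar>h 0 x\<bar> \<le> \<bar>A * S m\<bar>" if x: "x \<in> {of_int m..<of_int m + 1}" for m x
    proof -
      have t: "\<bar>x - of_int m\<bar> \<le> 1" using x by auto
      have "\<bar>poly ((pderiv ^^ i) (T m)) x\<bar> \<le> coeff_size n ((pderiv ^^ i) (P m))"
        unfolding PT by (rule poly_le_coeff_size[OF higher_pderiv_coeff_size(1)[OF dP] t])
      also have "... \<le> real n ^ i * coeff_size n (P m)" by (rule higher_pderiv_coeff_size(2)[OF dP])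
      also have "... \<le> real n ^ n * (C0 * (1 + real (n + 1) * real r ^ n) * S m)"
        using n i by (intro mult_mono power_increasing cs coeff_size_nonneg) auto
      finally have 1: "\<bar>poly ((pderiv ^^ i) (T m)) x\<bar> \<le> real n ^ n * (C0 * (1 + real (n + 1) * real r ^ n) * S m)" .
      have "\<bar>iprim (Suc (n - i)) F (of_int m) x\<bar> \<le> real 1 ^ (n - i) * (\<Sum>i<1. local_mass F (m + int i))"
        by (rule iprim_local_bound[OF liF]) (use x in auto)
      also have "... \<le> Lam m" unfolding Lam_def
        using member_le_sum[of 0 "{..<r}" "\<lambda>nu. local_mass F (m + int nu)"] by (simp add: r_def local_mass_nonneg)
      finally have 2: "\<bar>iprim (n + 1 - i) F (of_int m) x\<bar> \<le> S m" using LamS(1)[of m] unfolding ni(2) by linarith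
      have "\<bar>h m x\<bar> \<le> real n ^ n * (C0 * (1 + real (n + 1) * real r ^ n) * S m) + S m" unfolding h_def using 1 2 by linarith
      also have "... = A * S m" by (simp add: A_def distrib_right mult.assoc)
      also have "... \<le> \<bar>A * S m\<bar>" by simp
      finally show ?thesis unfolding h0[of x m] .
    qed
    have "seq_bound p (\<bar>A\<bar> * (\<Sum>nu<r. K + L)) (\<lambda>m. A * S m)"
      unfolding S_def
    proof (intro seq_bound_cmult[OF p] seq_bound_sum[OF p] seq_bound_add[OF p])
      fix nu
      show "seq_bound p K (\<lambda>m. \<bar>beta (m + int nu)\<bar>)"
        using seq_bound_shift[OF p b, of "int nu"] by (rule seq_bound_mono[OF p]) (simp_all add: beta_def)
      show "seq_bound p L (\<lambda>m. local_mass F (m + int nu))" by (rule seq_bound_shift[OF p seq_bound_local_mass[OF p F]])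
    qed
    moreover have "\<bar>A\<bar> * (\<Sum>nu<r. K + L) = A * real r * (K + L)" using A1 by simp
    ultimately have "seq_bound p (A * real r * (K + L)) (\<lambda>m. A * S m)" by (simp only:)
    then have "fun_bound p (A * real r * (K + L)) (h 0)"
      by (rule fun_bound_from_seq[OF p _ lmeas_continuous[OF hc]]) (rule hb)
    then show ?thesis using wg[of 0] by (intro exI[of _ "h 0"] conjI)
  qed
  moreover have "A * real r > 0" using A1 by (simp add: r_def)
  ultimately show ?thesis by blast
qed

section \<open>From spline coefficients to Sobolev functions\<close>

text \<open>The values sit on the grid \<open>th * nu\<close>, while the series translates in steps
  of \<open>th * t\<close>: \<open>t = 2\<close> treats integer translates on the half-integer grid,
  where each step moves the index by two.\<close>

lemma seq_bound_dual_series: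
  assumes p: "1 < p" and f: "f \<in> S_dual r" and c: "rapid_seq c" and zeta: "zeta \<in> S_space r" and sg: "sg \<in> S_space r"
    and s: "\<bar>th * of_int t\<bar> \<le> 1" and eq: "!!x. sg x = (\<Sum>\<^sub>\<infinity>k. c k * zeta (x - th * of_int t * of_int k))" and a: "a \<noteq> 0"
    and b: "seq_bound p K (\<lambda>nu. f (\<lambda>x. zeta (a * x - th * of_int nu)))"
  shows "seq_bound p ((\<Sum>\<^sub>\<infinity>k. \<bar>c k\<bar>) * K) (\<lambda>nu. f (\<lambda>x. sg (a * x - th * of_int nu)))"
proof (rule seq_bound_series[OF p rapid_seq_summable[OF c]])
  show "seq_bound p K (\<lambda>nu. f (\<lambda>x. zeta (a * x - th * of_int (nu + t * k))))" for k by (rule seq_bound_shift[OF p b])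
  show "(\<lambda>N. \<Sum>k\<in>{- int N..int N}. c k * f (\<lambda>x. zeta (a * x - th * of_int (nu + t * k)))) \<longlonglongrightarrow> f (\<lambda>x. sg (a * x - th * of_int nu))" for nu
    using S_dual_series[OF f c zeta s sg eq a, of "th * of_int nu"] by (simp add: distrib_left diff_diff_eq mult.assoc)
qed

text \<open>Each expansion of the chain multiplies the bound by the absolute sum of its
  coefficients, independently of the scale. The exponent has n + 2 in place of n + 1 because
  \<open>spline_coeff\<close> multiplies the values of \<open>f\<close> by 2^j.\<close>

lemma B_spline_coefficients_bound:
  assumes BL: "Battle_Lemarie_system n \<psi> \<Psi>" and n: "n \<ge> 1" and p: "1 < p"
  shows "\<exists>C>0. \<forall>f Q. f \<in> S_dual (n - 1) --> 0 \<le> Q --> spline_quantity n p \<psi> \<Psi> f \<le> ennreal Q -->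
     seq_bound p (C * Q) (\<lambda>mu. f (\<lambda>x. B_spline n (x - of_int mu))) \<and>
     (\<forall>j::nat. seq_bound p (C * (2 powr (- (real j * (real n + 2 - enn2real (1 / p)))) * Q)) (\<lambda>mu. f (\<lambda>x. diff_spline n (2 ^ j * x - 1/2 * of_int mu))))"
proof -
  note S = Battle_Lemarie_S_space[OF BL] and D = diff_spline_S_space[OF n] and W = spline_wavelet_S_space[OF n]
  obtain b where b: "rapid_seq b" "!!x. B_spline n x = (\<Sum>\<^sub>\<infinity>k. b k * \<Psi> (x - of_int k))"
    using Battle_Lemarie_expansions(1)[OF BL n] by blast
  obtain c where c: "rapid_seq c" "!!x. spline_wavelet n x = (\<Sum>\<^sub>\<infinity>k. c k * \<psi> (x - of_int k))"
    using Battle_Lemarie_expansions(2)[OF BL n] by blast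
  obtain h where h: "rapid_seq h" "!!x. diff_spline n x = (\<Sum>\<^sub>\<infinity>k. h k * spline_wavelet n (x - 1/2 * of_int k))"
    using Battle_Lemarie_expansions(3)[OF BL n] by blast
  define Mb where "Mb = (\<Sum>\<^sub>\<infinity>k. \<bar>b k\<bar>)"
  define Mc where "Mc = (\<Sum>\<^sub>\<infinity>k. \<bar>c k\<bar>)"
  define Mh where "Mh = (\<Sum>\<^sub>\<infinity>k. \<bar>h k\<bar>)"
  have M: "Mb \<ge> 0" "Mc \<ge> 0" "Mh \<ge> 0" unfolding Mb_def Mc_def Mh_def by (auto intro: infsum_nonneg)
  let ?e = "real n + 1 - enn2real (1 / p)"
  \<comment> \<open>\<open>2 powr ?e\<close> undoes the factor that the supremum carries at level
    -1; the factor 2 comes from separating the two shifts in one coefficient.\<close>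
  define C where "C = Mb * 2 powr ?e + Mh * Mc * 2 + 1"
  have C: "C > 0" "Mb * 2 powr ?e \<le> C" "Mh * Mc * 2 \<le> C" using M by (auto simp: C_def add_nonneg_pos)
  have "seq_bound p (C * Q) (\<lambda>mu. f (\<lambda>x. B_spline n (x - of_int mu)))"
    and "seq_bound p (C * (2 powr (- (real j * (real n + 2 - enn2real (1 / p)))) * Q)) (\<lambda>mu. f (\<lambda>x. diff_spline n (2 ^ j * x - 1/2 * of_int mu)))"
    if f: "f \<in> S_dual (n - 1)" and Q: "0 \<le> Q" and q: "spline_quantity n p \<psi> \<Psi> f \<le> ennreal Q" for f Q and j :: nat
  proof -
    have "seq_bound p (2 powr ?e * Q) (\<lambda>mu. f (\<lambda>x. \<Psi> (1 * x - 1 * of_int mu)))"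
      by (rule seq_bound_mono[OF p spline_quantity_ge[OF p q Q, of "-1"]]) (simp_all add: spline_coeff_def shifted_system_def)
    then have "seq_bound p (Mb * (2 powr ?e * Q)) (\<lambda>mu. f (\<lambda>x. B_spline n (1 * x - 1 * of_int mu)))"
      unfolding Mb_def by (intro seq_bound_dual_series[where t = 1, OF p f b(1) S(2) B_spline_S_space'[OF n]]) (simp_all add: b(2))
    then have "seq_bound p ((Mb * 2 powr ?e) * Q) (\<lambda>mu. f (\<lambda>x. B_spline n (x - of_int mu)))" by (simp add: mult.assoc)
    then show "seq_bound p (C * Q) (\<lambda>mu. f (\<lambda>x. B_spline n (x - of_int mu)))"
      by (rule seq_bound_pos[OF p]) (intro mult_right_mono C Q)
    define R where "R = 2 powr (- (real j * (real n + 2 - enn2real (1 / p)))) * Q"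
    define v where "v nu = f (\<lambda>x. \<psi> (2 ^ j * x - 1/2 * of_int nu))" for nu :: int
    have co: "spline_coeff \<psi> \<Psi> f (int j) mu = 2 ^ j * \<bar>v (2 * mu)\<bar> + 2 ^ j * \<bar>v (2 * mu + 1)\<bar>" for mu
      by (simp add: spline_coeff_def shifted_system_def v_def)
    have "\<bar>v nu\<bar> \<le> 1 / 2 ^ j * spline_coeff \<psi> \<Psi> f (int j) (nu div 2)" for nu
    proof -
      have "nu = 2 * (nu div 2) \<or> nu = 2 * (nu div 2) + 1" by presburger
      then have "2 ^ j * \<bar>v nu\<bar> \<le> spline_coeff \<psi> \<Psi> f (int j) (nu div 2)"
        unfolding co by (metis abs_ge_zero add_increasing add_increasing2 mult_nonneg_nonneg order_refl zero_le_numeral zero_le_power)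
      then show ?thesis by (simp add: pos_le_divide_eq mult.commute)
    qed
    then have vb: "\<bar>v nu\<bar> \<le> \<bar>1 / 2 ^ j * spline_coeff \<psi> \<Psi> f (int j) (nu div 2)\<bar>" for nu using order_trans abs_ge_self by blast
    have "seq_bound p (\<bar>1 / 2 ^ j\<bar> * (2 * (2 powr (- (of_int (int j) * ?e)) * Q))) (\<lambda>nu. 1 / 2 ^ j * spline_coeff \<psi> \<Psi> f (int j) (nu div 2))"
      by (intro seq_bound_cmult[OF p] seq_bound_div2[OF p] spline_quantity_ge[OF p q Q]) simp
    moreover have "\<bar>1 / 2 ^ j\<bar> * (2 * (2 powr (- (of_int (int j) * ?e)) * Q)) = 2 * R"
    proof -
      have "R = 2 powr (- real j + - (real j * ?e)) * Q" unfolding R_def by (intro arg_cong2[where f = "(*)"] arg_cong2[where f = "(powr)"] refl) (simp add: algebra_simps)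
      also have "... = (1 / 2 ^ j * 2 powr (- (real j * ?e))) * Q" unfolding powr_add by (simp add: powr_minus powr_realpow inverse_eq_divide)
      finally show ?thesis by simp
    qed
    ultimately have "seq_bound p (2 * R) v" by (intro seq_bound_mono[OF p _ vb order_refl]) (simp only:)
    then have "seq_bound p (Mc * (2 * R)) (\<lambda>nu. f (\<lambda>x. spline_wavelet n (2 ^ j * x - 1/2 * of_int nu)))"
      unfolding Mc_def v_def by (intro seq_bound_dual_series[where t = 2, OF p f c(1) S(1) W]) (simp_all add: c(2))
    then have "seq_bound p (Mh * (Mc * (2 * R))) (\<lambda>nu. f (\<lambda>x. diff_spline n (2 ^ j * x - 1/2 * of_int nu)))"
      unfolding Mh_def by (intro seq_bound_dual_series[where t = 1, OF p f h(1) W D]) (simp_all add: h(2))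
    then have "seq_bound p ((Mh * Mc * 2) * R) (\<lambda>nu. f (\<lambda>x. diff_spline n (2 ^ j * x - 1/2 * of_int nu)))" by (simp add: mult.assoc)
    then show "seq_bound p (C * (2 powr (- (real j * (real n + 2 - enn2real (1 / p)))) * Q)) (\<lambda>mu. f (\<lambda>x. diff_spline n (2 ^ j * x - 1/2 * of_int mu)))"
      unfolding R_def by (rule seq_bound_pos[OF p]) (intro mult_right_mono C mult_nonneg_nonneg Q powr_ge_zero)
  qed
  then show ?thesis using C(1) by blast
qed

section \<open>The spline approximation as polynomial plus iterated primitive of a step
  function\<close>

lemma sum_binomial_diff:
  fixes u :: "nat => real"
  shows "(\<Sum>i\<le>Suc m. sgn_parity (int i) * real (Suc m choose i) * u i)
    = (\<Sum>i\<le>m. sgn_parity (int i) * real (m choose i) * u i) - (\<Sum>i\<le>m. sgn_parity (int i) * real (m choose i) * u (Suc i))"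
proof -
  have s: "sgn_parity (1 + int i) = - sgn_parity (int i)" for i by (simp add: sgn_parity_def)
  have "(\<Sum>i\<le>m. sgn_parity (int i) * real (m choose i) * u i) = (\<Sum>i\<le>Suc m. sgn_parity (int i) * real (m choose i) * u i)"
    by (simp add: binomial_eq_0)
  also have "... = u 0 - (\<Sum>i\<le>m. sgn_parity (int i) * real (m choose Suc i) * u (Suc i))"
    by (subst sum.atMost_Suc_shift) (simp add: s sgn_parity_def[of 0] sum_negf)
  finally have 1: "(\<Sum>i\<le>m. sgn_parity (int i) * real (m choose i) * u i) = u 0 - (\<Sum>i\<le>m. sgn_parity (int i) * real (m choose Suc i) * u (Suc i))" .
  have "(\<Sum>i\<le>Suc m. sgn_parity (int i) * real (Suc m choose i) * u i) = u 0 - (\<Sum>i\<le>m. sgn_parity (int i) * real (Suc m choose Suc i) * u (Suc i))"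
    by (subst sum.atMost_Suc_shift) (simp add: s sgn_parity_def[of 0] sum_negf del: binomial_Suc_Suc)
  also have "... = u 0 - (\<Sum>i\<le>m. sgn_parity (int i) * real (m choose Suc i) * u (Suc i)) - (\<Sum>i\<le>m. sgn_parity (int i) * real (m choose i) * u (Suc i))"
    by (simp add: distrib_left distrib_right sum.distrib)
  finally show ?thesis unfolding 1 .
qed

lemma sum_binomial_nabla:
  "(\<Sum>i\<le>m. sgn_parity (int i) * real (m choose i) * c (mu + int i)) = sgn_parity (int m) * (nabla ^^ m) c (mu + int m)"
proof (induction m arbitrary: mu)
  case 0
  show ?case by (simp add: sgn_parity_def)
next
  case (Suc m)
  have "(\<Sum>i\<le>Suc m. sgn_parity (int i) * real (Suc m choose i) * c (mu + int i))
     = sgn_parity (int m) * (nabla ^^ m) c (mu + int m) - sgn_parity (int m) * (nabla ^^ m) c (mu + 1 + int m)"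
    unfolding sum_binomial_diff using Suc[of mu] Suc[of "mu + 1"] by (simp add: add_ac)
  also have "... = sgn_parity (int (Suc m)) * (nabla ^^ Suc m) c (mu + int (Suc m))"
    by (simp add: nabla_def sgn_parity_def add_ac)
  finally show ?case .
qed

lemma poly_antiderivative:
  fixes P :: "real poly"
  assumes "!!i. i \<ge> m ==> coeff P i = 0"
  obtains R where "pderiv R = P" "!!i. i \<ge> Suc m ==> coeff R i = 0"
proof
  define R where "R = (\<Sum>i<m. monom (coeff P i / real (Suc i)) (Suc i))"
  have c: "coeff R (Suc k) = (if k < m then coeff P k / real (Suc k) else 0)" for k
    by (simp add: R_def coeff_sum if_distrib sum.delta cong: if_cong)
  show "pderiv R = P" by (rule poly_eqI) (use assms in \<open>simp add: coeff_pderiv c del: of_nat_Suc\<close>)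
  show "coeff R i = 0" if "i \<ge> Suc m" for i using c[of "i - 1"] that by simp
qed

lemma iprim_linear:
  assumes u: "loc_int u" and v: "loc_int v"
  shows "iprim k (\<lambda>x. a * u x + b * v x) y = (\<lambda>x. a * iprim k u y x + b * iprim k v y x)"
proof (induction k)
  case (Suc k)
  have i: "(\<lambda>x. c * iprim k w y x) integrable_on {s..t}" if "loc_int w" for c w s t
    by (intro loc_int_integrable_on loc_int_cmult loc_int_iprim that)
  show ?case
  proof
    fix x
    show "iprim (Suc k) (\<lambda>x. a * u x + b * v x) y x = a * iprim (Suc k) u y x + b * iprim (Suc k) v y x"
      using prim_add[OF i[OF u] i[OF v], of a b y x] by (simp add: Suc prim_cmult iprim.simps)
  qed
qed simp

text \<open>Every integration constant becomes part of \<open>P\<close>, and every differentiation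
  of the dilated spline contributes one factor \<open>a\<close> and one
  \<open>nabla\<close>.\<close>

lemma spline_dilate_iprim:
  assumes a: "a > 0"
  shows "\<exists>P. (\<forall>i\<ge>m. coeff P i = 0) \<and> (\<forall>x. spline m c (a * x) = poly P x + iprim m (\<lambda>t. a ^ m * spline 0 ((nabla ^^ m) c) (a * t)) 0 x)"
proof (induction m arbitrary: c)
  case 0
  show ?case by (intro exI[of _ 0]) simp
next
  case (Suc m)
  define U where "U t = a ^ m * spline 0 ((nabla ^^ m) (nabla c)) (a * t)" for t
  have U: "loc_int U"
    using loc_int_cmult[OF loc_int_affine[OF loc_int_spline[of 0 "(nabla ^^ m) (nabla c)"], of a 0], of "a ^ m"] a
    by (simp add: U_def[abs_def])
  obtain P where P: "!!i. i \<ge> m ==> coeff P i = 0" "!!x. spline m (nabla c) (a * x) = poly P x + iprim m U 0 x"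
    using Suc.IH[of "nabla c"] unfolding U_def[abs_def] by blast
  obtain R where R: "pderiv R = P" "!!i. i \<ge> Suc m ==> coeff R i = 0" using poly_antiderivative[of m P] P(1) by metis
  define T where "T = [:spline (Suc m) c 0 - a * poly R 0:] + smult a R"
  have "spline (Suc m) c (a * x) = poly T x + iprim (Suc m) (\<lambda>t. a ^ Suc m * spline 0 ((nabla ^^ Suc m) c) (a * t)) 0 x" for x
  proof -
    have "spline (Suc m) c (a * x) = spline (Suc m) c 0 + prim (spline m (nabla c)) (a * 0) (a * x)"
      using spline_Suc_diff[of m c "a * x" 0] by simp
    also have "prim (spline m (nabla c)) (a * 0) (a * x) = a * prim (\<lambda>t. poly P t + iprim m U 0 t) 0 x"
      unfolding P(2)[symmetric] by (rule prim_dilate[OF loc_int_spline a])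
    also have "prim (\<lambda>t. poly P t + iprim m U 0 t) 0 x = prim (poly P) 0 x + iprim (Suc m) U 0 x"
      unfolding iprim.simps by (intro prim_add loc_int_integrable_on loc_int_poly loc_int_iprim U)
    also have "prim (poly P) 0 x = poly R x - poly R 0" using poly_prim[of R x 0] by (simp add: R(1))
    also have "iprim (Suc m) U 0 x = (1 / a) * iprim (Suc m) (\<lambda>t. a ^ Suc m * spline 0 ((nabla ^^ Suc m) c) (a * t)) 0 x"
    proof -
      have "(\<lambda>t. a ^ Suc m * spline 0 ((nabla ^^ Suc m) c) (a * t)) = (\<lambda>t. a * U t + 0 * U t)"
        by (simp add: U_def funpow_swap1 mult.assoc)
      then show ?thesis using iprim_linear[OF U U, of "Suc m" a 0 0] a by simp
    qed
    finally show ?thesis using a by (simp add: T_def distrib_left right_diff_distrib)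
  qed
  moreover have "coeff T i = 0" if "i \<ge> Suc m" for i using R(2)[OF that] that by (cases i) (auto simp: T_def)
  ultimately show ?case by blast
qed

lemma spline_0: "spline 0 d y = d \<lfloor>y\<rfloor>"
proof -
  have "0 \<le> y - of_int \<lfloor>y\<rfloor>" "y - of_int \<lfloor>y\<rfloor> < 1" using floor_correct[of y] by linarith+
  then show ?thesis by (simp add: spline_def)
qed

lemma fun_bound_step:
  assumes p: "1 < p" and d: "seq_bound p K d" and a: "a > 0"
  shows "fun_bound p (a powr (- enn2real (1 / p)) * K) (\<lambda>t. spline 0 d (a * t))"
proof (rule fun_bound_dilate[OF p _ a])
  show "fun_bound p K (spline 0 d)"
    by (rule fun_bound_from_seq[OF p d loc_int_measurable[OF loc_int_spline]])
       (simp only: floor_unit_interval spline_0 order_refl)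
qed

text \<open>The bound on \<open>H\<close> is uniform in \<open>j\<close>: with a = 2^(j+1), the
  factor a^(n+2) from n + 1 derivatives and the Jacobian, the factor a^(-1/p) from dilating a step
  function, and the decay of the differences multiply to a constant.\<close>

lemma spline_approx_iprim:
  assumes n: "n \<ge> 1" and p: "1 < p" and f: "f \<in> S_dual (n - 1)"
    and b: "seq_bound p (2 powr (- (real j * (real n + 2 - enn2real (1 / p)))) * K) (\<lambda>mu. f (\<lambda>x. diff_spline n (2 ^ j * x - 1/2 * of_int mu)))"
  shows "\<exists>P H. (\<forall>i\<ge>n+1. coeff P i = 0) \<and> (\<forall>x. spline_approx n f (2 ^ Suc j) x = poly P x + iprim (n + 1) H 0 x) \<and>
     fun_bound p (2 powr (real n + 2 - enn2real (1 / p)) * K) H"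
proof -
  define a :: real where "a = 2 ^ Suc j"
  have a: "a > 0" by (simp add: a_def)
  let ?e = "real n + 2 - enn2real (1 / p)"
  define beta where "beta k = f (\<lambda>x. B_spline n (a * x - of_int k))" for k :: int
  define d where "d = (nabla ^^ (n + 1)) beta"
  \<comment> \<open>Since \<open>a\<close> is twice \<open>2 ^ j\<close>, a half-integer shift at
    scale \<open>2 ^ j\<close> is an integer shift at scale \<open>a\<close>, and the alternating
    binomial sum is a difference of order \<open>n + 1\<close>.\<close>
  have fd: "f (\<lambda>x. diff_spline n (2 ^ j * x - 1/2 * of_int mu)) = sgn_parity (int (n + 1)) * d (mu + int (n + 1))" for mu
  proof -
    have "(\<lambda>x. diff_spline n (2 ^ j * x - 1/2 * of_int mu))
       = (\<lambda>x. \<Sum>i\<le>Suc n. (sgn_parity (int i) * real (Suc n choose i)) * B_spline n (a * x - of_int (mu + int i)))"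
      unfolding diff_spline_def a_def by (intro ext sum.cong refl arg_cong2[where f = "(*)"] arg_cong[where f = "B_spline n"]) (simp add: algebra_simps)
    then have "f (\<lambda>x. diff_spline n (2 ^ j * x - 1/2 * of_int mu)) = (\<Sum>i\<le>Suc n. (sgn_parity (int i) * real (Suc n choose i)) * beta (mu + int i))"
      unfolding beta_def using a by (simp only:) (intro S_dual_sum[OF f] S_space_affine'[OF B_spline_S_space'[OF n]]; simp)
    then show ?thesis unfolding d_def using sum_binomial_nabla[where m = "Suc n" and c = beta and mu = mu] by (simp only: Suc_eq_plus1)
  qed
  have db: "seq_bound p (2 powr (- (real j * ?e)) * K) d"
    by (rule seq_bound_mono[OF p seq_bound_shift[OF p b, of "- int (n + 1)"] _ order_refl])
       (simp only: fd abs_mult abs_sgn_parity mult_1 diff_add_cancel add.assoc add.left_inverse add_0_right order_refl)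
  define H where "H t = a ^ (n + 2) * spline 0 d (a * t)" for t
  have li: "loc_int (\<lambda>t. a ^ (n + 1) * spline 0 d (a * t))"
    using loc_int_cmult[OF loc_int_affine[OF loc_int_spline[of 0 d], of a 0], of "a ^ (n + 1)"] a by simp
  obtain P where P: "!!i. i \<ge> n + 1 ==> coeff P i = 0"
    "!!x. spline (n + 1) beta (a * x) = poly P x + iprim (n + 1) (\<lambda>t. a ^ (n + 1) * spline 0 d (a * t)) 0 x"
    using spline_dilate_iprim[OF a, of "n + 1" beta] unfolding d_def by blast
  have "spline_approx n f a x = poly (smult a P) x + iprim (n + 1) H 0 x" for x
  proof -
    have "H = (\<lambda>t. a * (a ^ (n + 1) * spline 0 d (a * t)) + 0 * (a ^ (n + 1) * spline 0 d (a * t)))" by (simp add: H_def fun_eq_iff)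
    then have "iprim (n + 1) H 0 x = a * iprim (n + 1) (\<lambda>t. a ^ (n + 1) * spline 0 d (a * t)) 0 x"
      using iprim_linear[OF li li, of "n + 1" a 0 0] by simp
    then show ?thesis using P(2)[of x] by (simp add: spline_approx_def beta_def[abs_def] distrib_left)
  qed
  moreover have "coeff (smult a P) i = 0" if "i \<ge> n + 1" for i using P(1)[OF that] by simp
  moreover have "fun_bound p (2 powr ?e * K) H"
  proof -
    have "fun_bound p (\<bar>a ^ (n + 2)\<bar> * (a powr (- enn2real (1 / p)) * (2 powr (- (real j * ?e)) * K))) H"
      unfolding H_def[abs_def] by (intro fun_bound_cmult[OF p] fun_bound_step[OF p db a])
    moreover have "\<bar>a ^ (n + 2)\<bar> * (a powr (- enn2real (1 / p)) * (2 powr (- (real j * ?e)) * K)) = 2 powr ?e * K"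
    proof -
      have a2: "a = 2 powr (real (Suc j))" unfolding a_def by (simp only: powr_realpow zero_less_numeral)
      have "\<bar>a ^ (n + 2)\<bar> = a powr (real (n + 2))" using a by (simp only: powr_realpow abs_of_pos zero_less_power)
      then have "\<bar>a ^ (n + 2)\<bar> * a powr (- enn2real (1 / p)) * 2 powr (- (real j * ?e)) = a powr ?e * 2 powr (- (real j * ?e))"
        by (simp add: powr_add[symmetric] add_ac add_diff_eq)
      also have "... = 2 powr (real (Suc j) * ?e + - (real j * ?e))" unfolding a2 powr_powr powr_add ..
      also have "real (Suc j) * ?e + - (real j * ?e) = ?e" by (simp add: algebra_simps)
      finally show ?thesis by (simp only: mult.assoc[symmetric])
    qed
    ultimately show ?thesis by (simp only:)
  qed
  ultimately show ?thesis unfolding a_def by blast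
qed

text \<open>Weighted \<open>L\<^sub>1\<close> convergence of the integrands gives uniform
  convergence of their iterated primitives on the support of \<open>phi\<close>, where the inverse
  weight is bounded.\<close>

lemma integral_iprim_tendsto:
  assumes p: "1 < p" and v: "!!N. fun_bound p K (v N)" and F: "fun_bound p K F"
    and lim: "(\<lambda>N. LI x. \<bar>v N x - F x\<bar> * wt x) \<longlonglongrightarrow> 0"
    and phi: "cont phi" and X: "!!x. \<bar>x\<bar> > X ==> phi x = 0"
  shows "(\<lambda>N. LI x. iprim (Suc n) (v N) 0 x * phi x) \<longlonglongrightarrow> (LI x. iprim (Suc n) F 0 x * phi x)"
proof -
  have li: "loc_int (v N)" "loc_int F" for N using fun_bound_locally_integrable[OF p] v F by auto
  have ig: "lint (\<lambda>x. u x * phi x)" if "loc_int u" for u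
    by (rule loc_int_mult_continuous[OF that phi, of "- \<bar>X\<bar>" "\<bar>X\<bar>"]) (auto intro!: X)
  have ia: "lint (\<lambda>x. \<bar>phi x\<bar>)"
    using ig[OF loc_int_continuous[of "\<lambda>x. 1"]] by (auto intro: integrable_abs)
  define M where "M = \<bar>X\<bar> ^ n * jb X ^ 2"
  define eps where "eps N = (LI x. \<bar>v N x - F x\<bar> * wt x)" for N
  have eps0: "eps N \<ge> 0" for N unfolding eps_def using wt_pos by (intro integral_nonneg_AE AE_I2 mult_nonneg_nonneg) (auto simp: less_imp_le)
  have "norm ((LI x. iprim (Suc n) (v N) 0 x * phi x) - (LI x. iprim (Suc n) F 0 x * phi x)) \<le> M * (LI x. \<bar>phi x\<bar>) * eps N" for N
  proof -
    let ?D = "\<lambda>x. v N x - F x"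
    have lD: "loc_int ?D" by (rule loc_int_diff[OF li])
    have wD: "lint (\<lambda>x. \<bar>?D x\<bar> / jb (x - 0) ^ 2)"
    proof -
      have "lint (\<lambda>x. \<bar>v N x\<bar> * wt x + \<bar>F x\<bar> * wt x)" using fun_bound_wt(1)[OF p v] fun_bound_wt(1)[OF p F] by simp
      then have "lint (\<lambda>x. \<bar>?D x\<bar> * wt x)"
      proof (rule lint_bound)
        show "(\<lambda>x. \<bar>?D x\<bar> * wt x) \<in> lmeas"
          using loc_int_measurable[OF lD] integrable_wt by (intro borel_measurable_times borel_measurable_abs) auto
        have "\<bar>?D x\<bar> * wt x \<le> (\<bar>v N x\<bar> + \<bar>F x\<bar>) * wt x" for x using wt_pos[of x] by (intro mult_right_mono) auto
        then show "AE x in lebesgue. norm (\<bar>?D x\<bar> * wt x) \<le> norm (\<bar>v N x\<bar> * wt x + \<bar>F x\<bar> * wt x)"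
          using wt_pos by (intro AE_I2) (simp add: abs_mult distrib_right less_imp_le)
      qed
      then show ?thesis by (simp add: wt_def)
    qed
    have De: "(LI x. \<bar>?D x\<bar> / jb (x - 0) ^ 2) = eps N" by (simp add: eps_def wt_def)
    have pw: "\<bar>iprim (Suc n) ?D 0 x * phi x\<bar> \<le> (M * eps N) * \<bar>phi x\<bar>" for x
    proof (cases "\<bar>x\<bar> \<le> X")
      case True
      have "\<bar>iprim (Suc n) ?D 0 x\<bar> \<le> \<bar>x - 0\<bar> ^ n * \<bar>prim (\<lambda>t. \<bar>?D t\<bar>) 0 x\<bar>" by (rule iprim_bound[OF lD])
      also have "... \<le> \<bar>X\<bar> ^ n * (jb X ^ 2 * eps N)"
      proof (intro mult_mono power_mono)
        have "\<bar>prim (\<lambda>t. \<bar>?D t\<bar>) 0 x\<bar> \<le> jb (x - 0) ^ 2 * eps N" using prim_weight_bound[OF lD wD, of x] unfolding De .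
        also have "... \<le> jb X ^ 2 * eps N" using True eps0 by (intro mult_right_mono power_mono) auto
        finally show "\<bar>prim (\<lambda>t. \<bar>?D t\<bar>) 0 x\<bar> \<le> jb X ^ 2 * eps N" .
      qed (use True in auto)
      finally have "\<bar>iprim (Suc n) ?D 0 x\<bar> * \<bar>phi x\<bar> \<le> (M * eps N) * \<bar>phi x\<bar>" unfolding M_def by (intro mult_right_mono) (auto simp: mult.assoc)
      then show ?thesis by (simp add: abs_mult)
    next
      case False
      then show ?thesis using X[of x] by simp
    qed
    have "(LI x. iprim (Suc n) (v N) 0 x * phi x) - (LI x. iprim (Suc n) F 0 x * phi x)
       = (LI x. iprim (Suc n) (v N) 0 x * phi x - iprim (Suc n) F 0 x * phi x)"
      by (rule LI_diff[symmetric]) (intro ig loc_int_iprim li)+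
    also have "... = (LI x. iprim (Suc n) ?D 0 x * phi x)"
      using iprim_linear[OF li, of "Suc n" 1 N "-1" 0] by (simp add: left_diff_distrib)
    finally have "norm ((LI x. iprim (Suc n) (v N) 0 x * phi x) - (LI x. iprim (Suc n) F 0 x * phi x))
       \<le> (LI x. \<bar>iprim (Suc n) ?D 0 x * phi x\<bar>)" unfolding real_norm_def by (simp only: integral_abs_bound)
    also have "... \<le> (LI x. (M * eps N) * \<bar>phi x\<bar>)"
      by (rule integral_mono[OF integrable_abs[OF ig[OF loc_int_iprim[OF lD]]] integrable_mult_right[OF ia] pw])
    also have "... = M * (LI x. \<bar>phi x\<bar>) * eps N" by simp
    finally show ?thesis .
  qed
  moreover have "(\<lambda>N. M * (LI x. \<bar>phi x\<bar>) * eps N) \<longlonglongrightarrow> 0" using tendsto_mult_right_zero[OF lim[folded eps_def]] .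
  ultimately have "(\<lambda>N. (LI x. iprim (Suc n) (v N) 0 x * phi x) - (LI x. iprim (Suc n) F 0 x * phi x)) \<longlonglongrightarrow> 0"
    by (intro Lim_null_comparison[where f = "\<lambda>N. (LI x. iprim (Suc n) (v N) 0 x * phi x) - (LI x. iprim (Suc n) F 0 x * phi x)"]) auto
  then show ?thesis by (rule LIM_zero_cancel)
qed

text \<open>The polynomial parts converge because finitely many spline moments determine their coefficients.\<close>
lemma polynomial_part_limit:
  assumes n: "n \<ge> 1" and P: "!!N. degree (P N) \<le> n" and G: "!!phi. phi \<in> Phi ==> cont phi \<and> (\<exists>X. \<forall>x. \<bar>x\<bar> > X --> phi x = 0)"
    and lim: "!!phi. phi \<in> Phi ==> (\<lambda>N. LI x. poly (P N) x * phi x) \<longlonglongrightarrow> c phi"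
    and B: "!!nu. (\<lambda>x. B_spline n (x - real nu)) \<in> Phi"
  shows "\<exists>T. degree T \<le> n \<and> (\<forall>phi\<in>Phi. (LI x. poly T x * phi x) = c phi)"
proof -
  obtain e where e: "!!P i. degree P \<le> n ==> i \<le> n ==> coeff P i = (\<Sum>nu\<le>n. e i nu * poly_moment n nu P)"
    using coeffs_from_moments[OF n, of n] by blast
  define gam where "gam i = (\<Sum>nu\<le>n. e i nu * c (\<lambda>x. B_spline n (x - real nu)))" for i
  have gam: "(\<lambda>N. coeff (P N) i) \<longlonglongrightarrow> gam i" if i: "i \<le> n" for i
    unfolding e[OF P i] gam_def poly_moment_def by (intro tendsto_sum tendsto_mult tendsto_const lim B)
  define T where "T = (\<Sum>i\<le>n. monom (gam i) i)"
  have "degree T \<le> n" unfolding T_def by (intro degree_sum_le) (auto intro: order_trans[OF degree_monom_le])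
  have "(LI x. poly T x * phi x) = c phi" if phi: "phi \<in> Phi" for phi
  proof -
    obtain X where X: "!!x. \<bar>x\<bar> > X ==> phi x = 0" using G[OF phi] by blast
    have ig: "lint (\<lambda>x. x ^ i * phi x)" for i
      by (rule loc_int_mult_continuous[of _ _ "- \<bar>X\<bar>" "\<bar>X\<bar>"])
         (use G[OF phi] in \<open>auto intro!: X loc_int_continuous continuous_intros\<close>)
    have sum: "(LI x. (\<Sum>i\<le>n. a i * x ^ i) * phi x) = (\<Sum>i\<le>n. a i * (LI x. x ^ i * phi x))" for a
      unfolding sum_distrib_right mult.assoc by (subst LI_sum) (auto intro: ig)
    have pP: "poly (P N) x = (\<Sum>i\<le>n. coeff (P N) i * x ^ i)" for N x
      by (rule poly_sum_upto) (use P[of N] in \<open>auto intro: coeff_eq_0\<close>)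
    have "(\<lambda>N. LI x. poly (P N) x * phi x) \<longlonglongrightarrow> (\<Sum>i\<le>n. gam i * (LI x. x ^ i * phi x))"
      unfolding pP sum by (intro tendsto_sum tendsto_mult tendsto_const gam) auto
    moreover have "(LI x. poly T x * phi x) = (\<Sum>i\<le>n. gam i * (LI x. x ^ i * phi x))"
      unfolding sum[symmetric] by (simp add: T_def poly_sum poly_monom)
    ultimately show ?thesis using LIMSEQ_unique[OF lim[OF phi]] by simp
  qed
  with \<open>degree T \<le> n\<close> show ?thesis by blast
qed

lemma higher_pderiv_eq_0: "degree P < k ==> (pderiv ^^ k) P = 0" for P :: "real poly"
proof (induction k arbitrary: P)
  case (Suc k)
  show ?case
  proof (cases "degree P = 0")
    case True
    then have "pderiv P = 0" using pderiv_eq_0_iff by blast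
    then show ?thesis by (simp add: funpow_Suc_right del: funpow.simps)
  next
    case False
    then have "degree (pderiv P) < k" using Suc.prems by (simp add: degree_pderiv)
    then show ?thesis using Suc.IH by (simp add: funpow_Suc_right del: funpow.simps)
  qed
qed simp

lemma midpoint_hull_induct:
  assumes t: "t \<in> midpoint_hull s N" and "!!J. N \<le> J ==> R (fst (s J)) (snd (s J))"
    and "!!u v u' v'. R u v ==> R u' v' ==> R (\<lambda>x. (u x + u' x) / 2) (\<lambda>x. (v x + v' x) / 2)"
  shows "R (fst t) (snd t)"
  using t by induction (use assms(2,3) in auto)

text \<open>Every hull element is a polynomial plus an iterated primitive of its second component.
  Its pairings with test functions and those of the primitive converge, hence so do the pairings of
  the polynomial part, and the limits assemble to \<open>g\<close>.\<close>

lemma Sobolev_from_quantity: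
  assumes BL: "Battle_Lemarie_system n \<psi> \<Psi>" and n: "n \<ge> 1" and p: "1 < p"
  shows "\<exists>C>0. \<forall>f Q. f \<in> S_dual (n - 1) --> 0 \<le> Q --> spline_quantity n p \<psi> \<Psi> f \<le> ennreal Q -->
     (\<exists>g F. has_weak_deriv (n + 1) g F \<and> fun_bound p (C * Q) F \<and> fun_bound p (C * Q) g \<and>
       (\<forall>i\<le>n. \<exists>h. has_weak_deriv i g h \<and> fun_bound p (C * Q) h) \<and> f = regular_functional (n - 1) g)"
proof -
  obtain C1 where C1: "C1 > 0" "!!f Q. f \<in> S_dual (n - 1) ==> 0 \<le> Q ==> spline_quantity n p \<psi> \<Psi> f \<le> ennreal Q ==>
     seq_bound p (C1 * Q) (\<lambda>mu. f (\<lambda>x. B_spline n (x - of_int mu))) \<and>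
     (\<forall>j::nat. seq_bound p (C1 * (2 powr (- (real j * (real n + 2 - enn2real (1 / p)))) * Q)) (\<lambda>mu. f (\<lambda>x. diff_spline n (2 ^ j * x - 1/2 * of_int mu))))"
    using B_spline_coefficients_bound[OF BL n p] by blast
  obtain C2 where C2: "C2 > 0" "\<forall>g F K L. has_weak_deriv (n + 1) g F --> fun_bound p L F -->
     seq_bound p K (\<lambda>m. LI x. g x * B_spline n (x - of_int m)) -->
     (\<forall>i\<le>n. \<exists>h. has_weak_deriv i g h \<and> fun_bound p (C2 * (K + L)) h)"
    using Sobolev_from_moments[OF n p] by blast
  let ?c = "2 powr (real n + 2 - enn2real (1 / p))"
  define C where "C = ?c * C1 + C2 * (C1 + ?c * C1)"
  have C: "C > 0" "?c * C1 \<le> C" "C2 * (C1 + ?c * C1) \<le> C" using C1(1) C2(1) by (auto simp: C_def add_pos_pos)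
  have "\<exists>g F. has_weak_deriv (n + 1) g F \<and> fun_bound p (C * Q) F \<and> fun_bound p (C * Q) g \<and>
       (\<forall>i\<le>n. \<exists>h. has_weak_deriv i g h \<and> fun_bound p (C * Q) h) \<and> f = regular_functional (n - 1) g"
    if f: "f \<in> S_dual (n - 1)" and Q: "0 \<le> Q" and q: "spline_quantity n p \<psi> \<Psi> f \<le> ennreal Q" for f Q
  proof -
    note b = C1(2)[OF f Q q]
    define K where "K = ?c * (C1 * Q)"
    have "\<exists>P H. (\<forall>i\<ge>n+1. coeff P i = 0) \<and> (\<forall>x. spline_approx n f (2 ^ Suc j) x = poly P x + iprim (n + 1) H 0 x) \<and> fun_bound p K H" for j
      unfolding K_def using b by (intro spline_approx_iprim[OF n p f]) (simp add: mult.left_commute)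
    then obtain P H where PH: "!!j i. i \<ge> n + 1 ==> coeff (P j) i = 0"
      "!!j x. spline_approx n f (2 ^ Suc j) x = poly (P j) x + iprim (n + 1) (H j) 0 x" "!!j. fun_bound p K (H j)" by metis
    define s where "s j = (spline_approx n f (2 ^ Suc j), H j)" for j
    have sb: "fun_bound p K (snd (s j))" for j by (simp add: s_def PH(3))
    obtain t F where t: "!!N. t N \<in> midpoint_hull s N" and F: "fun_bound p K F"
      and lim: "(\<lambda>N. LI x. \<bar>snd (t N) x - F x\<bar> * wt x) \<longlonglongrightarrow> 0" using midpoint_hull_limit[of p K s, OF p sb] by blast
    have tb: "fun_bound p K (snd (t N))" for N by (rule midpoint_hull_fun_bound[OF p sb t])
    \<comment> \<open>This shape is linear in the pair, so it passes from the spline approximations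
      to their midpoints.\<close>
    define R where "R u v \<longleftrightarrow> loc_int v \<and> (\<exists>T. degree T \<le> n \<and> u = (\<lambda>x. poly T x + iprim (n + 1) v 0 x))" for u v
    have RH: "R (fst (t N)) (snd (t N))" for N
      using t[of N]
    proof (rule midpoint_hull_induct)
      fix J
      have "degree (P J) \<le> n" using PH(1) by (intro degree_le) auto
      then show "R (fst (s J)) (snd (s J))" unfolding R_def s_def
        using PH(2) fun_bound_locally_integrable[OF p PH(3)] by (auto simp: fun_eq_iff simp del: power_Suc)
    next
      fix u v u' v' assume "R u v" "R u' v'"
      then obtain T T' where T: "loc_int v" "degree T \<le> n" "u = (\<lambda>x. poly T x + iprim (n + 1) v 0 x)"
        and T': "loc_int v'" "degree T' \<le> n" "u' = (\<lambda>x. poly T' x + iprim (n + 1) v' 0 x)" unfolding R_def by blast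
      have e: "(\<lambda>x. (v x + v' x) / 2) = (\<lambda>x. 1/2 * v x + 1/2 * v' x)" by (simp add: fun_eq_iff add_divide_distrib)
      have "loc_int (\<lambda>x. (v x + v' x) / 2)" unfolding e by (intro loc_int_add loc_int_cmult T(1) T'(1))
      moreover have "degree (smult (1/2) (T + T')) \<le> n" using degree_add_le[OF T(2) T'(2)] by simp
      moreover have "(\<lambda>x. (u x + u' x) / 2) = (\<lambda>x. poly (smult (1/2) (T + T')) x + iprim (n + 1) (\<lambda>x. (v x + v' x) / 2) 0 x)"
        unfolding e iprim_linear[OF T(1) T'(1)] T(3) T'(3) by (simp add: fun_eq_iff add_divide_distrib)
      ultimately show "R (\<lambda>x. (u x + u' x) / 2) (\<lambda>x. (v x + v' x) / 2)" unfolding R_def by blast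
    qed
    then obtain T where T: "!!N. degree (T N) \<le> n" "!!N. fst (t N) = (\<lambda>x. poly (T N) x + iprim (n + 1) (snd (t N)) 0 x)"
      unfolding R_def by metis
    have liF: "loc_int F" and lit: "loc_int (snd (t N))" for N using fun_bound_locally_integrable[OF p] F tb by auto
    \<comment> \<open>Unlike \<open>test_funs\<close>, this class contains the dyadic B-splines, on
      which \<open>f\<close> and the functional of \<open>g\<close> are compared at the end.\<close>
    define Phi where "Phi = {phi \<in> S_space (n - 1). \<exists>X. \<forall>x. \<bar>x\<bar> > X --> phi x = 0}"
    have Phi: "cont phi" if "phi \<in> Phi" for phi using that S_space_continuous by (auto simp: Phi_def)
    have ig: "lint (\<lambda>x. u x * phi x)" if phi: "phi \<in> Phi" and "loc_int u" for u phi
    proof -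
      obtain X where "!!x. \<bar>x\<bar> > X ==> phi x = 0" using phi by (auto simp: Phi_def)
      then show ?thesis by (intro loc_int_mult_continuous[OF that(2) Phi[OF phi], of "- \<bar>X\<bar>" "\<bar>X\<bar>"]) auto
    qed
    have BP: "(\<lambda>x. B_spline n (2 ^ L * x - of_int k)) \<in> Phi" for L :: nat and k :: int
    proof -
      have "B_spline n (2 ^ L * x - of_int k) = 0" if x: "\<bar>x\<bar> > \<bar>of_int k\<bar> + real n + 1" for x
      proof -
        have "\<bar>x\<bar> \<le> 2 ^ L * \<bar>x\<bar>" using mult_right_mono[OF one_le_power[of "2::real" L], of "\<bar>x\<bar>"] by simp
        then have "\<bar>2 ^ L * x\<bar> > \<bar>of_int k\<bar> + real n + 1" using x by (simp add: abs_mult)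
        then show ?thesis by (intro B_spline_outside) (auto simp: abs_if split: if_splits)
      qed
      then show ?thesis using S_space_affine'[OF B_spline_S_space'[OF n], of "2 ^ L" "of_int k"] unfolding Phi_def by auto
    qed
    \<comment> \<open>From some index on, all spline approximations pair with \<open>phi\<close> to
      within \<open>e / 2\<close> of \<open>f phi\<close>. This condition is convex, so it holds on
      the whole hull of the tail.\<close>
    have tlim: "(\<lambda>N. LI x. fst (t N) x * phi x) \<longlonglongrightarrow> f phi" if phi: "phi \<in> Phi" for phi
    proof (rule LIMSEQ_I)
      fix e :: real assume e: "e > 0"
      obtain X where "!!x. \<bar>x\<bar> > X ==> phi x = 0" using phi by (auto simp: Phi_def)
      then have "(\<lambda>J. LI x. spline_approx n f (2 ^ J) x * phi x) \<longlonglongrightarrow> f phi"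
        using phi by (intro integral_spline_approx_tendsto[OF f _ n]) (auto simp: Phi_def)
      from LIMSEQ_D[OF LIMSEQ_Suc[OF this], of "e / 2"] e obtain N0 where
        N0: "!!J. J \<ge> N0 ==> \<bar>(LI x. spline_approx n f (2 ^ Suc J) x * phi x) - f phi\<bar> < e / 2" by auto
      have "loc_int (fst (t N)) \<and> \<bar>(LI x. fst (t N) x * phi x) - f phi\<bar> \<le> e / 2" if N: "N \<ge> N0" for N
        using t[of N]
      proof (rule midpoint_hull_induct[where R = "\<lambda>u v. loc_int u \<and> \<bar>(LI x. u x * phi x) - f phi\<bar> \<le> e / 2"])
        fix J assume "N \<le> J"
        moreover have "loc_int (spline_approx n f (2 ^ Suc J))"
          using PH(2)[of J] fun_bound_locally_integrable[OF p PH(3)]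
          by (subst PH(2)[abs_def]) (intro loc_int_add loc_int_poly loc_int_iprim)
        ultimately show "loc_int (fst (s J)) \<and> \<bar>(LI x. fst (s J) x * phi x) - f phi\<bar> \<le> e / 2"
          using N0[of J] N by (simp add: s_def less_imp_le del: power_Suc)
      next
        fix u u' :: "real => real"
        assume u: "loc_int u \<and> \<bar>(LI x. u x * phi x) - f phi\<bar> \<le> e / 2"
          and u': "loc_int u' \<and> \<bar>(LI x. u' x * phi x) - f phi\<bar> \<le> e / 2"
        have e2: "(\<lambda>x. (u x + u' x) / 2) = (\<lambda>x. 1/2 * u x + 1/2 * u' x)" by (simp add: fun_eq_iff add_divide_distrib)
        have "(LI x. (1/2 * u x + 1/2 * u' x) * phi x) = (LI x. 1/2 * (u x * phi x) + 1/2 * (u' x * phi x))"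
          by (simp only: distrib_right mult.assoc)
        also have "... = 1/2 * (LI x. u x * phi x) + 1/2 * (LI x. u' x * phi x)"
          using ig[OF phi] u u' by simp
        finally have i: "(LI x. (1/2 * u x + 1/2 * u' x) * phi x) = 1/2 * (LI x. u x * phi x) + 1/2 * (LI x. u' x * phi x)" .
        show "loc_int (\<lambda>x. (u x + u' x) / 2) \<and> \<bar>(LI x. (u x + u' x) / 2 * phi x) - f phi\<bar> \<le> e / 2"
          unfolding e2 fun_cong[OF e2] i
        proof
          show "loc_int (\<lambda>x. 1/2 * u x + 1/2 * u' x)" using u u' by (intro loc_int_add loc_int_cmult) auto
          have m: "\<bar>1/2 * A + 1/2 * B - y\<bar> \<le> e / 2" if "\<bar>A - y\<bar> \<le> e / 2" "\<bar>B - y\<bar> \<le> e / 2" for A B y :: real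
            using that unfolding abs_le_iff by linarith
          show "\<bar>1/2 * (LI x. u x * phi x) + 1/2 * (LI x. u' x * phi x) - f phi\<bar> \<le> e / 2" using u u' by (intro m) auto
        qed
      qed
      then show "\<exists>N0. \<forall>N\<ge>N0. norm ((LI x. fst (t N) x * phi x) - f phi) < e" using e by (intro exI[of _ N0]) (auto intro: le_less_trans[of _ "e / 2"])
    qed
    define c where "c phi = f phi - (LI x. iprim (n + 1) F 0 x * phi x)" for phi
    have plim: "(\<lambda>N. LI x. poly (T N) x * phi x) \<longlonglongrightarrow> c phi" if phi: "phi \<in> Phi" for phi
    proof -
      obtain X where X: "!!x. \<bar>x\<bar> > X ==> phi x = 0" using phi by (auto simp: Phi_def)
      have "(LI x. fst (t N) x * phi x) - (LI x. iprim (n + 1) (snd (t N)) 0 x * phi x) = (LI x. poly (T N) x * phi x)" for N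
        using ig[OF phi loc_int_poly[of "T N"]] ig[OF phi loc_int_iprim[OF lit[of N], of "n + 1" 0]]
        unfolding T(2) by (simp add: distrib_right)
      moreover have "(\<lambda>N. (LI x. fst (t N) x * phi x) - (LI x. iprim (n + 1) (snd (t N)) 0 x * phi x)) \<longlonglongrightarrow> c phi"
        unfolding c_def Suc_eq_plus1[symmetric] by (intro tendsto_diff tlim[OF phi] integral_iprim_tendsto[OF p tb F lim Phi[OF phi] X])
      ultimately show ?thesis by simp
    qed
    have "\<exists>T. degree T \<le> n \<and> (\<forall>phi\<in>Phi. (LI x. poly T x * phi x) = c phi)"
    proof (rule polynomial_part_limit[OF n T(1) _ plim])
      show "phi \<in> Phi ==> cont phi \<and> (\<exists>X. \<forall>x. \<bar>x\<bar> > X --> phi x = 0)" for phi using Phi by (auto simp: Phi_def)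
      show "(\<lambda>x. B_spline n (x - real nu)) \<in> Phi" for nu using BP[of 0 "int nu"] by simp
    qed
    then obtain T0 where T0: "degree T0 \<le> n" "!!phi. phi \<in> Phi ==> (LI x. poly T0 x * phi x) = c phi" by blast
    define g where "g x = poly T0 x + iprim (n + 1) F 0 x" for x
    have gF: "has_weak_deriv (n + 1) g F"
      using has_weak_deriv_iprim[OF liF refl, of "n + 1" T0 0 0] T0(1) unfolding g_def[abs_def]
      by (simp add: higher_pderiv_eq_0[of T0 "Suc n"] del: funpow.simps)
    have lig: "loc_int g" using gF by (simp add: has_weak_deriv_def)
    have gf: "(LI x. g x * phi x) = f phi" if phi: "phi \<in> Phi" for phi
      using ig[OF phi loc_int_poly[of T0]] ig[OF phi loc_int_iprim[OF liF, of "n + 1" 0]] T0(2)[OF phi]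
      by (simp add: g_def distrib_right c_def)
    have "seq_bound p (C1 * Q) (\<lambda>m. LI x. g x * B_spline n (x - of_int m))"
      using b gf[OF BP[of 0]] by simp
    then have h: "\<exists>h. has_weak_deriv i g h \<and> fun_bound p (C2 * (C1 * Q + K)) h" if "i \<le> n" for i
      using C2(2)[rule_format, OF gF F _ that] by blast
    have KC: "K \<le> C * Q" "C2 * (C1 * Q + K) \<le> C * Q"
      using mult_right_mono[OF C(2) Q] mult_right_mono[OF C(3) Q] by (simp_all add: K_def algebra_simps)
    have h': "\<exists>h. has_weak_deriv i g h \<and> fun_bound p (C * Q) h" if "i \<le> n" for i using h[OF that] fun_bound_pos[OF p _ KC(2)] by blast
    \<comment> \<open>Order 0 of the moment estimate bounds a function that equals \<open>g\<close>
      almost everywhere.\<close>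
    have gb: "fun_bound p (C * Q) g"
    proof -
      obtain h where h: "has_weak_deriv 0 g h" "fun_bound p (C * Q) h" using h'[of 0] by auto
      have "has_weak_deriv 0 g g" using lig by (simp add: has_weak_deriv_def)
      from has_weak_deriv_unique[OF h(1) this] have "AE x in lebesgue. h x = g x" by simp
      then show ?thesis by (rule fun_bound_cong_AE[OF h(2) _ loc_int_measurable[OF lig]])
    qed
    have "f = regular_functional (n - 1) g"
    proof (rule S_dual_eqI[OF f regular_functional_S_dual[OF p gb] n])
      fix J :: nat and k :: int
      have "(\<lambda>x. B_spline n (2 ^ J * x - of_int k)) \<in> S_space (n - 1)" using BP by (simp add: Phi_def)
      then show "f (\<lambda>x. B_spline n (2 ^ J * x - of_int k)) = regular_functional (n - 1) g (\<lambda>x. B_spline n (2 ^ J * x - of_int k))"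
        using gf[OF BP] by (simp add: regular_functional_def)
    qed
    then show ?thesis using gF gb h' fun_bound_pos[OF p F KC(1)] by blast
  qed
  then show ?thesis using C(1) by blast
qed

section \<open>From bounds by real constants back to the norms\<close>

lemma fun_bound_Lp_norm:
  assumes p: "1 < p" and g: "fun_bound p M g"
  shows "fun_bound p (enn2real (Lp_norm p g)) g" "ennreal (enn2real (Lp_norm p g)) = Lp_norm p g"
proof -
  have "Lp_norm p g \<le> ennreal M" using Lp_norm_le_iff[OF p fun_bound_nonneg[OF g] fun_bound_measurable[OF g]] g by simp
  then show e: "ennreal (enn2real (Lp_norm p g)) = Lp_norm p g"
    by (intro ennreal_enn2real) (auto intro: le_less_trans)
  show "fun_bound p (enn2real (Lp_norm p g)) g"
    using Lp_norm_le_iff[OF p _ fun_bound_measurable[OF g], of "enn2real (Lp_norm p g)"] e by simp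
qed

text \<open>\<open>weak_deriv\<close> is a choice; uniqueness up to null sets transfers to it the
  bound of the derivative that membership provides.\<close>

lemma weak_deriv_Sobolev:
  assumes p: "1 < p" and g: "g \<in> Sobolev_space (Suc k) p"
  shows "has_weak_deriv (Suc k) g (weak_deriv (Suc k) g)" "\<exists>M. fun_bound p M (weak_deriv (Suc k) g)" "\<exists>M. fun_bound p M g"
proof -
  obtain h where h: "has_weak_deriv (Suc k) g h" "h \<in> Lp_space p" 
    using g unfolding Sobolev_space_def by (auto dest!: bspec[of _ _ "Suc k"])
  show w: "has_weak_deriv (Suc k) g (weak_deriv (Suc k) g)" unfolding weak_deriv_def by (rule someI[of _ h]) (rule h)
  obtain M where M: "fun_bound p M h" using h(2) Lp_space_iff[OF p] by blast
  have "AE x in lebesgue. h x = weak_deriv (Suc k) g x" by (rule has_weak_deriv_unique[OF h(1) w]) simp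
  moreover have "weak_deriv (Suc k) g \<in> lmeas"
    using w by (simp add: has_weak_deriv_def loc_int_measurable)
  ultimately show "\<exists>M. fun_bound p M (weak_deriv (Suc k) g)" using fun_bound_cong_AE[OF M] by blast
  show "\<exists>M. fun_bound p M g" using g Lp_space_iff[OF p] by (simp add: Sobolev_space_def)
qed

lemma regular_functional_inj_AE:
  assumes g: "loc_int g" "loc_int g'" and eq: "regular_functional r g = regular_functional r g'"
  shows "AE x in lebesgue. g x = g' x"
proof -
  have z: "(LI x. (g x - g' x) * phi x) = 0" if phi: "phi \<in> test_funs" for phi
    using scs_integrable_mult[OF g(1) phi] scs_integrable_mult[OF g(2) phi] fun_cong[OF eq, of phi] scs_S_space[OF phi]
    by (simp add: left_diff_distrib regular_functional_def)
  have "AE x in lebesgue. g x - g' x = 0" by (rule AE_zero_if_test_zero[OF loc_int_diff[OF g]]) (rule z)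
  then show ?thesis by eventually_elim simp
qed

theorem theorem1p4:
  fixes n :: nat and p :: ennreal and \<psi> \<Psi> :: "real => real"
  assumes "n \<ge> 1"
    and "Battle_Lemarie_system n \<psi> \<Psi>"
    and "1 < p"
  shows "regular_functional (n - 1) ` Sobolev_space (n + 1) p =
           {f \<in> S_dual (n - 1). spline_quantity n p \<psi> \<Psi> f < \<infinity>} \<and>
         (\<exists>c C :: real. 0 < c \<and> 0 < C \<and>
           (\<forall>g \<in> Sobolev_space (n + 1) p.
              ennreal c * Sobolev_norm (n + 1) p g
                \<le> spline_quantity n p \<psi> \<Psi> (regular_functional (n - 1) g) \<and>
              spline_quantity n p \<psi> \<Psi> (regular_functional (n - 1) g)
                \<le> ennreal C * Sobolev_norm (n + 1) p g))"
proof -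
  note n = assms(1) and BL = assms(2) and p = assms(3)
  let ?R = "regular_functional (n - 1)" and ?q = "spline_quantity n p \<psi> \<Psi>" and ?D = "weak_deriv (n + 1)"
  obtain C1 where C1: "C1 > 0" "\<forall>g F K L. has_weak_deriv (n + 1) g F --> fun_bound p K g --> fun_bound p L F -->
     ?q (?R g) \<le> ennreal (C1 * (K + L))" using spline_quantity_Sobolev_le[OF BL n p] by blast
  obtain C2 where C2: "C2 > 0" "\<forall>f Q. f \<in> S_dual (n - 1) --> 0 \<le> Q --> ?q f \<le> ennreal Q -->
     (\<exists>g F. has_weak_deriv (n + 1) g F \<and> fun_bound p (C2 * Q) F \<and> fun_bound p (C2 * Q) g \<and>
       (\<forall>i\<le>n. \<exists>h. has_weak_deriv i g h \<and> fun_bound p (C2 * Q) h) \<and> f = ?R g)"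
    using Sobolev_from_quantity[OF BL n p] by blast
  have wd: "has_weak_deriv (n + 1) g (?D g)" "fun_bound p (enn2real (Lp_norm p (?D g))) (?D g)" "fun_bound p (enn2real (Lp_norm p g)) g"
    "Sobolev_norm (n + 1) p g = ennreal (enn2real (Lp_norm p g) + enn2real (Lp_norm p (?D g)))"
    if g: "g \<in> Sobolev_space (n + 1) p" for g
  proof -
    note w = weak_deriv_Sobolev[OF p, of g n]
    show "has_weak_deriv (n + 1) g (?D g)" using w(1) g by simp
    obtain M where M: "fun_bound p M (?D g)" using w(2) g by auto
    obtain M' where M': "fun_bound p M' g" using w(3) g by auto
    note L = fun_bound_Lp_norm[OF p M] fun_bound_Lp_norm[OF p M']
    show "fun_bound p (enn2real (Lp_norm p (?D g))) (?D g)" "fun_bound p (enn2real (Lp_norm p g)) g" by (rule L)+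
    show "Sobolev_norm (n + 1) p g = ennreal (enn2real (Lp_norm p g) + enn2real (Lp_norm p (?D g)))"
      unfolding Sobolev_norm_def by (subst ennreal_plus) (simp_all only: L enn2real_nonneg)
  qed
  have upper: "?q (?R g) \<le> ennreal C1 * Sobolev_norm (n + 1) p g" if g: "g \<in> Sobolev_space (n + 1) p" for g
    using C1(2)[rule_format, OF wd(1)[OF g] wd(3)[OF g] wd(2)[OF g]] C1(1) unfolding wd(4)[OF g] by (simp only: ennreal_mult' less_imp_le)
  have dual: "?R g \<in> S_dual (n - 1)" "?q (?R g) < \<infinity>" if g: "g \<in> Sobolev_space (n + 1) p" for g
  proof -
    show "?R g \<in> S_dual (n - 1)" by (rule regular_functional_S_dual[OF p wd(3)[OF g]])
    show "?q (?R g) < \<infinity>" using upper[OF g] unfolding wd(4)[OF g] by (rule le_less_trans) (simp add: ennreal_mult_less_top)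
  qed
  have lower: "ennreal (1 / (2 * C2)) * Sobolev_norm (n + 1) p g \<le> ?q (?R g)" if g: "g \<in> Sobolev_space (n + 1) p" for g
  proof -
    define Q where "Q = enn2real (?q (?R g))"
    have Q: "ennreal Q = ?q (?R g)" "Q \<ge> 0" using dual(2)[OF g] by (auto simp: Q_def)
    \<comment> \<open>The converse direction with \<open>Q\<close> equal to the quantity yields some
      representative \<open>g'\<close>. It agrees with \<open>g\<close> almost everywhere, and so do
      the top derivatives; each of the two norms is at most \<open>C2 * Q\<close>, whence the
      constant \<open>1 / (2 * C2)\<close>.\<close>
    obtain g' F' where g': "has_weak_deriv (n + 1) g' F'" "fun_bound p (C2 * Q) F'" "fun_bound p (C2 * Q) g'" "?R g = ?R g'"
      using C2(2)[rule_format, OF dual(1)[OF g] Q(2)] Q(1) by auto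
    have li: "loc_int g" "loc_int g'" "?D g \<in> lmeas"
      using wd(1)[OF g] g'(1) by (auto simp: has_weak_deriv_def dest: loc_int_measurable)
    have ae: "AE x in lebesgue. g' x = g x" by (rule regular_functional_inj_AE[OF li(2,1) g'(4)[symmetric]])
    have CQ: "0 \<le> C2 * Q" using C2(1) Q(2) by simp
    have "Lp_norm p g \<le> ennreal (C2 * Q)"
      using fun_bound_cong_AE[OF g'(3) ae loc_int_measurable[OF li(1)]]
      by (simp add: Lp_norm_le_iff[OF p CQ loc_int_measurable[OF li(1)]])
    moreover have "Lp_norm p (?D g) \<le> ennreal (C2 * Q)"
      using fun_bound_cong_AE[OF g'(2) has_weak_deriv_unique[OF g'(1) wd(1)[OF g] ae] li(3)]
      by (simp only: Lp_norm_le_iff[OF p CQ li(3)])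
    ultimately have "Sobolev_norm (n + 1) p g \<le> ennreal (C2 * Q) + ennreal (C2 * Q)" unfolding Sobolev_norm_def by (rule add_mono)
    also have "... = ennreal (2 * C2 * Q)" using CQ by (subst ennreal_plus[symmetric]) (simp_all del: ennreal_plus)
    finally have "ennreal (1 / (2 * C2)) * Sobolev_norm (n + 1) p g \<le> ennreal (1 / (2 * C2)) * ennreal (2 * C2 * Q)" by (rule mult_left_mono) simp
    also have "... = ennreal Q" using C2(1) by (subst ennreal_mult'[symmetric]) simp_all
    finally show ?thesis unfolding Q(1) .
  qed
  have "f \<in> ?R ` Sobolev_space (n + 1) p" if f: "f \<in> S_dual (n - 1)" and q: "?q f < \<infinity>" for f
  proof -
    have "?q f \<le> ennreal (enn2real (?q f))" using q by simp
    then obtain g F K where g: "has_weak_deriv (n + 1) g F" "fun_bound p K F" "fun_bound p K g"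
      "!!i. i \<le> n ==> \<exists>h. has_weak_deriv i g h \<and> fun_bound p K h" "f = ?R g"
      using C2(2)[rule_format, OF f enn2real_nonneg] by blast
    have "\<exists>h\<in>Lp_space p. has_weak_deriv i g h" if i: "i \<in> {1..n + 1}" for i
    proof (cases "i \<le> n")
      case True
      then show ?thesis using g(4) Lp_space_iff[OF p] by blast
    next
      case False
      then have "i = n + 1" using i by simp
      then show ?thesis using g(1,2) Lp_space_iff[OF p] by blast
    qed
    moreover have "g \<in> Lp_space p" using g(3) Lp_space_iff[OF p] by blast
    ultimately show ?thesis unfolding g(5) Sobolev_space_def by blast
  qed
  then have "?R ` Sobolev_space (n + 1) p = {f \<in> S_dual (n - 1). ?q f < \<infinity>}" using dual by blast
  moreover have "0 < 1 / (2 * C2)" using C2(1) by simp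
  ultimately show ?thesis using upper lower C1(1) by blast
qed

end
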